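(* Assume that for every $R>0$ $$\mathcal A_R\,\mathbf y\in L^2\big(\Omega;C([0,T];\mathbb H^2(\mathbb T^2)^2)\big)\cap C^1\big([0,T];L^4(\Omega;\mathbb V)\big),\qquad \mathcal A_R\,\partial_t\mathbf y\in C^{1/2}\big([0,T];L^2(\Omega;\mathbb V)\big),$$ and that $\mathbb P(\Omega_R)\to1$ as $R\to\infty$. Then for any $\xi>0$ and $\alpha<3/2$, $$\max_{1\le n\le N}\mathbb P\Big[\|\mathbf y(t_n)-\mathbf y_n\|_{L^2(\mathbb T^2)^2}^2+\sum_{m=1}^{n-1}\tau\|\nabla\bar{\mathbf y}^{m+\frac12}-\nabla\mathbf y^{m+\frac12}\|_{L^2(\mathbb T^2)^4}^2>\xi\,\tau^{2\alpha}\Big]\to0,$$ $$\max_{1\le n\le N}\mathbb P\Big[\|\mathbf u(t_n)-\mathbf u_n\|_{L^2(\mathbb T^2)^2}^2+\sum_{m=1}^{n-1}\tau\|\nabla\bar{\mathbf X}^{m+\frac12}-\nabla\mathbf u^{m+\frac12}\|_{L^2(\mathbb T^2)^4}^2>\xi\,\tau^{2\alpha}\Big]\to0$$ as $\tau\to0$.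
   Context: **Spaces.** $\mathbb T^2$ is the two-dimensional torus; $\mathbb H^k(\mathbb T^2)$ are the $L^2$-based Sobolev spaces of periodic functions; $Q=\{q\in L^2(\mathbb T^2):\int q=0\}$; $\mathbb H$ is the space of (weakly) divergence-free fields in $L^2(\mathbb T^2)^2$; $\mathbb V=\{\mathbf v\in\mathbb H^1(\mathbb T^2)^2:\operatorname{div}\mathbf v=0\}$ with the $\mathbb H^1$ norm. $(\cdot,\cdot)$ is the $L^2(\mathbb T^2)$ inner product and $\mathcal C(\mathbf a,\mathbf b,\mathbf c)=\int_{\mathbb T^2}(\mathbf a\cdot\nabla)\mathbf b\cdot\mathbf c\,dx$. **Noise and exact solution.** $T>0$, $\nu>0$. $(\Omega,\mathfrak F,(\mathfrak F_t)_{t\ge0},\mathbb P)$ is a stochastic basis with complete right-continuous filtration; $W=\sum_k W_k\mathfrak e_k$ is a cylindrical Wiener process ($(W_k)$ independent standard real $(\mathfrak F_t)$-Wiener processes, $(\mathfrak e_k)$ an orthonormal basis of a separable Hilbert space $\mathfrak U$). $\Phi$ is deterministic, Hilbert–Schmidt from $\mathfrak U$ to $\mathbb H^2(\mathbb T^2)^2$, with each $\Phi\mathfrak e_k$ divergence-free; $\Phi W(t)=\sum_kW_k(t)\Phi\mathfrak e_k$. $\mathbf u_0$ is $\mathfrak F_0$-measurable, $\mathbb V$-valued, with $\mathbf u_0\in L^r(\Omega;\mathbb H)$ for some $r>2$. $\mathbf u$ is the unique weak pathwise solution of the 2D stochastic Navier–Stokes equations $d\mathbf u+[(\mathbf u\cdot\nabla)\mathbf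 u-\nu\Delta\mathbf u+\nabla p]dt=\Phi\,dW$, $\operatorname{div}\mathbf u=0$, $\mathbf u(0)=\mathbf u_0$: it is adapted, $\mathbf u\in C([0,T];\mathbb H)\cap L^2(0,T;\mathbb V)$ a.s., and $(\mathbf u(t),\boldsymbol\varphi)-(\mathbf u_0,\boldsymbol\varphi)=-\int_0^t\mathcal C(\mathbf u,\mathbf u,\boldsymbol\varphi)ds-\nu\int_0^t(\nabla\mathbf u,\nabla\boldsymbol\varphi)ds+(\Phi W(t),\boldsymbol\varphi)$ a.s. for all $t\in[0,T]$, $\boldsymbol\varphi\in\mathbb V$. Set $\mathbf y(t)=\mathbf u(t)-\Phi W(t)$; it solves the random PDE $\partial_t\mathbf y+((\mathbf y+\Phi W)\cdot\nabla)(\mathbf y+\Phi W)-\nu\Delta(\mathbf y+\Phi W)+\nabla p=0$, $\operatorname{div}\mathbf y=0$, $\mathbf y(0)=\mathbf u_0$. **Localization.** $\mathbf Y(t)=\mathbf y(t)+\Phi W(t)$, $\Omega_R=\{\omega:\sup_{t\in[0,T]}\|\mathbf Y(t,\omega)\|_{\mathbb H^2(\mathbb T^2)^2}\le R\}$, $\mathcal A_R=\mathbf 1_{\Omega_R}$. **Scheme.** $\tau=T/N$, $t_n=n\tau$, with $M=\tau^{-1}$ an integer; $t_{n,\ell}=t_n+\ell\tau^2$, $\ell=0,\dots,M$. Put $\mathcal I_n^W=\tau\sum_{\ell=1}^M W(t_{n,\ell})$ (so $\Phi\mathcal I_n^W=\tau\sum_\ell\Phi W(t_{n,\ell})$) and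 $\mathcal I_n^{W^2}=\tau\sum_{\ell=1}^M(\Phi W(t_{n,\ell})-\Phi\mathcal I_n^W)\otimes(\Phi W(t_{n,\ell})-\Phi\mathcal I_n^W)$. With $\mathbf y_{-1}=\mathbf y_0=\mathbf u_0$, $\mathbf y^{n+\frac12}=\frac12(\mathbf y_{n+1}+\mathbf y_n)$, $\mathbf y_\star^{n+\frac12}=\frac32\mathbf y_n-\frac12\mathbf y_{n-1}$, the pair $(\mathbf y_{n+1},p_{n+1})\in\mathbb H^1(\mathbb T^2)^2\times Q$, $n=0,\dots,N-1$, is determined by: for all $(\boldsymbol\varphi,q)\in\mathbb H^1(\mathbb T^2)^2\times Q$, $$\Big(\tfrac{\mathbf y_{n+1}-\mathbf y_n}{\tau},\boldsymbol\varphi\Big)+\mathcal C(\mathbf y_\star^{n+\frac12}+\Phi\mathcal I_n^W,\mathbf y^{n+\frac12}+\Phi\mathcal I_n^W,\boldsymbol\varphi)-(\mathcal I_n^{W^2},\nabla\boldsymbol\varphi)+\nu(\nabla(\mathbf y^{n+\frac12}+\Phi\mathcal I_n^W),\nabla\boldsymbol\varphi)-(p_{n+1},\operatorname{div}\boldsymbol\varphi)=0,$$ $$(\operatorname{div}\mathbf y_{n+1},q)=0.$$ Finally $\bar{\mathbf y}^{n+\frac12}=\frac12(\mathbf y(t_n)+\mathbf y(t_{n+1}))$, $\mathbf u_n=\mathbf y_n+\Phi W(t_n)$, $\mathbf u^{n+\frac12}=\frac12(\mathbf u_{n+1}+\mathbf u_n)$, $\bar{\mathbf X}^{n+\frac12}=\frac12(\mathbf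 u(t_n)+\mathbf u(t_{n+1}))$. *)

theory Defs
  imports "HOL-Probability.Probability"
begin

section \<open>Function spaces on the two-dimensional torus\<close>

text \<open>
  The torus is \<open>\<real>\<^sup>2/\<int>\<^sup>2\<close>. A function on it is a 1-periodic function on the plane, integrated over
  the fundamental cell. Elements of \<open>L\<^sup>2\<close> and of the Sobolev spaces are represented by functions,
  not by classes; integrals, weak derivatives and norms do not change under modification on a null
  set (the completed Lebesgue measure is needed for this).
\<close>

type_synonym 'b field = "real^2 \<Rightarrow> 'b"

definition torus :: "(real^2) measure" where
  "torus = restrict_space lebesgue {x. \<forall>i. 0 \<le> x $ i \<and> x $ i < 1}"

definition periodic :: "'b field \<Rightarrow> bool" where
  "periodic f \<longleftrightarrow> (\<forall>x i. f (x + axis i 1) = f x)"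

definition ae_eq :: "'b field \<Rightarrow> 'b field \<Rightarrow> bool" where
  "ae_eq f g \<longleftrightarrow> (AE x in torus. f x = g x)"

definition L2 :: "'b::euclidean_space field set" where
  "L2 = {f. periodic f \<and> f \<in> borel_measurable lebesgue \<and> integrable torus (\<lambda>x. (norm (f x))\<^sup>2)}"

definition l2_inner :: "'b::euclidean_space field \<Rightarrow> 'b field \<Rightarrow> real" where
  "l2_inner f g = (\<integral>x. f x \<bullet> g x \<partial>torus)"

definition l2_norm :: "'b::euclidean_space field \<Rightarrow> real" where
  "l2_norm f = sqrt (l2_inner f f)"

definition pdiff :: "2 \<Rightarrow> real field \<Rightarrow> real field" where
  "pdiff i \<phi> = (\<lambda>x. frechet_derivative \<phi> (at x) (axis i 1))"

primrec cont_diff :: "nat \<Rightarrow> real field \<Rightarrow> bool" where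
  "cont_diff 0 \<phi> = continuous_on UNIV \<phi>"
| "cont_diff (Suc k) \<phi> = ((\<forall>x. \<phi> differentiable (at x)) \<and> (\<forall>i. cont_diff k (pdiff i \<phi>)))"

definition test_fun :: "real field set" where
  "test_fun = {\<phi>. periodic \<phi> \<and> (\<forall>k. cont_diff k \<phi>)}"

definition weak_pdiff :: "2 \<Rightarrow> 'b::euclidean_space field \<Rightarrow> 'b field \<Rightarrow> bool" where
  "weak_pdiff i f g \<longleftrightarrow> g \<in> L2 \<and>
     (\<forall>\<phi>\<in>test_fun. (\<integral>x. pdiff i \<phi> x *\<^sub>R f x \<partial>torus) = - (\<integral>x. \<phi> x *\<^sub>R g x \<partial>torus))"

text \<open>Weak derivatives are unique up to null sets; \<open>wpd\<close> picks a representative and is meaningful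
  only when a weak derivative exists.\<close>

definition wpd :: "2 \<Rightarrow> 'b::euclidean_space field \<Rightarrow> 'b field" where
  "wpd i f = (SOME g. weak_pdiff i f g)"

text \<open>The row index of the gradient is the direction of differentiation:
  \<open>wgrad f x $ i = \<partial>\<^sub>i f x\<close>.\<close>

definition wgrad :: "'b::euclidean_space field \<Rightarrow> ('b^2) field" where
  "wgrad f = (\<lambda>x. \<chi> i. wpd i f x)"

definition wdiv :: "(real^2) field \<Rightarrow> real field" where
  "wdiv v = (\<lambda>x. \<Sum>i\<in>UNIV. wpd i v x $ i)"

primrec Hk :: "nat \<Rightarrow> 'b::euclidean_space field set" where
  "Hk 0 = L2"
| "Hk (Suc k) = {f \<in> L2. \<forall>i. \<exists>g\<in>Hk k. weak_pdiff i f g}"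

text \<open>Squared Sobolev norm
  \<open>\<parallel>f\<parallel>\<^sup>2 + \<Sum>\<^sub>i \<parallel>\<partial>\<^sub>i f\<parallel>\<^sup>2 + \<Sum>\<^sub>i \<Sum>\<^sub>j \<parallel>\<partial>\<^sub>j \<partial>\<^sub>i f\<parallel>\<^sup>2 + \<dots>\<close>, with derivatives up to order \<open>k\<close>;
  meaningful only on \<open>Hk k\<close>.\<close>

primrec Hk_norm_sq :: "nat \<Rightarrow> 'b::euclidean_space field \<Rightarrow> real" where
  "Hk_norm_sq 0 f = (l2_norm f)\<^sup>2"
| "Hk_norm_sq (Suc k) f = (l2_norm f)\<^sup>2 + (\<Sum>i\<in>UNIV. Hk_norm_sq k (wpd i f))"

definition Hk_norm :: "nat \<Rightarrow> 'b::euclidean_space field \<Rightarrow> real" where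
  "Hk_norm k f = sqrt (Hk_norm_sq k f)"

definition QQ :: "real field set" where
  "QQ = {q \<in> L2. (\<integral>x. q x \<partial>torus) = 0}"

definition HH :: "(real^2) field set" where
  "HH = {v \<in> L2. \<forall>\<psi>\<in>test_fun. l2_inner v (\<lambda>x. \<chi> i. pdiff i \<psi> x) = 0}"

definition VV :: "(real^2) field set" where
  "VV = {v \<in> Hk 1. ae_eq (wdiv v) (\<lambda>x. 0)}"

definition trilin :: "(real^2) field \<Rightarrow> (real^2) field \<Rightarrow> (real^2) field \<Rightarrow> real" where
  "trilin a b c = l2_inner (\<lambda>x. \<Sum>i\<in>UNIV. a x $ i *\<^sub>R wpd i b x) c"


section \<open>Random fields and Bochner spaces\<close>

text \<open>Borel measurability of a map into the separable space \<open>Hk k\<close>: all distance functions to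
  fixed points are measurable.\<close>

definition Hk_measurable :: "nat \<Rightarrow> 'a measure \<Rightarrow> ('a \<Rightarrow> 'b::euclidean_space field) \<Rightarrow> bool" where
  "Hk_measurable k M X \<longleftrightarrow> (\<forall>\<omega>\<in>space M. X \<omega> \<in> Hk k) \<and>
     (\<forall>g\<in>Hk k. (\<lambda>\<omega>. Hk_norm k (\<lambda>x. X \<omega> x - g x)) \<in> borel_measurable M)"

text \<open>\<open>Lp M p k S\<close> is \<open>L\<^sup>p(M; S)\<close> for a closed subspace \<open>S\<close> of \<open>Hk k\<close> with the norm of \<open>Hk k\<close>. Its
  elements need to lie in \<open>S\<close> only almost everywhere, hence the measurable version \<open>X'\<close>.\<close>

definition Lp :: "'a measure \<Rightarrow> real \<Rightarrow> nat \<Rightarrow> 'b::euclidean_space field set \<Rightarrow> ('a \<Rightarrow> 'b field) set" where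
  "Lp M p k S = {X. \<exists>X'. Hk_measurable k M X' \<and> (\<forall>\<omega>\<in>space M. X' \<omega> \<in> S) \<and>
     (AE \<omega> in M. ae_eq (X \<omega>) (X' \<omega>)) \<and>
     (\<integral>\<^sup>+\<omega>. ennreal (Hk_norm k (X' \<omega>) powr p) \<partial>M) < \<infinity>}"

definition Lp_norm :: "'a measure \<Rightarrow> real \<Rightarrow> nat \<Rightarrow> ('a \<Rightarrow> 'b::euclidean_space field) \<Rightarrow> real" where
  "Lp_norm M p k X = (\<integral>\<omega>. Hk_norm k (X \<omega>) powr p \<partial>M) powr (1 / p)"

definition Hk_path :: "nat \<Rightarrow> real \<Rightarrow> (real \<Rightarrow> 'b::euclidean_space field) \<Rightarrow> bool" where
  "Hk_path k T f \<longleftrightarrow> (\<forall>t\<in>{0..T}. f t \<in> Hk k \<and>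
     ((\<lambda>s. Hk_norm k (\<lambda>x. f s x - f t x)) \<longlongrightarrow> 0) (at t within {0..T}))"

text \<open>\<open>L\<^sup>p(M; C([0,T]; H\<^sup>k))\<close>. Measurability into \<open>C([0,T]; H\<^sup>k)\<close> is measurability of all evaluations.\<close>

definition Lp_paths ::
  "'a measure \<Rightarrow> real \<Rightarrow> real \<Rightarrow> nat \<Rightarrow> (real \<Rightarrow> 'a \<Rightarrow> 'b::euclidean_space field) set" where
  "Lp_paths M p T k = {X. \<exists>X'. (\<forall>t\<in>{0..T}. Hk_measurable k M (X' t)) \<and>
     (\<forall>\<omega>\<in>space M. Hk_path k T (\<lambda>t. X' t \<omega>)) \<and>
     (AE \<omega> in M. \<forall>t\<in>{0..T}. ae_eq (X t \<omega>) (X' t \<omega>)) \<and>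
     (\<integral>\<^sup>+\<omega>. (SUP t\<in>{0..T}. ennreal (Hk_norm k (X' t \<omega>) powr p)) \<partial>M) < \<infinity>}"

text \<open>\<open>X\<close> is in \<open>C\<^sup>1([0,T]; L\<^sup>p(M; S))\<close> and \<open>D\<close> is its time derivative.\<close>

definition C1_Lp :: "'a measure \<Rightarrow> real \<Rightarrow> nat \<Rightarrow> 'b::euclidean_space field set \<Rightarrow> real \<Rightarrow>
    (real \<Rightarrow> 'a \<Rightarrow> 'b field) \<Rightarrow> (real \<Rightarrow> 'a \<Rightarrow> 'b field) \<Rightarrow> bool" where
  "C1_Lp M p k S T X D \<longleftrightarrow> (\<forall>t\<in>{0..T}. X t \<in> Lp M p k S \<and> D t \<in> Lp M p k S \<and>
     ((\<lambda>s. Lp_norm M p k (\<lambda>\<omega> x. (1 / (s - t)) *\<^sub>R (X s \<omega> x - X t \<omega> x) - D t \<omega> x)) \<longlongrightarrow> 0)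
       (at t within {0..T}) \<and>
     ((\<lambda>s. Lp_norm M p k (\<lambda>\<omega> x. D s \<omega> x - D t \<omega> x)) \<longlongrightarrow> 0) (at t within {0..T}))"

text \<open>The Hoelder space \<open>C\<^sup>\<gamma>([0,T]; L\<^sup>p(M; S))\<close>.\<close>

definition holder_Lp :: "'a measure \<Rightarrow> real \<Rightarrow> nat \<Rightarrow> 'b::euclidean_space field set \<Rightarrow> real \<Rightarrow> real \<Rightarrow>
    (real \<Rightarrow> 'a \<Rightarrow> 'b field) \<Rightarrow> bool" where
  "holder_Lp M p k S T \<gamma> X \<longleftrightarrow> (\<forall>t\<in>{0..T}. X t \<in> Lp M p k S) \<and>
     (\<exists>C. \<forall>s\<in>{0..T}. \<forall>t\<in>{0..T}.
        Lp_norm M p k (\<lambda>\<omega> x. X t \<omega> x - X s \<omega> x) \<le> C * \<bar>t - s\<bar> powr \<gamma>)"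


section \<open>Noise\<close>

text \<open>Completeness includes that of the probability space itself: subsets of null sets are events.\<close>

definition stochastic_basis :: "'w measure \<Rightarrow> (real \<Rightarrow> 'w measure) \<Rightarrow> bool" where
  "stochastic_basis P F \<longleftrightarrow> prob_space P \<and>
     (\<forall>t\<ge>0. subalgebra P (F t)) \<and>
     (\<forall>s\<ge>0. \<forall>t\<ge>s. sets (F s) \<subseteq> sets (F t)) \<and>
     (\<forall>t\<ge>0. sets (F t) = (\<Inter>s\<in>{t<..}. sets (F s))) \<and>
     (\<forall>N\<in>null_sets P. \<forall>A\<subseteq>N. A \<in> sets (F 0))"

definition wiener_process :: "'w measure \<Rightarrow> (real \<Rightarrow> 'w measure) \<Rightarrow> (real \<Rightarrow> 'w \<Rightarrow> real) \<Rightarrow> bool" where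
  "wiener_process P F B \<longleftrightarrow>
     (\<forall>t\<ge>0. B t \<in> borel_measurable (F t)) \<and>
     (AE \<omega> in P. B 0 \<omega> = 0) \<and>
     (AE \<omega> in P. continuous_on {0..} (\<lambda>t. B t \<omega>)) \<and>
     (\<forall>s\<ge>0. \<forall>t>s.
        distributed P lborel (\<lambda>\<omega>. B t \<omega> - B s \<omega>) (normal_density 0 (sqrt (t - s))) \<and>
        prob_space.indep_set P (sets (F s))
          {(\<lambda>\<omega>. B t \<omega> - B s \<omega>) -` A \<inter> space P | A. A \<in> sets borel})"

text \<open>The index set \<open>K\<close> allows for finite-dimensional as well as infinite-dimensional spaces.\<close>

definition orthonormal_basis :: "nat set \<Rightarrow> (nat \<Rightarrow> 'u::real_inner) \<Rightarrow> bool" where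
  "orthonormal_basis K e \<longleftrightarrow>
     (\<forall>j\<in>K. \<forall>k\<in>K. e j \<bullet> e k = (if j = k then 1 else 0)) \<and> closure (span (e ` K)) = UNIV"

text \<open>The coordinates \<open>W k\<close> of a cylindrical Wiener process, independent as processes.\<close>

definition cylindrical_wiener ::
  "'w measure \<Rightarrow> (real \<Rightarrow> 'w measure) \<Rightarrow> nat set \<Rightarrow> (nat \<Rightarrow> real \<Rightarrow> 'w \<Rightarrow> real) \<Rightarrow> bool" where
  "cylindrical_wiener P F K W \<longleftrightarrow> (\<forall>k\<in>K. wiener_process P F (W k)) \<and>
     prob_space.indep_vars P (\<lambda>_. Pi\<^sub>M {0..} (\<lambda>_. borel)) (\<lambda>k \<omega>. \<lambda>t\<in>{0..}. W k t \<omega>) K"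

definition hilbert_schmidt ::
  "nat set \<Rightarrow> (nat \<Rightarrow> 'u::real_inner) \<Rightarrow> nat \<Rightarrow> ('u \<Rightarrow> 'b::euclidean_space field) \<Rightarrow> bool" where
  "hilbert_schmidt K e m \<Phi> \<longleftrightarrow> (\<forall>v. \<Phi> v \<in> Hk m) \<and>
     (\<forall>a b v w. ae_eq (\<Phi> (a *\<^sub>R v + b *\<^sub>R w)) (\<lambda>x. a *\<^sub>R \<Phi> v x + b *\<^sub>R \<Phi> w x)) \<and>
     (\<exists>C. \<forall>v. Hk_norm m (\<Phi> v) \<le> C * norm v) \<and>
     (\<lambda>k. (Hk_norm m (\<Phi> (e k)))\<^sup>2) summable_on K"

text \<open>\<open>PhiW\<close> is (a version with almost surely continuous paths in \<open>H\<^sup>2\<close> of) the process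
  \<open>\<Sum>\<^sub>k W\<^sub>k(t) \<Phi> e\<^sub>k\<close>, the series converging in \<open>L\<^sup>2(\<Omega>; H\<^sup>2)\<close>. These properties determine \<open>PhiW\<close> up to
  indistinguishability.\<close>

definition noise_process :: "'w measure \<Rightarrow> (real \<Rightarrow> 'w measure) \<Rightarrow> real \<Rightarrow> nat set \<Rightarrow>
    (nat \<Rightarrow> 'u::real_inner) \<Rightarrow> ('u \<Rightarrow> (real^2) field) \<Rightarrow> (nat \<Rightarrow> real \<Rightarrow> 'w \<Rightarrow> real) \<Rightarrow>
    (real \<Rightarrow> 'w \<Rightarrow> (real^2) field) \<Rightarrow> bool" where
  "noise_process P F T K e \<Phi> W PhiW \<longleftrightarrow>
     (\<forall>t\<in>{0..T}. Hk_measurable 2 (F t) (PhiW t)) \<and>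
     (AE \<omega> in P. Hk_path 2 T (\<lambda>t. PhiW t \<omega>)) \<and>
     (\<forall>t\<in>{0..T}.
        (\<lambda>n. \<integral>\<^sup>+\<omega>. ennreal ((Hk_norm 2 (\<lambda>x. PhiW t \<omega> x - (\<Sum>k\<in>K \<inter> {..<n}. W k t \<omega> *\<^sub>R \<Phi> (e k) x)))\<^sup>2) \<partial>P)
          \<longlonglongrightarrow> 0)"


section \<open>The stochastic Navier--Stokes equations\<close>

definition weak_pathwise_solution :: "'w measure \<Rightarrow> (real \<Rightarrow> 'w measure) \<Rightarrow> real \<Rightarrow> real \<Rightarrow>
    ('w \<Rightarrow> (real^2) field) \<Rightarrow> (real \<Rightarrow> 'w \<Rightarrow> (real^2) field) \<Rightarrow> (real \<Rightarrow> 'w \<Rightarrow> (real^2) field) \<Rightarrow> bool" where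
  "weak_pathwise_solution P F T \<nu> u0 PhiW u \<longleftrightarrow>
     (\<forall>t\<in>{0..T}. Hk_measurable 0 (F t) (u t)) \<and>
     (AE \<omega> in P.
        (\<forall>t\<in>{0..T}. u t \<omega> \<in> HH) \<and> Hk_path 0 T (\<lambda>t. u t \<omega>) \<and>
        (\<lambda>t. u t \<omega>) \<in> Lp (lebesgue_on {0..T}) 2 1 VV \<and>
        (\<forall>t\<in>{0..T}. \<forall>\<phi>\<in>VV.
           l2_inner (u t \<omega>) \<phi> - l2_inner (u0 \<omega>) \<phi> =
             - (\<integral>s\<in>{0..t}. trilin (u s \<omega>) (u s \<omega>) \<phi> \<partial>lebesgue)
             - \<nu> * (\<integral>s\<in>{0..t}. l2_inner (wgrad (u s \<omega>)) (wgrad \<phi>) \<partial>lebesgue)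
             + l2_inner (PhiW t \<omega>) \<phi>))"

text \<open>The event that the supremum over \<open>[0,T]\<close> of the \<open>H\<^sup>2\<close> norm of \<open>Y\<close> is at most \<open>R\<close>, the norm being
  infinite outside \<open>H\<^sup>2\<close>.\<close>

definition Omega_R :: "'w measure \<Rightarrow> real \<Rightarrow> (real \<Rightarrow> 'w \<Rightarrow> (real^2) field) \<Rightarrow> real \<Rightarrow> 'w set" where
  "Omega_R P T Y R = {\<omega>\<in>space P. \<forall>t\<in>{0..T}. Y t \<omega> \<in> Hk 2 \<and> Hk_norm 2 (Y t \<omega>) \<le> R}"

definition localize :: "'w set \<Rightarrow> (real \<Rightarrow> 'w \<Rightarrow> (real^2) field) \<Rightarrow> real \<Rightarrow> 'w \<Rightarrow> (real^2) field" where
  "localize A X = (\<lambda>t \<omega> x. indicator A \<omega> *\<^sub>R X t \<omega> x)"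


section \<open>The scheme\<close>

text \<open>Pathwise definitions: \<open>w\<close> is a path of \<open>\<Phi>W\<close>, \<open>N\<close> the number of time steps \<open>\<tau> = T/N\<close>, and \<open>M\<close> the
  number of substeps of length \<open>\<tau>\<^sup>2\<close> in a time step.\<close>

definition noise_mean :: "real \<Rightarrow> nat \<Rightarrow> (real \<Rightarrow> (real^2) field) \<Rightarrow> nat \<Rightarrow> (real^2) field" where
  "noise_mean \<tau> M w n = (\<lambda>x. \<tau> *\<^sub>R (\<Sum>l=1..M. w (real n * \<tau> + real l * \<tau>\<^sup>2) x))"

definition outer :: "real^2 \<Rightarrow> real^2 \<Rightarrow> real^2^2" where
  "outer a b = (\<chi> i j. a $ i * b $ j)"

definition noise_cov :: "real \<Rightarrow> nat \<Rightarrow> (real \<Rightarrow> (real^2) field) \<Rightarrow> nat \<Rightarrow> (real^2^2) field" where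
  "noise_cov \<tau> M w n = (\<lambda>x. \<tau> *\<^sub>R (\<Sum>l=1..M.
     outer (w (real n * \<tau> + real l * \<tau>\<^sup>2) x - noise_mean \<tau> M w n x)
           (w (real n * \<tau> + real l * \<tau>\<^sup>2) x - noise_mean \<tau> M w n x)))"

definition midpoint_field :: "'b::euclidean_space field \<Rightarrow> 'b field \<Rightarrow> 'b field" where
  "midpoint_field f g = (\<lambda>x. (1/2) *\<^sub>R (f x + g x))"

text \<open>The convention \<open>y\<^sub>-\<^sub>1 = y\<^sub>0\<close> makes the extrapolation at \<open>n = 0\<close> equal to \<open>y\<^sub>0\<close>.\<close>

definition extrapolate :: "(nat \<Rightarrow> (real^2) field) \<Rightarrow> nat \<Rightarrow> (real^2) field" where
  "extrapolate y n = (\<lambda>x. (3/2) *\<^sub>R y n x - (1/2) *\<^sub>R (if n = 0 then y 0 else y (n - 1)) x)"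

definition is_scheme :: "real \<Rightarrow> nat \<Rightarrow> nat \<Rightarrow> real \<Rightarrow> (real^2) field \<Rightarrow> (real \<Rightarrow> (real^2) field) \<Rightarrow>
    (nat \<Rightarrow> (real^2) field) \<Rightarrow> (nat \<Rightarrow> real field) \<Rightarrow> bool" where
  "is_scheme \<tau> N M \<nu> u0 w y p \<longleftrightarrow> ae_eq (y 0) u0 \<and>
     (\<forall>n<N. y (Suc n) \<in> Hk 1 \<and> p (Suc n) \<in> QQ \<and>
       (\<forall>\<phi>\<in>Hk 1.
          l2_inner (\<lambda>x. (1 / \<tau>) *\<^sub>R (y (Suc n) x - y n x)) \<phi>
          + trilin (\<lambda>x. extrapolate y n x + noise_mean \<tau> M w n x)
                   (\<lambda>x. midpoint_field (y (Suc n)) (y n) x + noise_mean \<tau> M w n x) \<phi>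
          - l2_inner (noise_cov \<tau> M w n) (wgrad \<phi>)
          + \<nu> * l2_inner (wgrad (\<lambda>x. midpoint_field (y (Suc n)) (y n) x + noise_mean \<tau> M w n x)) (wgrad \<phi>)
          - l2_inner (p (Suc n)) (wdiv \<phi>) = 0) \<and>
       (\<forall>q\<in>QQ. l2_inner (wdiv (y (Suc n))) q = 0))"

text \<open>The squared error at time \<open>t\<^sub>n\<close> of an approximation \<open>v\<close> of \<open>z\<close>, in \<open>l\<^sup>\<infinity>(L\<^sup>2)\<close> and in \<open>l\<^sup>2(H\<^sup>1)\<close> at midpoints.\<close>

definition error_sq ::
  "real \<Rightarrow> (real \<Rightarrow> (real^2) field) \<Rightarrow> (nat \<Rightarrow> (real^2) field) \<Rightarrow> nat \<Rightarrow> real" where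
  "error_sq \<tau> z v n = (l2_norm (\<lambda>x. z (real n * \<tau>) x - v n x))\<^sup>2
     + (\<Sum>m=1..n-1. \<tau> * (l2_norm (\<lambda>x.
          wgrad (midpoint_field (z (real m * \<tau>)) (z (real (Suc m) * \<tau>))) x
          - wgrad (midpoint_field (v (Suc m)) (v m)) x))\<^sup>2)"

text \<open>The limit \<open>\<tau> = T/N \<rightarrow> 0\<close> along those \<open>N\<close> for which \<open>1/\<tau>\<close> is an integer.\<close>

definition step_filter :: "real \<Rightarrow> nat filter" where
  "step_filter T = inf sequentially (principal {N. \<exists>M. real M * (T / real N) = 1})"

end

(*
The error e_n = y(t_n) - y_n satisfies, pathwise, a discrete energy inequality whose right-hand side is the
square of a consistency error K_n. Three cancellations keep K_n small. The skew-symmetry of the trilinear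
form moves all derivatives to the test function. The linear part of y around the midpoint of a step
integrates to zero. The products of noise values at the substeps are reproduced exactly by the mean and the
covariance of the scheme, up to increments over intervals of length tau^2. On the event where y and the
noise are bounded in H^2, the discrete Gronwall lemma bounds the error by a constant times sum_n K_n^2 / tau.

The mean square of K_n is of order tau^5 (tau^4 in the first step, where the extrapolation is only of first
order): the regularity of y gives E |y(s) - y(t) - (s - t) y'(t)|^2 <= C |s - t|^3 in H^1, and increments of
the noise are Gaussian, with fourth moments in H^2 bounded by the square of the elapsed time. Hence the
squared error has expectation of order tau^3 on an event of probability close to one, and Markov's
inequality gives every rate below 3/2.

Sobolev spaces are handled through Fourier coefficients with respect to the real basis
cos(2 pi k.x) + sin(2 pi k.x).
*)
theory Submission
  imports Defs
begin

section \<open>Integration over the torus\<close>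

text \<open>The obstacle is the roughness of the noise: its paths are not differentiable in time,
  yet the quadrature of convection over a step of length tau must be accurate to order tau^(5/2).
  With M = 1/tau substeps of length tau^2 a single increment has size tau, and summing M norms would
  give order 1. Grouping the substeps by a common offset instead puts increments over M disjoint
  intervals into one sum, whose variance is of order M tau^2 = tau; its size tau^(1/2), integrated
  over offsets in [0, tau^2], gives tau^(5/2). Products of increments reach the same order because
  one factor is a deviation of the noise from its value at the start of the step, of size tau^(1/2).
  The event \<open>Om R\<close> controls only the sum of y and the noise, so the noise is bounded on
  a second event of large probability. The Gronwall constant is exponential in the square of the
  bound, hence both events are fixed before tau tends to 0. Fourth moments are carried along since
  products of the time derivative with increments occur, and no independence between these factors
  is available.\<close>

definition cell :: "(real^2) set" where
  "cell = {x. \<forall>i. 0 \<le> x $ i \<and> x $ i < 1}"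

text \<open>Coordinates that present the plane as a product of two lines, so that Fubini's theorem
  for two copies of \<open>lborel\<close> becomes available on the torus.\<close>

definition pt :: "real \<times> real \<Rightarrow> real^2" where
  "pt z = (\<chi> i. if i = 1 then fst z else snd z)"

lemma pt_nth [simp]: "pt z $ 1 = fst z" "pt z $ 2 = snd z"
  by (auto simp: pt_def)

lemma continuous_on_pt [continuous_intros]:
  "continuous_on S f ==> continuous_on S (\<lambda>x. pt (f x))"
  unfolding pt_def
proof (rule continuous_on_vec_lambda)
  fix i :: 2 assume "continuous_on S f"
  then show "continuous_on S (\<lambda>x. if i = 1 then fst (f x) else snd (f x))"
    by (cases "i = 1") (auto intro!: continuous_intros)
qed

lemma measurable_pt [measurable]: "pt \<in> borel_measurable borel"
  by (rule borel_measurable_continuous_onI) (auto intro!: continuous_intros)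

text \<open>Lebesgue measure is determined by its values on boxes, and the preimage of a box under
  \<open>pt\<close> is the box with the same corner coordinates.\<close>

lemma distr_lborel_pt: "distr lborel borel pt = lborel"
proof (rule lborel_eqI[symmetric])
  fix l u :: "real^2"
  assume le: "\<And>b. b \<in> Basis ==> l \<bullet> b \<le> u \<bullet> b"
  have le': "l $ i \<le> u $ i" for i
    using le[of "axis i 1"] by (simp add: inner_axis axis_in_Basis_iff)
  have eq: "pt -` box l u = box (l $ 1, l $ 2) (u $ 1, u $ 2)"
    by (auto simp: mem_box_cart forall_2 mem_box Basis_prod_def ball_Un)
  have "emeasure (distr lborel borel pt) (box l u) = emeasure lborel (box (l $ 1, l $ 2) (u $ 1, u $ 2))"
    by (subst emeasure_distr) (auto simp: eq)
  also have "\<dots> = ennreal ((u $ 1 - l $ 1) * (u $ 2 - l $ 2))"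
    using le'[of 1] le'[of 2]
    by (simp add: emeasure_lborel_box_eq Basis_prod_def image_Un prod.union_disjoint
        sum.union_disjoint prod.reindex inj_on_def)
  also have "\<dots> = ennreal (\<Prod>b\<in>Basis. (u - l) \<bullet> b)"
  proof -
    have B: "(Basis :: (real^2) set) = {axis 1 1, axis 2 1}"
      by (auto simp: Basis_vec_def UNIV_2)
    have "axis 1 (1::real) \<noteq> (axis 2 1 :: real^2)"
      by (simp add: axis_eq_axis)
    then show ?thesis
      unfolding B by (simp add: inner_axis)
  qed
  finally show "emeasure (distr lborel borel pt) (box l u) = (\<Prod>b\<in>Basis. (u - l) \<bullet> b)"
    by simp
qed simp

lemma cell_borel [measurable]: "cell \<in> sets borel"
proof -
  have "cell = ({x. 0 \<le> x $ 1} \<inter> {x. x $ 1 < 1}) \<inter> ({x. 0 \<le> x $ 2} \<inter> {x. x $ 2 < 1})"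
    by (auto simp: cell_def forall_2)
  also have "\<dots> \<in> sets borel"
    by (intro sets.Int borel_closed borel_open closed_Collect_le open_Collect_less continuous_intros)
  finally show ?thesis .
qed

lemma cell_lebesgue [measurable]: "cell \<in> sets lebesgue"
  by auto

lemma torus_eq: "torus = restrict_space lebesgue cell"
  by (simp add: torus_def cell_def)

lemma space_torus [simp]: "space torus = cell"
  by (simp add: torus_eq space_restrict_space)

lemma measurable_torus_borel: "f \<in> borel_measurable borel ==> f \<in> borel_measurable torus"
  unfolding torus_eq by (auto intro!: measurable_restrict_space1 measurable_completion)

lemma measurable_torus_lebesgue: "f \<in> borel_measurable lebesgue ==> f \<in> borel_measurable torus"
  unfolding torus_eq by (auto intro!: measurable_restrict_space1)

lemma pt_cell: "pt (a, b) \<in> cell \<longleftrightarrow> a \<in> {0..<1} \<and> b \<in> {0..<1}"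
  by (auto simp: cell_def forall_2)

lemma nn_integral_torus:
  assumes [measurable]: "f \<in> borel_measurable borel"
  shows "(\<integral>\<^sup>+x. f x \<partial>torus) =
    (\<integral>\<^sup>+z. f (pt z) * indicator ({0..<1} \<times> {0..<1}) z \<partial>(lborel \<Otimes>\<^sub>M lborel))"
proof -
  have "(\<integral>\<^sup>+x. f x \<partial>torus) = (\<integral>\<^sup>+x. f x * indicator cell x \<partial>lborel)"
    unfolding torus_eq by (simp add: nn_integral_restrict_space nn_integral_completion)
  also have "\<dots> = (\<integral>\<^sup>+z. f (pt z) * indicator cell (pt z) \<partial>lborel)"
    by (subst distr_lborel_pt[symmetric], subst nn_integral_distr) auto
  also have "\<dots> = (\<integral>\<^sup>+z. f (pt z) * indicator ({0..<1} \<times> {0..<1}) z \<partial>(lborel \<Otimes>\<^sub>M lborel))"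
    unfolding lborel_prod
    by (intro nn_integral_cong) (auto split: split_indicator simp: pt_cell)
  finally show ?thesis .
qed

lemma emeasure_torus: "emeasure torus (space torus) = 1"
proof -
  have "emeasure torus (space torus) = (\<integral>\<^sup>+x. 1 \<partial>torus)"
    by simp
  also have "\<dots> = (\<integral>\<^sup>+z. indicator ({0..<1::real} \<times> {0..<1::real}) z \<partial>(lborel \<Otimes>\<^sub>M lborel))"
    by (subst nn_integral_torus) auto
  also have "\<dots> = emeasure (lborel \<Otimes>\<^sub>M lborel) ({0..<1::real} \<times> {0..<1::real})"
    by (subst nn_integral_indicator) (auto intro!: pair_measureI)
  also have "\<dots> = 1"
    by (subst lborel.emeasure_pair_measure_Times) auto
  finally show ?thesis .
qed

interpretation torus: prob_space torus
  by (rule prob_spaceI) (rule emeasure_torus)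

lemma integrable_torus_bounded:
  fixes f :: "real^2 \<Rightarrow> 'b::{banach, second_countable_topology}"
  assumes "f \<in> borel_measurable torus" "\<And>x. x \<in> cell ==> norm (f x) \<le> B"
  shows "integrable torus f"
  using assms by (intro torus.integrable_const_bound[of _ B]) auto

lemma cell_subset_cbox: "cell \<subseteq> cbox 0 1"
  by (auto simp: cell_def mem_box_cart order.strict_implies_order)

lemma continuous_bounded_cell:
  fixes f :: "real^2 \<Rightarrow> 'b::real_normed_vector"
  assumes "continuous_on UNIV f"
  obtains B where "\<And>x. x \<in> cell ==> norm (f x) \<le> B"
proof -
  have "bounded (f ` cbox 0 1)"
    using assms by (intro compact_imp_bounded compact_continuous_image) (auto intro: continuous_on_subset)
  then show ?thesis
    using that cell_subset_cbox by (auto simp: bounded_iff)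
qed

lemma continuous_measurable_torus:
  "continuous_on UNIV f ==> f \<in> borel_measurable torus"
  by (intro measurable_torus_borel borel_measurable_continuous_onI)

lemma integrable_torus_continuous:
  fixes f :: "real^2 \<Rightarrow> 'b::{banach, second_countable_topology}"
  assumes "continuous_on UNIV f"
  shows "integrable torus f"
  using continuous_bounded_cell[OF assms]
  by (metis assms integrable_torus_bounded continuous_measurable_torus)

text \<open>Both orders of iteration are recorded because a partial derivative has to be integrated
  first along its own coordinate.\<close>

lemma
  fixes f :: "real^2 \<Rightarrow> real"
  assumes f: "continuous_on UNIV f"
  shows integral_torus_iter1:
      "(\<integral>x. f x \<partial>torus) = (\<integral>b. indicator {0..<1} b * (\<integral>a. indicator {0..<1} a * f (pt (a, b)) \<partial>lborel) \<partial>lborel)" (is ?th1)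
    and integral_torus_iter2:
      "(\<integral>x. f x \<partial>torus) = (\<integral>a. indicator {0..<1} a * (\<integral>b. indicator {0..<1} b * f (pt (a, b)) \<partial>lborel) \<partial>lborel)" (is ?th2)
proof -
  have [measurable]: "f \<in> borel_measurable borel"
    using f by (rule borel_measurable_continuous_onI)
  define g where "g = (\<lambda>a b. indicator {0..<1} a * (indicator {0..<1} b * f (pt (a, b))))"
  have gz: "case_prod g = (\<lambda>z. indicator cell (pt z) * f (pt z))"
    by (rule ext) (auto simp: g_def pt_cell split: split_indicator)
  have int: "integrable lborel (\<lambda>x. indicator cell x *\<^sub>R f x)"
  proof -
    have "integrable torus f"
      by (rule integrable_torus_continuous[OF f])
    then have "integrable lebesgue (\<lambda>x. indicator cell x *\<^sub>R f x)"
      unfolding torus_eq by (subst (asm) integrable_restrict_space) auto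
    then show ?thesis
      by (subst (asm) integrable_completion) auto
  qed
  have "(\<integral>x. f x \<partial>torus) = (\<integral>x. indicator cell x *\<^sub>R f x \<partial>lborel)"
    unfolding torus_eq by (subst integral_restrict_space) (auto simp: integral_completion)
  also have "\<dots> = (\<integral>z. case_prod g z \<partial>lborel)"
    unfolding gz by (subst distr_lborel_pt[symmetric], subst integral_distr) auto
  finally have eq: "(\<integral>x. f x \<partial>torus) = (\<integral>z. case_prod g z \<partial>(lborel \<Otimes>\<^sub>M lborel))"
    unfolding lborel_prod .
  have "integrable lborel (case_prod g)"
    unfolding gz using int by (subst (asm) distr_lborel_pt[symmetric], subst (asm) integrable_distr_eq) auto
  then have ig: "integrable (lborel \<Otimes>\<^sub>M lborel) (case_prod g)"
    unfolding lborel_prod .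
  have "(\<integral>z. case_prod g z \<partial>(lborel \<Otimes>\<^sub>M lborel)) = (\<integral>b. \<integral>a. g a b \<partial>lborel \<partial>lborel)"
    by (rule lborel_pair.integral_snd[OF ig, symmetric])
  also have "\<dots> = (\<integral>b. indicator {0..<1} b * (\<integral>a. indicator {0..<1} a * f (pt (a, b)) \<partial>lborel) \<partial>lborel)"
    unfolding g_def
    by (subst Bochner_Integration.integral_mult_right_zero[symmetric]) (simp only: mult.left_commute)
  finally show ?th1
    unfolding eq .
  have "(\<integral>z. case_prod g z \<partial>(lborel \<Otimes>\<^sub>M lborel)) = (\<integral>a. \<integral>b. g a b \<partial>lborel \<partial>lborel)"
    by (rule lborel_pair.integral_fst[OF ig, symmetric])
  also have "\<dots> = (\<integral>a. indicator {0..<1} a * (\<integral>b. indicator {0..<1} b * f (pt (a, b)) \<partial>lborel) \<partial>lborel)"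
    unfolding g_def by simp
  finally show ?th2
    unfolding eq .
qed

text \<open>Along a line in direction i the fundamental theorem of calculus gives the difference of
  two values one period apart, which is zero; Fubini with direction i innermost finishes. The
  orthogonality of the functions \<open>cas\<close> and their weak derivatives both rest on
  it.\<close>

lemma integral_deriv_periodic:
  fixes \<psi> :: "real^2 \<Rightarrow> real"
  assumes per: "periodic \<psi>"
    and der: "\<And>x. (\<psi> has_derivative \<psi>' x) (at x)"
    and cont: "continuous_on UNIV (\<lambda>x. \<psi>' x (axis i 1))"
  shows "(\<integral>x. \<psi>' x (axis i 1) \<partial>torus) = 0"
proof -
  have line: "(\<integral>t. indicator {0..<1} t * \<psi>' (x + t *\<^sub>R axis i 1) (axis i 1) \<partial>lborel) = 0" for x
  proof -
    have "((\<lambda>t. \<psi> (x + t *\<^sub>R axis i 1)) has_derivative (\<lambda>h. \<psi>' (x + t *\<^sub>R axis i 1) (h *\<^sub>R axis i 1))) (at t)" for t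
      by (rule has_derivative_compose[OF _ der, where f="\<lambda>t. x + t *\<^sub>R axis i 1"]) (auto intro!: derivative_eq_intros)
    moreover have "(\<lambda>h. \<psi>' y (h *\<^sub>R axis i 1)) = (*) (\<psi>' y (axis i 1))" for y
      using has_derivative_bounded_linear[OF der[of y]] by (intro ext) (simp add: linear_simps)
    ultimately have D: "((\<lambda>t. \<psi> (x + t *\<^sub>R axis i 1)) has_real_derivative \<psi>' (x + t *\<^sub>R axis i 1) (axis i 1)) (at t)" for t
      by (simp add: has_field_derivative_def)
    have c: "continuous_on UNIV (\<lambda>t. \<psi>' (x + t *\<^sub>R axis i 1) (axis i 1))"
      by (rule continuous_on_compose2[OF cont]) (auto intro!: continuous_intros)
    have [measurable]: "(\<lambda>t. \<psi>' (x + t *\<^sub>R axis i 1) (axis i 1)) \<in> borel_measurable borel"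
      using c by (rule borel_measurable_continuous_onI)
    have "(\<integral>t. indicator {0..1} t *\<^sub>R \<psi>' (x + t *\<^sub>R axis i 1) (axis i 1) \<partial>lborel) =
        \<psi> (x + 1 *\<^sub>R axis i 1) - \<psi> (x + 0 *\<^sub>R axis i 1)"
    proof (rule integral_FTC_Icc)
      fix t :: real assume "0 \<le> t" "t \<le> 1"
      show "((\<lambda>t. \<psi> (x + t *\<^sub>R axis i 1)) has_vector_derivative \<psi>' (x + t *\<^sub>R axis i 1) (axis i 1)) (at t within {0..1})"
        using D[of t] by (auto simp: has_real_derivative_iff_has_vector_derivative intro: has_vector_derivative_at_within)
    qed (auto intro: continuous_on_subset[OF c])
    also have "\<dots> = 0"
      using per by (simp add: periodic_def)
    also have "(\<integral>t. indicator {0..1} t *\<^sub>R \<psi>' (x + t *\<^sub>R axis i 1) (axis i 1) \<partial>lborel) =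
        (\<integral>t. indicator {0..<1} t * \<psi>' (x + t *\<^sub>R axis i 1) (axis i 1) \<partial>lborel)"
    proof (rule integral_cong_AE)
      show "AE t in lborel. indicator {0..1} t *\<^sub>R \<psi>' (x + t *\<^sub>R axis i 1) (axis i 1) =
        indicator {0..<1} t * \<psi>' (x + t *\<^sub>R axis i 1) (axis i 1)"
        using AE_lborel_singleton[of "1::real"] by eventually_elim (auto split: split_indicator)
    qed auto
    finally show ?thesis .
  qed
  show ?thesis
  proof (cases "i = 1")
    case True
    have eq: "pt (0, b) + a *\<^sub>R axis i 1 = pt (a, b)" for a b
      by (auto simp: vec_eq_iff forall_2 True axis_def)
    have "(\<integral>a. indicator {0..<1} a * \<psi>' (pt (a, b)) (axis i 1) \<partial>lborel) = 0" for b
      using line[of "pt (0, b)"] unfolding eq .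
    then show ?thesis
      by (subst integral_torus_iter1[OF cont]) simp
  next
    case False
    then have i: "i = 2" using exhaust_2 by auto
    have eq: "pt (a, 0) + b *\<^sub>R axis i 1 = pt (a, b)" for a b
      by (auto simp: vec_eq_iff forall_2 axis_def i)
    have "(\<integral>b. indicator {0..<1} b * \<psi>' (pt (a, b)) (axis i 1) \<partial>lborel) = 0" for a
      using line[of "pt (a, 0)"] unfolding eq .
    then show ?thesis
      by (subst integral_torus_iter2[OF cont]) simp
  qed
qed

section \<open>Square-integrable fields\<close>

text \<open>Square integrability on the cell alone. The space \<open>L2\<close> also demands
  periodicity and measurability on the whole plane, which integrals over the cell do not see and
  which would otherwise have to be checked for every indicator, product and limit.\<close>

definition L2t :: "'b::euclidean_space field set" where
  "L2t = {f. f \<in> borel_measurable torus \<and> integrable torus (\<lambda>x. (norm (f x))^2)}"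

lemma L2tD: "f \<in> L2t ==> f \<in> borel_measurable torus" "f \<in> L2t ==> integrable torus (\<lambda>x. (norm (f x))^2)"
  by (auto simp: L2t_def)

lemmas L2t_measurable [measurable_dest] = L2tD(1)

lemma L2_L2t: "f \<in> L2 ==> f \<in> L2t"
  by (auto simp: L2_def L2t_def intro: measurable_torus_lebesgue)

lemma integrable_norm_mult:
  assumes f: "f \<in> L2t" and g: "g \<in> L2t"
  shows "integrable torus (\<lambda>x. norm (f x) * norm (g x))"
proof (rule Bochner_Integration.integrable_bound)
  show "integrable torus (\<lambda>x. (norm (f x))^2 + (norm (g x))^2)"
    using f g by (auto simp: L2t_def)
  have "norm (f x) * norm (g x) \<le> (norm (f x))^2 + (norm (g x))^2" for x
    using sum_squares_bound[of "norm (f x)" "norm (g x)"] mult_nonneg_nonneg[OF norm_ge_zero[of "f x"] norm_ge_zero[of "g x"]]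
    by linarith
  then show "AE x in torus. norm (norm (f x) * norm (g x)) \<le> norm ((norm (f x))^2 + (norm (g x))^2)"
    by (intro always_eventually allI) auto
qed (use f g in \<open>auto simp: L2t_def\<close>)

lemma integrable_inner:
  assumes f: "f \<in> L2t" and g: "g \<in> L2t"
  shows "integrable torus (\<lambda>x. f x \<bullet> g x)"
  using integrable_norm_mult[OF assms]
proof (rule Bochner_Integration.integrable_bound)
  show "AE x in torus. norm (f x \<bullet> g x) \<le> norm (norm (f x) * norm (g x))"
    using Cauchy_Schwarz_ineq2 by (intro always_eventually allI) (auto)
qed (use f g in \<open>auto simp: L2t_def\<close>)

lemma L2tI_bound:
  assumes "f \<in> borel_measurable torus" "g \<in> L2t" "AE x in torus. norm (f x) \<le> norm (g x)"
  shows "f \<in> L2t"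
  unfolding L2t_def
proof safe
  show "integrable torus (\<lambda>x. (norm (f x))^2)"
    using L2tD(2)[OF assms(2)]
  proof (rule Bochner_Integration.integrable_bound)
    show "AE x in torus. norm ((norm (f x))^2) \<le> norm ((norm (g x))^2)"
      using assms(3) by eventually_elim (auto intro!: power_mono)
  qed (use assms in auto)
qed fact

lemma L2t_scaleR [intro, simp]: "f \<in> L2t ==> (\<lambda>x. c *\<^sub>R f x) \<in> L2t"
  by (auto simp: L2t_def power_mult_distrib)

lemma L2t_minus [intro, simp]: "f \<in> L2t ==> (\<lambda>x. - f x) \<in> L2t"
  by (auto simp: L2t_def)

lemma L2t_mult [intro, simp]: "f \<in> L2t ==> (\<lambda>x. c * f x) \<in> L2t" for f :: "real field"
  using L2t_scaleR[of f c] by simp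

lemma L2t_zero [intro, simp]: "(\<lambda>x. 0) \<in> L2t"
  by (auto simp: L2t_def)

lemma L2t_add [intro, simp]:
  assumes "f \<in> L2t" "g \<in> L2t"
  shows "(\<lambda>x. f x + g x) \<in> L2t"
  unfolding L2t_def
proof safe
  show "integrable torus (\<lambda>x. (norm (f x + g x))^2)"
  proof (rule Bochner_Integration.integrable_bound)
    show "integrable torus (\<lambda>x. 2 * (norm (f x))^2 + 2 * (norm (g x))^2)"
      using assms by (auto simp: L2t_def)
    have "(norm (f x + g x))^2 \<le> 2 * (norm (f x))^2 + 2 * (norm (g x))^2" for x
    proof -
      have "(norm (f x + g x))^2 \<le> (norm (f x) + norm (g x))^2"
        by (intro power_mono norm_triangle_ineq) auto
      also have "\<dots> \<le> 2 * (norm (f x))^2 + 2 * (norm (g x))^2"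
        using sum_squares_bound[of "norm (f x)" "norm (g x)"] by (simp add: power2_sum)
      finally show ?thesis .
    qed
    then show "AE x in torus. norm ((norm (f x + g x))^2) \<le> norm (2 * (norm (f x))^2 + 2 * (norm (g x))^2)"
      by auto
  qed (use assms in \<open>auto simp: L2t_def\<close>)
qed (use assms in \<open>auto simp: L2t_def\<close>)

lemma L2t_diff [intro, simp]: "f \<in> L2t ==> g \<in> L2t ==> (\<lambda>x. f x - g x) \<in> L2t"
  using L2t_add[of f "\<lambda>x. - g x"] by auto

lemma L2t_sum [intro, simp]: "(\<And>i. i \<in> I ==> f i \<in> L2t) ==> (\<lambda>x. \<Sum>i\<in>I. f i x) \<in> L2t"
  by (induction I rule: infinite_finite_induct) auto

lemma L2t_bounded:
  assumes "f \<in> borel_measurable torus" "\<And>x. x \<in> cell ==> norm (f x) \<le> B"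
  shows "f \<in> L2t"
  unfolding L2t_def
proof safe
  show "integrable torus (\<lambda>x. (norm (f x))^2)"
    using assms by (intro integrable_torus_bounded[of _ "B^2"]) (auto intro!: power_mono)
qed fact

lemma L2t_continuous: "continuous_on UNIV f ==> f \<in> L2t"
  by (metis continuous_bounded_cell continuous_measurable_torus L2t_bounded)

lemma L2t_inner_const [intro, simp]: "f \<in> L2t ==> (\<lambda>x. f x \<bullet> c) \<in> L2t"
  by (rule L2tI_bound[of _ "\<lambda>x. norm c *\<^sub>R f x"])
     (auto simp: mult.commute[of "norm c"] intro!: always_eventually Cauchy_Schwarz_ineq2)

lemma L2t_scaleR_bounded:
  assumes "\<phi> \<in> borel_measurable torus" "\<And>x. x \<in> cell ==> \<bar>\<phi> x\<bar> \<le> B" "f \<in> L2t"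
  shows "(\<lambda>x. \<phi> x *\<^sub>R f x) \<in> L2t"
proof (rule L2tI_bound[of _ "\<lambda>x. B *\<^sub>R f x"])
  show "AE x in torus. norm (\<phi> x *\<^sub>R f x) \<le> norm (B *\<^sub>R f x)"
    using assms(2) by (intro AE_I2) (force intro!: mult_right_mono)
qed (use assms in auto)

lemma integrable_L2t: "f \<in> L2t ==> integrable torus f"
  for f :: "'b::euclidean_space field"
proof -
  assume f: "f \<in> L2t"
  have "integrable torus (\<lambda>x. norm (f x) * norm (1::real))"
    by (rule integrable_norm_mult[OF f]) (rule L2t_continuous, simp)
  then show "integrable torus f"
    using L2tD(1)[OF f] by (simp add: integrable_norm_iff)
qed

lemma l2_inner_commute: "l2_inner f g = l2_inner g f"
  by (simp add: l2_inner_def inner_commute)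

lemma l2_inner_add_left: "f \<in> L2t ==> g \<in> L2t ==> h \<in> L2t ==> l2_inner (\<lambda>x. f x + g x) h = l2_inner f h + l2_inner g h"
  by (simp add: l2_inner_def inner_add_left integrable_inner)

lemma l2_inner_diff_left: "f \<in> L2t ==> g \<in> L2t ==> h \<in> L2t ==> l2_inner (\<lambda>x. f x - g x) h = l2_inner f h - l2_inner g h"
  by (simp add: l2_inner_def inner_diff_left integrable_inner)

lemma l2_inner_scaleR_left: "l2_inner (\<lambda>x. c *\<^sub>R f x) h = c * l2_inner f h"
  by (simp add: l2_inner_def)

lemma l2_inner_zero [simp]: "l2_inner (\<lambda>x. 0) h = 0" "l2_inner h (\<lambda>x. 0) = 0"
  by (simp_all add: l2_inner_def)

lemma l2_inner_sum_left:
  "(\<And>i. i \<in> I ==> f i \<in> L2t) ==> h \<in> L2t ==> l2_inner (\<lambda>x. \<Sum>i\<in>I. f i x) h = (\<Sum>i\<in>I. l2_inner (f i) h)"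
  by (induction I rule: infinite_finite_induct) (auto simp: l2_inner_add_left)

lemma l2_inner_add_right: "f \<in> L2t ==> g \<in> L2t ==> h \<in> L2t ==> l2_inner h (\<lambda>x. f x + g x) = l2_inner h f + l2_inner h g"
  by (simp add: l2_inner_commute[of h] l2_inner_add_left)

lemma l2_inner_diff_right: "f \<in> L2t ==> g \<in> L2t ==> h \<in> L2t ==> l2_inner h (\<lambda>x. f x - g x) = l2_inner h f - l2_inner h g"
  by (simp add: l2_inner_commute[of h] l2_inner_diff_left)

lemma l2_inner_scaleR_right: "l2_inner h (\<lambda>x. c *\<^sub>R f x) = c * l2_inner h f"
  by (simp add: l2_inner_commute[of h] l2_inner_scaleR_left)

lemma l2_inner_sum_right:
  "(\<And>i. i \<in> I ==> f i \<in> L2t) ==> h \<in> L2t ==> l2_inner h (\<lambda>x. \<Sum>i\<in>I. f i x) = (\<Sum>i\<in>I. l2_inner h (f i))"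
  by (simp add: l2_inner_commute[of h] l2_inner_sum_left)

lemma l2_inner_self: "l2_inner f f = (\<integral>x. (norm (f x))^2 \<partial>torus)"
  by (simp add: l2_inner_def power2_norm_eq_inner)

lemma l2_inner_self_ge0 [simp]: "0 \<le> l2_inner f f"
  by (simp add: l2_inner_self)

lemma l2_norm_ge0 [simp]: "0 \<le> l2_norm f"
  by (simp add: l2_norm_def)

lemma l2_norm_sq: "(l2_norm f)^2 = l2_inner f f"
  by (simp add: l2_norm_def)

lemma l2_norm_scaleR: "l2_norm (\<lambda>x. c *\<^sub>R f x) = \<bar>c\<bar> * l2_norm f"
  unfolding l2_norm_def l2_inner_scaleR_left l2_inner_scaleR_right
  by (simp add: real_sqrt_mult flip: mult.assoc)

lemma l2_norm_minus: "l2_norm (\<lambda>x. - f x) = l2_norm f"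
  using l2_norm_scaleR[of "-1" f] by simp

lemma l2_cauchy_schwarz:
  assumes f: "f \<in> L2t" and g: "g \<in> L2t"
  shows "\<bar>l2_inner f g\<bar> \<le> l2_norm f * l2_norm g"
proof -
  have q: "0 \<le> l2_inner f f - 2 * t * l2_inner f g + t^2 * l2_inner g g" for t
  proof -
    have "0 \<le> l2_inner (\<lambda>x. f x - t *\<^sub>R g x) (\<lambda>x. f x - t *\<^sub>R g x)"
      by simp
    also have "\<dots> = l2_inner f f - 2 * t * l2_inner f g + t^2 * l2_inner g g"
      using f g by (simp add: l2_inner_diff_left l2_inner_diff_right l2_inner_scaleR_left l2_inner_scaleR_right
          l2_inner_commute[of g f] power2_eq_square algebra_simps)
    finally show ?thesis .
  qed
  have "(l2_inner f g)^2 \<le> l2_inner f f * l2_inner g g"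
  proof (cases "l2_inner g g = 0")
    case True
    have "l2_inner f g = 0"
    proof (rule ccontr)
      assume "l2_inner f g \<noteq> 0"
      then show False
        \<comment> \<open>With \<open>l2_inner g g = 0\<close> the quadratic in \<open>q\<close> is
          affine in t, and this t gives it the value -1.\<close>
        using q[of "(l2_inner f f + 1) / (2 * l2_inner f g)"] True by simp
    qed
    then show ?thesis using True by simp
  next
    case False
    then have p: "0 < l2_inner g g" using l2_inner_self_ge0[of g] by linarith
    have "0 \<le> l2_inner f f - (l2_inner f g)^2 / l2_inner g g"
      using q[of "l2_inner f g / l2_inner g g"] p by (simp add: power2_eq_square field_simps)
    then show ?thesis using p by (simp add: field_simps)
  qed
  then have "sqrt ((l2_inner f g)^2) \<le> sqrt (l2_inner f f * l2_inner g g)"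
    by (rule real_sqrt_le_mono)
  then show ?thesis
    by (simp add: l2_norm_def real_sqrt_mult)
qed

lemma l2_triangle:
  assumes f: "f \<in> L2t" and g: "g \<in> L2t"
  shows "l2_norm (\<lambda>x. f x + g x) \<le> l2_norm f + l2_norm g"
proof (rule power2_le_imp_le)
  have "(l2_norm (\<lambda>x. f x + g x))^2 = l2_inner f f + 2 * l2_inner f g + l2_inner g g"
    using f g by (simp add: l2_norm_sq l2_inner_add_left l2_inner_add_right l2_inner_commute[of g f])
  also have "\<dots> \<le> (l2_norm f + l2_norm g)^2"
    using l2_cauchy_schwarz[OF f g] by (simp add: power2_sum l2_norm_sq)
  finally show "(l2_norm (\<lambda>x. f x + g x))^2 \<le> (l2_norm f + l2_norm g)^2" .
qed simp

lemma l2_norm_eq_0: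
  assumes f: "f \<in> L2t"
  shows "l2_norm f = 0 \<longleftrightarrow> (AE x in torus. f x = 0)"
proof -
  have "l2_norm f = 0 \<longleftrightarrow> (\<integral>x. (norm (f x))^2 \<partial>torus) = 0"
    by (simp add: l2_norm_def l2_inner_self)
  also have "\<dots> \<longleftrightarrow> (AE x in torus. (norm (f x))^2 = 0)"
    by (rule integral_nonneg_eq_0_iff_AE) (use f in \<open>auto simp: L2t_def\<close>)
  finally show ?thesis by simp
qed

lemma l2_norm_mono:
  assumes "g \<in> L2t" "AE x in torus. norm (f x) \<le> norm (g x)"
  shows "l2_norm f \<le> l2_norm g"
proof -
  have "(\<integral>x. (norm (f x))^2 \<partial>torus) \<le> (\<integral>x. (norm (g x))^2 \<partial>torus)"
  proof (rule integral_mono_AE')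
    show "AE x in torus. (norm (f x))^2 \<le> (norm (g x))^2"
      using assms(2) by eventually_elim (auto intro!: power_mono)
  qed (use assms in \<open>auto simp: L2t_def\<close>)
  then show ?thesis
    by (simp add: l2_norm_def l2_inner_self)
qed

section \<open>The Hartley basis\<close>

definition kv :: "int \<times> int \<Rightarrow> real^2" where
  "kv \<kappa> = (\<chi> i. if i = 1 then of_int (fst \<kappa>) else of_int (snd \<kappa>))"

text \<open>The functions \<open>cas \<kappa>\<close> form a real orthonormal basis without any case distinction on the
  frequency, and \<open>\<partial>\<^sub>i cas \<kappa> = 2 \<pi> \<kappa>\<^sub>i cas (-\<kappa>)\<close>.\<close>

definition cas :: "int \<times> int \<Rightarrow> real field" where
  "cas \<kappa> = (\<lambda>x. cos (2 * pi * (kv \<kappa> \<bullet> x)) + sin (2 * pi * (kv \<kappa> \<bullet> x)))"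

definition fc :: "int \<times> int \<Rightarrow> 'b::euclidean_space field \<Rightarrow> 'b" where
  "fc \<kappa> f = (\<integral>x. cas \<kappa> x *\<^sub>R f x \<partial>torus)"

lemma kv_add: "kv (\<kappa> + \<mu>) = kv \<kappa> + kv \<mu>" and kv_minus: "kv (- \<kappa>) = - kv \<kappa>"
  and kv_diff: "kv (\<kappa> - \<mu>) = kv \<kappa> - kv \<mu>" and kv_0: "kv 0 = 0"
  by (auto simp: kv_def vec_eq_iff)

lemma kv_eq_0: "kv \<kappa> = 0 \<longleftrightarrow> \<kappa> = 0"
  by (auto simp: kv_def vec_eq_iff forall_2 prod_eq_iff)

lemma cas_0: "cas 0 = (\<lambda>x. 1)"
  by (simp add: cas_def kv_0)

lemma continuous_cas: "continuous_on S (cas \<kappa>)"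
  unfolding cas_def by (intro continuous_intros)

lemma cas_measurable [measurable]: "cas \<kappa> \<in> borel_measurable torus"
  by (intro continuous_measurable_torus continuous_cas)

lemma cas_bound: "\<bar>cas \<kappa> x\<bar> \<le> 2"
  unfolding cas_def
  by (rule order_trans[OF abs_triangle_ineq]) (use add_mono[OF abs_cos_le_one abs_sin_le_one] in auto)

lemma cas_L2t [simp]: "cas \<kappa> \<in> L2t"
  by (intro L2t_continuous continuous_cas)

lemma L2t_cas_scaleR [simp]: "f \<in> L2t ==> (\<lambda>x. cas \<kappa> x *\<^sub>R f x) \<in> L2t"
  using L2t_scaleR_bounded[OF cas_measurable, of \<kappa> 2 f] cas_bound by auto

lemma L2t_cas_const [simp]: "(\<lambda>x. cas \<kappa> x *\<^sub>R b) \<in> L2t"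
  by (rule L2t_cas_scaleR) (auto intro: L2t_continuous)

lemma periodic_trig:
  "periodic (\<lambda>x. cos (2 * pi * (kv \<kappa> \<bullet> x)))" "periodic (\<lambda>x. sin (2 * pi * (kv \<kappa> \<bullet> x)))"
proof -
  have eq: "2 * pi * (kv \<kappa> \<bullet> (x + axis i 1)) = 2 * pi * (kv \<kappa> \<bullet> x) + 2 * pi * of_int (if i = 1 then fst \<kappa> else snd \<kappa>)"
    for x i by (simp add: inner_add_right inner_axis kv_def algebra_simps)
  show "periodic (\<lambda>x. cos (2 * pi * (kv \<kappa> \<bullet> x)))" "periodic (\<lambda>x. sin (2 * pi * (kv \<kappa> \<bullet> x)))"
    unfolding periodic_def eq cos_add sin_add
    by (simp_all add: cos_int_2pin sin_int_2pin)
qed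

lemma periodic_cas: "periodic (cas \<kappa>)"
  using periodic_trig unfolding periodic_def cas_def by simp

lemma cas_has_derivative:
  "(cas \<kappa> has_derivative (\<lambda>h. 2 * pi * (kv \<kappa> \<bullet> h) * cas (- \<kappa>) x)) (at x)"
  unfolding cas_def kv_minus
  by (rule derivative_eq_intros refl)+ (auto simp: algebra_simps)

lemma cos_kv: "cos (2 * pi * (kv \<kappa> \<bullet> x)) = (cas \<kappa> x + cas (- \<kappa>) x) / 2"
  and sin_kv: "sin (2 * pi * (kv \<kappa> \<bullet> x)) = (cas \<kappa> x - cas (- \<kappa>) x) / 2"
  by (simp_all add: cas_def kv_minus)

lemma cas_mult: "cas \<kappa> x * cas \<mu> x = cos (2 * pi * (kv (\<kappa> - \<mu>) \<bullet> x)) + sin (2 * pi * (kv (\<kappa> + \<mu>) \<bullet> x))"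
  by (simp add: cas_def kv_diff kv_add inner_diff_left inner_add_left distrib_left right_diff_distrib
      cos_diff sin_add algebra_simps)

text \<open>For a nonzero frequency, \<open>cas \<kappa>\<close> is up to a nonzero factor the
  derivative of \<open>cas (- \<kappa>)\<close> in a direction in which the frequency does not
  vanish.\<close>

lemma integral_cas: "(\<integral>x. cas \<kappa> x \<partial>torus) = (if \<kappa> = 0 then 1 else 0)"
proof (cases "\<kappa> = 0")
  case True
  then show ?thesis using torus.prob_space by (simp add: cas_0)
next
  case False
  then obtain i where i: "kv \<kappa> $ i \<noteq> 0"
    using kv_eq_0 by (metis vec_eq_iff zero_index)
  have "(\<integral>x. 2 * pi * (kv (-\<kappa>) \<bullet> axis i 1) * cas (- (-\<kappa>)) x \<partial>torus) = 0"
    by (rule integral_deriv_periodic[OF periodic_cas cas_has_derivative])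
      (intro continuous_intros continuous_cas)
  then show ?thesis
    using i False by (simp add: inner_axis kv_minus)
qed

text \<open>The product formula leaves the even part of \<open>cas (\<kappa> - \<mu>)\<close> and
  the odd part of \<open>cas (\<kappa> + \<mu>)\<close>; the odd part integrates to zero for every
  frequency.\<close>

lemma cas_orthonormal: "l2_inner (cas \<kappa>) (cas \<mu>) = (if \<kappa> = \<mu> then 1 else 0)"
proof -
  have [simp]: "integrable torus (cas \<kappa>)" for \<kappa>
    by (simp add: integrable_L2t)
  have "l2_inner (cas \<kappa>) (cas \<mu>) = (\<integral>x. (cas (\<kappa> - \<mu>) x + cas (- (\<kappa> - \<mu>)) x) / 2 + (cas (\<kappa> + \<mu>) x - cas (- (\<kappa> + \<mu>)) x) / 2 \<partial>torus)"
    unfolding l2_inner_def by (simp add: cas_mult cos_kv sin_kv)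
  also have "\<dots> = (if \<kappa> = \<mu> then 1 else 0)"
    by (simp add: integral_cas neg_equal_zero del: minus_diff_eq minus_add_distrib)
  finally show ?thesis .
qed

lemma fc_inner: "f \<in> L2t ==> fc \<kappa> f \<bullet> b = fc \<kappa> (\<lambda>x. f x \<bullet> b)"
  unfolding fc_def
  by (subst integral_inner_left[symmetric]) (auto intro: integrable_L2t)

lemma fc_real: "fc \<kappa> f = l2_inner (cas \<kappa>) f" for f :: "real field"
  by (simp add: fc_def l2_inner_def)

lemma fc_add: "f \<in> L2t ==> g \<in> L2t ==> fc \<kappa> (\<lambda>x. f x + g x) = fc \<kappa> f + fc \<kappa> g"
  by (simp add: fc_def scaleR_add_right integrable_L2t)

lemma fc_diff: "f \<in> L2t ==> g \<in> L2t ==> fc \<kappa> (\<lambda>x. f x - g x) = fc \<kappa> f - fc \<kappa> g"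
  by (simp add: fc_def scaleR_diff_right integrable_L2t)

lemma fc_scaleR: "fc \<kappa> (\<lambda>x. c *\<^sub>R f x) = c *\<^sub>R fc \<kappa> f"
proof -
  have "(\<lambda>x. cas \<kappa> x *\<^sub>R c *\<^sub>R f x) = (\<lambda>x. c *\<^sub>R (cas \<kappa> x *\<^sub>R f x))"
    by (simp add: mult.commute)
  then show ?thesis
    unfolding fc_def by (simp del: scaleR_scaleR)
qed

lemma fc_zero [simp]: "fc \<kappa> (\<lambda>x. 0) = 0"
  by (simp add: fc_def)

lemma fc_sum: "(\<And>i. i \<in> I ==> f i \<in> L2t) ==> fc \<kappa> (\<lambda>x. \<Sum>i\<in>I. f i x) = (\<Sum>i\<in>I. fc \<kappa> (f i))"
  by (induction I rule: infinite_finite_induct) (auto simp: fc_add)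

lemma fc_cas: "fc \<kappa> (\<lambda>x. cas \<mu> x *\<^sub>R b) = (if \<kappa> = \<mu> then b else 0)"
proof -
  have "fc \<kappa> (\<lambda>x. cas \<mu> x *\<^sub>R b) = (\<integral>x. (cas \<kappa> x * cas \<mu> x) *\<^sub>R b \<partial>torus)"
    by (simp add: fc_def)
  also have "\<dots> = (\<integral>x. cas \<kappa> x * cas \<mu> x \<partial>torus) *\<^sub>R b"
  proof (rule integral_scaleR_left)
    show "b \<noteq> 0 ==> integrable torus (\<lambda>x. cas \<kappa> x * cas \<mu> x)"
      using integrable_inner[of "cas \<kappa>" "cas \<mu>"] by simp
  qed
  also have "(\<integral>x. cas \<kappa> x * cas \<mu> x \<partial>torus) = (if \<kappa> = \<mu> then 1 else 0)"
    using cas_orthonormal[of \<kappa> \<mu>] by (simp add: l2_inner_def)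
  finally show ?thesis by simp
qed

section \<open>Completeness and Parseval's identity\<close>

lemma l2_norm_const: "l2_norm (\<lambda>x. c) = norm c"
  using torus.prob_space by (simp add: l2_norm_def l2_inner_self)

section \<open>Density of trigonometric polynomials\<close>

inductive trig_poly :: "real field \<Rightarrow> bool" where
  cas: "trig_poly (\<lambda>x. c * cas \<kappa> x)"
| add: "trig_poly p ==> trig_poly q ==> trig_poly (\<lambda>x. p x + q x)"

lemma trig_poly_const: "trig_poly (\<lambda>x. c)"
  using trig_poly.cas[of c 0] by (simp add: cas_0)

lemma trig_poly_scale: "trig_poly p ==> trig_poly (\<lambda>x. c * p x)"
proof (induction rule: trig_poly.induct)
  case (cas d \<kappa>)
  then show ?case using trig_poly.cas[of "c * d" \<kappa>] by (simp add: mult.assoc)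
next
  case (add p q)
  then show ?case using trig_poly.add by (simp add: distrib_left)
qed

lemma trig_poly_cos: "trig_poly (\<lambda>x. cos (2 * pi * (kv \<kappa> \<bullet> x)))"
  and trig_poly_sin: "trig_poly (\<lambda>x. sin (2 * pi * (kv \<kappa> \<bullet> x)))"
  using trig_poly.add[OF trig_poly.cas[of "1/2" \<kappa>] trig_poly.cas[of "1/2" "-\<kappa>"]]
    trig_poly.add[OF trig_poly.cas[of "1/2" \<kappa>] trig_poly.cas[of "-(1/2)" "-\<kappa>"]]
  by (simp_all add: cos_kv[abs_def] sin_kv[abs_def] add_divide_distrib diff_divide_distrib)

lemma trig_poly_mult:
  assumes "trig_poly p" "trig_poly q"
  shows "trig_poly (\<lambda>x. p x * q x)"
  using assms(1)
proof (induction rule: trig_poly.induct)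
  case (cas c \<kappa>)
  show ?case
    using assms(2)
  proof (induction rule: trig_poly.induct)
    case (cas d \<mu>)
    have "(\<lambda>x. c * cas \<kappa> x * (d * cas \<mu> x)) =
        (\<lambda>x. (c * d) * (cos (2 * pi * (kv (\<kappa> - \<mu>) \<bullet> x)) + sin (2 * pi * (kv (\<kappa> + \<mu>) \<bullet> x))))"
      unfolding cas_mult[symmetric] by (simp add: mult_ac)
    then show ?case
      by (simp only: trig_poly_scale trig_poly.add trig_poly_cos trig_poly_sin)
  next
    case (add p q)
    then show ?case using trig_poly.add by (simp add: distrib_left)
  qed
next
  case (add p q)
  then show ?case using trig_poly.add by (simp add: distrib_right)
qed

lemma trig_poly_continuous: "trig_poly p ==> continuous_on S p"
  by (induction rule: trig_poly.induct) (auto intro!: continuous_intros continuous_cas)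

lemma trig_poly_L2t: "trig_poly p ==> p \<in> L2t"
  by (intro L2t_continuous trig_poly_continuous)

text \<open>The embedding of the torus as a product of two unit circles. Periodicity is built in,
  and ordinary polynomials on the compact image become trigonometric polynomials.\<close>

definition circ :: "real^2 \<Rightarrow> complex \<times> complex" where
  "circ x = (cis (2 * pi * x $ 1), cis (2 * pi * x $ 2))"

lemma continuous_circ: "continuous_on S circ"
  unfolding circ_def by (intro continuous_intros)

text \<open>A linear functional of \<open>circ\<close> is a combination of the cosines and sines of
  the two unit frequencies; sums and products are covered by the algebra structure of trigonometric
  polynomials.\<close>

lemma trig_poly_circ:
  assumes "real_polynomial_function F"
  shows "trig_poly (\<lambda>x. F (circ x))"
  using assms
proof (induction rule: real_polynomial_function.induct)
  case (linear f)
  then interpret bounded_linear f .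
  have kv: "kv (1, 0) \<bullet> x = x $ 1" "kv (0, 1) \<bullet> x = x $ 2" for x
    by (auto simp: kv_def inner_vec_def sum_2)
  have "f (circ x) = f (1, 0) * cos (2 * pi * (kv (1, 0) \<bullet> x)) + f (\<i>, 0) * sin (2 * pi * (kv (1, 0) \<bullet> x))
      + (f (0, 1) * cos (2 * pi * (kv (0, 1) \<bullet> x)) + f (0, \<i>) * sin (2 * pi * (kv (0, 1) \<bullet> x)))" for x
  proof -
    have "circ x = cos (2 * pi * x $ 1) *\<^sub>R (1, 0) + sin (2 * pi * x $ 1) *\<^sub>R (\<i>, 0)
        + (cos (2 * pi * x $ 2) *\<^sub>R (0, 1) + sin (2 * pi * x $ 2) *\<^sub>R (0, \<i>))"
      by (auto simp: circ_def complex_eq_iff)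
    then show ?thesis
      by (simp only: add scaleR kv) (simp add: mult.commute)
  qed
  moreover have "trig_poly (\<lambda>x. f (1, 0) * cos (2 * pi * (kv (1, 0) \<bullet> x)) + f (\<i>, 0) * sin (2 * pi * (kv (1, 0) \<bullet> x))
      + (f (0, 1) * cos (2 * pi * (kv (0, 1) \<bullet> x)) + f (0, \<i>) * sin (2 * pi * (kv (0, 1) \<bullet> x))))"
    by (intro trig_poly.add trig_poly_scale trig_poly_cos trig_poly_sin)
  ultimately show ?case by simp
qed (auto intro: trig_poly_const trig_poly.add trig_poly_mult)

definition approximable :: "real field \<Rightarrow> bool" where
  "approximable f \<longleftrightarrow> f \<in> L2t \<and> (\<forall>\<epsilon>>0. \<exists>p. trig_poly p \<and> l2_norm (\<lambda>x. f x - p x) < \<epsilon>)"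

lemma approximable_trig: "trig_poly p ==> approximable p"
  unfolding approximable_def by (auto simp: trig_poly_L2t l2_norm_def intro!: exI[of _ p])

lemma approximable_closed:
  assumes f: "f \<in> L2t" and ap: "\<And>\<epsilon>. \<epsilon> > 0 ==> \<exists>g. approximable g \<and> l2_norm (\<lambda>x. f x - g x) < \<epsilon>"
  shows "approximable f"
  unfolding approximable_def
proof safe
  fix \<epsilon> :: real assume "\<epsilon> > 0"
  then obtain g where g: "approximable g" "l2_norm (\<lambda>x. f x - g x) < \<epsilon> / 2"
    using ap[of "\<epsilon> / 2"] by auto
  then obtain p where p: "trig_poly p" "l2_norm (\<lambda>x. g x - p x) < \<epsilon> / 2"
    using \<open>\<epsilon> > 0\<close> unfolding approximable_def by (meson half_gt_zero)
  have "l2_norm (\<lambda>x. f x - p x) = l2_norm (\<lambda>x. (f x - g x) + (g x - p x))"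
    by simp
  also have "\<dots> \<le> l2_norm (\<lambda>x. f x - g x) + l2_norm (\<lambda>x. g x - p x)"
    using f g(1) p(1) by (intro l2_triangle) (auto simp: approximable_def trig_poly_L2t)
  also have "\<dots> < \<epsilon>" using g p by simp
  finally show "\<exists>p. trig_poly p \<and> l2_norm (\<lambda>x. f x - p x) < \<epsilon>"
    using p by auto
qed fact

lemma approximable_seq:
  assumes "f \<in> L2t" "\<And>n. approximable (g n)" "(\<lambda>n. l2_norm (\<lambda>x. f x - g n x)) \<longlonglongrightarrow> 0"
  shows "approximable f"
proof (rule approximable_closed)
  fix \<epsilon> :: real assume "\<epsilon> > 0"
  then have "\<forall>\<^sub>F n in sequentially. l2_norm (\<lambda>x. f x - g n x) < \<epsilon>"
    using assms(3) by (rule order_tendstoD(2)[rotated])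
  then show "\<exists>g. approximable g \<and> l2_norm (\<lambda>x. f x - g x) < \<epsilon>"
    using assms(2) by (auto simp: eventually_sequentially)
qed fact

lemma l2_dominated:
  assumes "\<And>n. g n \<in> L2t" "f \<in> L2t" "h \<in> L2t"
    and "\<And>x. x \<in> cell ==> (\<lambda>n. g n x) \<longlonglongrightarrow> f x"
    and "\<And>n x. x \<in> cell ==> norm (f x - g n x) \<le> norm (h x)"
  shows "(\<lambda>n. l2_norm (\<lambda>x. f x - g n x)) \<longlonglongrightarrow> 0"
proof -
  have "(\<lambda>n. \<integral>x. (norm (f x - g n x))^2 \<partial>torus) \<longlonglongrightarrow> (\<integral>x. 0 \<partial>torus)"
  proof (rule integral_dominated_convergence[where w="\<lambda>x. (norm (h x))^2"])
    show "AE x in torus. (\<lambda>n. (norm (f x - g n x))^2) \<longlonglongrightarrow> 0"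
    proof (rule AE_I2)
      fix x assume "x \<in> space torus"
      then have "(\<lambda>n. (norm (f x - g n x))^2) \<longlonglongrightarrow> (norm (f x - f x))^2"
        by (intro tendsto_intros assms) simp
      then show "(\<lambda>n. (norm (f x - g n x))^2) \<longlonglongrightarrow> 0" by simp
    qed
    show "AE x in torus. norm ((norm (f x - g n x))^2) \<le> (norm (h x))^2" for n
      using assms(5) by (intro AE_I2) (auto intro!: power_mono)
    have [measurable]: "f \<in> borel_measurable torus" "g n \<in> borel_measurable torus" for n
      using assms by auto
    show "(\<lambda>x. (norm (f x - g n x))^2) \<in> borel_measurable torus" for n
      by measurable
  qed (use assms in \<open>auto simp: L2t_def\<close>)
  then have "(\<lambda>n. sqrt (\<integral>x. (norm (f x - g n x))^2 \<partial>torus)) \<longlonglongrightarrow> sqrt 0"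
    by (intro tendsto_intros) simp
  then show ?thesis
    by (simp add: l2_norm_def l2_inner_self)
qed

lemma approximable_add:
  assumes f: "approximable f" and g: "approximable g"
  shows "approximable (\<lambda>x. f x + g x)"
  unfolding approximable_def
proof safe
  show "(\<lambda>x. f x + g x) \<in> L2t" using assms by (auto simp: approximable_def)
  fix \<epsilon> :: real assume "\<epsilon> > 0"
  then obtain p q where p: "trig_poly p" "l2_norm (\<lambda>x. f x - p x) < \<epsilon> / 2"
    and q: "trig_poly q" "l2_norm (\<lambda>x. g x - q x) < \<epsilon> / 2"
    using f g unfolding approximable_def by (meson half_gt_zero)
  have "l2_norm (\<lambda>x. f x + g x - (p x + q x)) = l2_norm (\<lambda>x. (f x - p x) + (g x - q x))"
    by (simp add: algebra_simps)
  also have "\<dots> \<le> l2_norm (\<lambda>x. f x - p x) + l2_norm (\<lambda>x. g x - q x)"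
    using f g p(1) q(1) by (intro l2_triangle) (auto simp: approximable_def trig_poly_L2t)
  also have "\<dots> < \<epsilon>" using p q by simp
  finally show "\<exists>p. trig_poly p \<and> l2_norm (\<lambda>x. f x + g x - p x) < \<epsilon>"
    using trig_poly.add[OF p(1) q(1)] by auto
qed

lemma approximable_scale:
  assumes f: "approximable f"
  shows "approximable (\<lambda>x. c * f x)"
proof (cases "c = 0")
  case True
  then show ?thesis using approximable_trig[OF trig_poly_const[of 0]] by simp
next
  case False
  show ?thesis
    unfolding approximable_def
  proof safe
    show "(\<lambda>x. c * f x) \<in> L2t" using assms by (auto simp: approximable_def)
    fix \<epsilon> :: real assume "\<epsilon> > 0"
    then obtain p where p: "trig_poly p" "l2_norm (\<lambda>x. f x - p x) < \<epsilon> / \<bar>c\<bar>"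
      using f False unfolding approximable_def by (meson divide_pos_pos zero_less_abs_iff)
    have "l2_norm (\<lambda>x. c * f x - c * p x) = \<bar>c\<bar> * l2_norm (\<lambda>x. f x - p x)"
      using l2_norm_scaleR[of c "\<lambda>x. f x - p x"] by (simp add: right_diff_distrib)
    also have "\<dots> < \<epsilon>" using p False by (simp add: field_simps)
    finally show "\<exists>p. trig_poly p \<and> l2_norm (\<lambda>x. c * f x - p x) < \<epsilon>"
      using trig_poly_scale[OF p(1)] by auto
  qed
qed

lemma approximable_sum:
  "(\<And>i. i \<in> I ==> approximable (f i)) ==> approximable (\<lambda>x. \<Sum>i\<in>I. f i x)"
proof (induction I rule: infinite_finite_induct)
  case (insert i I)
  then show ?case using approximable_add[of "f i" "\<lambda>x. \<Sum>i\<in>I. f i x"] by auto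
qed (use approximable_trig[OF trig_poly_const[of 0]] in auto)

text \<open>Stone-Weierstrass on the compact image of the closed cell. As the torus has measure one,
  a uniform bound is also a bound of the L^2 norm.\<close>

lemma approximable_continuous_circ:
  assumes F: "continuous_on UNIV (F :: complex \<times> complex \<Rightarrow> real)"
  shows "approximable (\<lambda>x. F (circ x))"
proof (rule approximable_closed)
  show L: "(\<lambda>x. F (circ x)) \<in> L2t"
    by (intro L2t_continuous continuous_on_compose2[OF F continuous_circ]) auto
  fix \<epsilon> :: real assume \<epsilon>: "\<epsilon> > 0"
  have "compact (circ ` cbox 0 1)"
    by (intro compact_continuous_image continuous_circ) auto
  then obtain G where G: "real_polynomial_function G" "\<And>z. z \<in> circ ` cbox 0 1 ==> \<bar>F z - G z\<bar> < \<epsilon> / 2"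
    using Stone_Weierstrass_real_polynomial_function[of "circ ` cbox 0 1" F "\<epsilon> / 2"] F \<epsilon>
    by (metis continuous_on_subset half_gt_zero subset_UNIV)
  have "l2_norm (\<lambda>x. F (circ x) - G (circ x)) \<le> l2_norm (\<lambda>x. \<epsilon> / 2 :: real)"
  proof (rule l2_norm_mono)
    show "AE x in torus. norm (F (circ x) - G (circ x)) \<le> norm (\<epsilon> / 2)"
    proof (rule AE_I2)
      fix x assume "x \<in> space torus"
      then have "circ x \<in> circ ` cbox 0 1"
        using cell_subset_cbox by auto
      from G(2)[OF this] show "norm (F (circ x) - G (circ x)) \<le> norm (\<epsilon> / 2)"
        using \<epsilon> by simp
    qed
  qed (auto intro: L2t_continuous)
  also have "\<dots> < \<epsilon>"
    using \<epsilon> by (simp add: l2_norm_const)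
  finally show "\<exists>g. approximable g \<and> l2_norm (\<lambda>x. F (circ x) - g x) < \<epsilon>"
    using approximable_trig[OF trig_poly_circ[OF G(1)]] by auto
qed

text \<open>The indicator of an open set is the pointwise limit of the continuous functions min(1, n
  dist(., complement)), all bounded by 1.\<close>

lemma approximable_open_circ:
  assumes "open U"
  shows "approximable (\<lambda>x. indicator U (circ x))"
\<comment> \<open>The distance to the empty set is 0 by convention, so the whole space needs its own
  case.\<close>
proof (cases "U = UNIV")
  case True
  then show ?thesis using approximable_trig[OF trig_poly_const[of 1]] by simp
next
  case False
  define F where "F n z = min 1 (real n * infdist z (- U))" for n z
  have cF: "continuous_on UNIV (F n)" for n
    unfolding F_def by (intro continuous_intros)
  have [measurable]: "U \<in> sets borel" "circ \<in> borel_measurable borel"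
    using assms continuous_circ by (auto intro: borel_measurable_continuous_onI)
  have [measurable]: "(\<lambda>x. indicator U (circ x) :: real) \<in> borel_measurable torus"
    by (rule measurable_torus_borel) measurable
  show ?thesis
  proof (rule approximable_seq)
    show L: "(\<lambda>x. indicator U (circ x) :: real) \<in> L2t"
      by (rule L2t_bounded[of _ 1]) (auto split: split_indicator)
    show ap: "approximable (\<lambda>x. F n (circ x))" for n
      by (rule approximable_continuous_circ[OF cF])
    show "(\<lambda>n. l2_norm (\<lambda>x. indicator U (circ x) - F n (circ x))) \<longlonglongrightarrow> 0"
    proof (rule l2_dominated[where h="\<lambda>x. 1::real"])
      fix x :: "real^2"
      show "(\<lambda>n. F n (circ x)) \<longlonglongrightarrow> indicator U (circ x)"
      proof (cases "circ x \<in> U")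
        case True
        have "closed (- U)" "- U \<noteq> {}"
          using assms False by auto
        with \<open>circ x \<in> U\<close> have "infdist (circ x) (- U) > 0"
          using in_closed_iff_infdist_zero[of "- U" "circ x"] infdist_nonneg[of "circ x" "- U"]
          by (simp add: less_eq_real_def)
        then obtain N where N: "1 < real N * infdist (circ x) (- U)"
          using reals_Archimedean3 by blast
        have "F n (circ x) = 1" if "n \<ge> N" for n
          using N mult_right_mono[of "real N" "real n" "infdist (circ x) (- U)"] that
          by (simp add: F_def infdist_nonneg)
        then show ?thesis
          using True by (intro tendsto_eventually) (auto simp: eventually_sequentially)
      next
        case False
        then have "F n (circ x) = 0" for n by (simp add: F_def)
        then show ?thesis using False by simp
      qed
      show "norm (indicator U (circ x) - F n (circ x)) \<le> norm (1::real)" for n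
        using infdist_nonneg[of "circ x" "- U"] by (auto simp: F_def split: split_indicator)
    qed (use L ap in \<open>auto simp: approximable_def intro: L2t_continuous\<close>)
  qed
qed

text \<open>The pi-lambda theorem: open sets are stable under intersection, and approximability
  passes to complements and, by dominated convergence, to countable disjoint unions.\<close>

lemma approximable_borel_circ:
  assumes "B \<in> sets borel"
  shows "approximable (\<lambda>x. indicator B (circ x))"
proof -
  have c [measurable]: "circ \<in> borel_measurable borel"
    using continuous_circ by (rule borel_measurable_continuous_onI)
  have L: "(\<lambda>x. indicator B (circ x) :: real) \<in> L2t" if [measurable]: "B \<in> sets borel" for B
  proof -
    have [measurable]: "(\<lambda>x. indicator B (circ x) :: real) \<in> borel_measurable torus"
      by (rule measurable_torus_borel) measurable
    show ?thesis by (rule L2t_bounded[of _ 1]) (auto split: split_indicator)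
  qed
  have "Int_stable {S. open (S :: (complex \<times> complex) set)}"
    by (auto simp: Int_stable_def)
  moreover have "{S. open (S :: (complex \<times> complex) set)} \<subseteq> Pow UNIV"
    by simp
  moreover have "B \<in> sigma_sets UNIV {S. open S}"
    using assms by (simp add: borel_def)
  ultimately show ?thesis
  proof (induction rule: sigma_sets_induct_disjoint)
    case (basic A)
    then show ?case by (auto intro: approximable_open_circ)
  next
    case empty
    then show ?case using approximable_trig[OF trig_poly_const[of 0]] by simp
  next
    case (compl A)
    have "(\<lambda>x. indicator (UNIV - A) (circ x) :: real) = (\<lambda>x. 1 + (-1) * indicator A (circ x))"
      by (auto split: split_indicator)
    then show ?case
      using approximable_add[OF approximable_trig[OF trig_poly_const[of 1]] approximable_scale[OF compl(2), of "-1"]]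
      by simp
  next
    case (union A)
    then have A [measurable]: "A i \<in> sets borel" for i by (auto simp: borel_def)
    show ?case
    proof (rule approximable_seq)
      show "approximable (\<lambda>x. \<Sum>i<n. indicator (A i) (circ x))" for n
        by (rule approximable_sum) (use union in auto)
      have eq: "(\<Sum>i<n. indicator (A i) z) = (indicator (\<Union>i<n. A i) z :: real)" for n z
        using union(1) by (subst indicator_UN_disjoint) (auto simp: disjoint_family_on_def)
      have eq': "(\<lambda>n. \<Sum>i<n. indicator (A i) z :: real) \<longlonglongrightarrow> indicator (\<Union>i. A i) z" for z
        unfolding eq by (rule LIMSEQ_indicator_UN)
      show "(\<lambda>n. l2_norm (\<lambda>x. indicator (\<Union>i. A i) (circ x) - (\<Sum>i<n. indicator (A i) (circ x) :: real))) \<longlonglongrightarrow> 0"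
      proof (rule l2_dominated[where h="\<lambda>x. 1::real" and f="\<lambda>x. indicator (\<Union>i. A i) (circ x)"
            and g="\<lambda>n x. \<Sum>i<n. indicator (A i) (circ x)"])
        fix n and x :: "real^2"
        show "(\<lambda>x. \<Sum>i<n. indicator (A i) (circ x) :: real) \<in> L2t"
          by (intro L2t_sum L) simp
        show "(\<lambda>n. \<Sum>i<n. indicator (A i) (circ x) :: real) \<longlonglongrightarrow> indicator (\<Union>i. A i) (circ x)"
          by (rule eq')
        show "norm (indicator (\<Union>i. A i) (circ x) - (\<Sum>i<n. indicator (A i) (circ x) :: real)) \<le> norm (1::real)"
          unfolding eq by (auto split: split_indicator)
      qed (auto intro: L simp: cas_L2t[of 0, unfolded cas_0])
    qed (auto intro: L)
  qed
qed

definition uncirc :: "complex \<times> complex \<Rightarrow> real^2" where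
  "uncirc z = pt (Arg2pi (fst z) / (2 * pi), Arg2pi (snd z) / (2 * pi))"

text \<open>\<open>Arg2pi\<close> is continuous off the closed half-line of nonnegative reals and
  vanishes on it.\<close>

lemma Arg2pi_borel [measurable]: "Arg2pi \<in> borel_measurable borel"
proof -
  have "(\<lambda>z. if z \<in> \<real>\<^sub>\<ge>\<^sub>0 then 0 else Arg2pi z) \<in> borel_measurable borel"
  proof (rule borel_measurable_continuous_on_if)
    show "continuous_on (- \<real>\<^sub>\<ge>\<^sub>0) Arg2pi"
      using continuous_at_Arg2pi by (auto intro!: continuous_at_imp_continuous_on)
  qed (auto intro!: borel_closed)
  also have "(\<lambda>z. if z \<in> \<real>\<^sub>\<ge>\<^sub>0 then 0 else Arg2pi z) = Arg2pi"
    using Arg2pi_eq_0 by (auto simp: complex_nonneg_Reals_iff complex_is_Real_iff)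
  finally show ?thesis .
qed

lemma uncirc_borel [measurable]: "uncirc \<in> borel_measurable borel"
  unfolding uncirc_def[abs_def] borel_prod[symmetric] by measurable

lemma uncirc_circ:
  assumes "x \<in> cell"
  shows "uncirc (circ x) = x"
proof -
  have "Arg2pi (cis (2 * pi * x $ i)) = 2 * pi * x $ i" for i
  proof (rule Arg2pi_unique[of 1])
    show "of_real 1 * exp (\<i> * of_real (2 * pi * x $ i)) = cis (2 * pi * x $ i)"
      by (simp add: cis_conv_exp)
  qed (use assms in \<open>auto simp: cell_def\<close>)
  then show ?thesis
    by (auto simp: uncirc_def circ_def vec_eq_iff forall_2)
qed

lemma approximable_cong_AE:
  assumes "approximable f" "g \<in> L2t" "AE x in torus. f x = g x"
  shows "approximable g"
proof (rule approximable_closed)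
  fix \<epsilon> :: real assume "\<epsilon> > 0"
  have "l2_norm (\<lambda>x. g x - f x) = 0"
    using assms by (subst l2_norm_eq_0) (auto simp: approximable_def)
  then show "\<exists>h. approximable h \<and> l2_norm (\<lambda>x. g x - h x) < \<epsilon>"
    using assms \<open>\<epsilon> > 0\<close> by auto
qed fact

text \<open>A Lebesgue measurable set differs from a Borel set by a null set, and inside the cell
  the Borel set is pulled back from the two circles.\<close>

lemma approximable_indicator:
  assumes A: "A \<in> sets torus"
  shows "approximable (indicator A)"
proof -
  obtain A' where A': "A' \<in> sets lebesgue" "A = cell \<inter> A'"
    using A by (auto simp: torus_eq sets_restrict_space)
  then obtain S N N' where S: "A' = S \<union> N" "N \<subseteq> N'" "N' \<in> null_sets lborel" "S \<in> sets lborel"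
    by (auto elim: sets_completionE)
  have [measurable]: "S \<in> sets borel" using S by simp
  have "uncirc -` S \<in> sets borel"
    using measurable_sets[OF uncirc_borel, of S] by simp
  then have ap: "approximable (\<lambda>x. indicator (uncirc -` S) (circ x))"
    by (rule approximable_borel_circ)
  show ?thesis
  proof (rule approximable_cong_AE[OF ap])
    show "(indicator A :: real field) \<in> L2t"
      using A by (intro L2t_bounded[of _ 1]) (auto simp: indicator_def)
    have "AE x in lebesgue. x \<notin> N'"
      using S(3) by (intro AE_completion AE_not_in)
    then have "AE x in torus. x \<notin> N'"
      unfolding torus_eq by (subst AE_restrict_space_iff) auto
    moreover have "AE x in torus. x \<in> cell"
      by (rule AE_I2) simp
    ultimately show "AE x in torus. indicator (uncirc -` S) (circ x) = (indicator A x :: real)"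
      by eventually_elim (use S A'(2) in \<open>auto simp: uncirc_circ split: split_indicator\<close>)
  qed
qed

text \<open>Simple functions converge to f pointwise and are dominated by 2 |f|; the differences are
  then dominated by 3 |f|, which is square integrable.\<close>

theorem approximable_L2t:
  assumes f: "f \<in> L2t"
  shows "approximable f"
proof -
  obtain F where F: "\<And>i. simple_function torus (F i)" "\<And>x. x \<in> cell ==> (\<lambda>i. F i x) \<longlonglongrightarrow> f x"
    "\<And>i x. x \<in> cell ==> dist (F i x) 0 \<le> 2 * dist (f x) 0"
    using borel_measurable_implies_sequence_metric[OF L2tD(1)[OF f], of 0] by (metis space_torus)
  have Fm [measurable]: "F i \<in> borel_measurable torus" for i
    by (rule borel_measurable_simple_function[OF F(1)])
  have FL: "F i \<in> L2t" for i
    by (rule L2tI_bound[of _ "\<lambda>x. 2 * f x"]) (use F(3) f in \<open>auto simp: abs_mult intro!: AE_I2\<close>)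
  show ?thesis
  proof (rule approximable_seq[OF f])
    fix i
    have fin: "finite (F i ` cell)"
      using F(1)[of i] by (simp add: simple_function_def)
    have ap: "approximable (\<lambda>x. \<Sum>y\<in>F i ` cell. y * indicator (F i -` {y} \<inter> cell) x)"
    proof (intro approximable_sum approximable_scale approximable_indicator)
      show "F i -` {y} \<inter> cell \<in> sets torus" for y
        using measurable_sets[OF Fm, of "{y}" i] by simp
    qed
    show "approximable (F i)"
    proof (rule approximable_cong_AE[OF ap FL], rule AE_I2)
      fix x assume "x \<in> space torus"
      then show "(\<Sum>y\<in>F i ` cell. y * indicator (F i -` {y} \<inter> cell) x) = F i x"
        using fin by (subst sum.remove[of _ "F i x"]) (auto intro!: sum.neutral split: split_indicator)
    qed
  next
    show "(\<lambda>n. l2_norm (\<lambda>x. f x - F n x)) \<longlonglongrightarrow> 0"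
    proof (rule l2_dominated[where h="\<lambda>x. 3 * f x"])
      fix n x assume "x \<in> cell"
      then have "\<bar>F n x\<bar> \<le> 2 * \<bar>f x\<bar>" using F(3)[of x n] by simp
      then show "norm (f x - F n x) \<le> norm (3 * f x)"
        by (simp add: abs_mult)
    qed (use f FL F in auto)
  qed
qed

section \<open>Bessel's inequality and Parseval's identity\<close>

lemma trig_poly_sum:
  assumes "trig_poly p"
  shows "\<exists>F c. finite F \<and> p = (\<lambda>x. \<Sum>\<kappa>\<in>F. c \<kappa> *\<^sub>R cas \<kappa> x)"
  using assms
proof (induction rule: trig_poly.induct)
  case (cas c \<kappa>)
  show ?case by (rule exI[of _ "{\<kappa>}"], rule exI[of _ "\<lambda>_. c"]) simp
next
  case (add p q)
  then obtain F c G d where 1: "finite F" "p = (\<lambda>x. \<Sum>\<kappa>\<in>F. c \<kappa> *\<^sub>R cas \<kappa> x)"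
    "finite G" "q = (\<lambda>x. \<Sum>\<kappa>\<in>G. d \<kappa> *\<^sub>R cas \<kappa> x)" by blast
  have p: "p x = (\<Sum>\<kappa>\<in>F \<union> G. (if \<kappa> \<in> F then c \<kappa> else 0) *\<^sub>R cas \<kappa> x)" for x
    unfolding 1(2) by (rule sum.mono_neutral_cong_left) (use 1 in auto)
  have q: "q x = (\<Sum>\<kappa>\<in>F \<union> G. (if \<kappa> \<in> G then d \<kappa> else 0) *\<^sub>R cas \<kappa> x)" for x
    unfolding 1(4) by (rule sum.mono_neutral_cong_left) (use 1 in auto)
  show ?case
  proof (intro exI conjI ext)
    show "finite (F \<union> G)" using 1 by simp
    show "p x + q x = (\<Sum>\<kappa>\<in>F \<union> G. ((if \<kappa> \<in> F then c \<kappa> else 0) + (if \<kappa> \<in> G then d \<kappa> else 0)) *\<^sub>R cas \<kappa> x)" for x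
      unfolding p q by (simp only: scaleR_add_left sum.distrib)
  qed
qed

text \<open>Expanding the square and completing it in the coefficients. Taking c to be the Fourier
  coefficients gives Bessel's inequality; a general c shows that no other choice does
  better.\<close>

lemma l2_dist_trig_sum:
  fixes f :: "real field"
  assumes f: "f \<in> L2t" and F: "finite F"
  shows "(l2_norm (\<lambda>x. f x - (\<Sum>\<kappa>\<in>F. c \<kappa> *\<^sub>R cas \<kappa> x)))^2 =
    (l2_norm f)^2 - (\<Sum>\<kappa>\<in>F. (fc \<kappa> f)^2) + (\<Sum>\<kappa>\<in>F. (c \<kappa> - fc \<kappa> f)^2)"
proof -
  define p where "p = (\<lambda>x. \<Sum>\<kappa>\<in>F. c \<kappa> *\<^sub>R cas \<kappa> x)"
  have L: "p \<in> L2t"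
    unfolding p_def by (intro L2t_sum L2t_scaleR cas_L2t)
  have a: "l2_inner g p = (\<Sum>\<kappa>\<in>F. c \<kappa> * fc \<kappa> g)" if "g \<in> L2t" for g
    unfolding p_def
    by (subst l2_inner_sum_right) (use that in \<open>auto simp del: real_scaleR_def simp: l2_inner_scaleR_right fc_real l2_inner_commute[of g]\<close>)
  have b: "l2_inner p p = (\<Sum>\<kappa>\<in>F. (c \<kappa>)^2)"
    unfolding a[OF L]
  proof (intro sum.cong refl)
    fix \<kappa> assume "\<kappa> \<in> F"
    then have "l2_inner (cas \<kappa>) p = c \<kappa>"
      using F by (simp add: a fc_real cas_orthonormal if_distrib cong: if_cong)
    then show "c \<kappa> * fc \<kappa> p = (c \<kappa>)^2"
      by (simp add: fc_real power2_eq_square)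
  qed
  have "(l2_norm (\<lambda>x. f x - p x))^2 = l2_inner f f - 2 * l2_inner f p + l2_inner p p"
    unfolding l2_norm_sq using f L
    by (simp add: l2_inner_diff_left l2_inner_diff_right l2_inner_commute[of p f])
  also have "\<dots> = (l2_norm f)^2 - (\<Sum>\<kappa>\<in>F. (fc \<kappa> f)^2) + (\<Sum>\<kappa>\<in>F. (c \<kappa> - fc \<kappa> f)^2)"
    unfolding a[OF f] b by (simp add: l2_norm_sq power2_diff sum.distrib sum_subtractf sum_distrib_left mult.assoc)
  finally show ?thesis by (simp add: p_def)
qed

text \<open>Bessel bounds every finite sum from above. If F carries a trigonometric polynomial
  within distance sqrt(eps) of f, the partial sum over F is already within eps of the norm, since
  the Fourier coefficients are the best choice on F.\<close>

lemma parseval_real: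
  fixes f :: "real field"
  assumes f: "f \<in> L2t"
  shows "((\<lambda>\<kappa>. (fc \<kappa> f)^2) has_sum (l2_norm f)^2) UNIV"
  unfolding has_sum_def
proof (rule tendstoI)
  fix \<epsilon> :: real assume "\<epsilon> > 0"
  then obtain p where p: "trig_poly p" "l2_norm (\<lambda>x. f x - p x) < sqrt \<epsilon>"
    using approximable_L2t[OF f] unfolding approximable_def by (meson real_sqrt_gt_zero)
  obtain F c where F: "finite F" "p = (\<lambda>x. \<Sum>\<kappa>\<in>F. c \<kappa> *\<^sub>R cas \<kappa> x)"
    using trig_poly_sum[OF p(1)] by blast
  have le: "(\<Sum>\<kappa>\<in>G. (fc \<kappa> f)^2) \<le> (l2_norm f)^2" if "finite G" for G
  proof -
    have "0 \<le> (l2_norm (\<lambda>x. f x - (\<Sum>\<kappa>\<in>G. fc \<kappa> f *\<^sub>R cas \<kappa> x)))^2"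
      by simp
    then show ?thesis unfolding l2_dist_trig_sum[OF f that] by simp
  qed
  have "(l2_norm f)^2 - (\<Sum>\<kappa>\<in>F. (fc \<kappa> f)^2) \<le> (l2_norm (\<lambda>x. f x - p x))^2"
    unfolding F(2) l2_dist_trig_sum[OF f F(1)] by (simp add: sum_nonneg)
  also have "\<dots> < (sqrt \<epsilon>)^2"
    using p(2) by (intro power_strict_mono) auto
  also have "(sqrt \<epsilon>)^2 = \<epsilon>" using \<open>\<epsilon> > 0\<close> by simp
  finally have *: "(l2_norm f)^2 - \<epsilon> < (\<Sum>\<kappa>\<in>F. (fc \<kappa> f)^2)" by simp
  show "\<forall>\<^sub>F G in finite_subsets_at_top UNIV. dist (\<Sum>\<kappa>\<in>G. (fc \<kappa> f)^2) ((l2_norm f)^2) < \<epsilon>"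
    unfolding eventually_finite_subsets_at_top
  proof (rule exI[of _ F], safe)
    fix G :: "(int \<times> int) set" assume G: "finite G" "F \<subseteq> G"
    have "(\<Sum>\<kappa>\<in>F. (fc \<kappa> f)^2) \<le> (\<Sum>\<kappa>\<in>G. (fc \<kappa> f)^2)"
      using G by (intro sum_mono2) auto
    then show "dist (\<Sum>\<kappa>\<in>G. (fc \<kappa> f)^2) ((l2_norm f)^2) < \<epsilon>"
      using * le[OF G(1)] by (simp add: dist_real_def)
  qed (use F in auto)
qed

lemma has_sum_sum:
  fixes f :: "'i \<Rightarrow> 'k \<Rightarrow> real"
  assumes "\<And>i. i \<in> I ==> (f i has_sum s i) A"
  shows "((\<lambda>k. \<Sum>i\<in>I. f i k) has_sum (\<Sum>i\<in>I. s i)) A"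
  using assms by (induction I rule: infinite_finite_induct) (auto intro!: has_sum_add)

lemma norm_sq_Basis: "(norm (x::'b::euclidean_space))^2 = (\<Sum>b\<in>Basis. (x \<bullet> b)^2)"
  unfolding power2_norm_eq_inner by (subst euclidean_inner) (simp add: power2_eq_square)

theorem parseval:
  assumes f: "f \<in> L2t"
  shows "((\<lambda>\<kappa>. (norm (fc \<kappa> f))^2) has_sum (l2_norm f)^2) UNIV"
proof -
  have "((\<lambda>\<kappa>. \<Sum>b\<in>Basis. (fc \<kappa> (\<lambda>x. f x \<bullet> b))^2) has_sum (\<Sum>b\<in>Basis. (l2_norm (\<lambda>x. f x \<bullet> b))^2)) UNIV"
    using f by (intro has_sum_sum parseval_real) auto
  moreover have "(\<Sum>b\<in>Basis. (l2_norm (\<lambda>x. f x \<bullet> b))^2) = (l2_norm f)^2"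
  proof -
    have "(\<Sum>b\<in>Basis. (l2_norm (\<lambda>x. f x \<bullet> b))^2) = (\<Sum>b\<in>Basis. \<integral>x. (norm (f x \<bullet> b))^2 \<partial>torus)"
      unfolding l2_norm_sq l2_inner_self ..
    also have "\<dots> = (\<integral>x. (\<Sum>b\<in>Basis. (norm (f x \<bullet> b))^2) \<partial>torus)"
      using f by (subst Bochner_Integration.integral_sum) (auto simp: L2tD(2)[OF L2t_inner_const[OF f], simplified])
    also have "\<dots> = (l2_norm f)^2"
      unfolding l2_norm_sq l2_inner_self norm_sq_Basis by simp
    finally show ?thesis .
  qed
  ultimately show ?thesis
    unfolding norm_sq_Basis fc_inner[OF f] by simp
qed

lemma fc_unique:
  assumes "f \<in> L2t" "g \<in> L2t" "\<And>\<kappa>. fc \<kappa> f = fc \<kappa> g"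
  shows "ae_eq f g"
proof -
  have "((\<lambda>\<kappa>. (norm (fc \<kappa> (\<lambda>x. f x - g x)))^2) has_sum (l2_norm (\<lambda>x. f x - g x))^2) UNIV"
    using assms by (intro parseval) auto
  then have "((\<lambda>\<kappa>::int\<times>int. 0) has_sum (l2_norm (\<lambda>x. f x - g x))^2) UNIV"
    using assms by (simp add: fc_diff)
  then have "l2_norm (\<lambda>x. f x - g x) = 0"
    using has_sum_unique[OF _ has_sum_0_simp] by fastforce
  then show ?thesis
    using assms by (subst (asm) l2_norm_eq_0) (auto simp: ae_eq_def)
qed

section \<open>Square partial sums of Fourier series\<close>

definition freqs :: "nat \<Rightarrow> (int \<times> int) set" where
  "freqs n = {- int n..int n} \<times> {- int n..int n}"

lemma finite_freqs [simp]: "finite (freqs n)"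
  by (simp add: freqs_def)

lemma freqs_at_top: "filterlim freqs (finite_subsets_at_top UNIV) sequentially"
  unfolding filterlim_iff eventually_finite_subsets_at_top
proof safe
  fix P and F :: "(int \<times> int) set"
  assume F: "finite F" and P: "\<forall>Y. finite Y \<and> F \<subseteq> Y \<and> Y \<subseteq> UNIV \<longrightarrow> P Y"
  define N where "N = (\<Sum>\<kappa>\<in>F. nat \<bar>fst \<kappa>\<bar> + nat \<bar>snd \<kappa>\<bar>)"
  have "F \<subseteq> freqs n" if "n \<ge> N" for n
  proof
    fix \<kappa> assume "\<kappa> \<in> F"
    then have "nat \<bar>fst \<kappa>\<bar> + nat \<bar>snd \<kappa>\<bar> \<le> N"
      unfolding N_def using F by (intro member_le_sum[where f="\<lambda>\<kappa>. nat \<bar>fst \<kappa>\<bar> + nat \<bar>snd \<kappa>\<bar>"]) auto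
    then show "\<kappa> \<in> freqs n" using that by (auto simp: freqs_def mem_Times_iff)
  qed
  then show "\<forall>\<^sub>F n in sequentially. P (freqs n)"
    using P by (intro eventually_sequentiallyI[of N]) auto
qed

lemma has_sum_freqs: "(f has_sum s) UNIV ==> (\<lambda>n. \<Sum>\<kappa>\<in>freqs n. f \<kappa>) \<longlonglongrightarrow> s"
  unfolding has_sum_def by (rule filterlim_compose[OF _ freqs_at_top])

definition psum :: "nat \<Rightarrow> 'b::euclidean_space field \<Rightarrow> 'b field" where
  "psum n f = (\<lambda>x. \<Sum>\<kappa>\<in>freqs n. cas \<kappa> x *\<^sub>R fc \<kappa> f)"

lemma psum_L2t [simp]: "psum n f \<in> L2t"
  unfolding psum_def by (intro L2t_sum L2t_cas_const)

lemma fc_psum: "fc \<kappa> (psum n f) = (if \<kappa> \<in> freqs n then fc \<kappa> f else 0)"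
proof -
  have "fc \<kappa> (psum n f) = (\<Sum>\<mu>\<in>freqs n. if \<kappa> = \<mu> then fc \<mu> f else 0)"
    unfolding psum_def by (subst fc_sum) (auto simp: fc_cas)
  also have "\<dots> = (if \<kappa> \<in> freqs n then fc \<kappa> f else 0)" by simp
  finally show ?thesis .
qed

text \<open>The squared error is the tail of the series in Parseval's identity.\<close>

lemma psum_tendsto:
  assumes f: "f \<in> L2t"
  shows "(\<lambda>n. l2_norm (\<lambda>x. f x - psum n f x)) \<longlonglongrightarrow> 0"
proof -
  have eq: "(l2_norm (\<lambda>x. f x - psum n f x))^2 = (l2_norm f)^2 - (\<Sum>\<kappa>\<in>freqs n. (norm (fc \<kappa> f))^2)" for n
  proof (rule has_sum_unique)
    show "((\<lambda>\<kappa>. (norm (fc \<kappa> (\<lambda>x. f x - psum n f x)))^2) has_sum (l2_norm (\<lambda>x. f x - psum n f x))^2) UNIV"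
      using f by (intro parseval) auto
    have "((\<lambda>\<kappa>. if \<kappa> \<in> freqs n then - ((norm (fc \<kappa> f))^2) else 0) has_sum (\<Sum>\<kappa>\<in>freqs n. - ((norm (fc \<kappa> f))^2))) UNIV"
      by (rule has_sum_finite_neutralI[where B="freqs n"]) auto
    from has_sum_add[OF parseval[OF f] this]
    show "((\<lambda>\<kappa>. (norm (fc \<kappa> (\<lambda>x. f x - psum n f x)))^2) has_sum ((l2_norm f)^2 - (\<Sum>\<kappa>\<in>freqs n. (norm (fc \<kappa> f))^2))) UNIV"
    proof (rule back_subst[where P="\<lambda>x. x"], intro arg_cong2[where f="\<lambda>f s. (f has_sum s) UNIV"] ext)
      show "(norm (fc \<kappa> f))^2 + (if \<kappa> \<in> freqs n then - ((norm (fc \<kappa> f))^2) else 0) = (norm (fc \<kappa> (\<lambda>x. f x - psum n f x)))^2" for \<kappa>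
        using f by (simp add: fc_diff fc_psum)
    qed (simp add: sum_negf)
  qed
  have "(\<lambda>n. sqrt ((l2_norm f)^2 - (\<Sum>\<kappa>\<in>freqs n. (norm (fc \<kappa> f))^2))) \<longlonglongrightarrow> sqrt ((l2_norm f)^2 - (l2_norm f)^2)"
    by (intro tendsto_intros has_sum_freqs parseval f)
  then show ?thesis
    unfolding eq[symmetric] by simp
qed

section \<open>Weak derivatives and Sobolev norms in Fourier variables\<close>

lemma pdiff_cas: "pdiff i (\<lambda>x. c * cas \<kappa> x) = (\<lambda>x. c * (2 * pi * kv \<kappa> $ i) * cas (- \<kappa>) x)"
proof
  fix x
  have "((\<lambda>x. c * cas \<kappa> x) has_derivative (\<lambda>h. c * (2 * pi * (kv \<kappa> \<bullet> h) * cas (- \<kappa>) x))) (at x)"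
    by (intro has_derivative_mult_right cas_has_derivative)
  from frechet_derivative_at[OF this, symmetric]
  show "pdiff i (\<lambda>x. c * cas \<kappa> x) x = c * (2 * pi * kv \<kappa> $ i) * cas (- \<kappa>) x"
    by (simp add: pdiff_def inner_axis)
qed

lemma cont_diff_cas: "cont_diff k (\<lambda>x. c * cas \<kappa> x)"
proof (induction k arbitrary: c \<kappa>)
  case 0
  show ?case by (auto intro!: continuous_intros continuous_cas)
next
  case (Suc k)
  have "(\<lambda>x. c * cas \<kappa> x) differentiable (at x)" for x
    unfolding differentiable_def by (blast intro: has_derivative_mult_right[OF cas_has_derivative])
  then show ?case
    using Suc by (simp add: pdiff_cas)
qed

lemma cas_test: "cas \<kappa> \<in> test_fun"
  using cont_diff_cas[of _ 1 \<kappa>] periodic_cas by (simp add: test_fun_def)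

lemma test_fun_props:
  assumes "\<phi> \<in> test_fun"
  shows "continuous_on UNIV \<phi>" "continuous_on UNIV (pdiff i \<phi>)" "periodic \<phi>"
    "(\<phi> has_derivative frechet_derivative \<phi> (at x)) (at x)"
proof -
  have c: "cont_diff k \<phi>" for k using assms by (simp add: test_fun_def)
  show "continuous_on UNIV \<phi>" "periodic \<phi>" using c[of 0] assms by (simp_all add: test_fun_def)
  show "continuous_on UNIV (pdiff i \<phi>)" using c[of "Suc 0"] by simp
  show "(\<phi> has_derivative frechet_derivative \<phi> (at x)) (at x)"
    using c[of "Suc 0"] by (simp add: frechet_derivative_works[symmetric])
qed

text \<open>The basis functions are admissible test functions. Differentiating
  \<open>cas \<kappa>\<close> gives a multiple of \<open>cas (- \<kappa>)\<close>, which is why f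
  enters at the negated frequency.\<close>

lemma weak_fc:
  assumes "weak_pdiff i f g"
  shows "fc \<kappa> g = - ((2 * pi * kv \<kappa> $ i) *\<^sub>R fc (- \<kappa>) f)"
proof -
  have "pdiff i (cas \<kappa>) = (\<lambda>x. (2 * pi * kv \<kappa> $ i) * cas (- \<kappa>) x)"
    using pdiff_cas[of i 1 \<kappa>] by simp
  then have "(\<integral>x. ((2 * pi * kv \<kappa> $ i) * cas (- \<kappa>) x) *\<^sub>R f x \<partial>torus) = - fc \<kappa> g"
    using assms cas_test[of \<kappa>] unfolding weak_pdiff_def fc_def by auto
  moreover have "(\<integral>x. ((2 * pi * kv \<kappa> $ i) * cas (- \<kappa>) x) *\<^sub>R f x \<partial>torus) = (2 * pi * kv \<kappa> $ i) *\<^sub>R fc (- \<kappa>) f"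
    unfolding fc_def by (simp only: scaleR_scaleR[symmetric] integral_scaleR_right)
  ultimately show ?thesis by simp
qed

lemma L2_iff: "f \<in> L2 \<longleftrightarrow> periodic f \<and> f \<in> borel_measurable lebesgue \<and> f \<in> L2t"
  unfolding L2_def L2t_def by (blast intro: measurable_torus_lebesgue)

lemma L2_lin [intro, simp]:
  "f \<in> L2 ==> g \<in> L2 ==> (\<lambda>x. f x + g x) \<in> L2"
  "f \<in> L2 ==> g \<in> L2 ==> (\<lambda>x. f x - g x) \<in> L2"
  "f \<in> L2 ==> (\<lambda>x. c *\<^sub>R f x) \<in> L2" "(\<lambda>x. 0) \<in> L2"
  unfolding L2_iff periodic_def
  by (simp_all add: borel_measurable_add borel_measurable_diff borel_measurable_scaleR)

lemma L2_continuous: "continuous_on UNIV f ==> periodic f ==> f \<in> L2"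
  unfolding L2_iff by (auto intro!: L2t_continuous measurable_completion borel_measurable_continuous_onI)

lemma L2_cas [simp]: "(\<lambda>x. cas \<kappa> x *\<^sub>R b) \<in> L2"
  by (intro L2_continuous continuous_intros continuous_cas)
    (use periodic_cas in \<open>auto simp: periodic_def\<close>)

text \<open>The product of the test function with \<open>cas \<kappa>\<close> is periodic, so its
  classical derivative has integral zero.\<close>

lemma weak_cas: "weak_pdiff i (\<lambda>x. cas \<kappa> x *\<^sub>R b) (\<lambda>x. cas (- \<kappa>) x *\<^sub>R ((2 * pi * kv \<kappa> $ i) *\<^sub>R b))"
  unfolding weak_pdiff_def
proof safe
  fix \<phi> assume \<phi>: "\<phi> \<in> test_fun"
  note T = test_fun_props[OF \<phi>]
  define c where "c = 2 * pi * kv \<kappa> $ i"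
  have I: "integrable torus (\<lambda>x. pdiff i \<phi> x * cas \<kappa> x)" "integrable torus (\<lambda>x. \<phi> x * (c * cas (- \<kappa>) x))"
    by (intro integrable_torus_continuous continuous_intros T continuous_cas)+
  have "(\<integral>x. \<phi> x * (2 * pi * (kv \<kappa> \<bullet> axis i 1) * cas (- \<kappa>) x) + frechet_derivative \<phi> (at x) (axis i 1) * cas \<kappa> x \<partial>torus) = 0"
  proof (rule integral_deriv_periodic[where \<psi>="\<lambda>x. \<phi> x * cas \<kappa> x"])
    show "periodic (\<lambda>x. \<phi> x * cas \<kappa> x)"
      using T(3) periodic_cas by (simp add: periodic_def)
    show "((\<lambda>x. \<phi> x * cas \<kappa> x) has_derivative
       (\<lambda>h. \<phi> x * (2 * pi * (kv \<kappa> \<bullet> h) * cas (- \<kappa>) x) + frechet_derivative \<phi> (at x) h * cas \<kappa> x)) (at x)" for x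
      by (rule has_derivative_mult[OF T(4) cas_has_derivative])
    show "continuous_on UNIV (\<lambda>x. \<phi> x * (2 * pi * (kv \<kappa> \<bullet> axis i 1) * cas (- \<kappa>) x) + frechet_derivative \<phi> (at x) (axis i 1) * cas \<kappa> x)"
      using T(2)[of i] unfolding pdiff_def by (intro continuous_intros T(1) continuous_cas)
  qed
  then have "(\<integral>x. pdiff i \<phi> x * cas \<kappa> x \<partial>torus) + (\<integral>x. \<phi> x * (c * cas (- \<kappa>) x) \<partial>torus) = 0"
    using I by (subst Bochner_Integration.integral_add[symmetric]) (simp_all add: pdiff_def inner_axis c_def add.commute)
  moreover have "(\<integral>x. pdiff i \<phi> x *\<^sub>R cas \<kappa> x *\<^sub>R b \<partial>torus) = (\<integral>x. pdiff i \<phi> x * cas \<kappa> x \<partial>torus) *\<^sub>R b"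
    using I by simp
  moreover have "(\<integral>x. \<phi> x *\<^sub>R cas (- \<kappa>) x *\<^sub>R ((2 * pi * kv \<kappa> $ i) *\<^sub>R b) \<partial>torus) = (\<integral>x. \<phi> x * (c * cas (- \<kappa>) x) \<partial>torus) *\<^sub>R b"
    using I(2) by (subst integral_scaleR_left[symmetric]) (auto simp: c_def mult_ac intro!: Bochner_Integration.integral_cong)
  ultimately show "(\<integral>x. pdiff i \<phi> x *\<^sub>R cas \<kappa> x *\<^sub>R b \<partial>torus) =
       - (\<integral>x. \<phi> x *\<^sub>R cas (- \<kappa>) x *\<^sub>R ((2 * pi * kv \<kappa> $ i) *\<^sub>R b) \<partial>torus)"
    by (simp add: eq_neg_iff_add_eq_0 scaleR_add_left[symmetric])
qed (rule L2_cas)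

lemma weak_unique: "weak_pdiff i f g ==> weak_pdiff i f g' ==> ae_eq g g'"
  using weak_fc[of i f g] weak_fc[of i f g'] by (intro fc_unique) (auto simp: weak_pdiff_def L2_L2t)

lemma weak_lin:
  fixes f f' g g' :: "'b::euclidean_space field"
  assumes f: "weak_pdiff i f f'" "f \<in> L2t" and g: "weak_pdiff i g g'" "g \<in> L2t"
  shows "weak_pdiff i (\<lambda>x. a *\<^sub>R f x + b *\<^sub>R g x) (\<lambda>x. a *\<^sub>R f' x + b *\<^sub>R g' x)"
  unfolding weak_pdiff_def
proof safe
  have L: "f' \<in> L2" "g' \<in> L2" using f g by (auto simp: weak_pdiff_def)
  show "(\<lambda>x. a *\<^sub>R f' x + b *\<^sub>R g' x) \<in> L2" using L by auto
  fix \<phi> assume \<phi>: "\<phi> \<in> test_fun"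
  note T = test_fun_props[OF \<phi>]
  have I: "integrable torus (\<lambda>x. \<psi> x *\<^sub>R h x)" if c: "continuous_on UNIV \<psi>" and h: "h \<in> L2t"
    for \<psi> :: "real field" and h :: "'b field"
  proof -
    obtain B where "\<And>x. x \<in> cell ==> norm (\<psi> x) \<le> B" using continuous_bounded_cell[OF c] by blast
    then show ?thesis
      using continuous_measurable_torus[OF c] h by (intro integrable_L2t L2t_scaleR_bounded) auto
  qed
  have 1: "(\<integral>x. \<psi> x *\<^sub>R (a *\<^sub>R h x + b *\<^sub>R k x) \<partial>torus) = a *\<^sub>R (\<integral>x. \<psi> x *\<^sub>R h x \<partial>torus) + b *\<^sub>R (\<integral>x. \<psi> x *\<^sub>R k x \<partial>torus)"
    if "continuous_on UNIV \<psi>" "h \<in> L2t" "k \<in> L2t" for \<psi> :: "real field" and h k :: "'b field"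
  proof -
    have "(\<integral>x. \<psi> x *\<^sub>R (a *\<^sub>R h x + b *\<^sub>R k x) \<partial>torus) = (\<integral>x. a *\<^sub>R (\<psi> x *\<^sub>R h x) + b *\<^sub>R (\<psi> x *\<^sub>R k x) \<partial>torus)"
      by (simp add: scaleR_add_right mult.commute)
    also have "\<dots> = (\<integral>x. a *\<^sub>R (\<psi> x *\<^sub>R h x) \<partial>torus) + (\<integral>x. b *\<^sub>R (\<psi> x *\<^sub>R k x) \<partial>torus)"
      by (intro Bochner_Integration.integral_add integrable_scaleR_right I that)
    finally show ?thesis by (simp only: integral_scaleR_right)
  qed
  show "(\<integral>x. pdiff i \<phi> x *\<^sub>R (a *\<^sub>R f x + b *\<^sub>R g x) \<partial>torus) = - (\<integral>x. \<phi> x *\<^sub>R (a *\<^sub>R f' x + b *\<^sub>R g' x) \<partial>torus)"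
    unfolding 1[OF T(2) f(2) g(2)] 1[OF T(1) L2_L2t[OF L(1)] L2_L2t[OF L(2)]]
    using f(1) g(1) \<phi> by (simp add: weak_pdiff_def)
qed

text \<open>Preimages under f and g differ by a subset of a null set, which completeness makes
  measurable.\<close>

lemma (in complete_measure) borel_measurable_cong_AE:
  fixes f g :: "'a \<Rightarrow> 'b::topological_space"
  assumes f: "f \<in> borel_measurable M" and ae: "AE x in M. f x = g x"
  shows "g \<in> borel_measurable M"
proof (rule measurableI)
  fix A :: "'b set" assume "A \<in> sets borel"
  then have "f -` A \<inter> space M \<in> sets M"
    using f by (rule measurable_sets[rotated])
  moreover have "AE x in M. x \<in> f -` A \<inter> space M \<longleftrightarrow> x \<in> g -` A \<inter> space M"
    using ae by eventually_elim simp
  ultimately show "g -` A \<inter> space M \<in> sets M"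
    using in_sets_AE[of "f -` A \<inter> space M" "g -` A \<inter> space M"] by blast
qed simp

text \<open>Either both functions are measurable or neither is, and in the second case both
  integrals have the default value 0. Representatives may therefore be exchanged under any
  integral.\<close>

lemma (in complete_measure) integral_cong_AE_complete:
  fixes f g :: "'a \<Rightarrow> 'b::{banach, second_countable_topology}"
  assumes ae: "AE x in M. f x = g x"
  shows "integral\<^sup>L M f = integral\<^sup>L M g"
proof (cases "f \<in> borel_measurable M")
  case True
  with ae show ?thesis
    using borel_measurable_cong_AE by (intro integral_cong_AE) auto
next
  case False
  moreover have "AE x in M. g x = f x" using ae by eventually_elim auto
  ultimately have "g \<notin> borel_measurable M"
    using borel_measurable_cong_AE by blast
  with False show ?thesis
    using borel_measurable_integrable by (metis not_integrable_integral_eq)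
qed

interpretation torus: complete_measure torus
proof
  fix A B assume "B \<subseteq> A" "A \<in> null_sets torus"
  then have "A \<in> null_sets lebesgue" "A \<subseteq> cell"
    unfolding torus_eq by (auto simp: null_sets_restrict_space)
  then have "B \<in> null_sets lebesgue" "B \<subseteq> cell"
    using \<open>B \<subseteq> A\<close> null_sets_completion_subset by auto
  then show "B \<in> sets torus"
    unfolding torus_eq by (auto simp: sets_restrict_space)
qed

section \<open>Equality almost everywhere and the choice of weak derivatives\<close>

lemma ae_eq_refl [simp]: "ae_eq f f"
  by (simp add: ae_eq_def)

lemma ae_eq_map2:
  assumes "ae_eq f f'" "ae_eq g g'"
  shows "ae_eq (\<lambda>x. h (f x) (g x)) (\<lambda>x. h (f' x) (g' x))"
  using assms unfolding ae_eq_def by eventually_elim simp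

lemma ae_eq_sym: "ae_eq f g ==> ae_eq g f"
  by (simp add: ae_eq_def eq_commute)

lemma ae_eq_trans:
  assumes "ae_eq f g" "ae_eq g h"
  shows "ae_eq f h"
  using assms unfolding ae_eq_def by eventually_elim simp

lemma l2_inner_cong:
  assumes "ae_eq f f'" "ae_eq g g'"
  shows "l2_inner f g = l2_inner f' g'"
  unfolding l2_inner_def
  using ae_eq_map2[OF assms, of "(\<bullet>)"] unfolding ae_eq_def by (rule torus.integral_cong_AE_complete)

lemma l2_norm_cong: "ae_eq f g ==> l2_norm f = l2_norm g"
  unfolding l2_norm_def by (simp add: l2_inner_cong)

lemma weak_pdiff_cong: "ae_eq f f' ==> weak_pdiff i f = weak_pdiff i f'"
proof -
  assume "ae_eq f f'"
  then have "(\<integral>x. pdiff i \<phi> x *\<^sub>R f x \<partial>torus) = (\<integral>x. pdiff i \<phi> x *\<^sub>R f' x \<partial>torus)" for \<phi>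
  proof (intro torus.integral_cong_AE_complete)
    show "AE x in torus. pdiff i \<phi> x *\<^sub>R f x = pdiff i \<phi> x *\<^sub>R f' x"
      using \<open>ae_eq f f'\<close> unfolding ae_eq_def by eventually_elim simp
  qed
  then show ?thesis by (simp add: weak_pdiff_def fun_eq_iff)
qed

lemma wpd_cong: "ae_eq f f' ==> wpd i f = wpd i f'"
  by (simp add: wpd_def weak_pdiff_cong)

section \<open>Sobolev spaces as vector spaces\<close>

lemma Hk_L2: "f \<in> Hk k ==> f \<in> L2"
  by (cases k) auto

lemma Hk_L2t [simp]: "f \<in> Hk k ==> f \<in> L2t"
  by (intro L2_L2t Hk_L2)

lemma wpd_weak: "f \<in> Hk (Suc k) ==> weak_pdiff i f (wpd i f)"
proof -
  assume "f \<in> Hk (Suc k)"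
  then have "\<exists>g. weak_pdiff i f g" by auto
  then show ?thesis unfolding wpd_def by (rule someI_ex)
qed

lemma wpd_L2: "f \<in> Hk (Suc k) ==> wpd i f \<in> L2"
  using wpd_weak[of f k i] by (simp add: weak_pdiff_def)

text \<open>Weak derivatives depend only on the class on the cell. Periodicity and measurability on
  the plane do not, hence the condition that g lies in \<open>L2\<close>.\<close>

lemma Hk_cong: "f \<in> Hk k ==> ae_eq f g ==> g \<in> L2 ==> g \<in> Hk k"
  by (cases k) (auto simp: weak_pdiff_cong)

lemma wpd_ae: "weak_pdiff i f g ==> ae_eq (wpd i f) g"
  unfolding wpd_def by (rule weak_unique[OF someI[of "weak_pdiff i f"]])

lemma wpd_Hk: "f \<in> Hk (Suc k) ==> wpd i f \<in> Hk k"
proof -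
  assume f: "f \<in> Hk (Suc k)"
  then obtain g where "g \<in> Hk k" "weak_pdiff i f g" by auto
  then show ?thesis
    using wpd_ae[of i f g] wpd_L2[OF f] Hk_cong[of g k "wpd i f"] ae_eq_sym by blast
qed

lemma Hk_mono: "f \<in> Hk (Suc k) ==> f \<in> Hk k"
proof (induction k arbitrary: f)
  case (Suc k)
  have "\<exists>g\<in>Hk k. weak_pdiff i f g" for i
    using wpd_Hk[OF Suc.prems, of i] wpd_weak[OF Suc.prems, of i] Suc.IH by blast
  then show ?case using Hk_L2[OF Suc.prems] by simp
qed auto

lemma Hk_le: "j \<le> k ==> f \<in> Hk k ==> f \<in> Hk j"
proof (induction k)
  case (Suc k)
  then show ?case using Hk_mono[of f k] by (cases "j = Suc k") auto
qed simp

lemma Hk_lin: "f \<in> Hk k ==> g \<in> Hk k ==> (\<lambda>x. a *\<^sub>R f x + b *\<^sub>R g x) \<in> Hk k"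
proof (induction k arbitrary: f g)
  case (Suc k)
  have "\<exists>h\<in>Hk k. weak_pdiff i (\<lambda>x. a *\<^sub>R f x + b *\<^sub>R g x) h" for i
    using weak_lin[OF wpd_weak[OF Suc.prems(1), of i] _ wpd_weak[OF Suc.prems(2), of i], of a b]
      Suc.IH[OF wpd_Hk[OF Suc.prems(1), of i] wpd_Hk[OF Suc.prems(2), of i]] Suc.prems
    by (meson Hk_L2t)
  then show ?case using Suc.prems by auto
qed auto

lemma Hk_add [simp]: "f \<in> Hk k ==> g \<in> Hk k ==> (\<lambda>x. f x + g x) \<in> Hk k"
  using Hk_lin[of f k g 1 1] by simp

lemma Hk_diff [simp]: "f \<in> Hk k ==> g \<in> Hk k ==> (\<lambda>x. f x - g x) \<in> Hk k"
  using Hk_lin[of f k g 1 "-1"] by simp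

lemma Hk_scaleR [simp]: "f \<in> Hk k ==> (\<lambda>x. c *\<^sub>R f x) \<in> Hk k"
  using Hk_lin[of f k f c 0] by simp

lemma Hk_cas [simp]: "(\<lambda>x. cas \<kappa> x *\<^sub>R b) \<in> Hk k"
proof (induction k arbitrary: \<kappa> b)
  case (Suc k)
  have "\<exists>g\<in>Hk k. weak_pdiff i (\<lambda>x. cas \<kappa> x *\<^sub>R b) g" for i
    by (rule bexI[of _ "\<lambda>x. cas (- \<kappa>) x *\<^sub>R ((2 * pi * kv \<kappa> $ i) *\<^sub>R b)"], rule weak_cas, rule Suc)
  then show ?case by simp
qed simp

lemma Hk_zero [simp]: "(\<lambda>x. 0) \<in> Hk k"
  using Hk_cas[of 0 0 k] by simp

lemma Hk_sum [simp]: "(\<And>i. i \<in> I ==> f i \<in> Hk k) ==> (\<lambda>x. \<Sum>i\<in>I. f i x) \<in> Hk k"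
  by (induction I rule: infinite_finite_induct) auto

lemma wpd_lin:
  assumes "f \<in> Hk (Suc k)" "g \<in> Hk (Suc k)"
  shows "ae_eq (wpd i (\<lambda>x. a *\<^sub>R f x + b *\<^sub>R g x)) (\<lambda>x. a *\<^sub>R wpd i f x + b *\<^sub>R wpd i g x)"
  using assms by (intro wpd_ae weak_lin wpd_weak Hk_L2t)

lemma wpd_diff: "f \<in> Hk (Suc k) ==> g \<in> Hk (Suc k) ==> ae_eq (wpd i (\<lambda>x. f x - g x)) (\<lambda>x. wpd i f x - wpd i g x)"
  using wpd_lin[of f k g i 1 "-1"] by simp

lemma wpd_scaleR: "f \<in> Hk (Suc k) ==> ae_eq (wpd i (\<lambda>x. c *\<^sub>R f x)) (\<lambda>x. c *\<^sub>R wpd i f x)"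
  using wpd_lin[of f k f i c 0] by simp

section \<open>Sobolev norms as weighted sums of Fourier coefficients\<close>

lemma fc_wpd: "f \<in> Hk (Suc k) ==> fc \<kappa> (wpd i f) = - ((2 * pi * kv \<kappa> $ i) *\<^sub>R fc (- \<kappa>) f)"
  by (rule weak_fc[OF wpd_weak])

text \<open>The polynomial 1 + s + ... + s^k in s = |2 pi kappa|^2, written in Horner form to match
  the recursion of \<open>Hk_norm_sq\<close>.\<close>

primrec wt :: "nat \<Rightarrow> int \<times> int \<Rightarrow> real" where
  "wt 0 \<kappa> = 1"
| "wt (Suc k) \<kappa> = 1 + (\<Sum>i\<in>UNIV. (2 * pi * kv \<kappa> $ i)^2) * wt k \<kappa>"

lemma wt_ge1: "1 \<le> wt k \<kappa>"
  by (induction k) (auto intro!: mult_nonneg_nonneg sum_nonneg)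

lemma wt_mono: "wt k \<kappa> \<le> wt (Suc k) \<kappa>"
proof (induction k)
  case 0
  show ?case by (auto intro!: sum_nonneg)
next
  case (Suc k)
  have "(\<Sum>i\<in>UNIV. (2 * pi * kv \<kappa> $ i)^2) * wt k \<kappa> \<le> (\<Sum>i\<in>UNIV. (2 * pi * kv \<kappa> $ i)^2) * wt (Suc k) \<kappa>"
    using Suc by (intro mult_left_mono sum_nonneg) auto
  then show ?case by (subst (1 2) wt.simps) simp
qed

lemma wt_minus: "wt k (- \<kappa>) = wt k \<kappa>"
  by (induction k) (auto simp: kv_minus)

text \<open>A derivative moves the coefficient to the negated frequency. Weights and squared
  frequencies are even, so reindexing by negation moves it back before the sums over i are
  collected.\<close>

lemma Hk_parseval:
  "f \<in> Hk k ==> ((\<lambda>\<kappa>. wt k \<kappa> * (norm (fc \<kappa> f))^2) has_sum Hk_norm_sq k f) UNIV"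
proof (induction k arbitrary: f)
  case 0
  then show ?case using parseval[of f] by (simp add: L2_L2t)
next
  case (Suc k)
  have "((\<lambda>\<kappa>. wt k \<kappa> * (norm (fc \<kappa> (wpd i f)))^2) has_sum Hk_norm_sq k (wpd i f)) UNIV" for i
    by (rule Suc.IH[OF wpd_Hk[OF Suc.prems]])
  then have *: "((\<lambda>\<kappa>. wt k \<kappa> * ((2 * pi * kv \<kappa> $ i)^2 * (norm (fc (- \<kappa>) f))^2)) has_sum Hk_norm_sq k (wpd i f)) UNIV" for i
    by (simp add: fc_wpd[OF Suc.prems] power_mult_distrib abs_mult)
  have "((\<lambda>\<kappa>. wt k \<kappa> * ((2 * pi * kv \<kappa> $ i)^2 * (norm (fc \<kappa> f))^2)) has_sum Hk_norm_sq k (wpd i f)) UNIV" for i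
    using *[of i]
    by (rule has_sum_reindex_bij_witness[where i="uminus" and j="uminus", THEN iffD1, rotated -1])
       (auto simp: wt_minus kv_minus)
  then have "((\<lambda>\<kappa>. \<Sum>i\<in>UNIV. wt k \<kappa> * ((2 * pi * kv \<kappa> $ i)^2 * (norm (fc \<kappa> f))^2)) has_sum (\<Sum>i\<in>UNIV. Hk_norm_sq k (wpd i f))) UNIV"
    by (intro has_sum_sum)
  from has_sum_add[OF parseval[OF L2_L2t[OF Hk_L2[OF Suc.prems]]] this]
  have "((\<lambda>\<kappa>. (norm (fc \<kappa> f))^2 + (\<Sum>i\<in>UNIV. wt k \<kappa> * ((2 * pi * kv \<kappa> $ i)^2 * (norm (fc \<kappa> f))^2))) has_sum Hk_norm_sq (Suc k) f) UNIV"
    by simp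
  moreover have "(norm (fc \<kappa> f))^2 + (\<Sum>i\<in>UNIV. wt k \<kappa> * ((2 * pi * kv \<kappa> $ i)^2 * (norm (fc \<kappa> f))^2)) =
      wt (Suc k) \<kappa> * (norm (fc \<kappa> f))^2" for \<kappa>
    by (simp add: sum_distrib_left sum_distrib_right algebra_simps)
  ultimately show ?case by simp
qed

lemma Hk_norm_sq_ge0: "0 \<le> Hk_norm_sq k f"
  by (induction k arbitrary: f) (auto intro!: add_nonneg_nonneg sum_nonneg)

lemma Hk_norm_sq: "(Hk_norm k f)^2 = Hk_norm_sq k f"
  by (simp add: Hk_norm_def Hk_norm_sq_ge0)

lemma Hk_norm_ge0 [simp]: "0 \<le> Hk_norm k f"
  by (simp add: Hk_norm_def Hk_norm_sq_ge0)

lemma Hk_norm_sq_cong: "ae_eq f g ==> Hk_norm_sq k f = Hk_norm_sq k g"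
  by (cases k) (simp_all add: l2_norm_cong[of f g] wpd_cong[of f g])

lemma Hk_norm_cong: "ae_eq f g ==> Hk_norm k f = Hk_norm k g"
  by (simp add: Hk_norm_def Hk_norm_sq_cong[of f g])

lemma Hk_parseval': "f \<in> Hk k ==> ((\<lambda>\<kappa>. wt k \<kappa> * (norm (fc \<kappa> f))^2) has_sum (Hk_norm k f)^2) UNIV"
  unfolding Hk_norm_sq by (rule Hk_parseval)

lemma Hk_norm_scaleR: "f \<in> Hk k ==> Hk_norm k (\<lambda>x. c *\<^sub>R f x) = \<bar>c\<bar> * Hk_norm k f"
proof (rule power2_eq_imp_eq)
  assume f: "f \<in> Hk k"
  have "((\<lambda>\<kappa>. c^2 * (wt k \<kappa> * (norm (fc \<kappa> f))^2)) has_sum c^2 * (Hk_norm k f)^2) UNIV"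
    by (intro has_sum_cmult_right Hk_parseval' f)
  moreover have "((\<lambda>\<kappa>. wt k \<kappa> * (norm (fc \<kappa> (\<lambda>x. c *\<^sub>R f x)))^2) has_sum (Hk_norm k (\<lambda>x. c *\<^sub>R f x))^2) UNIV"
    using f by (intro Hk_parseval') simp
  ultimately show "(Hk_norm k (\<lambda>x. c *\<^sub>R f x))^2 = (\<bar>c\<bar> * Hk_norm k f)^2"
    by (simp add: fc_scaleR power_mult_distrib mult.left_commute has_sum_unique)
qed auto

lemma Hk_norm_zero [simp]: "Hk_norm k (\<lambda>x. 0) = 0"
  using Hk_norm_scaleR[of "\<lambda>x. 0" k 0] by simp

text \<open>Parseval turns the norm into a weighted l^2 norm of coefficients; Minkowski's inequality
  on finite sets of frequencies then passes to the full sum.\<close>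

lemma Hk_triangle:
  assumes f: "f \<in> Hk k" and g: "g \<in> Hk k"
  shows "Hk_norm k (\<lambda>x. f x + g x) \<le> Hk_norm k f + Hk_norm k g"
proof (rule power2_le_imp_le)
  show "(Hk_norm k (\<lambda>x. f x + g x))^2 \<le> (Hk_norm k f + Hk_norm k g)^2"
  proof (rule has_sum_le_finite_sums)
    show "((\<lambda>\<kappa>. wt k \<kappa> * (norm (fc \<kappa> (\<lambda>x. f x + g x)))^2) has_sum (Hk_norm k (\<lambda>x. f x + g x))^2) UNIV"
      using f g by (intro Hk_parseval') simp
    fix F :: "(int \<times> int) set" assume F: "finite F"
    have w: "0 \<le> wt k \<kappa>" for \<kappa> using wt_ge1[of k \<kappa>] by simp
    have L: "L2_set (\<lambda>\<kappa>. sqrt (wt k \<kappa>) * norm (fc \<kappa> h)) F \<le> Hk_norm k h" if "h \<in> Hk k" for h :: "'a field"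
    proof -
      have "(\<Sum>\<kappa>\<in>F. wt k \<kappa> * (norm (fc \<kappa> h))^2) \<le> (Hk_norm k h)^2"
        using Hk_parseval'[OF that] F w by (intro finite_sum_le_has_sum) auto
      then have "sqrt (\<Sum>\<kappa>\<in>F. wt k \<kappa> * (norm (fc \<kappa> h))^2) \<le> Hk_norm k h"
        by (intro real_le_lsqrt) (auto intro!: sum_nonneg mult_nonneg_nonneg w)
      then show ?thesis
        by (simp add: L2_set_def power_mult_distrib w)
    qed
    have "sqrt (\<Sum>\<kappa>\<in>F. wt k \<kappa> * (norm (fc \<kappa> (\<lambda>x. f x + g x)))^2) =
        L2_set (\<lambda>\<kappa>. sqrt (wt k \<kappa>) * norm (fc \<kappa> (\<lambda>x. f x + g x))) F"
      by (simp add: L2_set_def power_mult_distrib w)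
    also have "\<dots> \<le> L2_set (\<lambda>\<kappa>. sqrt (wt k \<kappa>) * norm (fc \<kappa> f) + sqrt (wt k \<kappa>) * norm (fc \<kappa> g)) F"
    proof (rule L2_set_mono)
      fix \<kappa>
      have "norm (fc \<kappa> (\<lambda>x. f x + g x)) \<le> norm (fc \<kappa> f) + norm (fc \<kappa> g)"
        using f g by (simp add: fc_add norm_triangle_ineq)
      then show "sqrt (wt k \<kappa>) * norm (fc \<kappa> (\<lambda>x. f x + g x)) \<le> sqrt (wt k \<kappa>) * norm (fc \<kappa> f) + sqrt (wt k \<kappa>) * norm (fc \<kappa> g)"
        unfolding distrib_left[symmetric] by (intro mult_left_mono) (auto simp: w)
    qed (auto simp: w)
    also have "\<dots> \<le> Hk_norm k f + Hk_norm k g"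
      by (rule order_trans[OF L2_set_triangle_ineq]) (intro add_mono L f g)
    finally show "(\<Sum>\<kappa>\<in>F. wt k \<kappa> * (norm (fc \<kappa> (\<lambda>x. f x + g x)))^2) \<le> (Hk_norm k f + Hk_norm k g)^2"
      by (rule sqrt_le_D)
  qed
qed simp

lemma Hk_norm_diff_commute: "f \<in> Hk k ==> g \<in> Hk k ==> Hk_norm k (\<lambda>x. f x - g x) = Hk_norm k (\<lambda>x. g x - f x)"
  using Hk_norm_scaleR[of "\<lambda>x. f x - g x" k "-1"] by simp

lemma Hk_triangle_diff:
  "f \<in> Hk k ==> g \<in> Hk k ==> Hk_norm k (\<lambda>x. f x - g x) \<le> Hk_norm k f + Hk_norm k g"
  using Hk_triangle[of f k "\<lambda>x. (-1) *\<^sub>R g x"] Hk_norm_scaleR[of g k "-1"] Hk_scaleR[of g k "-1"] by simp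

lemma Hk_triangle_abs:
  "f \<in> Hk k ==> g \<in> Hk k ==> \<bar>Hk_norm k f - Hk_norm k g\<bar> \<le> Hk_norm k (\<lambda>x. f x - g x)"
  using Hk_triangle[of "\<lambda>x. f x - g x" k g] Hk_triangle[of "\<lambda>x. g x - f x" k f] Hk_norm_diff_commute[of f k g]
  by auto

lemma Hk_triangle_sum:
  "(\<And>i. i \<in> I ==> f i \<in> Hk k) ==> Hk_norm k (\<lambda>x. \<Sum>i\<in>I. f i x) \<le> (\<Sum>i\<in>I. Hk_norm k (f i))"
proof (induction I rule: infinite_finite_induct)
  case (insert i I)
  then show ?case using Hk_triangle[of "f i" k "\<lambda>x. \<Sum>i\<in>I. f i x"] by force
qed auto

lemma Hk_norm_Suc: "f \<in> Hk (Suc k) ==> Hk_norm k f \<le> Hk_norm (Suc k) f"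
proof (rule power2_le_imp_le)
  assume f: "f \<in> Hk (Suc k)"
  show "(Hk_norm k f)^2 \<le> (Hk_norm (Suc k) f)^2"
    by (rule has_sum_mono[OF Hk_parseval'[OF Hk_mono[OF f]] Hk_parseval'[OF f]])
       (intro mult_right_mono wt_mono, simp)
qed simp

lemma Hk_norm_mono: "j \<le> k ==> f \<in> Hk k ==> Hk_norm j f \<le> Hk_norm k f"
proof (induction k)
  case (Suc k)
  show ?case
  proof (cases "j = Suc k")
    case False
    then show ?thesis using Suc.IH Suc.prems Hk_norm_Suc[of f k] Hk_mono[of f k] by simp
  qed simp
qed simp

lemma Hk_norm_0: "Hk_norm 0 f = l2_norm f"
  by (simp add: Hk_norm_def)

lemma l2_norm_le_Hk: "f \<in> Hk k ==> l2_norm f \<le> Hk_norm k f"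
  using Hk_norm_mono[of 0 k f] by (simp add: Hk_norm_0)

lemma Hk_norm_sq_1: "(Hk_norm 1 f)^2 = (l2_norm f)^2 + (\<Sum>i\<in>UNIV. (l2_norm (wpd i f))^2)"
  by (simp add: Hk_norm_sq)

declare Hk.simps(2) [simp del] Hk_norm_sq.simps(2) [simp del] wt.simps(2) [simp del]

section \<open>Measurability of Sobolev norms\<close>

text \<open>Polarization: the distances of X from 0 and from the basis field g determine the
  coefficient of X along g, because g has squared norm \<open>wt k \<kappa>\<close>.\<close>

lemma Hk_measurable_fc:
  assumes X: "Hk_measurable k M X" and b: "b \<in> Basis"
  shows "(\<lambda>w. fc \<kappa> (X w) \<bullet> b) \<in> borel_measurable M"
proof -
  define g where "g = (\<lambda>x. cas \<kappa> x *\<^sub>R b)"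
  have m: "(\<lambda>w. Hk_norm k (\<lambda>x. X w x - h x)) \<in> borel_measurable M" if "h \<in> Hk k" for h
    using X that by (simp add: Hk_measurable_def)
  have H: "X w \<in> Hk k" if "w \<in> space M" for w
    using X that by (simp add: Hk_measurable_def)
  have eq: "fc \<kappa> (X w) \<bullet> b = ((Hk_norm k (\<lambda>x. X w x - 0))^2 - (Hk_norm k (\<lambda>x. X w x - g x))^2 + wt k \<kappa>) / (2 * wt k \<kappa>)"
    if "w \<in> space M" for w
  proof -
    have g: "g \<in> Hk k" unfolding g_def by simp
    have 1: "((\<lambda>\<mu>. wt k \<mu> * (norm (fc \<mu> (\<lambda>x. X w x - g x)))^2) has_sum (Hk_norm k (\<lambda>x. X w x - g x))^2) UNIV"
      by (intro Hk_parseval' Hk_diff H that g)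
    have fcg: "fc \<mu> g = (if \<mu> = \<kappa> then b else 0)" for \<mu>
      unfolding g_def by (rule fc_cas)
    have "((\<lambda>\<mu>. wt k \<mu> * (norm (fc \<mu> (X w)))^2 + (if \<mu> \<in> {\<kappa>} then wt k \<kappa> * (1 - 2 * (fc \<kappa> (X w) \<bullet> b)) else 0))
        has_sum (Hk_norm k (X w))^2 + wt k \<kappa> * (1 - 2 * (fc \<kappa> (X w) \<bullet> b))) UNIV"
      by (intro has_sum_add Hk_parseval' H that has_sum_finite_neutralI[of "{\<kappa>}"]) auto
    moreover have "wt k \<mu> * (norm (fc \<mu> (X w)))^2 + (if \<mu> \<in> {\<kappa>} then wt k \<kappa> * (1 - 2 * (fc \<kappa> (X w) \<bullet> b)) else 0)
        = wt k \<mu> * (norm (fc \<mu> (\<lambda>x. X w x - g x)))^2" for \<mu>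
      using b H[OF that] g
      by (auto simp: fc_diff[of "X w" g] fcg power2_norm_eq_inner inner_diff_left inner_diff_right inner_commute algebra_simps)
    ultimately have "(Hk_norm k (\<lambda>x. X w x - g x))^2 = (Hk_norm k (X w))^2 + wt k \<kappa> * (1 - 2 * (fc \<kappa> (X w) \<bullet> b))"
      using has_sum_unique[OF 1] by simp
    then show ?thesis
      using wt_ge1[of k \<kappa>] by (simp add: field_simps)
  qed
  have "(\<lambda>w. ((Hk_norm k (\<lambda>x. X w x - 0))^2 - (Hk_norm k (\<lambda>x. X w x - g x))^2 + wt k \<kappa>) / (2 * wt k \<kappa>)) \<in> borel_measurable M"
    using m[of g] m[of "\<lambda>x. 0"] by (simp add: g_def)
  then show ?thesis
    by (rule measurable_cong[THEN iffD1, rotated]) (simp add: eq)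
qed

text \<open>Measurability is tested on Fourier coefficients, so that it passes to linear combinations
  without an appeal to separability.\<close>

definition fcm :: "'a measure \<Rightarrow> ('a \<Rightarrow> 'b::euclidean_space field) \<Rightarrow> bool" where
  "fcm M X \<longleftrightarrow> (\<forall>\<kappa>. (\<lambda>w. fc \<kappa> (X w)) \<in> borel_measurable M)"

lemma Hk_measurable_fcm: "Hk_measurable k M X ==> fcm M X"
  unfolding fcm_def
proof safe
  fix \<kappa> assume X: "Hk_measurable k M X"
  have "(\<lambda>w. \<Sum>b\<in>Basis. (fc \<kappa> (X w) \<bullet> b) *\<^sub>R b) \<in> borel_measurable M"
    by (intro borel_measurable_sum borel_measurable_scaleR Hk_measurable_fc[OF X]) auto
  then show "(\<lambda>w. fc \<kappa> (X w)) \<in> borel_measurable M"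
    by (simp add: euclidean_representation)
qed

text \<open>By Parseval the squared norm is a limit of finite sums of measurable functions.\<close>

lemma fcm_norm:
  assumes "fcm M X" "\<And>w. w \<in> space M ==> X w \<in> Hk k"
  shows "(\<lambda>w. Hk_norm k (X w)) \<in> borel_measurable M"
proof -
  have [measurable]: "(\<lambda>w. fc \<kappa> (X w)) \<in> borel_measurable M" for \<kappa>
    using assms(1) unfolding fcm_def by blast
  have "(\<lambda>w. Hk_norm_sq k (X w)) \<in> borel_measurable M"
  proof (rule borel_measurable_LIMSEQ_real)
    show "(\<lambda>n. \<Sum>\<kappa>\<in>freqs n. wt k \<kappa> * (norm (fc \<kappa> (X w)))^2) \<longlonglongrightarrow> Hk_norm_sq k (X w)" if "w \<in> space M" for w
      by (intro has_sum_freqs Hk_parseval assms that)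
  qed measurable
  then show ?thesis unfolding Hk_norm_def by measurable
qed

lemma fcm_lin:
  assumes "fcm M X" "fcm M Y" "\<And>w. w \<in> space M ==> X w \<in> L2t" "\<And>w. w \<in> space M ==> Y w \<in> L2t"
  shows "fcm M (\<lambda>w x. a *\<^sub>R X w x + b *\<^sub>R Y w x)"
  unfolding fcm_def
proof safe
  fix \<kappa>
  have [measurable]: "(\<lambda>w. fc \<kappa> (X w)) \<in> borel_measurable M" "(\<lambda>w. fc \<kappa> (Y w)) \<in> borel_measurable M"
    using assms(1,2) unfolding fcm_def by blast+
  have "(\<lambda>w. a *\<^sub>R fc \<kappa> (X w) + b *\<^sub>R fc \<kappa> (Y w)) \<in> borel_measurable M"
    by measurable
  then show "(\<lambda>w. fc \<kappa> (\<lambda>x. a *\<^sub>R X w x + b *\<^sub>R Y w x)) \<in> borel_measurable M"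
    by (rule measurable_cong[THEN iffD1, rotated]) (use assms in \<open>simp add: fc_add fc_scaleR\<close>)
qed

section \<open>Sobolev inequalities on the torus\<close>

text \<open>On a probability space convergence in L^2 implies convergence in L^1, and this gives an
  almost everywhere convergent subsequence.\<close>

lemma l2_AE_subseq:
  fixes f :: "nat \<Rightarrow> 'b::euclidean_space field"
  assumes f: "\<And>n. f n \<in> L2t" and lim: "(\<lambda>n. l2_norm (f n)) \<longlonglongrightarrow> 0"
  obtains r where "strict_mono r" "AE x in torus. (\<lambda>n. f (r n) x) \<longlonglongrightarrow> 0"
proof -
  have "(\<lambda>n. \<integral>x. norm (f n x) \<partial>torus) \<longlonglongrightarrow> 0"
  proof (rule tendsto_sandwich[OF _ _ tendsto_const lim])
    have "(\<integral>x. norm (f n x) \<partial>torus) \<le> l2_norm (f n)" for n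
    proof -
      have n: "(\<lambda>x. norm (f n x)) \<in> L2t"
        using f[of n] by (auto simp: L2t_def)
      have "(\<integral>x. norm (f n x) \<partial>torus) = l2_inner (\<lambda>x. norm (f n x)) (\<lambda>x. 1)"
        by (simp add: l2_inner_def)
      also have "\<dots> \<le> l2_norm (\<lambda>x. norm (f n x)) * l2_norm (\<lambda>x. 1::real)"
        using l2_cauchy_schwarz[OF n, of "\<lambda>x. 1"] L2t_continuous[of "\<lambda>x. 1::real"] by simp
      also have "\<dots> = l2_norm (f n)"
        by (simp add: l2_norm_const) (simp add: l2_norm_def l2_inner_self)
      finally show ?thesis .
    qed
    then show "\<forall>\<^sub>F n in sequentially. (\<integral>x. norm (f n x) \<partial>torus) \<le> l2_norm (f n)" by simp
  qed simp
  then show ?thesis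
    using tendsto_L1_AE_subseq[of torus f] integrable_L2t[OF f] that by blast
qed

text \<open>The subsequence is taken inside a given one, so that two fields can be treated along a
  common subsequence.\<close>

lemma psum_AE_subseq:
  assumes f: "f \<in> L2t" and r: "strict_mono (r :: nat \<Rightarrow> nat)"
  obtains s where "strict_mono s" "AE x in torus. (\<lambda>n. psum (r (s n)) f x) \<longlonglongrightarrow> f x"
proof -
  have "(\<lambda>n. l2_norm (\<lambda>x. f x - psum (r n) f x)) \<longlonglongrightarrow> 0"
    using LIMSEQ_subseq_LIMSEQ[OF psum_tendsto[OF f] r] by (simp add: o_def)
  then obtain s where s: "strict_mono s" "AE x in torus. (\<lambda>n. f x - psum (r (s n)) f x) \<longlonglongrightarrow> 0"
    by (rule l2_AE_subseq[rotated]) (use f in auto)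
  from s(2) have "AE x in torus. (\<lambda>n. psum (r (s n)) f x) \<longlonglongrightarrow> f x"
  proof eventually_elim
    case (elim x)
    from tendsto_diff[OF tendsto_const[of "f x"] this] show ?case by simp
  qed
  then show ?thesis using s(1) that by blast
qed

section \<open>Embedding of H^2 into bounded functions\<close>

lemma wt_2_ge: "(1 + (of_int (fst \<kappa>))^2) * (1 + (of_int (snd \<kappa>))^2) \<le> wt 2 \<kappa>"
proof -
  define a b where "a = (of_int (fst \<kappa>) :: real)^2" and "b = (of_int (snd \<kappa>) :: real)^2"
  define s where "s = (\<Sum>i\<in>UNIV. (2 * pi * kv \<kappa> $ i)^2)"
  have ab: "0 \<le> a" "0 \<le> b" by (auto simp: a_def b_def)
  have "s = (2 * pi)^2 * (a + b)"
    by (simp add: s_def sum_2 kv_def a_def b_def power_mult_distrib distrib_left)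
  moreover have "1 \<le> (2 * pi)^2"
    using pi_gt3 by (intro one_le_power) auto
  ultimately have s: "a + b \<le> s"
    using ab mult_right_mono[of 1 "(2 * pi)^2" "a + b"] by simp
  have "a * b \<le> (a + b) * (a + b)"
    using ab by (intro mult_mono) auto
  also have "\<dots> \<le> s * s"
    using s ab by (intro mult_mono) auto
  finally have "(1 + a) * (1 + b) \<le> 1 + s * (1 + s)"
    using s by (simp add: algebra_simps)
  then show ?thesis
    by (simp add: a_def b_def s_def numeral_2_eq_2 wt.simps(2))
qed

text \<open>Telescoping: the two terms with |j| = m satisfy 2 / (1 + m^2) <= 4/m - 4/(m + 1). For n
  = 0 both sides equal 1.\<close>

lemma sum_inverse_squares_le: "(\<Sum>j\<in>{- int n..int n}. 1 / (1 + (of_int j)^2)) \<le> 5 - 4 / (real n + 1)"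
proof (induction n)
  case (Suc n)
  have eq: "{- int (Suc n)..int (Suc n)} = insert (int (Suc n)) (insert (- int (Suc n)) {- int n..int n})"
    by auto
  define m where "m = real n + 1"
  have m: "m \<ge> 1" by (simp add: m_def)
  have "2 / (1 + m^2) \<le> 4 / (m * (m + 1))"
  proof -
    have "2 * (m * (m + 1)) \<le> 4 * (1 + m^2)"
      using m sum_squares_bound[of m 1] by (simp add: power2_eq_square algebra_simps)
    moreover have "0 < 1 + m^2" "0 < m * (m + 1)"
      using m by (auto intro!: add_pos_nonneg)
    ultimately show ?thesis by (simp add: divide_le_eq mult.commute[of _ "1 + m^2"] pos_le_divide_eq)
  qed
  also have "\<dots> = 4 / m - 4 / (m + 1)"
    using m by (simp add: field_simps)
  finally have "2 / (1 + m^2) \<le> 4 / m - 4 / (m + 1)" .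
  moreover have "(\<Sum>j\<in>{- int (Suc n)..int (Suc n)}. 1 / (1 + (of_int j)^2)) =
      2 / (1 + m^2) + (\<Sum>j\<in>{- int n..int n}. 1 / (1 + (of_int j :: real)^2))"
  proof -
    have sq: "(of_int (int (Suc n)))^2 = m^2" "(of_int (- int (Suc n)))^2 = m^2"
      by (simp_all add: m_def power2_eq_square algebra_simps)
    show ?thesis
      unfolding eq by (subst sum.insert, simp, simp, subst sum.insert, simp, simp, unfold sq) simp
  qed
  ultimately show ?case
    using Suc by (simp add: m_def add.commute)
qed simp

text \<open>The weight dominates a product of one-dimensional weights, so the double sum factors
  into two sums of at most 5 each.\<close>

lemma sum_inverse_wt_2: "(\<Sum>\<kappa>\<in>freqs n. 1 / wt 2 \<kappa>) \<le> 25"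
proof -
  define c where "c = (\<lambda>j::int. 1 / (1 + (of_int j :: real)^2))"
  have c: "0 \<le> c j" for j
    by (simp add: c_def)
  have c5: "(\<Sum>j\<in>{- int n..int n}. c j) \<le> 5"
    using sum_inverse_squares_le[of n] divide_nonneg_nonneg[of 4 "real n + 1"] unfolding c_def by linarith
  have "(\<Sum>\<kappa>\<in>freqs n. 1 / wt 2 \<kappa>) \<le> (\<Sum>\<kappa>\<in>freqs n. c (fst \<kappa>) * c (snd \<kappa>))"
  proof (intro sum_mono)
    fix \<kappa>
    have "0 < (1 + (of_int (fst \<kappa>) :: real)^2) * (1 + (of_int (snd \<kappa>))^2)"
      by (intro mult_pos_pos add_pos_nonneg) auto
    then show "1 / wt 2 \<kappa> \<le> c (fst \<kappa>) * c (snd \<kappa>)"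
      using wt_2_ge[of \<kappa>] by (simp add: c_def frac_le)
  qed
  also have "\<dots> = (\<Sum>j\<in>{- int n..int n}. c j) * (\<Sum>j\<in>{- int n..int n}. c j)"
    by (simp add: freqs_def sum.cartesian_product sum_product split_beta)
  also have "\<dots> \<le> 5 * 5"
    by (intro mult_mono sum_nonneg c c5) simp
  finally show ?thesis by simp
qed

text \<open>Cauchy-Schwarz against the weights. The constant 10 is the bound 2 for
  \<open>cas\<close> times the square root of 25.\<close>

lemma psum_bound:
  assumes f: "f \<in> Hk 2"
  shows "norm (psum n f x) \<le> 10 * Hk_norm 2 f"
proof -
  have w: "0 < wt 2 \<kappa>" for \<kappa> using wt_ge1[of 2 \<kappa>] by simp
  have "norm (psum n f x) \<le> (\<Sum>\<kappa>\<in>freqs n. 2 * norm (fc \<kappa> f))"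
    unfolding psum_def
    by (rule order_trans[OF norm_sum], intro sum_mono) (auto intro!: mult_right_mono cas_bound)
  also have "\<dots> = 2 * (\<Sum>\<kappa>\<in>freqs n. (1 / sqrt (wt 2 \<kappa>)) * (sqrt (wt 2 \<kappa>) * norm (fc \<kappa> f)))"
    unfolding sum_distrib_left using w by (intro sum.cong refl) (simp add: less_imp_neq[symmetric])
  also have "\<dots> \<le> 2 * (L2_set (\<lambda>\<kappa>. 1 / sqrt (wt 2 \<kappa>)) (freqs n) * L2_set (\<lambda>\<kappa>. sqrt (wt 2 \<kappa>) * norm (fc \<kappa> f)) (freqs n))"
    using L2_set_mult_ineq[of "\<lambda>\<kappa>. 1 / sqrt (wt 2 \<kappa>)" "\<lambda>\<kappa>. sqrt (wt 2 \<kappa>) * norm (fc \<kappa> f)" "freqs n"] w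
    by (simp add: abs_mult less_imp_le)
  also have "\<dots> \<le> 2 * (5 * Hk_norm 2 f)"
  proof (intro mult_left_mono mult_mono L2_set_nonneg)
    show "L2_set (\<lambda>\<kappa>. 1 / sqrt (wt 2 \<kappa>)) (freqs n) \<le> 5"
      unfolding L2_set_def using sum_inverse_wt_2[of n] w
      by (intro real_le_lsqrt) (auto simp: power_divide less_imp_le intro!: sum_nonneg)
    have "(\<Sum>\<kappa>\<in>freqs n. wt 2 \<kappa> * (norm (fc \<kappa> f))^2) \<le> (Hk_norm 2 f)^2"
      using w by (intro finite_sum_le_has_sum[OF Hk_parseval'[OF f]]) (auto simp: less_imp_le)
    then show "L2_set (\<lambda>\<kappa>. sqrt (wt 2 \<kappa>) * norm (fc \<kappa> f)) (freqs n) \<le> Hk_norm 2 f"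
      unfolding L2_set_def using w
      by (intro real_le_lsqrt) (auto simp: power_mult_distrib less_imp_le intro!: sum_nonneg)
  qed auto
  finally show ?thesis by simp
qed

theorem sobolev_Linf:
  assumes f: "f \<in> Hk 2"
  shows "AE x in torus. norm (f x) \<le> 10 * Hk_norm 2 f"
proof -
  obtain s where "AE x in torus. (\<lambda>n. psum (id (s n)) f x) \<longlonglongrightarrow> f x"
    by (rule psum_AE_subseq[of f id]) (use f in \<open>auto simp: strict_mono_def\<close>)
  then show ?thesis
  proof eventually_elim
    case (elim x)
    show ?case
      by (rule LIMSEQ_le_const2[OF tendsto_norm[OF elim]]) (auto intro!: psum_bound f)
  qed
qed

section \<open>Square integrability of products of H^1 functions\<close>

lemma freqs_minus: "\<kappa> \<in> freqs n ==> - \<kappa> \<in> freqs n"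
  by (cases \<kappa>) (auto simp: freqs_def)

lemma psum_has_derivative:
  assumes f: "f \<in> Hk (Suc k)"
  shows "\<exists>D. (psum n f has_derivative D) (at x) \<and> (\<forall>i. D (axis i 1) = psum n (wpd i f) x)"
proof (intro exI conjI allI)
  define D where "D = (\<lambda>h. \<Sum>\<kappa>\<in>freqs n. (2 * pi * (kv \<kappa> \<bullet> h) * cas (- \<kappa>) x) *\<^sub>R fc \<kappa> f)"
  show "(psum n f has_derivative D) (at x)"
    unfolding psum_def D_def
    by (intro has_derivative_sum has_derivative_scaleR_left cas_has_derivative)
  fix i
  have "psum n (wpd i f) x = (\<Sum>\<kappa>\<in>freqs n. cas \<kappa> x *\<^sub>R (- ((2 * pi * kv \<kappa> $ i) *\<^sub>R fc (- \<kappa>) f)))"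
    by (simp add: psum_def fc_wpd[OF f])
  also have "\<dots> = (\<Sum>\<kappa>\<in>freqs n. cas (- \<kappa>) x *\<^sub>R (- ((2 * pi * kv (- \<kappa>) $ i) *\<^sub>R fc \<kappa> f)))"
    by (rule sum.reindex_bij_witness[of _ uminus uminus]) (auto simp: freqs_minus)
  also have "\<dots> = D (axis i 1)"
    by (simp add: D_def kv_minus inner_axis mult_ac)
  finally show "D (axis i 1) = psum n (wpd i f) x" ..
qed

lemma psum_continuous: "continuous_on S (psum n f)"
  unfolding psum_def by (intro continuous_intros continuous_cas)

lemma l2_norm_psum_le: "f \<in> L2t ==> l2_norm (psum n f) \<le> l2_norm f"
proof (rule power2_le_imp_le)
  assume f: "f \<in> L2t"
  show "(l2_norm (psum n f))^2 \<le> (l2_norm f)^2"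
    by (rule has_sum_mono[OF parseval parseval]) (auto simp: fc_psum f)
qed simp

text \<open>For every t the value h(a) is at most h(t) plus the integral of |h'|; averaging over t
  in [0,1] gives the claim.\<close>

lemma interval_bound:
  fixes h h' :: "real \<Rightarrow> real"
  assumes h: "\<And>t. (h has_real_derivative h' t) (at t)" and c: "continuous_on UNIV h'"
    and a: "a \<in> {0..1}"
  shows "h a \<le> integral {0..1} (\<lambda>t. h t + \<bar>h' t\<bar>)"
proof -
  have ch: "continuous_on S h" for S
    using h by (intro DERIV_continuous_on) (auto intro: has_field_derivative_at_within)
  have ch': "continuous_on S (\<lambda>t. \<bar>h' t\<bar>)" for S
    by (intro continuous_intros continuous_on_subset[OF c]) simp
  have le: "h a - h t \<le> integral {0..1} (\<lambda>t. \<bar>h' t\<bar>)" if t: "t \<in> {0..1}" for t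
  proof -
    have *: "\<bar>h q - h p\<bar> \<le> integral {0..1} (\<lambda>t. \<bar>h' t\<bar>)" if pq: "0 \<le> p" "p \<le> q" "q \<le> 1" for p q
    proof -
      have "(h' has_integral (h q - h p)) {p..q}"
        using pq h by (intro fundamental_theorem_of_calculus)
          (auto simp: has_real_derivative_iff_has_vector_derivative[symmetric] intro: has_field_derivative_at_within)
      then have "\<bar>h q - h p\<bar> = \<bar>integral {p..q} h'\<bar>" by (simp add: integral_unique)
      also have "\<dots> \<le> integral {p..q} (\<lambda>t. \<bar>h' t\<bar>)"
        using integral_norm_bound_integral[of h' "{p..q}" "\<lambda>t. \<bar>h' t\<bar>"] c ch'
        by (auto intro!: integrable_continuous_real intro: continuous_on_subset)
      also have "\<dots> \<le> integral {0..1} (\<lambda>t. \<bar>h' t\<bar>)"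
        using pq ch' by (intro integral_subset_le integrable_continuous_real) auto
      finally show ?thesis .
    qed
    show ?thesis
      using *[of a t] *[of t a] a t by (cases "a \<le> t") auto
  qed
  have "h a = integral {0..1} (\<lambda>t::real. h a)" by simp
  also have "\<dots> \<le> integral {0..1} (\<lambda>t. h t + integral {0..1} (\<lambda>t. \<bar>h' t\<bar>))"
    using le by (intro integral_le integrable_continuous_real continuous_intros ch) (auto simp: algebra_simps)
  also have "\<dots> = integral {0..1} h + integral {0..1} (\<lambda>t. \<bar>h' t\<bar>)"
    by (subst integral_add) (auto intro!: integrable_continuous_real ch)
  also have "\<dots> = integral {0..1} (\<lambda>t. h t + \<bar>h' t\<bar>)"
    by (subst integral_add) (auto intro!: integrable_continuous_real ch ch')
  finally show ?thesis .
qed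

lemma nn_integral_interval:
  fixes g :: "real \<Rightarrow> real"
  assumes "continuous_on UNIV g" "\<And>t. 0 \<le> g t"
  shows "(\<integral>\<^sup>+t. ennreal (g t) * indicator {0..<1} t \<partial>lborel) = ennreal (integral {0..1} g)"
proof -
  have "(\<integral>\<^sup>+t. ennreal (g t) * indicator {0..<1} t \<partial>lborel) = (\<integral>\<^sup>+t. ennreal (g t) * indicator {0..1} t \<partial>lborel)"
  proof (rule nn_integral_cong_AE)
    show "AE t in lborel. ennreal (g t) * indicator {0..<1} t = ennreal (g t) * indicator {0..1} t"
      using AE_lborel_singleton[of "1::real"] by eventually_elim (auto split: split_indicator)
  qed
  also have "\<dots> = ennreal (integral {0..1} g)"
  proof -
    have si: "set_integrable lborel {0..1} g"
      by (rule borel_integrable_atLeastAtMost') (rule continuous_on_subset[OF assms(1)], simp)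
    have "(\<integral>\<^sup>+t. ennreal (g t) * indicator {0..1} t \<partial>lborel) = (\<integral>\<^sup>+t. ennreal (indicator {0..1} t *\<^sub>R g t) \<partial>lborel)"
      by (intro nn_integral_cong) (auto split: split_indicator)
    also have "\<dots> = ennreal (\<integral>t. indicator {0..1} t *\<^sub>R g t \<partial>lborel)"
      using si assms(2) unfolding set_integrable_def by (intro nn_integral_eq_integral) auto
    also have "\<dots> = ennreal (integral {0..1} g)"
      using set_borel_integral_eq_integral(2)[OF si] by (simp add: set_lebesgue_integral_def)
    finally show ?thesis .
  qed
  finally show ?thesis .
qed

text \<open>The one-dimensional bound in direction \<open>i\<close> for \<open>|f|\<^sup>2\<close>, which makes \<open>|f|\<^sup>2 |g|\<^sup>2\<close> bounded by a
  product of a function of \<open>x\<^sub>2\<close> and a function of \<open>x\<^sub>1\<close>.\<close>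

lemma psum_line_bound:
  fixes f :: "'b::euclidean_space field"
  assumes f: "f \<in> Hk 1" and a: "a \<in> {0..<1}"
  shows "ennreal ((norm (psum n f (x + a *\<^sub>R axis i 1)))^2) \<le>
    (\<integral>\<^sup>+t. ennreal (2 * (norm (psum n f (x + t *\<^sub>R axis i 1)))^2 + (norm (psum n (wpd i f) (x + t *\<^sub>R axis i 1)))^2) * indicator {0..<1} t \<partial>lborel)"
proof -
  define p q where "p t = psum n f (x + t *\<^sub>R axis i 1)" and "q t = psum n (wpd i f) (x + t *\<^sub>R axis i 1)" for t
  have cp: "continuous_on UNIV p"
    unfolding p_def by (rule continuous_on_compose2[OF psum_continuous]) (auto intro!: continuous_intros)
  have cq: "continuous_on UNIV q"
    unfolding q_def by (rule continuous_on_compose2[OF psum_continuous]) (auto intro!: continuous_intros)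
  have dp: "(p has_vector_derivative q t) (at t)" for t
  proof -
    obtain D where D: "(psum n f has_derivative D) (at (x + t *\<^sub>R axis i 1))" "D (axis i 1) = q t"
      using psum_has_derivative[of f 0 n "x + t *\<^sub>R axis i 1"] f unfolding q_def by auto
    have "(p has_derivative (\<lambda>h. D (h *\<^sub>R axis i 1))) (at t)"
      unfolding p_def by (rule has_derivative_compose[where f="\<lambda>t. x + t *\<^sub>R axis i 1" and g="psum n f", OF _ D(1)]) (auto intro!: derivative_eq_intros)
    moreover have "(\<lambda>h. D (h *\<^sub>R axis i 1)) = (\<lambda>h. h *\<^sub>R q t)"
      using has_derivative_bounded_linear[OF D(1)] D(2) by (simp add: linear_simps)
    ultimately show ?thesis by (simp add: has_vector_derivative_def)
  qed
  have dh: "((\<lambda>t. p t \<bullet> p t) has_real_derivative (2 * (p t \<bullet> q t))) (at t)" for t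
    unfolding has_real_derivative_iff_has_vector_derivative
    by (rule has_vector_derivative_eq_rhs[OF bounded_bilinear.has_vector_derivative[OF bounded_bilinear_inner dp dp]])
       (simp add: inner_commute)
  have pq: "\<bar>2 * (p t \<bullet> q t)\<bar> \<le> (norm (p t))^2 + (norm (q t))^2" for t
    using Cauchy_Schwarz_ineq2[of "p t" "q t"] sum_squares_bound[of "norm (p t)" "norm (q t)"] by simp
  have "p a \<bullet> p a \<le> integral {0..1} (\<lambda>t. p t \<bullet> p t + \<bar>2 * (p t \<bullet> q t)\<bar>)"
    using a by (intro interval_bound[OF dh]) (auto intro!: continuous_intros cp cq)
  also have "\<dots> \<le> integral {0..1} (\<lambda>t. 2 * (norm (p t))^2 + (norm (q t))^2)"
  proof (intro integral_le integrable_continuous_real continuous_intros continuous_on_subset[OF cp] continuous_on_subset[OF cq])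
    fix t
    show "p t \<bullet> p t + \<bar>2 * (p t \<bullet> q t)\<bar> \<le> 2 * (norm (p t))^2 + (norm (q t))^2"
      using pq[of t] by (simp add: power2_norm_eq_inner)
  qed auto
  finally have "ennreal ((norm (p a))^2) \<le> ennreal (integral {0..1} (\<lambda>t. 2 * (norm (p t))^2 + (norm (q t))^2))"
    by (intro ennreal_leI) (simp add: power2_norm_eq_inner)
  also have "\<dots> = (\<integral>\<^sup>+t. ennreal (2 * (norm (p t))^2 + (norm (q t))^2) * indicator {0..<1} t \<partial>lborel)"
    by (intro nn_integral_interval[symmetric] continuous_intros cp cq) auto
  finally show ?thesis unfolding p_def q_def .
qed

text \<open>Ladyzhenskaya's argument. Horizontally |f|^2 is bounded by a function A of the second
  coordinate alone, vertically |g|^2 by a function B of the first, so the integral of the product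
  factors. Each factor is at most twice a squared H^1 norm, hence the 4. Partial sums are used
  because the bound along lines needs smooth functions.\<close>

lemma nn_integral_psum_product:
  fixes f :: "'b::euclidean_space field" and g :: "'c::euclidean_space field"
  assumes f: "f \<in> Hk 1" and g: "g \<in> Hk 1"
  shows "(\<integral>\<^sup>+x. ennreal ((norm (psum n f x))^2 * (norm (psum n g x))^2) \<partial>torus) \<le>
    ennreal (4 * (Hk_norm 1 f)^2 * (Hk_norm 1 g)^2)"
proof -
  define F where "F x = ennreal (2 * (norm (psum n f x))^2 + (norm (psum n (wpd 1 f) x))^2)" for x
  define G where "G x = ennreal (2 * (norm (psum n g x))^2 + (norm (psum n (wpd 2 g) x))^2)" for x
  have m [measurable]: "psum n h \<in> borel_measurable borel" for h :: "'d::euclidean_space field"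
    by (intro borel_measurable_continuous_onI psum_continuous)
  have [measurable]: "F \<in> borel_measurable borel" "G \<in> borel_measurable borel"
    unfolding F_def G_def by measurable
  have [measurable]: "pt \<in> borel \<Otimes>\<^sub>M borel \<rightarrow>\<^sub>M borel"
    unfolding borel_prod by simp
  define I :: "real \<Rightarrow> ennreal" where "I = indicator {0..<1}"
  have [measurable]: "I \<in> borel_measurable borel" by (simp add: I_def)
  define A where "A b = (\<integral>\<^sup>+a. F (pt (a, b)) * I a \<partial>lborel)" for b
  define B where "B a = (\<integral>\<^sup>+b. G (pt (a, b)) * I b \<partial>lborel)" for a
  have [measurable]: "A \<in> borel_measurable borel" "B \<in> borel_measurable borel"
    unfolding A_def B_def by measurable
  have bA: "ennreal ((norm (psum n f (pt (a, b))))^2) \<le> A b" if "a \<in> {0..<1}" for a b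
  proof -
    have eq: "pt (0, b) + t *\<^sub>R axis 1 1 = pt (t, b)" for t
      by (auto simp: vec_eq_iff forall_2 axis_def)
    show ?thesis
      using psum_line_bound[OF f that, of n "pt (0, b)" 1] unfolding A_def F_def I_def eq .
  qed
  have bB: "ennreal ((norm (psum n g (pt (a, b))))^2) \<le> B a" if "b \<in> {0..<1}" for a b
  proof -
    have eq: "pt (a, 0) + t *\<^sub>R axis 2 1 = pt (a, t)" for t
      by (auto simp: vec_eq_iff forall_2 axis_def)
    show ?thesis
      using psum_line_bound[OF g that, of n "pt (a, 0)" 2] unfolding B_def G_def I_def eq .
  qed
  have tor: "(\<integral>\<^sup>+x. H x \<partial>torus) = (\<integral>\<^sup>+z. H (pt z) * (I (fst z) * I (snd z)) \<partial>(lborel \<Otimes>\<^sub>M lborel))"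
    if "H \<in> borel_measurable borel" for H
    unfolding nn_integral_torus[OF that] by (intro nn_integral_cong) (auto simp: I_def split: split_indicator)
  have iA: "(\<integral>\<^sup>+b. A b * I b \<partial>lborel) = (\<integral>\<^sup>+x. F x \<partial>torus)"
  proof -
    have "(\<integral>\<^sup>+x. F x \<partial>torus) = (\<integral>\<^sup>+z. F (pt z) * (I (fst z) * I (snd z)) \<partial>(lborel \<Otimes>\<^sub>M lborel))"
      by (rule tor) simp
    also have "\<dots> = (\<integral>\<^sup>+b. \<integral>\<^sup>+a. F (pt (a, b)) * (I a * I b) \<partial>lborel \<partial>lborel)"
      by (subst lborel_pair.nn_integral_snd[symmetric]) (auto simp: split_beta')
    also have "\<dots> = (\<integral>\<^sup>+b. A b * I b \<partial>lborel)"
      unfolding A_def by (subst nn_integral_multc[symmetric]) (auto simp: mult.assoc)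
    finally show ?thesis ..
  qed
  have iB: "(\<integral>\<^sup>+a. B a * I a \<partial>lborel) = (\<integral>\<^sup>+x. G x \<partial>torus)"
  proof -
    have "(\<integral>\<^sup>+x. G x \<partial>torus) = (\<integral>\<^sup>+z. G (pt z) * (I (fst z) * I (snd z)) \<partial>(lborel \<Otimes>\<^sub>M lborel))"
      by (rule tor) simp
    also have "\<dots> = (\<integral>\<^sup>+a. \<integral>\<^sup>+b. G (pt (a, b)) * (I a * I b) \<partial>lborel \<partial>lborel)"
      by (subst lborel.nn_integral_fst[symmetric]) (auto simp: split_beta')
    also have "\<dots> = (\<integral>\<^sup>+a. B a * I a \<partial>lborel)"
      unfolding B_def by (subst nn_integral_multc[symmetric]) (auto simp: mult_ac)
    finally show ?thesis ..
  qed
  have tF: "(\<integral>\<^sup>+x. ennreal (2 * (norm (psum n h x))^2 + (norm (psum n (wpd i h) x))^2) \<partial>torus) \<le> ennreal (2 * (Hk_norm 1 h)^2)"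
    if h: "h \<in> Hk 1" for h :: "'d::euclidean_space field" and i
  proof -
    have I2: "integrable torus (\<lambda>x. (norm (psum n h' x))^2)" for h' :: "'d field"
      by (intro L2tD psum_L2t)
    have "(\<integral>\<^sup>+x. ennreal (2 * (norm (psum n h x))^2 + (norm (psum n (wpd i h) x))^2) \<partial>torus) =
        ennreal (\<integral>x. 2 * (norm (psum n h x))^2 + (norm (psum n (wpd i h) x))^2 \<partial>torus)"
      by (rule nn_integral_eq_integral) (auto intro!: I2)
    also have "(\<integral>x. 2 * (norm (psum n h x))^2 + (norm (psum n (wpd i h) x))^2 \<partial>torus) =
        2 * (l2_norm (psum n h))^2 + (l2_norm (psum n (wpd i h)))^2"
      by (simp add: I2 l2_norm_sq l2_inner_self)
    also have "\<dots> \<le> 2 * (l2_norm h)^2 + (l2_norm (wpd i h))^2"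
      using h wpd_L2[of h 0 i] by (intro add_mono mult_left_mono power_mono l2_norm_psum_le) (auto intro: L2_L2t)
    also have "\<dots> \<le> 2 * (Hk_norm 1 h)^2"
    proof -
      define S where "S = (\<Sum>i\<in>UNIV. (l2_norm (wpd i h))^2)"
      have "(l2_norm (wpd i h))^2 \<le> S"
        unfolding S_def by (rule member_le_sum) auto
      moreover have "0 \<le> S" unfolding S_def by (intro sum_nonneg) auto
      ultimately have "2 * (l2_norm h)^2 + (l2_norm (wpd i h))^2 \<le> 2 * ((l2_norm h)^2 + S)"
        using add_mono[of "(l2_norm (wpd i h))^2" S 0 S] by simp
      then show ?thesis unfolding Hk_norm_sq_1 S_def .
    qed
    finally show ?thesis by (simp add: ennreal_leI)
  qed
  have "(\<integral>\<^sup>+x. ennreal ((norm (psum n f x))^2 * (norm (psum n g x))^2) \<partial>torus) =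
      (\<integral>\<^sup>+z. ennreal ((norm (psum n f (pt z)))^2 * (norm (psum n g (pt z)))^2) * (I (fst z) * I (snd z)) \<partial>(lborel \<Otimes>\<^sub>M lborel))"
    by (rule tor) measurable
  also have "\<dots> \<le> (\<integral>\<^sup>+z. (A (snd z) * I (snd z)) * (B (fst z) * I (fst z)) \<partial>(lborel \<Otimes>\<^sub>M lborel))"
  proof (intro nn_integral_mono)
    fix z :: "real \<times> real"
    show "ennreal ((norm (psum n f (pt z)))^2 * (norm (psum n g (pt z)))^2) * (I (fst z) * I (snd z)) \<le>
        (A (snd z) * I (snd z)) * (B (fst z) * I (fst z))"
      using bA[of "fst z" "snd z"] bB[of "snd z" "fst z"]
      by (auto simp: I_def ennreal_mult' intro!: mult_mono split: split_indicator)
  qed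
  also have "\<dots> = (\<integral>\<^sup>+a. \<integral>\<^sup>+b. (A b * I b) * (B a * I a) \<partial>lborel \<partial>lborel)"
    by (subst lborel.nn_integral_fst[symmetric]) (auto simp: split_beta')
  also have "\<dots> = (\<integral>\<^sup>+x. F x \<partial>torus) * (\<integral>\<^sup>+x. G x \<partial>torus)"
    by (subst nn_integral_multc, simp, subst nn_integral_cmult) (auto simp: iA iB)
  also have "\<dots> \<le> ennreal (2 * (Hk_norm 1 f)^2) * ennreal (2 * (Hk_norm 1 g)^2)"
    unfolding F_def G_def by (intro mult_mono tF f g) auto
  also have "\<dots> = ennreal (4 * (Hk_norm 1 f)^2 * (Hk_norm 1 g)^2)"
    by (subst ennreal_mult[symmetric]) (auto simp: mult_ac)
  finally show ?thesis .
qed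

text \<open>Fatou's lemma along a common subsequence on which the partial sums of both fields
  converge almost everywhere. This is the substitute in dimension two for a pointwise bound, which
  fails in H^1.\<close>

theorem sobolev_product:
  fixes f :: "'b::euclidean_space field" and g :: "'c::euclidean_space field"
  assumes f: "f \<in> Hk 1" and g: "g \<in> Hk 1"
  shows "(\<lambda>x. norm (f x) * norm (g x)) \<in> L2t" (is ?L)
    and "l2_norm (\<lambda>x. norm (f x) * norm (g x)) \<le> 2 * Hk_norm 1 f * Hk_norm 1 g" (is ?N)
proof -
  have fL: "f \<in> L2t" "g \<in> L2t" using f g by auto
  obtain r where r: "strict_mono r" "AE x in torus. (\<lambda>n. psum (id (r n)) f x) \<longlonglongrightarrow> f x"
    by (rule psum_AE_subseq[OF fL(1), of id]) (auto simp: strict_mono_def)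
  obtain s where s: "strict_mono s" "AE x in torus. (\<lambda>n. psum (r (s n)) g x) \<longlonglongrightarrow> g x"
    using psum_AE_subseq[OF fL(2) r(1)] by blast
  have "AE x in torus. (\<lambda>n. psum (r (s n)) f x) \<longlonglongrightarrow> f x"
    using r(2) by eventually_elim (use LIMSEQ_subseq_LIMSEQ[OF _ s(1)] in \<open>force simp: o_def\<close>)
  with s(2) have lim: "AE x in torus. (\<lambda>n. ennreal ((norm (psum (r (s n)) f x))^2 * (norm (psum (r (s n)) g x))^2)) \<longlonglongrightarrow>
      ennreal ((norm (f x))^2 * (norm (g x))^2)"
    by eventually_elim (intro tendsto_intros)
  have "(\<integral>\<^sup>+x. ennreal ((norm (f x))^2 * (norm (g x))^2) \<partial>torus) =
      (\<integral>\<^sup>+x. liminf (\<lambda>n. ennreal ((norm (psum (r (s n)) f x))^2 * (norm (psum (r (s n)) g x))^2)) \<partial>torus)"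
  proof (rule nn_integral_cong_AE)
    show "AE x in torus. ennreal ((norm (f x))^2 * (norm (g x))^2) =
        liminf (\<lambda>n. ennreal ((norm (psum (r (s n)) f x))^2 * (norm (psum (r (s n)) g x))^2))"
      using lim
    proof eventually_elim
      case (elim x)
      show ?case by (rule lim_imp_Liminf[OF _ elim, symmetric]) simp
    qed
  qed
  also have "\<dots> \<le> liminf (\<lambda>n. \<integral>\<^sup>+x. ennreal ((norm (psum (r (s n)) f x))^2 * (norm (psum (r (s n)) g x))^2) \<partial>torus)"
    by (rule nn_integral_liminf) (use psum_L2t in \<open>measurable\<close>)
  also have "\<dots> \<le> ennreal (4 * (Hk_norm 1 f)^2 * (Hk_norm 1 g)^2)"
    by (rule Liminf_le, simp, rule always_eventually, rule allI, rule nn_integral_psum_product[OF f g])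
  finally have le: "(\<integral>\<^sup>+x. ennreal ((norm (f x))^2 * (norm (g x))^2) \<partial>torus) \<le> ennreal (4 * (Hk_norm 1 f)^2 * (Hk_norm 1 g)^2)" .
  have int: "integrable torus (\<lambda>x. (norm (f x))^2 * (norm (g x))^2)"
  proof (rule integrableI_nonneg)
    show "(\<integral>\<^sup>+x. ennreal ((norm (f x))^2 * (norm (g x))^2) \<partial>torus) < \<infinity>"
      using le by (rule order_le_less_trans) simp
  qed (use fL in auto)
  then show ?L
    using fL by (auto simp: L2t_def power_mult_distrib)
  have "ennreal ((l2_norm (\<lambda>x. norm (f x) * norm (g x)))^2) = (\<integral>\<^sup>+x. ennreal ((norm (f x))^2 * (norm (g x))^2) \<partial>torus)"
    using int by (subst nn_integral_eq_integral) (auto simp: l2_norm_sq l2_inner_self power_mult_distrib)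
  with le have "ennreal ((l2_norm (\<lambda>x. norm (f x) * norm (g x)))^2) \<le> ennreal (4 * (Hk_norm 1 f)^2 * (Hk_norm 1 g)^2)"
    by simp
  then have "(l2_norm (\<lambda>x. norm (f x) * norm (g x)))^2 \<le> 4 * (Hk_norm 1 f)^2 * (Hk_norm 1 g)^2"
    by (subst (asm) ennreal_le_iff) (intro mult_nonneg_nonneg zero_le_power2, simp)
  then have "(l2_norm (\<lambda>x. norm (f x) * norm (g x)))^2 \<le> (2 * Hk_norm 1 f * Hk_norm 1 g)^2"
    by (simp add: power_mult_distrib)
  then show ?N
    by (rule power2_le_imp_le) simp
qed

section \<open>The trilinear form\<close>

lemma psum_Hk [simp]: "psum n f \<in> Hk k"
  unfolding psum_def by (intro Hk_sum Hk_cas)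

lemma wpd_psum:
  assumes f: "f \<in> Hk (Suc k)"
  shows "ae_eq (wpd i (psum n f)) (psum n (wpd i f))"
proof (rule fc_unique)
  show "wpd i (psum n f) \<in> L2t"
    by (intro L2_L2t wpd_L2[of _ 0] psum_Hk)
  show "fc \<kappa> (wpd i (psum n f)) = fc \<kappa> (psum n (wpd i f))" for \<kappa>
    using freqs_minus[of \<kappa> n] freqs_minus[of "- \<kappa>" n]
    by (auto simp: fc_wpd[OF psum_Hk] fc_wpd[OF f] fc_psum)
qed simp

text \<open>Partial sums commute with weak derivatives, because the set of frequencies is symmetric;
  so each derivative converges in L^2.\<close>

lemma psum_H1_tendsto:
  assumes f: "f \<in> Hk 1"
  shows "(\<lambda>n. Hk_norm 1 (\<lambda>x. f x - psum n f x)) \<longlonglongrightarrow> 0"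
proof -
  have f': "f \<in> Hk (Suc 0)" using f by simp
  have eq: "l2_norm (wpd i (\<lambda>x. f x - psum n f x)) = l2_norm (\<lambda>x. wpd i f x - psum n (wpd i f) x)" for i n
    by (rule l2_norm_cong, rule ae_eq_trans[OF wpd_diff[OF f' psum_Hk]])
       (intro ae_eq_map2[of _ _ _ _ "(-)"] wpd_psum[OF f'] ae_eq_refl)
  have "(\<lambda>n. sqrt ((l2_norm (\<lambda>x. f x - psum n f x))^2 + (\<Sum>i\<in>UNIV. (l2_norm (\<lambda>x. wpd i f x - psum n (wpd i f) x))^2))) \<longlonglongrightarrow>
      sqrt (0^2 + (\<Sum>i\<in>(UNIV :: 2 set). 0^2))"
    by (intro tendsto_intros psum_tendsto L2_L2t wpd_L2[OF f'] Hk_L2[OF f])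
  moreover have "Hk_norm 1 (\<lambda>x. f x - psum n f x) =
      sqrt ((l2_norm (\<lambda>x. f x - psum n f x))^2 + (\<Sum>i\<in>UNIV. (l2_norm (\<lambda>x. wpd i f x - psum n (wpd i f) x))^2))" for n
    unfolding eq[symmetric] Hk_norm_sq_1[symmetric] by simp
  ultimately show ?thesis by simp
qed

lemma l2_inner_tendsto:
  fixes f g :: "'b::euclidean_space field"
  assumes L: "f \<in> L2t" "g \<in> L2t" "\<And>n. F n \<in> L2t" "\<And>n. G n \<in> L2t"
    and F: "(\<lambda>n. l2_norm (\<lambda>x. f x - F n x)) \<longlonglongrightarrow> 0" and G: "(\<lambda>n. l2_norm (\<lambda>x. g x - G n x)) \<longlonglongrightarrow> 0"
  shows "(\<lambda>n. l2_inner (F n) (G n)) \<longlonglongrightarrow> l2_inner f g"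
proof -
  have z: "(\<lambda>n. l2_inner (H n) (K n)) \<longlonglongrightarrow> 0"
    if "\<And>n. H n \<in> L2t" "\<And>n. K n \<in> L2t" "(\<lambda>n. l2_norm (H n) * l2_norm (K n)) \<longlonglongrightarrow> 0" for H K :: "nat \<Rightarrow> 'b field"
    by (rule Lim_null_comparison[OF _ that(3)]) (use l2_cauchy_schwarz[OF that(1,2)] in auto)
  have "(\<lambda>n. l2_inner f g - l2_inner (\<lambda>x. f x - F n x) g - l2_inner f (\<lambda>x. g x - G n x) +
      l2_inner (\<lambda>x. f x - F n x) (\<lambda>x. g x - G n x)) \<longlonglongrightarrow> l2_inner f g - 0 - 0 + 0"
    by (intro tendsto_intros z) (use L in \<open>auto intro!: tendsto_mult_zero tendsto_mult_left_zero tendsto_mult_right_zero F G\<close>)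
  moreover have "l2_inner f g - l2_inner (\<lambda>x. f x - F n x) g - l2_inner f (\<lambda>x. g x - G n x) +
      l2_inner (\<lambda>x. f x - F n x) (\<lambda>x. g x - G n x) = l2_inner (F n) (G n)" for n
    using L by (simp add: l2_inner_diff_left l2_inner_diff_right)
  ultimately show ?thesis by simp
qed

section \<open>The convection term as a tensor paired with a gradient\<close>

lemma norm_outer: "norm (outer a b) = norm a * norm b"
proof -
  have "(norm (outer a b))^2 = (\<Sum>i\<in>UNIV. \<Sum>j\<in>UNIV. (a $ i)^2 * (b $ j)^2)"
    unfolding power2_norm_eq_inner inner_vec_def outer_def by (simp add: power2_eq_square mult_ac)
  also have "\<dots> = (norm a)^2 * (norm b)^2"
    unfolding power2_norm_eq_inner inner_vec_def by (simp add: sum_product power2_eq_square)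
  finally have "(norm (outer a b))^2 = (norm a * norm b)^2"
    by (simp add: power_mult_distrib)
  then show ?thesis by (rule power2_eq_imp_eq) auto
qed

lemma outer_add_left: "outer (a + a') b = outer a b + outer a' b"
  and outer_add_right: "outer a (b + b') = outer a b + outer a b'"
  and outer_diff_left: "outer (a - a') b = outer a b - outer a' b"
  and outer_diff_right: "outer a (b - b') = outer a b - outer a b'"
  and outer_scaleR_left: "outer (c *\<^sub>R a) b = c *\<^sub>R outer a b"
  and outer_scaleR_right: "outer a (c *\<^sub>R b) = c *\<^sub>R outer a b"
  by (simp_all add: outer_def vec_eq_iff algebra_simps)

lemma outer_measurable [measurable (raw)]:
  assumes "a \<in> borel_measurable M" "b \<in> borel_measurable M"
  shows "(\<lambda>x. outer (a x) (b x)) \<in> borel_measurable M"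
  using assms
  by (rule borel_measurable_continuous_Pair) (auto simp: outer_def intro!: continuous_intros)

lemma l2_norm_abs_cong: "(\<And>x. norm (f x) = norm (g x)) ==> l2_norm f = l2_norm g"
  by (simp add: l2_norm_def l2_inner_self)

lemma outer_H1:
  assumes a: "a \<in> Hk 1" and b: "b \<in> Hk 1"
  shows "(\<lambda>x. outer (a x) (b x)) \<in> L2t" "l2_norm (\<lambda>x. outer (a x) (b x)) \<le> 2 * Hk_norm 1 a * Hk_norm 1 b"
proof -
  have L: "a \<in> L2t" "b \<in> L2t" using Hk_L2t a b by blast+
  show "(\<lambda>x. outer (a x) (b x)) \<in> L2t"
    by (rule L2tI_bound[OF _ sobolev_product(1)[OF a b]]) (use L in \<open>auto simp: norm_outer\<close>)
  have "l2_norm (\<lambda>x. outer (a x) (b x)) = l2_norm (\<lambda>x. norm (a x) * norm (b x))"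
    by (rule l2_norm_abs_cong) (simp add: norm_outer)
  then show "l2_norm (\<lambda>x. outer (a x) (b x)) \<le> 2 * Hk_norm 1 a * Hk_norm 1 b"
    using sobolev_product(2)[OF a b] by simp
qed

text \<open>One factor is bounded pointwise by the embedding of H^2, so square integrability of the
  other is enough.\<close>

lemma
  assumes a: "a \<in> Hk 2" and b: "b \<in> L2t"
  shows outer_H2_left_L2t: "(\<lambda>x. outer (a x) (b x)) \<in> L2t"
    and outer_H2_left: "l2_norm (\<lambda>x. outer (a x) (b x)) \<le> 10 * Hk_norm 2 a * l2_norm b"
    and outer_H2_right_L2t: "(\<lambda>x. outer (b x) (a x)) \<in> L2t"
    and outer_H2_right: "l2_norm (\<lambda>x. outer (b x) (a x)) \<le> 10 * Hk_norm 2 a * l2_norm b"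
proof -
  have a': "a \<in> L2t" using Hk_L2t a by blast
  have le: "AE x in torus. norm (a x) * norm (b x) \<le> norm ((10 * Hk_norm 2 a) *\<^sub>R b x)"
    using sobolev_Linf[OF a] by eventually_elim (auto intro!: mult_right_mono)
  have m: "(\<lambda>x. outer (a x) (b x)) \<in> borel_measurable torus" "(\<lambda>x. outer (b x) (a x)) \<in> borel_measurable torus"
    by (intro outer_measurable L2tD a' b)+
  have L: "(\<lambda>x. (10 * Hk_norm 2 a) *\<^sub>R b x) \<in> L2t"
    using b by (rule L2t_scaleR)
  show "(\<lambda>x. outer (a x) (b x)) \<in> L2t"
    by (rule L2tI_bound[OF m(1) L]) (use le in \<open>simp only: norm_outer\<close>)
  show "(\<lambda>x. outer (b x) (a x)) \<in> L2t"
    by (rule L2tI_bound[OF m(2) L]) (use le in \<open>simp only: norm_outer mult.commute\<close>)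
  have "l2_norm (\<lambda>x. norm (a x) * norm (b x)) \<le> l2_norm (\<lambda>x. (10 * Hk_norm 2 a) *\<^sub>R b x)"
    using le b by (intro l2_norm_mono) auto
  then have *: "l2_norm (\<lambda>x. norm (a x) * norm (b x)) \<le> 10 * Hk_norm 2 a * l2_norm b"
    by (simp add: l2_norm_scaleR)
  have "l2_norm (\<lambda>x. outer (a x) (b x)) = l2_norm (\<lambda>x. norm (a x) * norm (b x))"
    "l2_norm (\<lambda>x. outer (b x) (a x)) = l2_norm (\<lambda>x. norm (a x) * norm (b x))"
    by (rule l2_norm_abs_cong, simp add: norm_outer mult.commute)+
  with * show "l2_norm (\<lambda>x. outer (a x) (b x)) \<le> 10 * Hk_norm 2 a * l2_norm b"
    "l2_norm (\<lambda>x. outer (b x) (a x)) \<le> 10 * Hk_norm 2 a * l2_norm b" by simp_all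
qed

text \<open>With the test function in the middle slot the form is linear in the tensor of the outer
  slots. The covariance term of the scheme has the same shape, and the two can be added.\<close>

lemma trilin_outer: "trilin a \<phi> b = l2_inner (\<lambda>x. outer (a x) (b x)) (wgrad \<phi>)"
  unfolding trilin_def l2_inner_def
proof (intro Bochner_Integration.integral_cong refl)
  fix x
  have "(\<Sum>i\<in>UNIV. a x $ i *\<^sub>R wpd i \<phi> x) \<bullet> b x = (\<Sum>i\<in>UNIV. a x $ i * (wpd i \<phi> x \<bullet> b x))"
    by (simp add: inner_sum_left)
  also have "\<dots> = outer (a x) (b x) \<bullet> wgrad \<phi> x"
    by (simp add: inner_vec_def outer_def wgrad_def sum_distrib_left mult_ac)
  finally show "(\<Sum>i\<in>UNIV. a x $ i *\<^sub>R wpd i \<phi> x) \<bullet> b x = outer (a x) (b x) \<bullet> wgrad \<phi> x" .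
qed

lemma wgrad_L2t [simp]:
  assumes f: "f \<in> Hk 1"
  shows "wgrad f \<in> L2t" and l2_norm_wgrad: "(l2_norm (wgrad f))^2 = (\<Sum>i\<in>UNIV. (l2_norm (wpd i f))^2)"
proof -
  have w: "wpd i f \<in> L2t" for i using wpd_L2[of f 0 i] f by (simp add: L2_L2t)
  have "wgrad f = (\<lambda>x. \<Sum>i\<in>UNIV. axis i (wpd i f x))"
    by (auto simp: wgrad_def vec_eq_iff axis_def fun_eq_iff if_distrib cong: if_cong)
  moreover have "(axis i :: 'a \<Rightarrow> 'a^2) \<in> borel_measurable borel" for i
  proof (rule borel_measurable_continuous_onI)
    have "continuous_on UNIV (\<lambda>v::'a. \<chi> j. if j = i then v else 0)"
    proof (rule continuous_on_vec_lambda)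
      show "continuous_on UNIV (\<lambda>v::'a. if j = i then v else 0)" for j
        by (cases "j = i") auto
    qed
    then show "continuous_on UNIV (axis i :: 'a \<Rightarrow> 'a^2)"
      by (simp add: axis_def[abs_def])
  qed
  ultimately have m: "wgrad f \<in> borel_measurable torus"
    using w by (simp add: borel_measurable_sum measurable_compose[OF L2tD(1)[OF w]])
  have eq: "(norm (wgrad f x))^2 = (\<Sum>i\<in>UNIV. (norm (wpd i f x))^2)" for x
    by (simp add: wgrad_def power2_norm_eq_inner inner_vec_def)
  show "wgrad f \<in> L2t"
    unfolding L2t_def mem_Collect_eq eq
    by (intro conjI m Bochner_Integration.integrable_sum L2tD(2) w)
  show "(l2_norm (wgrad f))^2 = (\<Sum>i\<in>UNIV. (l2_norm (wpd i f))^2)"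
    unfolding l2_norm_sq l2_inner_self eq
    by (rule Bochner_Integration.integral_sum) (auto simp: L2tD w)
qed

lemma l2_norm_wgrad_le: "f \<in> Hk 1 ==> l2_norm (wgrad f) \<le> Hk_norm 1 f"
proof (rule power2_le_imp_le)
  assume f: "f \<in> Hk 1"
  show "(l2_norm (wgrad f))^2 \<le> (Hk_norm 1 f)^2"
    unfolding Hk_norm_sq_1 l2_norm_wgrad[OF f] by simp
qed simp

lemma wgrad_lin:
  assumes f: "f \<in> Hk 1" and g: "g \<in> Hk 1"
  shows "ae_eq (wgrad (\<lambda>x. a *\<^sub>R f x + b *\<^sub>R g x)) (\<lambda>x. a *\<^sub>R wgrad f x + b *\<^sub>R wgrad g x)"
proof -
  have "\<forall>i. AE x in torus. wpd i (\<lambda>x. a *\<^sub>R f x + b *\<^sub>R g x) x = a *\<^sub>R wpd i f x + b *\<^sub>R wpd i g x"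
    using wpd_lin[of f 0 g] f g by (simp add: ae_eq_def)
  then have "AE x in torus. \<forall>i. wpd i (\<lambda>x. a *\<^sub>R f x + b *\<^sub>R g x) x = a *\<^sub>R wpd i f x + b *\<^sub>R wpd i g x"
    by (simp add: AE_all_countable)
  then show ?thesis
    unfolding ae_eq_def by eventually_elim (simp add: wgrad_def vec_eq_iff)
qed

lemma wgrad_add: "f \<in> Hk 1 ==> g \<in> Hk 1 ==> ae_eq (wgrad (\<lambda>x. f x + g x)) (\<lambda>x. wgrad f x + wgrad g x)"
  using wgrad_lin[of f g 1 1] by simp

lemma wgrad_diff: "f \<in> Hk 1 ==> g \<in> Hk 1 ==> ae_eq (wgrad (\<lambda>x. f x - g x)) (\<lambda>x. wgrad f x - wgrad g x)"
  using wgrad_lin[of f g 1 "-1"] by simp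

lemma wgrad_cong: "ae_eq f g ==> wgrad f = wgrad g"
  by (simp add: wgrad_def wpd_cong[of f g])

lemma wdiv_cong: "ae_eq f g ==> wdiv f = wdiv g"
  by (simp add: wdiv_def wpd_cong[of f g])

section \<open>Divergence-free fields\<close>

lemma VV_Hk: "v \<in> VV ==> v \<in> Hk 1"
  by (simp add: VV_def)

lemma VV_cong: "v \<in> VV ==> ae_eq v w ==> w \<in> L2 ==> w \<in> VV"
  using Hk_cong[of v 1 w] by (auto simp: VV_def wdiv_cong[of v w])

lemma VV_lin:
  assumes v: "v \<in> VV" and w: "w \<in> VV"
  shows "(\<lambda>x. a *\<^sub>R v x + b *\<^sub>R w x) \<in> VV"
proof -
  have H: "v \<in> Hk 1" "w \<in> Hk 1" using v w by (auto simp: VV_def)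
  have "\<forall>i. AE x in torus. wpd i (\<lambda>x. a *\<^sub>R v x + b *\<^sub>R w x) x = a *\<^sub>R wpd i v x + b *\<^sub>R wpd i w x"
    using wpd_lin[of v 0 w] H by (simp add: ae_eq_def)
  then have "AE x in torus. \<forall>i. wpd i (\<lambda>x. a *\<^sub>R v x + b *\<^sub>R w x) x = a *\<^sub>R wpd i v x + b *\<^sub>R wpd i w x"
    by (simp add: AE_all_countable)
  moreover have "AE x in torus. wdiv v x = 0" "AE x in torus. wdiv w x = 0"
    using v w by (auto simp: VV_def ae_eq_def)
  ultimately have "ae_eq (wdiv (\<lambda>x. a *\<^sub>R v x + b *\<^sub>R w x)) (\<lambda>x. 0)"
    unfolding ae_eq_def
  proof eventually_elim
    case (elim x)
    have "wdiv (\<lambda>x. a *\<^sub>R v x + b *\<^sub>R w x) x = a * wdiv v x + b * wdiv w x"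
      using elim(1) by (simp add: wdiv_def sum.distrib sum_distrib_left)
    then show ?case using elim(2,3) by simp
  qed
  then show ?thesis using H by (simp add: VV_def Hk_lin del: One_nat_def)
qed

lemma VV_add [simp]: "v \<in> VV ==> w \<in> VV ==> (\<lambda>x. v x + w x) \<in> VV"
  using VV_lin[of v w 1 1] by simp

lemma VV_diff [simp]: "v \<in> VV ==> w \<in> VV ==> (\<lambda>x. v x - w x) \<in> VV"
  using VV_lin[of v w 1 "-1"] by simp

lemma VV_scaleR [simp]: "v \<in> VV ==> (\<lambda>x. c *\<^sub>R v x) \<in> VV"
  using VV_lin[of v v c 0] by simp

lemma VV_zero [simp]: "(\<lambda>x. 0) \<in> VV"
proof -
  have "ae_eq (wpd i (\<lambda>x. 0::real^2)) (\<lambda>x. 0)" for i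
    using wpd_scaleR[of "\<lambda>x. 0::real^2" 0 i 0] by simp
  then have "AE x in torus. \<forall>i. wpd i (\<lambda>x. 0::real^2) x = 0"
    by (simp add: AE_all_countable ae_eq_def)
  then have "ae_eq (wdiv (\<lambda>x. 0)) (\<lambda>x. 0)"
    unfolding ae_eq_def by eventually_elim (simp add: wdiv_def)
  then show ?thesis by (simp add: VV_def)
qed

lemma VV_sum [simp]: "(\<And>i. i \<in> I ==> f i \<in> VV) ==> (\<lambda>x. \<Sum>i\<in>I. f i x) \<in> VV"
  by (induction I rule: infinite_finite_induct) auto

lemma wdiv_L2: "v \<in> Hk 1 ==> wdiv v \<in> L2"
proof -
  assume v: "v \<in> Hk 1"
  have c: "(\<lambda>x. f x $ i) \<in> L2" if "f \<in> L2" for f :: "(real^2) field" and i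
  proof -
    have "(\<lambda>x. f x \<bullet> axis i 1) \<in> L2"
      using that unfolding L2_iff by (auto simp: periodic_def)
    then show ?thesis by (simp add: inner_axis)
  qed
  have "(\<lambda>x. wpd 1 v x $ 1 + wpd 2 v x $ 2) \<in> L2"
    using wpd_L2[of v 0] v by (intro L2_lin c) auto
  then show ?thesis by (simp add: wdiv_def[abs_def] sum_2)
qed

lemma fc_wdiv:
  assumes v: "v \<in> Hk 1"
  shows "fc \<kappa> (wdiv v) = - (\<Sum>i\<in>UNIV. (2 * pi * kv \<kappa> $ i) * (fc (- \<kappa>) v $ i))"
proof -
  have L: "wpd i v \<in> L2t" for i using wpd_L2[of v 0 i] v by (simp add: L2_L2t)
  have "fc \<kappa> (wdiv v) = (\<Sum>i\<in>UNIV. fc \<kappa> (\<lambda>x. wpd i v x $ i))"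
    unfolding wdiv_def using L2t_inner_const[OF L] by (subst fc_sum) (auto simp: inner_axis[of _ _ "1::real", simplified, symmetric])
  also have "\<dots> = (\<Sum>i\<in>UNIV. fc \<kappa> (wpd i v) $ i)"
  proof (rule sum.cong[OF refl])
    fix i
    show "fc \<kappa> (\<lambda>x. wpd i v x $ i) = fc \<kappa> (wpd i v) $ i"
      using fc_inner[OF L, of \<kappa> i "axis i 1"] by (simp add: inner_axis)
  qed
  also have "\<dots> = - (\<Sum>i\<in>UNIV. (2 * pi * kv \<kappa> $ i) * (fc (- \<kappa>) v $ i))"
    using fc_wpd[of v 0] v by (simp add: sum_negf)
  finally show ?thesis .
qed

text \<open>Orthogonality to the gradient of each basis function says that the corresponding Fourier
  coefficient of the divergence vanishes.\<close>

lemma HH_VV: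
  assumes v: "v \<in> Hk 1" and h: "v \<in> HH"
  shows "v \<in> VV"
proof -
  have L: "v \<in> L2t" using Hk_L2t v by blast
  have "ae_eq (wdiv v) (\<lambda>x. 0)"
  proof (rule fc_unique)
    fix \<kappa>
    have "pdiff i (cas \<kappa>) = (\<lambda>x. (2 * pi * kv \<kappa> $ i) * cas (- \<kappa>) x)" for i
      using pdiff_cas[of i 1 \<kappa>] by simp
    then have "0 = l2_inner v (\<lambda>x. \<chi> i. (2 * pi * kv \<kappa> $ i) * cas (- \<kappa>) x)"
      using h cas_test[of \<kappa>] by (force simp: HH_def)
    also have "\<dots> = (\<integral>x. (cas (- \<kappa>) x *\<^sub>R v x) \<bullet> (\<chi> i. 2 * pi * kv \<kappa> $ i) \<partial>torus)"
      unfolding l2_inner_def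
      by (intro Bochner_Integration.integral_cong refl) (simp add: inner_vec_def sum_2 algebra_simps)
    also have "\<dots> = fc (- \<kappa>) v \<bullet> (\<chi> i. 2 * pi * kv \<kappa> $ i)"
      unfolding fc_def using L by (intro integral_inner_left) (auto intro: integrable_L2t)
    also have "\<dots> = - fc \<kappa> (wdiv v)"
      unfolding fc_wdiv[OF v] by (simp add: inner_vec_def mult.commute)
    finally show "fc \<kappa> (wdiv v) = fc \<kappa> (\<lambda>x. 0)" by simp
  qed (use wdiv_L2[OF v] in \<open>auto intro: L2_L2t\<close>)
  then show ?thesis using v by (simp add: VV_def)
qed

text \<open>The frequency factor vanishes at frequency 0. The divergence thus becomes an admissible
  test function for the incompressibility condition of the scheme.\<close>

lemma wdiv_mean: "v \<in> Hk 1 ==> wdiv v \<in> QQ"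
  using fc_wdiv[of v 0] wdiv_L2[of v] by (simp add: QQ_def kv_0 fc_def cas_0)

section \<open>Skew-symmetry of the trilinear form\<close>

lemma cont_diff_add: "cont_diff k f ==> cont_diff k g ==> cont_diff k (\<lambda>x. f x + g x)"
proof (induction k arbitrary: f g)
  case (Suc k)
  have "pdiff i (\<lambda>x. f x + g x) = (\<lambda>x. pdiff i f x + pdiff i g x)" for i
  proof
    fix x
    have "(f has_derivative frechet_derivative f (at x)) (at x)" "(g has_derivative frechet_derivative g (at x)) (at x)"
      using Suc.prems by (simp_all add: frechet_derivative_works[symmetric])
    from frechet_derivative_at[OF has_derivative_add[OF this], symmetric]
    show "pdiff i (\<lambda>x. f x + g x) x = pdiff i f x + pdiff i g x"
      by (simp add: pdiff_def)
  qed
  then show ?case using Suc by simp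
qed (auto intro: continuous_intros)

lemma trig_poly_test: "trig_poly p ==> p \<in> test_fun"
proof (induction rule: trig_poly.induct)
  case (cas c \<kappa>)
  then show ?case using cont_diff_cas[of _ c \<kappa>] periodic_cas[of \<kappa>] by (simp add: test_fun_def periodic_def)
next
  case (add p q)
  then show ?case by (simp add: test_fun_def periodic_def cont_diff_add)
qed

lemma trig_poly_sum': "(\<And>i. i \<in> I ==> trig_poly (p i)) ==> trig_poly (\<lambda>x. \<Sum>i\<in>I. p i x)"
  by (induction I rule: infinite_finite_induct) (auto intro: trig_poly.add trig_poly_const)

text \<open>The definition of the weak derivative, applied to component i in direction i and summed,
  leaves the test function against the divergence of a.\<close>

lemma VV_test:
  assumes a: "a \<in> VV" and \<phi>: "\<phi> \<in> test_fun"
  shows "(\<Sum>i\<in>UNIV. \<integral>x. a x $ i * pdiff i \<phi> x \<partial>torus) = 0"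
proof -
  have aH: "a \<in> Hk (Suc 0)" using a by (simp add: VV_def)
  note T = test_fun_props[OF \<phi>]
  have I: "integrable torus (\<lambda>x. \<psi> x *\<^sub>R h x)" if c: "continuous_on UNIV \<psi>" and h: "h \<in> L2t"
    for \<psi> :: "real field" and h :: "(real^2) field"
  proof -
    obtain B where "\<And>x. x \<in> cell ==> norm (\<psi> x) \<le> B" using continuous_bounded_cell[OF c] by blast
    then show ?thesis
      using continuous_measurable_torus[OF c] h by (intro integrable_L2t L2t_scaleR_bounded) auto
  qed
  have L: "a \<in> L2t" "wpd i a \<in> L2t" for i
    using Hk_L2t[OF aH] wpd_L2[OF aH] by (auto intro: L2_L2t)
  have comp: "(\<integral>x. \<psi> x * h x $ i \<partial>torus) = (\<integral>x. \<psi> x *\<^sub>R h x \<partial>torus) \<bullet> axis i 1"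
    "integrable torus (\<lambda>x. \<psi> x * h x $ i)"
    if c: "continuous_on UNIV \<psi>" and h: "h \<in> L2t" for \<psi> :: "real field" and h :: "(real^2) field" and i
    using integral_inner_left[OF I[OF that], of "axis i 1"] integrable_inner_left[OF I[OF that], of "axis i 1"]
    by (simp_all add: inner_axis)
  have "(\<integral>x. a x $ i * pdiff i \<phi> x \<partial>torus) = - (\<integral>x. \<phi> x * wpd i a x $ i \<partial>torus)" for i
  proof -
    have "(\<integral>x. a x $ i * pdiff i \<phi> x \<partial>torus) = (\<integral>x. pdiff i \<phi> x *\<^sub>R a x \<partial>torus) \<bullet> axis i 1"
      using comp(1)[OF T(2) L(1), of i i] by (simp add: mult.commute)
    also have "(\<integral>x. pdiff i \<phi> x *\<^sub>R a x \<partial>torus) = - (\<integral>x. \<phi> x *\<^sub>R wpd i a x \<partial>torus)"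
      using wpd_weak[OF aH, of i] \<phi> by (simp add: weak_pdiff_def)
    finally show ?thesis
      using comp(1)[OF T(1) L(2), of i i] by simp
  qed
  then have "(\<Sum>i\<in>UNIV. \<integral>x. a x $ i * pdiff i \<phi> x \<partial>torus) = - (\<Sum>i\<in>UNIV. \<integral>x. \<phi> x * wpd i a x $ i \<partial>torus)"
    by (simp only: sum_negf)
  also have "(\<Sum>i\<in>UNIV. \<integral>x. \<phi> x * wpd i a x $ i \<partial>torus) = (\<integral>x. \<phi> x * wdiv a x \<partial>torus)"
    unfolding wdiv_def sum_distrib_left
    by (rule Bochner_Integration.integral_sum[symmetric]) (rule comp(2)[OF T(1) L(2)])
  also have "(\<integral>x. \<phi> x * wdiv a x \<partial>torus) = (\<integral>x. 0 \<partial>torus)"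
  proof (rule torus.integral_cong_AE_complete)
    have "AE x in torus. wdiv a x = 0" using a by (simp add: VV_def ae_eq_def)
    then show "AE x in torus. \<phi> x * wdiv a x = 0" by eventually_elim simp
  qed
  finally show ?thesis by simp
qed

lemma component_product:
  fixes a :: "(real^2) field" and c :: "'b::euclidean_space field"
  assumes a: "a \<in> Hk 1" and c: "c \<in> Hk 1"
  shows "(\<lambda>x. a x $ i *\<^sub>R c x) \<in> L2t" "l2_norm (\<lambda>x. a x $ i *\<^sub>R c x) \<le> 2 * Hk_norm 1 a * Hk_norm 1 c"
proof -
  have L [measurable]: "a \<in> borel_measurable torus" "c \<in> borel_measurable torus"
    using Hk_L2t a c by (blast intro: L2tD)+
  have "(\<lambda>x. a x \<bullet> axis i 1) \<in> borel_measurable torus" by measurable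
  then have [measurable]: "(\<lambda>x. a x $ i) \<in> borel_measurable torus" by (simp add: inner_axis)
  have le: "AE x in torus. norm (a x $ i *\<^sub>R c x) \<le> norm (norm (a x) * norm (c x))"
    by (auto intro!: mult_right_mono simp: component_le_norm_cart)
  show "(\<lambda>x. a x $ i *\<^sub>R c x) \<in> L2t"
    by (rule L2tI_bound[OF _ sobolev_product(1)[OF a c] le]) measurable
  show "l2_norm (\<lambda>x. a x $ i *\<^sub>R c x) \<le> 2 * Hk_norm 1 a * Hk_norm 1 c"
    using l2_norm_mono[OF sobolev_product(1)[OF a c] le] sobolev_product(2)[OF a c] by linarith
qed

lemma trilin_sum:
  assumes a: "a \<in> Hk 1" and b: "b \<in> Hk 1" and c: "c \<in> Hk 1"
  shows "trilin a b c = (\<Sum>i\<in>UNIV. l2_inner (wpd i b) (\<lambda>x. a x $ i *\<^sub>R c x))"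
proof -
  have "wpd i b \<in> L2t" for i using wpd_L2[of b 0 i] b by (simp add: L2_L2t)
  then have I: "integrable torus (\<lambda>x. wpd i b x \<bullet> a x $ i *\<^sub>R c x)" for i
    by (intro integrable_inner component_product a c)
  have "trilin a b c = (\<integral>x. (\<Sum>i\<in>UNIV. wpd i b x \<bullet> a x $ i *\<^sub>R c x) \<partial>torus)"
    unfolding trilin_def l2_inner_def by (simp add: inner_sum_left)
  also have "\<dots> = (\<Sum>i\<in>UNIV. l2_inner (wpd i b) (\<lambda>x. a x $ i *\<^sub>R c x))"
    unfolding l2_inner_def by (rule Bochner_Integration.integral_sum) (rule I)
  finally show ?thesis .
qed

text \<open>If b and c are replaced by partial sums, the two forms add up to the integral of a
  against the gradient of the scalar product of b and c. That scalar product is a trigonometric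
  polynomial, hence a test function, and the integral vanishes. The limit is possible because
  products of H^1 fields are controlled in L^2.\<close>

theorem trilin_skew:
  assumes a: "a \<in> VV" and b: "b \<in> Hk 1" and c: "c \<in> Hk 1"
  shows "trilin a b c = - trilin a c b"
proof -
  have aH: "a \<in> Hk 1" using a by (simp add: VV_def)
  have w: "wpd i f \<in> L2t" if "f \<in> Hk 1" for i and f :: "(real^2) field"
    using wpd_L2[of f 0 i] that by (simp add: L2_L2t)
  have lim: "(\<lambda>n. l2_inner (psum n (wpd i f)) (\<lambda>x. a x $ i *\<^sub>R psum n g x)) \<longlonglongrightarrow> l2_inner (wpd i f) (\<lambda>x. a x $ i *\<^sub>R g x)"
    if f: "f \<in> Hk 1" and g: "g \<in> Hk 1" for f g :: "(real^2) field" and i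
  proof (rule l2_inner_tendsto)
    show "(\<lambda>n. l2_norm (\<lambda>x. wpd i f x - psum n (wpd i f) x)) \<longlonglongrightarrow> 0"
      by (intro psum_tendsto w f)
    show "(\<lambda>n. l2_norm (\<lambda>x. a x $ i *\<^sub>R g x - a x $ i *\<^sub>R psum n g x)) \<longlonglongrightarrow> 0"
    proof (rule Lim_null_comparison[OF _ tendsto_mult_right_zero[OF psum_H1_tendsto[OF g], of "2 * Hk_norm 1 a"]])
      show "\<forall>\<^sub>F n in sequentially. norm (l2_norm (\<lambda>x. a x $ i *\<^sub>R g x - a x $ i *\<^sub>R psum n g x)) \<le>
          2 * Hk_norm 1 a * Hk_norm 1 (\<lambda>x. g x - psum n g x)"
        using component_product(2)[OF aH Hk_diff[OF g psum_Hk], of i] by (auto simp: scaleR_diff_right)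
    qed
    show "(\<lambda>x. a x $ i *\<^sub>R psum n g x) \<in> L2t" for n
      by (intro component_product(1) aH psum_Hk)
  qed (use component_product(1)[OF aH] w f g in auto)
  have zero: "(\<Sum>i\<in>UNIV. l2_inner (psum n (wpd i b)) (\<lambda>x. a x $ i *\<^sub>R psum n c x) +
      l2_inner (psum n (wpd i c)) (\<lambda>x. a x $ i *\<^sub>R psum n b x)) = 0" for n
  proof -
    define \<phi> where "\<phi> x = psum n b x \<bullet> psum n c x" for x
    have comp: "trig_poly (\<lambda>x. psum n f x $ j)" for f :: "(real^2) field" and j
    proof -
      have "(\<lambda>x. psum n f x $ j) = (\<lambda>x. \<Sum>\<kappa>\<in>freqs n. fc \<kappa> f $ j * cas \<kappa> x)"
        by (simp add: psum_def mult.commute)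
      then show ?thesis by (simp only:) (intro trig_poly_sum' trig_poly.cas)
    qed
    have "trig_poly \<phi>"
      unfolding \<phi>_def inner_vec_def inner_real_def by (intro trig_poly_sum' trig_poly_mult comp)
    then have T: "\<phi> \<in> test_fun" by (rule trig_poly_test)
    have pd: "pdiff i \<phi> x = psum n b x \<bullet> psum n (wpd i c) x + psum n (wpd i b) x \<bullet> psum n c x" for i x
    proof -
      obtain D E where D: "(psum n b has_derivative D) (at x)" "D (axis i 1) = psum n (wpd i b) x"
        and E: "(psum n c has_derivative E) (at x)" "E (axis i 1) = psum n (wpd i c) x"
        using psum_has_derivative[of b 0 n x] psum_has_derivative[of c 0 n x] b c by auto
      from frechet_derivative_at[OF has_derivative_inner[OF D(1) E(1)], symmetric]
      show ?thesis unfolding pdiff_def \<phi>_def by (simp add: D E)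
    qed
    have I: "integrable torus (\<lambda>x. psum n f x \<bullet> a x $ i *\<^sub>R psum n g x)" for f g :: "(real^2) field" and i
      by (intro integrable_inner component_product aH psum_Hk psum_L2t)
    have "(\<Sum>i\<in>UNIV. \<integral>x. a x $ i * pdiff i \<phi> x \<partial>torus) = (\<Sum>i\<in>UNIV. l2_inner (psum n (wpd i b)) (\<lambda>x. a x $ i *\<^sub>R psum n c x) +
      l2_inner (psum n (wpd i c)) (\<lambda>x. a x $ i *\<^sub>R psum n b x))"
    proof (rule sum.cong[OF refl])
      fix i
      have "(\<integral>x. a x $ i * pdiff i \<phi> x \<partial>torus) = (\<integral>x. psum n (wpd i b) x \<bullet> a x $ i *\<^sub>R psum n c x + psum n (wpd i c) x \<bullet> a x $ i *\<^sub>R psum n b x \<partial>torus)"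
        unfolding pd by (intro Bochner_Integration.integral_cong refl) (simp add: algebra_simps inner_commute)
      also have "\<dots> = l2_inner (psum n (wpd i b)) (\<lambda>x. a x $ i *\<^sub>R psum n c x) + l2_inner (psum n (wpd i c)) (\<lambda>x. a x $ i *\<^sub>R psum n b x)"
        unfolding l2_inner_def by (intro Bochner_Integration.integral_add I)
      finally show "(\<integral>x. a x $ i * pdiff i \<phi> x \<partial>torus) = l2_inner (psum n (wpd i b)) (\<lambda>x. a x $ i *\<^sub>R psum n c x) + l2_inner (psum n (wpd i c)) (\<lambda>x. a x $ i *\<^sub>R psum n b x)" .
    qed
    then show ?thesis using VV_test[OF a T] by simp
  qed
  have "(\<lambda>n. \<Sum>i\<in>UNIV. l2_inner (psum n (wpd i b)) (\<lambda>x. a x $ i *\<^sub>R psum n c x) +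
      l2_inner (psum n (wpd i c)) (\<lambda>x. a x $ i *\<^sub>R psum n b x)) \<longlonglongrightarrow>
      (\<Sum>i\<in>UNIV. l2_inner (wpd i b) (\<lambda>x. a x $ i *\<^sub>R c x) + l2_inner (wpd i c) (\<lambda>x. a x $ i *\<^sub>R b x))"
    by (intro tendsto_sum tendsto_add lim b c)
  then have "0 = (\<Sum>i\<in>UNIV. l2_inner (wpd i b) (\<lambda>x. a x $ i *\<^sub>R c x) + l2_inner (wpd i c) (\<lambda>x. a x $ i *\<^sub>R b x))"
    unfolding zero using LIMSEQ_unique tendsto_const by blast
  then show ?thesis
    unfolding trilin_sum[OF aH b c] trilin_sum[OF aH c b] sum.distrib by simp
qed

section \<open>Continuous paths in Sobolev spaces\<close>

text \<open>Path continuity over an arbitrary set of times, so that it restricts to single steps and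
  composes with the shift to an offset inside a substep.\<close>

definition pcont :: "nat \<Rightarrow> real set \<Rightarrow> (real \<Rightarrow> 'b::euclidean_space field) \<Rightarrow> bool" where
  "pcont k S f \<longleftrightarrow> (\<forall>t\<in>S. f t \<in> Hk k \<and> ((\<lambda>s. Hk_norm k (\<lambda>x. f s x - f t x)) \<longlongrightarrow> 0) (at t within S))"

lemma Hk_path_pcont: "Hk_path k T f \<longleftrightarrow> pcont k {0..T} f"
  by (simp add: Hk_path_def pcont_def)

lemma pcont_Hk: "pcont k S f ==> t \<in> S ==> f t \<in> Hk k"
  by (simp add: pcont_def)

lemma pcont_const [intro]: "g \<in> Hk k ==> pcont k S (\<lambda>_. g)"
  by (simp add: pcont_def)

lemma pcont_subset: "pcont k S f ==> S' \<subseteq> S ==> pcont k S' f"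
  unfolding pcont_def by (meson subsetD tendsto_within_subset)

lemma pcont_lin:
  assumes f: "pcont k S f" and g: "pcont k S g"
  shows "pcont k S (\<lambda>s x. a *\<^sub>R f s x + b *\<^sub>R g s x)"
  unfolding pcont_def
proof safe
  fix t assume t: "t \<in> S"
  have H: "f s \<in> Hk k" "g s \<in> Hk k" if "s \<in> S" for s using f g that by (auto simp: pcont_def)
  show "(\<lambda>x. a *\<^sub>R f t x + b *\<^sub>R g t x) \<in> Hk k" using H t by (intro Hk_lin)
  have L: "((\<lambda>s. \<bar>a\<bar> * Hk_norm k (\<lambda>x. f s x - f t x) + \<bar>b\<bar> * Hk_norm k (\<lambda>x. g s x - g t x)) \<longlongrightarrow> \<bar>a\<bar> * 0 + \<bar>b\<bar> * 0) (at t within S)"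
    using f g t unfolding pcont_def by (intro tendsto_intros) auto
  have le: "Hk_norm k (\<lambda>x. a *\<^sub>R f s x + b *\<^sub>R g s x - (a *\<^sub>R f t x + b *\<^sub>R g t x)) \<le>
      \<bar>a\<bar> * Hk_norm k (\<lambda>x. f s x - f t x) + \<bar>b\<bar> * Hk_norm k (\<lambda>x. g s x - g t x)" if s: "s \<in> S" for s
  proof -
    have "Hk_norm k (\<lambda>x. a *\<^sub>R f s x + b *\<^sub>R g s x - (a *\<^sub>R f t x + b *\<^sub>R g t x)) =
        Hk_norm k (\<lambda>x. a *\<^sub>R (f s x - f t x) + b *\<^sub>R (g s x - g t x))"
      by (simp add: algebra_simps)
    also have "\<dots> \<le> Hk_norm k (\<lambda>x. a *\<^sub>R (f s x - f t x)) + Hk_norm k (\<lambda>x. b *\<^sub>R (g s x - g t x))"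
      using H s t by (intro Hk_triangle Hk_scaleR Hk_diff) auto
    also have "\<dots> = \<bar>a\<bar> * Hk_norm k (\<lambda>x. f s x - f t x) + \<bar>b\<bar> * Hk_norm k (\<lambda>x. g s x - g t x)"
      using H s t by (simp add: Hk_norm_scaleR)
    finally show ?thesis .
  qed
  show "((\<lambda>s. Hk_norm k (\<lambda>x. a *\<^sub>R f s x + b *\<^sub>R g s x - (a *\<^sub>R f t x + b *\<^sub>R g t x))) \<longlongrightarrow> 0) (at t within S)"
  proof (rule Lim_null_comparison)
    show "\<forall>\<^sub>F s in at t within S. norm (Hk_norm k (\<lambda>x. a *\<^sub>R f s x + b *\<^sub>R g s x - (a *\<^sub>R f t x + b *\<^sub>R g t x))) \<le>
        \<bar>a\<bar> * Hk_norm k (\<lambda>x. f s x - f t x) + \<bar>b\<bar> * Hk_norm k (\<lambda>x. g s x - g t x)"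
      unfolding eventually_at_topological using le by auto
  qed (use L in simp)
qed

lemma pcont_add [intro]: "pcont k S f ==> pcont k S g ==> pcont k S (\<lambda>s x. f s x + g s x)"
  using pcont_lin[of k S f g 1 1] by simp

lemma pcont_diff [intro]: "pcont k S f ==> pcont k S g ==> pcont k S (\<lambda>s x. f s x - g s x)"
  using pcont_lin[of k S f g 1 "-1"] by simp

lemma pcont_sum: "(\<And>i. i \<in> I ==> pcont k S (f i)) ==> pcont k S (\<lambda>s x. \<Sum>i\<in>I. f i s x)"
  by (induction I rule: infinite_finite_induct) auto

lemma pcont_mono: "pcont k S f ==> j \<le> k ==> pcont j S f"
  unfolding pcont_def
proof safe
  fix t assume f: "\<forall>t\<in>S. f t \<in> Hk k \<and> ((\<lambda>s. Hk_norm k (\<lambda>x. f s x - f t x)) \<longlongrightarrow> 0) (at t within S)"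
    and jk: "j \<le> k" and t: "t \<in> S"
  show "f t \<in> Hk j" using f t jk Hk_le by blast
  show "((\<lambda>s. Hk_norm j (\<lambda>x. f s x - f t x)) \<longlongrightarrow> 0) (at t within S)"
  proof (rule Lim_null_comparison)
    show "\<forall>\<^sub>F s in at t within S. norm (Hk_norm j (\<lambda>x. f s x - f t x)) \<le> Hk_norm k (\<lambda>x. f s x - f t x)"
      unfolding eventually_at_topological using f t jk by (auto intro!: Hk_norm_mono exI[of _ UNIV])
  qed (use f t in auto)
qed

lemma pcont_compose:
  assumes f: "pcont k S f" and g: "continuous_on S' g" "g ` S' \<subseteq> S"
  shows "pcont k S' (\<lambda>s. f (g s))"
  unfolding pcont_def
proof safe
  fix t assume t: "t \<in> S'"
  then show "f (g t) \<in> Hk k" using f g by (auto simp: pcont_def)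
  have "continuous (at (g t) within S) (\<lambda>s. Hk_norm k (\<lambda>x. f s x - f (g t) x))"
    unfolding continuous_within using f g t by (auto simp: pcont_def)
  then have "continuous (at t within S') ((\<lambda>s. Hk_norm k (\<lambda>x. f s x - f (g t) x)) \<circ> g)"
    using g t continuous_within_subset[OF _ g(2)]
    by (intro continuous_within_compose) (auto simp: continuous_on_eq_continuous_within)
  then show "((\<lambda>s. Hk_norm k (\<lambda>x. f (g s) x - f (g t) x)) \<longlongrightarrow> 0) (at t within S')"
    unfolding continuous_within by (simp add: o_def)
qed

lemma pcont_norm:
  assumes f: "pcont k S f"
  shows "continuous_on S (\<lambda>s. Hk_norm k (f s))"
  unfolding continuous_on_def
proof
  fix t assume t: "t \<in> S"
  have "((\<lambda>s. Hk_norm k (f s) - Hk_norm k (f t)) \<longlongrightarrow> 0) (at t within S)"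
  proof (rule Lim_null_comparison)
    show "\<forall>\<^sub>F s in at t within S. norm (Hk_norm k (f s) - Hk_norm k (f t)) \<le> Hk_norm k (\<lambda>x. f s x - f t x)"
      unfolding eventually_at_topological using f t Hk_triangle_abs[of _ k]
      by (auto simp: pcont_def intro!: exI[of _ UNIV])
    show "((\<lambda>s. Hk_norm k (\<lambda>x. f s x - f t x)) \<longlongrightarrow> 0) (at t within S)"
      using f t by (simp add: pcont_def)
  qed
  then show "((\<lambda>s. Hk_norm k (f s)) \<longlongrightarrow> Hk_norm k (f t)) (at t within S)"
    by (simp add: LIM_zero_iff)
qed

section \<open>Linearity, bounds and time continuity of the forms\<close>

lemma trilin_add_left:
  assumes "\<phi> \<in> Hk 1" "a \<in> Hk 1" "a' \<in> Hk 1" "b \<in> Hk 1"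
  shows "trilin (\<lambda>x. a x + a' x) \<phi> b = trilin a \<phi> b + trilin a' \<phi> b"
  unfolding trilin_outer outer_add_left by (intro l2_inner_add_left outer_H1 wgrad_L2t assms)

lemma trilin_add_right:
  assumes "\<phi> \<in> Hk 1" "a \<in> Hk 1" "b \<in> Hk 1" "b' \<in> Hk 1"
  shows "trilin a \<phi> (\<lambda>x. b x + b' x) = trilin a \<phi> b + trilin a \<phi> b'"
  unfolding trilin_outer outer_add_right by (intro l2_inner_add_left outer_H1 wgrad_L2t assms)

lemma trilin_diff_left:
  assumes "\<phi> \<in> Hk 1" "a \<in> Hk 1" "a' \<in> Hk 1" "b \<in> Hk 1"
  shows "trilin (\<lambda>x. a x - a' x) \<phi> b = trilin a \<phi> b - trilin a' \<phi> b"
  unfolding trilin_outer outer_diff_left by (intro l2_inner_diff_left outer_H1 wgrad_L2t assms)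

lemma trilin_diff_right:
  assumes "\<phi> \<in> Hk 1" "a \<in> Hk 1" "b \<in> Hk 1" "b' \<in> Hk 1"
  shows "trilin a \<phi> (\<lambda>x. b x - b' x) = trilin a \<phi> b - trilin a \<phi> b'"
  unfolding trilin_outer outer_diff_right by (intro l2_inner_diff_left outer_H1 wgrad_L2t assms)

lemma trilin_scaleR_left: "trilin (\<lambda>x. c *\<^sub>R a x) \<phi> b = c * trilin a \<phi> b"
  and trilin_scaleR_right: "trilin a \<phi> (\<lambda>x. c *\<^sub>R b x) = c * trilin a \<phi> b"
  unfolding trilin_outer outer_scaleR_left outer_scaleR_right by (simp_all add: l2_inner_scaleR_left)

lemma trilin_sum_left:
  assumes "\<phi> \<in> Hk 1" "\<And>i. i \<in> I ==> a i \<in> Hk 1" "b \<in> Hk 1"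
  shows "trilin (\<lambda>x. \<Sum>i\<in>I. a i x) \<phi> b = (\<Sum>i\<in>I. trilin (a i) \<phi> b)"
  using assms(2)
proof (induction I rule: infinite_finite_induct)
  case (insert i I)
  then show ?case
    using trilin_add_left[of \<phi> "a i" "\<lambda>x. \<Sum>i\<in>I. a i x" b] assms(1,3) by simp
qed (use trilin_scaleR_left[of 0 "\<lambda>x. 0"] in auto)

lemma trilin_sum_right:
  assumes "\<phi> \<in> Hk 1" "\<And>i. i \<in> I ==> b i \<in> Hk 1" "a \<in> Hk 1"
  shows "trilin a \<phi> (\<lambda>x. \<Sum>i\<in>I. b i x) = (\<Sum>i\<in>I. trilin a \<phi> (b i))"
  using assms(2)
proof (induction I rule: infinite_finite_induct)
  case (insert i I)
  then show ?case
    using trilin_add_right[of \<phi> a "b i" "\<lambda>x. \<Sum>i\<in>I. b i x"] assms(1,3) by simp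
qed (use trilin_scaleR_right[of a \<phi> 0 "\<lambda>x. 0"] in auto)

lemma trilin_bound_H1:
  assumes "\<phi> \<in> Hk 1" "a \<in> Hk 1" "b \<in> Hk 1"
  shows "\<bar>trilin a \<phi> b\<bar> \<le> 2 * Hk_norm 1 a * Hk_norm 1 b * l2_norm (wgrad \<phi>)"
  unfolding trilin_outer
  by (rule order_trans[OF l2_cauchy_schwarz[OF outer_H1(1) wgrad_L2t(1)]])
     (use assms in \<open>auto intro!: mult_right_mono outer_H1(2) simp del: One_nat_def\<close>)

lemma trilin_bound_H2_left:
  assumes "\<phi> \<in> Hk 1" "a \<in> Hk 2" "b \<in> L2t"
  shows "\<bar>trilin a \<phi> b\<bar> \<le> 10 * Hk_norm 2 a * l2_norm b * l2_norm (wgrad \<phi>)"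
  unfolding trilin_outer
  by (rule order_trans[OF l2_cauchy_schwarz[OF outer_H2_left_L2t wgrad_L2t(1)]])
     (use assms in \<open>auto intro!: mult_right_mono outer_H2_left\<close>)

lemma trilin_bound_H2_right:
  assumes "\<phi> \<in> Hk 1" "a \<in> L2t" "b \<in> Hk 2"
  shows "\<bar>trilin a \<phi> b\<bar> \<le> 10 * Hk_norm 2 b * l2_norm a * l2_norm (wgrad \<phi>)"
  unfolding trilin_outer
  by (rule order_trans[OF l2_cauchy_schwarz[OF outer_H2_right_L2t wgrad_L2t(1)]])
     (use assms in \<open>auto intro!: mult_right_mono outer_H2_right\<close>)

lemma tendsto_of_bound:
  fixes g :: "'a \<Rightarrow> real"
  assumes "(b \<longlongrightarrow> 0) F" "\<forall>\<^sub>F s in F. \<bar>g s - l\<bar> \<le> b s"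
  shows "(g \<longlongrightarrow> l) F"
  using Lim_null_comparison[of "\<lambda>s. g s - l" b F] assms by (simp add: LIM_zero_iff)

lemma trilin_continuous:
  assumes \<phi>: "\<phi> \<in> Hk 1" and f: "pcont 1 S f" and g: "pcont 1 S g"
  shows "continuous_on S (\<lambda>s. trilin (f s) \<phi> (g s))"
  unfolding continuous_on_def
proof
  fix t assume t: "t \<in> S"
  let ?G = "l2_norm (wgrad \<phi>)"
  have H: "f s \<in> Hk 1" "g s \<in> Hk 1" if "s \<in> S" for s
    using f g that by (auto intro: pcont_Hk simp del: One_nat_def)
  have "((\<lambda>s. 2 * Hk_norm 1 (\<lambda>x. f s x - f t x) * Hk_norm 1 (g s) * ?G + 2 * Hk_norm 1 (f t) * Hk_norm 1 (\<lambda>x. g s x - g t x) * ?G) \<longlongrightarrow>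
      2 * 0 * Hk_norm 1 (g t) * ?G + 2 * Hk_norm 1 (f t) * 0 * ?G) (at t within S)"
    using pcont_norm[OF g] f g t unfolding continuous_on_def pcont_def by (intro tendsto_intros) (auto simp del: One_nat_def)
  then have L: "((\<lambda>s. 2 * Hk_norm 1 (\<lambda>x. f s x - f t x) * Hk_norm 1 (g s) * ?G + 2 * Hk_norm 1 (f t) * Hk_norm 1 (\<lambda>x. g s x - g t x) * ?G) \<longlongrightarrow> 0) (at t within S)"
    by simp
  show "((\<lambda>s. trilin (f s) \<phi> (g s)) \<longlongrightarrow> trilin (f t) \<phi> (g t)) (at t within S)"
  proof (rule tendsto_of_bound[OF L])
    have "\<bar>trilin (f s) \<phi> (g s) - trilin (f t) \<phi> (g t)\<bar> \<le>
        2 * Hk_norm 1 (\<lambda>x. f s x - f t x) * Hk_norm 1 (g s) * ?G + 2 * Hk_norm 1 (f t) * Hk_norm 1 (\<lambda>x. g s x - g t x) * ?G"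
      if s: "s \<in> S" for s
    proof -
      have "trilin (f s) \<phi> (g s) - trilin (f t) \<phi> (g t) =
          trilin (\<lambda>x. f s x - f t x) \<phi> (g s) + trilin (f t) \<phi> (\<lambda>x. g s x - g t x)"
        using H s t \<phi> by (simp add: trilin_diff_left trilin_diff_right)
      moreover have "\<bar>trilin (\<lambda>x. f s x - f t x) \<phi> (g s)\<bar> \<le> 2 * Hk_norm 1 (\<lambda>x. f s x - f t x) * Hk_norm 1 (g s) * ?G"
        by (intro trilin_bound_H1 \<phi> Hk_diff H s t)
      moreover have "\<bar>trilin (f t) \<phi> (\<lambda>x. g s x - g t x)\<bar> \<le> 2 * Hk_norm 1 (f t) * Hk_norm 1 (\<lambda>x. g s x - g t x) * ?G"
        by (intro trilin_bound_H1 \<phi> Hk_diff H s t)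
      ultimately show ?thesis by linarith
    qed
    then show "\<forall>\<^sub>F s in at t within S. \<bar>trilin (f s) \<phi> (g s) - trilin (f t) \<phi> (g t)\<bar> \<le>
        2 * Hk_norm 1 (\<lambda>x. f s x - f t x) * Hk_norm 1 (g s) * ?G + 2 * Hk_norm 1 (f t) * Hk_norm 1 (\<lambda>x. g s x - g t x) * ?G"
      unfolding eventually_at_topological by (auto intro!: exI[of _ UNIV])
  qed
qed

definition gradf :: "(real^2) field \<Rightarrow> (real^2) field \<Rightarrow> real" where
  "gradf f \<phi> = l2_inner (wgrad f) (wgrad \<phi>)"

lemma gradf_lin:
  assumes "\<phi> \<in> Hk 1" "f \<in> Hk 1" "g \<in> Hk 1"
  shows "gradf (\<lambda>x. a *\<^sub>R f x + b *\<^sub>R g x) \<phi> = a * gradf f \<phi> + b * gradf g \<phi>"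
proof -
  have "gradf (\<lambda>x. a *\<^sub>R f x + b *\<^sub>R g x) \<phi> = l2_inner (\<lambda>x. a *\<^sub>R wgrad f x + b *\<^sub>R wgrad g x) (wgrad \<phi>)"
    unfolding gradf_def by (intro l2_inner_cong wgrad_lin assms ae_eq_refl)
  then show ?thesis
    using assms by (simp add: l2_inner_add_left l2_inner_scaleR_left gradf_def)
qed

lemma gradf_add: "\<phi> \<in> Hk 1 ==> f \<in> Hk 1 ==> g \<in> Hk 1 ==> gradf (\<lambda>x. f x + g x) \<phi> = gradf f \<phi> + gradf g \<phi>"
  using gradf_lin[of \<phi> f g 1 1] by simp

lemma gradf_diff: "\<phi> \<in> Hk 1 ==> f \<in> Hk 1 ==> g \<in> Hk 1 ==> gradf (\<lambda>x. f x - g x) \<phi> = gradf f \<phi> - gradf g \<phi>"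
  using gradf_lin[of \<phi> f g 1 "-1"] by simp

lemma gradf_scaleR: "\<phi> \<in> Hk 1 ==> f \<in> Hk 1 ==> gradf (\<lambda>x. c *\<^sub>R f x) \<phi> = c * gradf f \<phi>"
  using gradf_lin[of \<phi> f f c 0] by simp

lemma gradf_sum:
  assumes "\<phi> \<in> Hk 1" "\<And>i. i \<in> I ==> a i \<in> Hk 1"
  shows "gradf (\<lambda>x. \<Sum>i\<in>I. a i x) \<phi> = (\<Sum>i\<in>I. gradf (a i) \<phi>)"
  using assms(2)
proof (induction I rule: infinite_finite_induct)
  case (insert i I)
  then show ?case
    using gradf_add[of \<phi> "a i" "\<lambda>x. \<Sum>i\<in>I. a i x"] assms(1) by simp
qed (use gradf_scaleR[of \<phi> "\<lambda>x. 0" 0] assms in auto)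

lemma gradf_bound: "\<phi> \<in> Hk 1 ==> f \<in> Hk 1 ==> \<bar>gradf f \<phi>\<bar> \<le> Hk_norm 1 f * l2_norm (wgrad \<phi>)"
  unfolding gradf_def
  by (rule order_trans[OF l2_cauchy_schwarz], (intro wgrad_L2t(1); assumption)+,
      rule mult_right_mono[OF l2_norm_wgrad_le l2_norm_ge0])

lemma gradf_continuous:
  assumes \<phi>: "\<phi> \<in> Hk 1" and f: "pcont 1 S f"
  shows "continuous_on S (\<lambda>s. gradf (f s) \<phi>)"
  unfolding continuous_on_def
proof
  fix t assume t: "t \<in> S"
  have H: "f s \<in> Hk 1" if "s \<in> S" for s using f that by (rule pcont_Hk)
  have L: "((\<lambda>s. Hk_norm 1 (\<lambda>x. f s x - f t x) * l2_norm (wgrad \<phi>)) \<longlongrightarrow> 0) (at t within S)"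
    using f t unfolding pcont_def by (intro tendsto_mult_left_zero) auto
  show "((\<lambda>s. gradf (f s) \<phi>) \<longlongrightarrow> gradf (f t) \<phi>) (at t within S)"
  proof (rule tendsto_of_bound[OF L])
    have "\<bar>gradf (f s) \<phi> - gradf (f t) \<phi>\<bar> \<le> Hk_norm 1 (\<lambda>x. f s x - f t x) * l2_norm (wgrad \<phi>)" if s: "s \<in> S" for s
      using gradf_bound[OF \<phi> Hk_diff[OF H[OF s] H[OF t]]] by (simp only: gradf_diff[OF \<phi> H[OF s] H[OF t]])
    then show "\<forall>\<^sub>F s in at t within S. \<bar>gradf (f s) \<phi> - gradf (f t) \<phi>\<bar> \<le> Hk_norm 1 (\<lambda>x. f s x - f t x) * l2_norm (wgrad \<phi>)"
      unfolding eventually_at_topological by (auto intro!: exI[of _ UNIV])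
  qed
qed

text \<open>The integral over M substeps is folded into one integral over the offset r. Under it the
  contributions of all substeps with the same offset stand in one sum, which can be estimated before
  norms are taken.\<close>

lemma integral_substeps:
  fixes f :: "real \<Rightarrow> real"
  assumes h: "0 \<le> h" and c: "continuous_on {a..a + real M * h} f"
  shows "integral {a..a + real M * h} f = integral {0..h} (\<lambda>r. \<Sum>l=1..M. f (a + real (l - 1) * h + r))"
  using c
proof (induction M)
  case (Suc M)
  have le: "a + real M * h \<le> a + real (Suc M) * h" "a \<le> a + real M * h" using h by (auto simp: algebra_simps)
  have cM: "continuous_on {a..a + real M * h} f" "continuous_on {a + real M * h..a + real (Suc M) * h} f"
    using le by (auto intro!: continuous_on_subset[OF Suc.prems])
  have ct: "continuous_on {0..h} (\<lambda>r. f (a + real l * h + r))" if "l \<le> M" for l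
  proof (rule continuous_on_compose2[OF Suc.prems])
    have "real l * h + r \<le> real M * h + h" "0 \<le> real l * h" if "r \<le> h" for r
      using that \<open>l \<le> M\<close> h by (auto intro!: add_mono mult_right_mono)
    then show "(\<lambda>r. a + real l * h + r) ` {0..h} \<subseteq> {a..a + real (Suc M) * h}"
      by (force simp: algebra_simps)
  qed (auto intro!: continuous_intros)
  have "integral {a..a + real (Suc M) * h} f = integral {a..a + real M * h} f + integral {a + real M * h..a + real (Suc M) * h} f"
    using le Suc.prems by (intro Henstock_Kurzweil_Integration.integral_combine[symmetric] integrable_continuous_real) auto
  also have "integral {a + real M * h..a + real (Suc M) * h} f = integral {0..h} (\<lambda>r. f (a + real M * h + r))"
    using integral_shift_real_ivl[of "a + real M * h" "a + real M * h" "a + real (Suc M) * h" f]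
    by (simp add: algebra_simps)
  also have "integral {a..a + real M * h} f = integral {0..h} (\<lambda>r. \<Sum>l=1..M. f (a + real (l - 1) * h + r))"
    by (rule Suc.IH[OF cM(1)])
  also have "integral {0..h} (\<lambda>r. \<Sum>l=1..M. f (a + real (l - 1) * h + r)) + integral {0..h} (\<lambda>r. f (a + real M * h + r)) =
      integral {0..h} (\<lambda>r. \<Sum>l=1..Suc M. f (a + real (l - 1) * h + r))"
  proof -
    have "continuous_on {0..h} (\<lambda>r. \<Sum>l=1..M. f (a + real (l - 1) * h + r))"
      by (intro continuous_on_sum ct) auto
    then show ?thesis
      using ct[of M] by (subst integral_add[symmetric]) (simp_all add: integrable_continuous_real del: of_nat_diff)
  qed
  finally show ?case .
qed simp

declare One_nat_def [simp del] of_nat_diff [simp del]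

lemma integral_add4:
  fixes f g h k :: "real \<Rightarrow> real"
  assumes f: "continuous_on {a..b} f" and g: "continuous_on {a..b} g" and h: "continuous_on {a..b} h" and k: "continuous_on {a..b} k"
  shows "integral {a..b} (\<lambda>s. f s + (g s + (h s + k s))) =
    integral {a..b} f + (integral {a..b} g + (integral {a..b} h + integral {a..b} k))"
proof -
  note i = integrable_continuous_real
  have "integral {a..b} (\<lambda>s. h s + k s) = integral {a..b} h + integral {a..b} k"
    by (rule integral_add[OF i[OF h] i[OF k]])
  moreover have "integral {a..b} (\<lambda>s. g s + (h s + k s)) = integral {a..b} g + integral {a..b} (\<lambda>s. h s + k s)"
    by (rule integral_add[OF i[OF g] i[OF continuous_on_add[OF h k]]])
  moreover have "integral {a..b} (\<lambda>s. f s + (g s + (h s + k s))) = integral {a..b} f + integral {a..b} (\<lambda>s. g s + (h s + k s))"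
    by (rule integral_add[OF i[OF f] i[OF continuous_on_add[OF g continuous_on_add[OF h k]]]])
  ultimately show ?thesis by simp
qed

lemma pcont_linear:
  assumes g: "g \<in> Hk k"
  shows "pcont k S (\<lambda>s x. (s - c) *\<^sub>R g x)"
  unfolding pcont_def
proof safe
  fix t
  show "(\<lambda>x. (t - c) *\<^sub>R g x) \<in> Hk k" using g by simp
  have eq: "Hk_norm k (\<lambda>x. (s - c) *\<^sub>R g x - (t - c) *\<^sub>R g x) = \<bar>s - t\<bar> * Hk_norm k g" for s
    using Hk_norm_scaleR[OF g, of "s - t"] by (simp add: scaleR_left_diff_distrib[symmetric])
  have "((\<lambda>s. \<bar>s - t\<bar> * Hk_norm k g) \<longlongrightarrow> \<bar>t - t\<bar> * Hk_norm k g) (at t within S)"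
    by (intro tendsto_intros)
  then show "((\<lambda>s. Hk_norm k (\<lambda>x. (s - c) *\<^sub>R g x - (t - c) *\<^sub>R g x)) \<longlongrightarrow> 0) (at t within S)"
    unfolding eq by simp
qed

section \<open>Consistency of one time step\<close>

text \<open>Here \<open>y'\<close> stands for the time derivative of \<open>y\<close> at the left end point \<open>a\<close> of the step, but no relation
  between the two is needed: \<open>\<rho>\<close> and \<open>\<rho>s\<close> are Taylor remainders around the midpoint \<open>a + dt/2\<close>, where the
  linear term integrates to zero.\<close>

locale time_step =
  fixes a dt R :: real and M :: nat
    and y w :: "real \<Rightarrow> (real^2) field" and y' ystar :: "(real^2) field"
  assumes dt: "0 < dt" and M: "real M * dt = 1"
    and y: "pcont 2 {a..a + dt} y" and w: "pcont 2 {a..a + dt} w"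
    and yR: "\<And>s. s \<in> {a..a + dt} ==> Hk_norm 2 (y s) \<le> R"
    and wR: "\<And>s. s \<in> {a..a + dt} ==> Hk_norm 2 (w s) \<le> R"
    and y': "y' \<in> Hk 1"
    and ystar: "ystar \<in> Hk 2" "Hk_norm 2 ystar \<le> 2 * R"
begin

definition "u s = (\<lambda>x. y s x + w s x)"
definition "ymid = midpoint_field (y a) (y (a + dt))"
definition "wI = (\<lambda>x. dt *\<^sub>R (\<Sum>l=1..M. w (a + real l * dt^2) x))"
definition "wcov = (\<lambda>x. dt *\<^sub>R (\<Sum>l=1..M. outer (w (a + real l * dt^2) x - wI x) (w (a + real l * dt^2) x - wI x)))"
definition "\<rho> s = (\<lambda>x. y s x - ymid x - (s - (a + dt / 2)) *\<^sub>R y' x)"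
definition "\<rho>s s = (\<lambda>x. y s x - ystar x - (s - (a + dt / 2)) *\<^sub>R y' x)"
definition "dy s = (\<lambda>x. y s x - y a x)"
definition "dw s = (\<lambda>x. w s x - w a x)"
text \<open>Noise at offset r in substep l minus noise at the right end point of that substep, which
  is the quadrature node of the scheme.\<close>

definition "\<Delta> l r = (\<lambda>x. w (a + real (l - 1) * dt^2 + r) x - w (a + real l * dt^2) x)"
definition "\<Delta>sum r = (\<lambda>x. \<Sum>l=1..M. \<Delta> l r x)"
text \<open>Controls, at time s, what is left of convection and diffusion after removing the
  constant part, the part linear in s and the part carrying the noise.\<close>

definition "\<kappa>1 s = Hk_norm 1 (\<rho>s s) + Hk_norm 1 (\<rho> s) + dt * (Hk_norm 1 y' * (Hk_norm 1 (dy s) + Hk_norm 2 (dw s)))"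
text \<open>Controls the quadrature error of the part carrying the noise at offset r. Increments
  that enter linearly appear only through their sum; those multiplied by a deviation from
  \<open>w a\<close> appear term by term.\<close>

definition "\<kappa>2 r = Hk_norm 2 (\<Delta>sum r) +
  (\<Sum>l=1..M. Hk_norm 2 (\<Delta> l r) * (Hk_norm 2 (dw (a + real l * dt^2)) + Hk_norm 2 (dw (a + real (l - 1) * dt^2 + r))))"
definition "K = integral {a..a + dt} \<kappa>1 + integral {0..dt^2} \<kappa>2"

section \<open>Regularity and size of the quantities of one step\<close>

lemma Mh: "real M * dt^2 = dt"
  using M by (simp add: power2_eq_square mult.assoc[symmetric])

lemma t_in: "l \<in> {1..M} ==> r \<in> {0..dt^2} ==> a + real (l - 1) * dt^2 + r \<in> {a..a + dt}"
  and tl_in: "l \<in> {1..M} ==> a + real l * dt^2 \<in> {a..a + dt}"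
proof -
  assume l: "l \<in> {1..M}"
  have "real l * dt^2 \<le> real M * dt^2" using l by (intro mult_right_mono) auto
  then show *: "a + real l * dt^2 \<in> {a..a + dt}" using Mh by simp
  assume r: "r \<in> {0..dt^2}"
  have "real l * dt^2 = real (l - 1) * dt^2 + dt^2" using l by (simp add: of_nat_diff algebra_simps)
  then show "a + real (l - 1) * dt^2 + r \<in> {a..a + dt}" using * r by auto
qed

lemma a_in: "a \<in> {a..a + dt}" "a + dt \<in> {a..a + dt}"
  using dt by auto

lemma R0: "0 \<le> R"
  using yR[OF a_in(1)] Hk_norm_ge0[of 2 "y a"] by linarith

lemma yH: "s \<in> {a..a + dt} ==> y s \<in> Hk 2" and wH: "s \<in> {a..a + dt} ==> w s \<in> Hk 2"
  using y w by (auto intro: pcont_Hk)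

lemma H21: "f \<in> Hk 2 ==> f \<in> Hk 1"
  by (rule Hk_le[of 1 2]) auto

lemma N21: "f \<in> Hk 2 ==> Hk_norm 1 f \<le> Hk_norm 2 f"
  by (rule Hk_norm_mono) auto

lemma yH1: "s \<in> {a..a + dt} ==> y s \<in> Hk 1" and wH1: "s \<in> {a..a + dt} ==> w s \<in> Hk 1"
  and uH2: "s \<in> {a..a + dt} ==> u s \<in> Hk 2"
  using yH wH by (auto simp: H21 u_def)

lemma uH1: "s \<in> {a..a + dt} ==> u s \<in> Hk 1"
  using uH2 H21 by blast

lemma ymid_H2: "ymid \<in> Hk 2"
  unfolding ymid_def midpoint_field_def by (intro Hk_scaleR Hk_add yH a_in)

lemma ymid_R: "Hk_norm 2 ymid \<le> R"
proof -
  have "Hk_norm 2 ymid = \<bar>1/2\<bar> * Hk_norm 2 (\<lambda>x. y a x + y (a + dt) x)"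
    unfolding ymid_def midpoint_field_def by (intro Hk_norm_scaleR Hk_add yH a_in)
  also have "Hk_norm 2 (\<lambda>x. y a x + y (a + dt) x) \<le> Hk_norm 2 (y a) + Hk_norm 2 (y (a + dt))"
    by (intro Hk_triangle yH a_in)
  finally show ?thesis using yR[OF a_in(1)] yR[OF a_in(2)] by simp
qed

lemma wI_H2: "wI \<in> Hk 2"
  unfolding wI_def by (intro Hk_scaleR Hk_sum wH tl_in)

lemma wI_R: "Hk_norm 2 wI \<le> R"
proof -
  have "Hk_norm 2 wI = \<bar>dt\<bar> * Hk_norm 2 (\<lambda>x. \<Sum>l=1..M. w (a + real l * dt^2) x)"
    unfolding wI_def by (intro Hk_norm_scaleR Hk_sum wH tl_in)
  also have "Hk_norm 2 (\<lambda>x. \<Sum>l=1..M. w (a + real l * dt^2) x) \<le> (\<Sum>l=1..M. Hk_norm 2 (w (a + real l * dt^2)))"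
    by (intro Hk_triangle_sum wH tl_in)
  also have "\<dots> \<le> (\<Sum>l=1..M. R)" by (intro sum_mono wR tl_in)
  finally show ?thesis using dt M by (simp add: mult.assoc[symmetric] mult.commute[of dt])
qed

lemma uR: "s \<in> {a..a + dt} ==> Hk_norm 2 (u s) \<le> 2 * R"
  using Hk_triangle[of "y s" 2 "w s"] yH wH yR wR unfolding u_def by fastforce

lemma \<rho>_H1: "s \<in> {a..a + dt} ==> \<rho> s \<in> Hk 1" and \<rho>s_H1: "s \<in> {a..a + dt} ==> \<rho>s s \<in> Hk 1"
  unfolding \<rho>_def \<rho>s_def by (simp_all add: yH1 y' H21[OF ymid_H2] H21[OF ystar(1)])

lemma dy_H2: "s \<in> {a..a + dt} ==> dy s \<in> Hk 2" and dw_H2: "s \<in> {a..a + dt} ==> dw s \<in> Hk 2"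
  unfolding dy_def dw_def by (auto intro!: Hk_diff yH wH a_in)

lemma \<Delta>_H2: "l \<in> {1..M} ==> r \<in> {0..dt^2} ==> \<Delta> l r \<in> Hk 2"
  unfolding \<Delta>_def by (intro Hk_diff wH t_in tl_in)

lemma \<Delta>sum_H2: "r \<in> {0..dt^2} ==> \<Delta>sum r \<in> Hk 2"
  unfolding \<Delta>sum_def by (intro Hk_sum \<Delta>_H2)

lemma pcont_w_sub: "l \<in> {1..M} ==> pcont 2 {0..dt^2} (\<lambda>r. w (a + real (l - 1) * dt^2 + r))"
  by (rule pcont_compose[OF w], intro continuous_intros, use t_in in blast)

lemma pcont_\<Delta>: "l \<in> {1..M} ==> pcont 2 {0..dt^2} (\<Delta> l)"
  unfolding \<Delta>_def by (intro pcont_diff pcont_w_sub pcont_const wH tl_in)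

lemma pcont_\<Delta>sum: "pcont 2 {0..dt^2} \<Delta>sum"
  unfolding \<Delta>sum_def using pcont_sum[of "{1..M}" 2 "{0..dt^2}" \<Delta>] pcont_\<Delta> by blast

lemma cont_\<kappa>1: "continuous_on {a..a + dt} \<kappa>1"
proof -
  have y1: "pcont 1 {a..a + dt} y" using y by (rule pcont_mono) simp
  have "pcont 1 {a..a + dt} \<rho>" "pcont 1 {a..a + dt} \<rho>s" "pcont 1 {a..a + dt} dy"
    unfolding \<rho>_def[abs_def] \<rho>s_def[abs_def] dy_def[abs_def]
    by (intro pcont_diff y1 pcont_linear[OF y'] pcont_const H21 ymid_H2 ystar yH a_in)+
  moreover have "pcont 2 {a..a + dt} dw"
    unfolding dw_def[abs_def] by (intro pcont_diff w pcont_const wH a_in)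
  ultimately show ?thesis
    unfolding \<kappa>1_def[abs_def] by (intro continuous_intros pcont_norm)
qed

lemma cont_\<kappa>2: "continuous_on {0..dt^2} \<kappa>2"
  unfolding \<kappa>2_def[abs_def]
proof (intro continuous_intros pcont_norm pcont_\<Delta>sum pcont_\<Delta>)
  fix l assume l: "l \<in> {1..M}"
  show "pcont 2 {0..dt^2} (\<lambda>r. dw (a + real (l - 1) * dt^2 + r))"
    unfolding dw_def by (intro pcont_diff pcont_w_sub l pcont_const wH a_in)
qed

lemma integral_linear_zero: "integral {a..a + dt} (\<lambda>s. (s - (a + dt / 2)) * c) = 0"
proof -
  have "((\<lambda>s. (s - (a + dt / 2)) * c) has_integral ((a + dt - (a + dt / 2))^2 / 2 * c - (a - (a + dt / 2))^2 / 2 * c)) {a..a + dt}"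
    using dt by (intro fundamental_theorem_of_calculus)
      (auto intro!: derivative_eq_intros simp: has_real_derivative_iff_has_vector_derivative[symmetric])
  then have "((\<lambda>s. (s - (a + dt / 2)) * c) has_integral 0) {a..a + dt}" by simp
  then show ?thesis by (rule integral_unique)
qed

context
  fixes \<phi> :: "(real^2) field"
  assumes \<phi>: "\<phi> \<in> Hk 1"
begin

definition "G = l2_norm (wgrad \<phi>)"

lemma G0: "0 \<le> G"
  by (simp add: G_def)

text \<open>The noise part of convection, with y already replaced by the values that the scheme uses
  in the two slots. It is the part for which no Taylor expansion in time is possible.\<close>

definition "Q s = trilin ystar \<phi> (w s) + trilin (w s) \<phi> ymid + trilin (w s) \<phi> (w s)"

text \<open>The two slots of u are expanded differently: y around \<open>ystar\<close> in the
  convecting slot and around \<open>ymid\<close> in the convected one, as in the scheme. The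
  coefficient of the linear term is frozen at the left end point, which makes it independent of s;
  freezing costs products of \<open>y'\<close> with increments, each carrying a factor of at most
  dt.\<close>

lemma ibp_expand:
  assumes s: "s \<in> {a..a + dt}"
  shows "\<bar>trilin (u s) \<phi> (u s) - (s - (a + dt / 2)) * (trilin y' \<phi> (u a) + trilin ystar \<phi> y' + trilin (w a) \<phi> y')
    - trilin ystar \<phi> ymid - Q s\<bar> \<le> 30 * (R + 1) * G * \<kappa>1 s"
proof -
  define c where "c = s - (a + dt / 2)"
  note [simp] = \<phi> y' H21[OF ystar(1)] H21[OF ymid_H2] yH1[OF s] wH1[OF s] yH1[OF a_in(1)] wH1[OF a_in(1)]
    \<rho>_H1[OF s] \<rho>s_H1[OF s] H21[OF dy_H2[OF s]] H21[OF dw_H2[OF s]] uH1[OF s] uH1[OF a_in(1)]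
  have y1: "y s = (\<lambda>x. ystar x + (c *\<^sub>R y' x + \<rho>s s x))" and y2: "y s = (\<lambda>x. ymid x + (c *\<^sub>R y' x + \<rho> s x))"
    by (simp_all add: \<rho>s_def \<rho>_def c_def)
  have "trilin (u s) \<phi> (u s) = trilin (y s) \<phi> (u s) + trilin (w s) \<phi> (y s) + trilin (w s) \<phi> (w s)"
    unfolding u_def by (simp add: trilin_add_left trilin_add_right)
  also have "trilin (y s) \<phi> (u s) = trilin ystar \<phi> (u s) + c * trilin y' \<phi> (u s) + trilin (\<rho>s s) \<phi> (u s)"
    unfolding y1 by (simp add: trilin_add_left trilin_scaleR_left)
  also have "trilin (w s) \<phi> (y s) = trilin (w s) \<phi> ymid + c * trilin (w s) \<phi> y' + trilin (w s) \<phi> (\<rho> s)"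
    unfolding y2 by (simp add: trilin_add_right trilin_scaleR_right)
  also have "trilin ystar \<phi> (u s) = trilin ystar \<phi> (y s) + trilin ystar \<phi> (w s)"
    unfolding u_def by (simp add: trilin_add_right)
  also have "trilin ystar \<phi> (y s) = trilin ystar \<phi> ymid + c * trilin ystar \<phi> y' + trilin ystar \<phi> (\<rho> s)"
    unfolding y2 by (simp add: trilin_add_right trilin_scaleR_right)
  also have "trilin y' \<phi> (u s) = trilin y' \<phi> (u a) + (trilin y' \<phi> (dy s) + trilin y' \<phi> (dw s))"
  proof -
    have "u s = (\<lambda>x. u a x + (dy s x + dw s x))" by (simp add: u_def dy_def dw_def)
    then show ?thesis by (simp add: trilin_add_right)
  qed
  also have "trilin (w s) \<phi> y' = trilin (w a) \<phi> y' + trilin (dw s) \<phi> y'"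
  proof -
    have "w s = (\<lambda>x. w a x + dw s x)" by (simp add: dw_def)
    then show ?thesis using trilin_add_left[of \<phi> "w a" "dw s" y'] by simp
  qed
  finally have eq: "trilin (u s) \<phi> (u s) - c * (trilin y' \<phi> (u a) + trilin ystar \<phi> y' + trilin (w a) \<phi> y') - trilin ystar \<phi> ymid - Q s =
      c * (trilin y' \<phi> (dy s) + trilin y' \<phi> (dw s) + trilin (dw s) \<phi> y') + trilin (\<rho>s s) \<phi> (u s) + trilin ystar \<phi> (\<rho> s) + trilin (w s) \<phi> (\<rho> s)"
    unfolding Q_def by (simp add: algebra_simps)
  have n0: "l2_norm f \<le> Hk_norm 1 f" if "f \<in> Hk 1" for f :: "(real^2) field" using that by (rule l2_norm_le_Hk)
  have L: "f \<in> L2t" if "f \<in> Hk 1" for f :: "(real^2) field" using that by (rule Hk_L2t)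
  have c: "\<bar>c\<bar> \<le> dt" using s dt by (auto simp: c_def abs_if)
  have b1: "\<bar>trilin y' \<phi> (dy s)\<bar> \<le> 2 * (Hk_norm 1 y' * Hk_norm 1 (dy s)) * G"
    unfolding G_def by (rule order_trans[OF trilin_bound_H1]) (simp_all add: mult_ac)
  have b2: "\<bar>trilin y' \<phi> (dw s)\<bar> \<le> 10 * (Hk_norm 1 y' * Hk_norm 2 (dw s)) * G"
    unfolding G_def
    by (rule order_trans[OF trilin_bound_H2_right]) (auto simp: dw_H2[OF s] L mult_ac intro!: mult_right_mono mult_left_mono n0)
  have b3: "\<bar>trilin (dw s) \<phi> y'\<bar> \<le> 10 * (Hk_norm 1 y' * Hk_norm 2 (dw s)) * G"
    unfolding G_def
    by (rule order_trans[OF trilin_bound_H2_left]) (auto simp: dw_H2[OF s] L mult_ac intro!: mult_right_mono mult_left_mono n0)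
  have b4: "\<bar>trilin (\<rho>s s) \<phi> (u s)\<bar> \<le> 10 * (2 * R) * Hk_norm 1 (\<rho>s s) * G"
    unfolding G_def
    by (rule order_trans[OF trilin_bound_H2_right[OF \<phi> L[OF \<rho>s_H1[OF s]] uH2[OF s]]],
        intro mult_right_mono mult_mono order_refl n0 uR s \<rho>s_H1) (use R0 in auto)
  have b5: "\<bar>trilin ystar \<phi> (\<rho> s)\<bar> \<le> 10 * (2 * R) * Hk_norm 1 (\<rho> s) * G"
    unfolding G_def
    by (rule order_trans[OF trilin_bound_H2_left[OF \<phi> ystar(1) L[OF \<rho>_H1[OF s]]]],
        intro mult_right_mono mult_mono order_refl n0 ystar(2) s \<rho>_H1) (use R0 in auto)
  have b6: "\<bar>trilin (w s) \<phi> (\<rho> s)\<bar> \<le> 10 * R * Hk_norm 1 (\<rho> s) * G"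
    unfolding G_def
    by (rule order_trans[OF trilin_bound_H2_left[OF \<phi> wH[OF s] L[OF \<rho>_H1[OF s]]]],
        intro mult_right_mono mult_mono order_refl n0 wR s \<rho>_H1) (use R0 in auto)
  define A where "A = Hk_norm 1 y' * Hk_norm 1 (dy s)"
  define B where "B = Hk_norm 1 y' * Hk_norm 2 (dw s)"
  have AB: "0 \<le> A" "0 \<le> B" by (auto simp: A_def B_def)
  have "\<bar>c * (trilin y' \<phi> (dy s) + trilin y' \<phi> (dw s) + trilin (dw s) \<phi> y')\<bar> \<le> dt * (2 * A * G + 20 * B * G)"
    unfolding abs_mult using b1 b2 b3 c dt by (intro mult_mono) (auto simp: A_def B_def)
  then have "\<bar>c * (trilin y' \<phi> (dy s) + trilin y' \<phi> (dw s) + trilin (dw s) \<phi> y') + trilin (\<rho>s s) \<phi> (u s) + trilin ystar \<phi> (\<rho> s) + trilin (w s) \<phi> (\<rho> s)\<bar>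
      \<le> dt * (2 * A * G + 20 * B * G) + 20 * R * Hk_norm 1 (\<rho>s s) * G + 20 * R * Hk_norm 1 (\<rho> s) * G + 10 * R * Hk_norm 1 (\<rho> s) * G"
    using b4 b5 b6 by linarith
  \<comment> \<open>The remainder \<open>\<rho> s\<close> has the largest coefficient, 20 R + 10 R;
    the summand 1 in R + 1 absorbs the terms free of R.\<close>
  also have "\<dots> \<le> 30 * (R + 1) * G * \<kappa>1 s"
  proof -
    have k: "\<kappa>1 s = Hk_norm 1 (\<rho>s s) + Hk_norm 1 (\<rho> s) + dt * (A + B)"
      by (simp add: \<kappa>1_def A_def B_def distrib_left)
    have "0 \<le> dt * (28 * A * G + 10 * B * G) + 30 * R * G * dt * (A + B) + 10 * R * Hk_norm 1 (\<rho>s s) * G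
        + 30 * Hk_norm 1 (\<rho>s s) * G + 30 * Hk_norm 1 (\<rho> s) * G"
      using AB G0 R0 dt by (intro add_nonneg_nonneg mult_nonneg_nonneg) auto
    then show ?thesis unfolding k by (simp add: algebra_simps)
  qed
  finally show ?thesis using eq unfolding c_def by simp
qed

text \<open>The quadratic noise term is split around \<open>w a\<close>. The terms with coefficients
  independent of l can be summed over the substeps; the others are products of two
  increments.\<close>

lemma Q_diff:
  assumes l: "l \<in> {1..M}" and r: "r \<in> {0..dt^2}"
  shows "Q (a + real (l - 1) * dt^2 + r) - Q (a + real l * dt^2) =
    trilin (\<lambda>x. ystar x + w a x) \<phi> (\<Delta> l r) + trilin (\<Delta> l r) \<phi> (\<lambda>x. ymid x + w a x)
    + trilin (\<Delta> l r) \<phi> (dw (a + real l * dt^2)) + trilin (dw (a + real (l - 1) * dt^2 + r)) \<phi> (\<Delta> l r)"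
proof -
  define s t where "s = a + real (l - 1) * dt^2 + r" and "t = a + real l * dt^2"
  have st: "s \<in> {a..a + dt}" "t \<in> {a..a + dt}" unfolding s_def t_def by (intro t_in tl_in l r)+
  have D: "\<Delta> l r = (\<lambda>x. w s x - w t x)" by (simp add: \<Delta>_def s_def t_def)
  note [simp] = \<phi> H21[OF ystar(1)] H21[OF ymid_H2] wH1[OF st(1)] wH1[OF st(2)] wH1[OF a_in(1)]
  show ?thesis
    unfolding s_def[symmetric] t_def[symmetric] D Q_def dw_def
    by (simp add: trilin_add_left trilin_add_right trilin_diff_left trilin_diff_right)
qed

text \<open>For the fixed coefficients the sum over l is taken inside the form, so they meet only
  \<open>\<Delta>sum r\<close>. Their H^2 norms are at most 3 R and 2 R, which with the embedding
  constant 10 gives 30 + 20 = 50.\<close>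

lemma Q_bound:
  assumes r: "r \<in> {0..dt^2}"
  shows "\<bar>\<Sum>l=1..M. Q (a + real (l - 1) * dt^2 + r) - Q (a + real l * dt^2)\<bar> \<le> 50 * (R + 1) * G * \<kappa>2 r"
proof -
  note [simp] = \<phi> H21[OF ystar(1)] H21[OF ymid_H2] wH1[OF a_in(1)]
  have D1: "\<Delta> l r \<in> Hk 1" if "l \<in> {1..M}" for l using \<Delta>_H2[OF that r] by (rule H21)
  have LD: "\<Delta> l r \<in> L2t" if "l \<in> {1..M}" for l using D1[OF that] by (rule Hk_L2t)
  have nD: "l2_norm f \<le> Hk_norm 2 f" if "f \<in> Hk 2" for f :: "(real^2) field" using that by (rule l2_norm_le_Hk)
  have 1: "trilin (\<lambda>x. ystar x + w a x) \<phi> (\<Delta>sum r) = (\<Sum>l=1..M. trilin (\<lambda>x. ystar x + w a x) \<phi> (\<Delta> l r))"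
    unfolding \<Delta>sum_def by (rule trilin_sum_right) (auto simp: D1)
  have 2: "trilin (\<Delta>sum r) \<phi> (\<lambda>x. ymid x + w a x) = (\<Sum>l=1..M. trilin (\<Delta> l r) \<phi> (\<lambda>x. ymid x + w a x))"
    unfolding \<Delta>sum_def by (rule trilin_sum_left) (auto simp: D1)
  have eq: "(\<Sum>l=1..M. Q (a + real (l - 1) * dt^2 + r) - Q (a + real l * dt^2)) =
      trilin (\<lambda>x. ystar x + w a x) \<phi> (\<Delta>sum r) + trilin (\<Delta>sum r) \<phi> (\<lambda>x. ymid x + w a x) +
      (\<Sum>l=1..M. trilin (\<Delta> l r) \<phi> (dw (a + real l * dt^2)) + trilin (dw (a + real (l - 1) * dt^2 + r)) \<phi> (\<Delta> l r))"
    unfolding 1 2 sum.distrib[symmetric] by (intro sum.cong refl) (simp add: Q_diff[OF _ r])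
  define Z where "Z = Hk_norm 2 (\<Delta>sum r)"
  define S where "S = (\<Sum>l=1..M. Hk_norm 2 (\<Delta> l r) * (Hk_norm 2 (dw (a + real l * dt^2)) + Hk_norm 2 (dw (a + real (l - 1) * dt^2 + r))))"
  have ZS: "0 \<le> Z" "0 \<le> S" by (auto simp: Z_def S_def intro!: sum_nonneg)
  have sum: "Hk_norm 2 (\<lambda>x. f x + w a x) \<le> b + R" if "f \<in> Hk 2" "Hk_norm 2 f \<le> b" for f b
    using Hk_triangle[OF that(1) wH[OF a_in(1)]] that(2) wR[OF a_in(1)] by linarith
  have LDs: "\<Delta>sum r \<in> L2t" using \<Delta>sum_H2[OF r] by (rule Hk_L2t)
  have b1: "\<bar>trilin (\<lambda>x. ystar x + w a x) \<phi> (\<Delta>sum r)\<bar> \<le> 10 * (2 * R + R) * Z * G"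
    unfolding G_def Z_def
    by (rule order_trans[OF trilin_bound_H2_left[OF \<phi> Hk_add[OF ystar(1) wH[OF a_in(1)]] LDs]],
        intro mult_right_mono mult_mono order_refl sum ystar nD \<Delta>sum_H2 r) (use R0 in auto)
  have b2: "\<bar>trilin (\<Delta>sum r) \<phi> (\<lambda>x. ymid x + w a x)\<bar> \<le> 10 * (R + R) * Z * G"
    unfolding G_def Z_def
    by (rule order_trans[OF trilin_bound_H2_right[OF \<phi> LDs Hk_add[OF ymid_H2 wH[OF a_in(1)]]]],
        intro mult_right_mono mult_mono order_refl sum ymid_H2 ymid_R nD \<Delta>sum_H2 r) (use R0 in auto)
  have b3: "\<bar>\<Sum>l=1..M. trilin (\<Delta> l r) \<phi> (dw (a + real l * dt^2)) + trilin (dw (a + real (l - 1) * dt^2 + r)) \<phi> (\<Delta> l r)\<bar> \<le> 10 * S * G"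
  proof -
    have "\<bar>trilin (\<Delta> l r) \<phi> (dw (a + real l * dt^2)) + trilin (dw (a + real (l - 1) * dt^2 + r)) \<phi> (\<Delta> l r)\<bar> \<le>
        10 * (Hk_norm 2 (\<Delta> l r) * (Hk_norm 2 (dw (a + real l * dt^2)) + Hk_norm 2 (dw (a + real (l - 1) * dt^2 + r)))) * G"
      if l: "l \<in> {1..M}" for l
    proof -
      have "\<bar>trilin (\<Delta> l r) \<phi> (dw (a + real l * dt^2))\<bar> \<le> 10 * Hk_norm 2 (\<Delta> l r) * Hk_norm 2 (dw (a + real l * dt^2)) * G"
        unfolding G_def
        by (rule order_trans[OF trilin_bound_H2_left[OF \<phi> \<Delta>_H2[OF l r] Hk_L2t[OF dw_H2[OF tl_in[OF l]]]]])
           (intro mult_right_mono mult_left_mono nD dw_H2 tl_in l; simp)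
      moreover have "\<bar>trilin (dw (a + real (l - 1) * dt^2 + r)) \<phi> (\<Delta> l r)\<bar> \<le> 10 * Hk_norm 2 (\<Delta> l r) * Hk_norm 2 (dw (a + real (l - 1) * dt^2 + r)) * G"
        unfolding G_def
        by (rule order_trans[OF trilin_bound_H2_right[OF \<phi> Hk_L2t[OF dw_H2[OF t_in[OF l r]]] \<Delta>_H2[OF l r]]])
           (intro mult_right_mono mult_left_mono nD dw_H2 t_in l r; simp)
      ultimately show ?thesis by (simp add: algebra_simps)
    qed
    then have "(\<Sum>l=1..M. \<bar>trilin (\<Delta> l r) \<phi> (dw (a + real l * dt^2)) + trilin (dw (a + real (l - 1) * dt^2 + r)) \<phi> (\<Delta> l r)\<bar>) \<le> 10 * S * G"
      unfolding S_def sum_distrib_left sum_distrib_right by (intro sum_mono)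
    then show ?thesis by (rule order_trans[OF sum_abs])
  qed
  have "\<bar>\<Sum>l=1..M. Q (a + real (l - 1) * dt^2 + r) - Q (a + real l * dt^2)\<bar> \<le> 10 * (2 * R + R) * Z * G + 10 * (R + R) * Z * G + 10 * S * G"
    unfolding eq using b1 b2 b3 by linarith
  also have "\<dots> \<le> 50 * (R + 1) * G * (Z + S)"
  proof -
    have "0 \<le> 50 * Z * G + 50 * R * S * G + 40 * S * G"
      using ZS R0 G0 by (intro add_nonneg_nonneg mult_nonneg_nonneg) auto
    then show ?thesis by (simp add: algebra_simps)
  qed
  finally show ?thesis unfolding \<kappa>2_def Z_def S_def .
qed

text \<open>The variance identity: as M dt = 1, the average of the tensor squares of the nodal
  values is the tensor square of their average plus their covariance. The right-hand side is the
  right end point rule for \<open>Q\<close> with mesh dt^2.\<close>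

lemma scheme_tensor:
  "dt * (trilin (\<lambda>x. ystar x + wI x) \<phi> (\<lambda>x. ymid x + wI x) + l2_inner wcov (wgrad \<phi>)) =
    dt * trilin ystar \<phi> ymid + dt^2 * (\<Sum>l=1..M. Q (a + real l * dt^2))"
proof -
  define wl where "wl l = w (a + real l * dt^2)" for l
  have wl: "wl l \<in> Hk 1" if "l \<in> {1..M}" for l using wH1[OF tl_in[OF that]] by (simp add: wl_def)
  have wI: "wI \<in> Hk 1" by (rule H21[OF wI_H2])
  note [simp] = \<phi> H21[OF ystar(1)] H21[OF ymid_H2] wI
  have wIe: "wI = (\<lambda>x. dt *\<^sub>R (\<Sum>l=1..M. wl l x))" by (simp add: wI_def wl_def)
  have B1: "trilin wI \<phi> f = dt * (\<Sum>l=1..M. trilin (wl l) \<phi> f)" if "f \<in> Hk 1" for f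
    unfolding wIe trilin_scaleR_left using that wl by (subst trilin_sum_left) auto
  have B2: "trilin f \<phi> wI = dt * (\<Sum>l=1..M. trilin f \<phi> (wl l))" if "f \<in> Hk 1" for f
    unfolding wIe trilin_scaleR_right using that wl by (subst trilin_sum_right) auto
  have cov: "l2_inner wcov (wgrad \<phi>) = dt * (\<Sum>l=1..M. trilin (\<lambda>x. wl l x - wI x) \<phi> (\<lambda>x. wl l x - wI x))"
    unfolding wcov_def l2_inner_scaleR_left wl_def[symmetric] trilin_outer
    by (subst l2_inner_sum_left) (auto intro!: outer_H1(1) Hk_diff wl wgrad_L2t(1))
  have "(\<Sum>l=1..M. trilin (\<lambda>x. wl l x - wI x) \<phi> (\<lambda>x. wl l x - wI x)) =
      (\<Sum>l=1..M. trilin (wl l) \<phi> (wl l) - trilin (wl l) \<phi> wI - trilin wI \<phi> (wl l) + trilin wI \<phi> wI)"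
    by (intro sum.cong refl) (simp add: wl trilin_diff_left trilin_diff_right)
  also have "\<dots> = (\<Sum>l=1..M. trilin (wl l) \<phi> (wl l)) - (\<Sum>l=1..M. trilin (wl l) \<phi> wI)
      - (\<Sum>l=1..M. trilin wI \<phi> (wl l)) + real M * trilin wI \<phi> wI"
    by (simp add: sum.distrib sum_subtractf)
  finally have "l2_inner wcov (wgrad \<phi>) = dt * (\<Sum>l=1..M. trilin (wl l) \<phi> (wl l)) - dt * (\<Sum>l=1..M. trilin (wl l) \<phi> wI)
      - dt * (\<Sum>l=1..M. trilin wI \<phi> (wl l)) + (real M * dt) * trilin wI \<phi> wI"
    unfolding cov by (simp only: distrib_left right_diff_distrib mult_ac)
  then have cov': "l2_inner wcov (wgrad \<phi>) = dt * (\<Sum>l=1..M. trilin (wl l) \<phi> (wl l)) - trilin wI \<phi> wI"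
    unfolding B1[OF wI, symmetric] B2[OF wI, symmetric] M by simp
  have "trilin (\<lambda>x. ystar x + wI x) \<phi> (\<lambda>x. ymid x + wI x) = trilin ystar \<phi> ymid + trilin ystar \<phi> wI + trilin wI \<phi> ymid + trilin wI \<phi> wI"
    by (simp add: trilin_add_left trilin_add_right)
  then have "trilin (\<lambda>x. ystar x + wI x) \<phi> (\<lambda>x. ymid x + wI x) + l2_inner wcov (wgrad \<phi>) =
      trilin ystar \<phi> ymid + dt * (\<Sum>l=1..M. Q (a + real l * dt^2))"
    unfolding cov' Q_def wl_def[symmetric] by (simp add: B1 B2 sum.distrib distrib_left)
  then show ?thesis by (simp add: distrib_left power2_eq_square)
qed

lemma cont_u: "pcont 1 {a..a + dt} u"
  unfolding u_def[abs_def] by (intro pcont_add pcont_mono[OF y] pcont_mono[OF w]) auto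

lemma cont_w1: "pcont 1 {a..a + dt} w"
  by (rule pcont_mono[OF w]) auto

lemma cont_Q: "continuous_on {a..a + dt} Q"
  unfolding Q_def[abs_def]
  by (intro continuous_intros trilin_continuous \<phi> cont_w1 pcont_const H21 ystar ymid_H2)

lemma integral_Q:
  "\<bar>integral {a..a + dt} Q - dt^2 * (\<Sum>l=1..M. Q (a + real l * dt^2))\<bar> \<le> 50 * (R + 1) * G * integral {0..dt^2} \<kappa>2"
proof -
  have cq: "continuous_on {0..dt^2} (\<lambda>r. Q (a + real (l - 1) * dt^2 + r))" if "l \<in> {1..M}" for l
    by (rule continuous_on_compose2[OF cont_Q], intro continuous_intros, use t_in[OF that] in blast)
  have cS: "continuous_on {0..dt^2} (\<lambda>r. \<Sum>l=1..M. Q (a + real (l - 1) * dt^2 + r))"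
    by (rule continuous_on_sum) (rule cq)
  have "integral {a..a + dt} Q = integral {0..dt^2} (\<lambda>r. \<Sum>l=1..M. Q (a + real (l - 1) * dt^2 + r))"
    using integral_substeps[of "dt^2" a M Q] cont_Q Mh by simp
  moreover have "dt^2 * (\<Sum>l=1..M. Q (a + real l * dt^2)) = integral {0..dt^2} (\<lambda>r. \<Sum>l=1..M. Q (a + real l * dt^2))"
    by simp
  ultimately have eq: "integral {a..a + dt} Q - dt^2 * (\<Sum>l=1..M. Q (a + real l * dt^2)) =
      integral {0..dt^2} (\<lambda>r. (\<Sum>l=1..M. Q (a + real (l - 1) * dt^2 + r)) - (\<Sum>l=1..M. Q (a + real l * dt^2)))"
    by (simp only: integral_diff[OF integrable_continuous_real[OF cS] integrable_continuous_real[OF continuous_on_const]])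
  have "\<bar>integral {a..a + dt} Q - dt^2 * (\<Sum>l=1..M. Q (a + real l * dt^2))\<bar> \<le> integral {0..dt^2} (\<lambda>r. 50 * (R + 1) * G * \<kappa>2 r)"
    unfolding eq real_norm_def[symmetric]
  proof (rule integral_norm_bound_integral)
    show "(\<lambda>r. (\<Sum>l=1..M. Q (a + real (l - 1) * dt^2 + r)) - (\<Sum>l=1..M. Q (a + real l * dt^2))) integrable_on {0..dt^2}"
      by (rule integrable_continuous_real[OF continuous_on_diff[OF cS continuous_on_const]])
    show "(\<lambda>r. 50 * (R + 1) * G * \<kappa>2 r) integrable_on {0..dt^2}"
      by (intro integrable_continuous_real continuous_intros cont_\<kappa>2)
    show "norm ((\<Sum>l=1..M. Q (a + real (l - 1) * dt^2 + r)) - (\<Sum>l=1..M. Q (a + real l * dt^2))) \<le> 50 * (R + 1) * G * \<kappa>2 r"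
      if "r \<in> {0..dt^2}" for r
      using Q_bound[OF that] by (simp add: sum_subtractf)
  qed
  then show ?thesis by simp
qed

lemma \<kappa>_nonneg: "0 \<le> \<kappa>1 s" "0 \<le> \<kappa>2 r"
  using dt by (auto simp: \<kappa>1_def \<kappa>2_def intro!: add_nonneg_nonneg mult_nonneg_nonneg sum_nonneg)

lemma consistency_convection:
  "\<bar>integral {a..a + dt} (\<lambda>s. trilin (u s) \<phi> (u s)) -
    dt * (trilin (\<lambda>x. ystar x + wI x) \<phi> (\<lambda>x. ymid x + wI x) + l2_inner wcov (wgrad \<phi>))\<bar> \<le> 50 * (R + 1) * G * K"
proof -
  define A1 where "A1 = trilin y' \<phi> (u a) + trilin ystar \<phi> y' + trilin (w a) \<phi> y'"
  define A0 where "A0 = trilin ystar \<phi> ymid"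
  define F where "F s = trilin (u s) \<phi> (u s)" for s
  define E where "E s = F s - (s - (a + dt / 2)) * A1 - A0 - Q s" for s
  have cF: "continuous_on {a..a + dt} F"
    unfolding F_def[abs_def] by (intro trilin_continuous \<phi> cont_u)
  have cE: "continuous_on {a..a + dt} E"
    unfolding E_def[abs_def] by (intro continuous_intros cF cont_Q)
  have "integral {a..a + dt} F = integral {a..a + dt} (\<lambda>s. E s + ((s - (a + dt / 2)) * A1 + (A0 + Q s)))"
    by (simp add: E_def)
  also have "\<dots> = integral {a..a + dt} E + (integral {a..a + dt} (\<lambda>s. (s - (a + dt / 2)) * A1) + (integral {a..a + dt} (\<lambda>s. A0) + integral {a..a + dt} Q))"
    by (rule integral_add4[OF cE _ continuous_on_const cont_Q]) (intro continuous_intros)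
  finally have F: "integral {a..a + dt} F = integral {a..a + dt} E + (dt * A0 + integral {a..a + dt} Q)"
    unfolding integral_linear_zero using dt by simp
  have "\<bar>integral {a..a + dt} E\<bar> \<le> integral {a..a + dt} (\<lambda>s. 30 * (R + 1) * G * \<kappa>1 s)"
    unfolding real_norm_def[symmetric]
    by (intro integral_norm_bound_integral integrable_continuous_real continuous_intros cE cont_\<kappa>1)
       (use ibp_expand in \<open>simp add: E_def F_def A1_def A0_def\<close>)
  also have "\<dots> = 30 * ((R + 1) * G * integral {a..a + dt} \<kappa>1)" by simp
  also have "\<dots> \<le> 50 * ((R + 1) * G * integral {a..a + dt} \<kappa>1)"
    using R0 G0 by (intro mult_right_mono mult_nonneg_nonneg integral_nonneg integrable_continuous_real cont_\<kappa>1 \<kappa>_nonneg) auto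
  finally have E: "\<bar>integral {a..a + dt} E\<bar> \<le> 50 * (R + 1) * G * integral {a..a + dt} \<kappa>1"
    by (simp only: mult.assoc)
  show ?thesis
    unfolding scheme_tensor F_def[symmetric] F A0_def[symmetric] K_def
    using E integral_Q by (simp add: distrib_left)
qed

text \<open>The argument for convection in the linear case: only the remainder around the midpoint
  and the sum of the increments occur.\<close>

lemma consistency_gradient:
  "\<bar>integral {a..a + dt} (\<lambda>s. gradf (u s) \<phi>) - dt * gradf (\<lambda>x. ymid x + wI x) \<phi>\<bar> \<le> G * K"
proof -
  define q where "q s = gradf (w s) \<phi>" for s
  define E where "E s = gradf (u s) \<phi> - (s - (a + dt / 2)) * gradf y' \<phi> - gradf ymid \<phi> - q s" for s
  have cq: "continuous_on {a..a + dt} q"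
    unfolding q_def[abs_def] by (intro gradf_continuous \<phi> cont_w1)
  have cE: "continuous_on {a..a + dt} E"
    unfolding E_def[abs_def] by (intro continuous_intros gradf_continuous \<phi> cont_u cq)
  have wI: "wI \<in> Hk 1" by (rule H21[OF wI_H2])
  have "integral {a..a + dt} (\<lambda>s. gradf (u s) \<phi>) = integral {a..a + dt} (\<lambda>s. E s + ((s - (a + dt / 2)) * gradf y' \<phi> + (gradf ymid \<phi> + q s)))"
    by (simp add: E_def)
  also have "\<dots> = integral {a..a + dt} E + (integral {a..a + dt} (\<lambda>s. (s - (a + dt / 2)) * gradf y' \<phi>) + (integral {a..a + dt} (\<lambda>s. gradf ymid \<phi>) + integral {a..a + dt} q))"
    by (rule integral_add4[OF cE _ continuous_on_const cq]) (intro continuous_intros)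
  finally have F: "integral {a..a + dt} (\<lambda>s. gradf (u s) \<phi>) = integral {a..a + dt} E + (dt * gradf ymid \<phi> + integral {a..a + dt} q)"
    unfolding integral_linear_zero using dt by simp
  have "norm (E s) \<le> G * \<kappa>1 s" if s: "s \<in> {a..a + dt}" for s
  proof -
    note [simp] = \<phi> y' H21[OF ymid_H2] wH1[OF s] \<rho>_H1[OF s]
    have "u s = (\<lambda>x. (ymid x + ((s - (a + dt / 2)) *\<^sub>R y' x + \<rho> s x)) + w s x)"
      by (simp add: u_def \<rho>_def)
    then have "E s = gradf (\<rho> s) \<phi>"
      by (simp add: E_def q_def gradf_add gradf_scaleR)
    then have "norm (E s) \<le> Hk_norm 1 (\<rho> s) * G"
      using gradf_bound[OF \<phi> \<rho>_H1[OF s]] by (simp add: G_def)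
    also have "\<dots> \<le> \<kappa>1 s * G"
      using G0 dt by (intro mult_right_mono) (auto simp: \<kappa>1_def intro!: add_nonneg_nonneg mult_nonneg_nonneg)
    finally show ?thesis by (simp add: mult.commute)
  qed
  then have E: "\<bar>integral {a..a + dt} E\<bar> \<le> G * integral {a..a + dt} \<kappa>1"
    using integral_norm_bound_integral[of E "{a..a + dt}" "\<lambda>s. G * \<kappa>1 s"] cE cont_\<kappa>1
    by (simp add: integrable_continuous_real continuous_intros)
  have cqs: "continuous_on {0..dt^2} (\<lambda>r. q (a + real (l - 1) * dt^2 + r))" if "l \<in> {1..M}" for l
    by (rule continuous_on_compose2[OF cq], intro continuous_intros, use t_in[OF that] in blast)
  have cS: "continuous_on {0..dt^2} (\<lambda>r. \<Sum>l=1..M. q (a + real (l - 1) * dt^2 + r))"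
    by (rule continuous_on_sum) (rule cqs)
  have "integral {a..a + dt} q = integral {0..dt^2} (\<lambda>r. \<Sum>l=1..M. q (a + real (l - 1) * dt^2 + r))"
    using integral_substeps[of "dt^2" a M q] cq Mh by simp
  moreover have wIq: "dt * gradf wI \<phi> = integral {0..dt^2} (\<lambda>r. \<Sum>l=1..M. q (a + real l * dt^2))"
  proof -
    have "gradf wI \<phi> = dt * (\<Sum>l=1..M. gradf (w (a + real l * dt^2)) \<phi>)"
      unfolding wI_def
      by (subst gradf_scaleR[OF \<phi> Hk_sum[OF wH1[OF tl_in]]], assumption, subst gradf_sum[OF \<phi> wH1[OF tl_in]]) auto
    then show ?thesis by (simp add: q_def power2_eq_square)
  qed
  ultimately have eq: "integral {a..a + dt} q - dt * gradf wI \<phi> =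
      integral {0..dt^2} (\<lambda>r. (\<Sum>l=1..M. q (a + real (l - 1) * dt^2 + r)) - (\<Sum>l=1..M. q (a + real l * dt^2)))"
    by (simp only: integral_diff[OF integrable_continuous_real[OF cS] integrable_continuous_real[OF continuous_on_const]])
  have "\<bar>integral {a..a + dt} q - dt * gradf wI \<phi>\<bar> \<le> integral {0..dt^2} (\<lambda>r. G * \<kappa>2 r)"
    unfolding eq real_norm_def[symmetric]
  proof (rule integral_norm_bound_integral)
    show "(\<lambda>r. (\<Sum>l=1..M. q (a + real (l - 1) * dt^2 + r)) - (\<Sum>l=1..M. q (a + real l * dt^2))) integrable_on {0..dt^2}"
      by (rule integrable_continuous_real[OF continuous_on_diff[OF cS continuous_on_const]])
    show "(\<lambda>r. G * \<kappa>2 r) integrable_on {0..dt^2}"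
      by (intro integrable_continuous_real continuous_intros cont_\<kappa>2)
    fix r assume r: "r \<in> {0..dt^2}"
    have "(\<Sum>l=1..M. q (a + real (l - 1) * dt^2 + r)) - (\<Sum>l=1..M. q (a + real l * dt^2)) = gradf (\<Delta>sum r) \<phi>"
      unfolding \<Delta>sum_def sum_subtractf[symmetric] q_def using \<Delta>_H2[OF _ r] \<phi>
      by (subst gradf_sum) (auto intro!: sum.cong H21 simp: \<Delta>_def gradf_diff wH1[OF t_in[OF _ r]] wH1[OF tl_in])
    then have "norm ((\<Sum>l=1..M. q (a + real (l - 1) * dt^2 + r)) - (\<Sum>l=1..M. q (a + real l * dt^2))) \<le> Hk_norm 1 (\<Delta>sum r) * G"
      using gradf_bound[OF \<phi> H21[OF \<Delta>sum_H2[OF r]]] by (simp add: G_def)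
    also have "\<dots> \<le> \<kappa>2 r * G"
    proof (intro mult_right_mono G0)
      have "Hk_norm 1 (\<Delta>sum r) \<le> Hk_norm 2 (\<Delta>sum r)" by (rule N21[OF \<Delta>sum_H2[OF r]])
      also have "\<dots> \<le> \<kappa>2 r" unfolding \<kappa>2_def by (auto intro!: sum_nonneg mult_nonneg_nonneg add_nonneg_nonneg)
      finally show "Hk_norm 1 (\<Delta>sum r) \<le> \<kappa>2 r" .
    qed
    finally show "norm ((\<Sum>l=1..M. q (a + real (l - 1) * dt^2 + r)) - (\<Sum>l=1..M. q (a + real l * dt^2))) \<le> G * \<kappa>2 r"
      by (simp add: mult.commute)
  qed
  then have "\<bar>integral {a..a + dt} q - dt * gradf wI \<phi>\<bar> \<le> G * integral {0..dt^2} \<kappa>2" by simp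
  with E show ?thesis
    unfolding F K_def gradf_add[OF \<phi> H21[OF ymid_H2] wI] by (simp add: distrib_left)
qed

end

end

section \<open>The energy estimate\<close>

text \<open>The test function is the midpoint of the two errors: paired with their difference it
  gives half the difference of squares, and paired with the viscous term it gives the dissipation.
  Young's inequality spends half of the dissipation on the consistency error and on the
  extrapolation error \<open>es\<close>.\<close>

lemma (in time_step) energy_step:
  fixes Yn Yn1 Ys :: "(real^2) field"
  defines "e0 \<equiv> \<lambda>x. y a x - Yn x" and "e1 \<equiv> \<lambda>x. y (a + dt) x - Yn1 x" and "es \<equiv> \<lambda>x. ystar x - Ys x"
  assumes \<nu>: "0 < \<nu>"
    and e0: "e0 \<in> VV" and e1: "e1 \<in> VV" and es: "es \<in> Hk 1" and A: "(\<lambda>x. Ys x + wI x) \<in> VV"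
    and exact: "\<And>\<phi>. \<phi> \<in> VV ==> l2_inner (\<lambda>x. y (a + dt) x - y a x) \<phi> =
      integral {a..a + dt} (\<lambda>s. trilin (u s) \<phi> (u s)) - \<nu> * integral {a..a + dt} (\<lambda>s. gradf (u s) \<phi>)"
    and scheme: "\<And>\<phi>. \<phi> \<in> VV ==> l2_inner (\<lambda>x. (1 / dt) *\<^sub>R (Yn1 x - Yn x)) \<phi>
      + trilin (\<lambda>x. Ys x + wI x) (\<lambda>x. midpoint_field Yn1 Yn x + wI x) \<phi> - l2_inner wcov (wgrad \<phi>)
      + \<nu> * gradf (\<lambda>x. midpoint_field Yn1 Yn x + wI x) \<phi> = 0"
  shows "(l2_norm e1)^2 + \<nu> * dt * (l2_norm (wgrad (midpoint_field e1 e0)))^2 \<le>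
    (l2_norm e0)^2 + (800 * R^2 / \<nu>) * dt * (l2_norm es)^2 + (2 * (50 * (R + 1) + \<nu>)^2 / \<nu>) * (K^2 / dt)"
proof -
  define \<phi> where "\<phi> = midpoint_field e1 e0"
  have \<phi>V: "\<phi> \<in> VV" unfolding \<phi>_def midpoint_field_def using e0 e1 by simp
  have \<phi>: "\<phi> \<in> Hk 1" using \<phi>V by (rule VV_Hk)
  define g where "g = l2_norm (wgrad \<phi>)"
  have gG: "G \<phi> = g" by (simp add: G_def[OF \<phi>] g_def)
  have eH: "e0 \<in> Hk 1" "e1 \<in> Hk 1" using e0 e1 by (auto intro: VV_Hk)
  have yH: "y a \<in> Hk 1" "y (a + dt) \<in> Hk 1" using yH1 a_in by auto
  have YnH: "Yn \<in> Hk 1" "Yn1 \<in> Hk 1"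
    using Hk_diff[OF yH(1) eH(1)] Hk_diff[OF yH(2) eH(2)] by (simp_all add: e0_def e1_def)
  have wIH: "wI \<in> Hk 1" by (rule H21[OF wI_H2])
  define bb where "bb = (\<lambda>x. ymid x + wI x)"
  have bb2: "bb \<in> Hk 2" unfolding bb_def by (intro Hk_add ymid_H2 wI_H2)
  have bbH: "bb \<in> Hk 1" by (rule H21[OF bb2])
  have bbR: "Hk_norm 2 bb \<le> 2 * R"
    using Hk_triangle[OF ymid_H2 wI_H2] ymid_R wI_R unfolding bb_def by linarith
  have beq: "(\<lambda>x. midpoint_field Yn1 Yn x + wI x) = (\<lambda>x. bb x - \<phi> x)"
    by (rule ext) (simp add: bb_def \<phi>_def ymid_def midpoint_field_def e0_def e1_def algebra_simps)
  define AA where "AA = (\<lambda>x. Ys x + wI x)"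
  have AAV: "AA \<in> VV" using A by (simp add: AA_def)
  have AAH: "AA \<in> Hk 1" using AAV by (rule VV_Hk)
  have Aeq: "AA = (\<lambda>x. (ystar x + wI x) - es x)"
    by (rule ext) (simp add: AA_def es_def)
  \<comment> \<open>The convecting field of the scheme itself is kept here, since it is divergence
    free. The error in the convected slot then drops out, and the extrapolation error
    \<open>es\<close> meets only \<open>bb\<close>, which is bounded in H^2.\<close>
  have sk: "trilin AA \<phi> \<phi> = 0"
    using trilin_skew[OF AAV \<phi> \<phi>] by simp
  have T: "trilin AA (\<lambda>x. bb x - \<phi> x) \<phi> = - (trilin (\<lambda>x. ystar x + wI x) \<phi> bb - trilin es \<phi> bb)"
  proof -
    have "trilin AA (\<lambda>x. bb x - \<phi> x) \<phi> = - trilin AA \<phi> (\<lambda>x. bb x - \<phi> x)"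
      by (intro trilin_skew AAV Hk_diff bbH \<phi>)
    also have "trilin AA \<phi> (\<lambda>x. bb x - \<phi> x) = trilin AA \<phi> bb - trilin AA \<phi> \<phi>"
      by (rule trilin_diff_right[OF \<phi> AAH bbH \<phi>])
    also have "trilin AA \<phi> bb = trilin (\<lambda>x. ystar x + wI x) \<phi> bb - trilin es \<phi> bb"
      unfolding Aeq by (rule trilin_diff_left[OF \<phi> Hk_add[OF H21[OF ystar(1)] wIH] es bbH])
    finally show ?thesis using sk by simp
  qed
  have gr: "gradf (\<lambda>x. bb x - \<phi> x) \<phi> = gradf bb \<phi> - g^2"
    unfolding gradf_diff[OF \<phi> bbH \<phi>] by (simp add: gradf_def g_def l2_norm_sq)
  define S where "S = l2_inner (\<lambda>x. Yn1 x - Yn x) \<phi>"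
  have "(1 / dt) * S + trilin AA (\<lambda>x. bb x - \<phi> x) \<phi> - l2_inner wcov (wgrad \<phi>) + \<nu> * gradf (\<lambda>x. bb x - \<phi> x) \<phi> = 0"
    using scheme[OF \<phi>V] unfolding beq AA_def[symmetric] S_def l2_inner_scaleR_left .
  then have "S = dt * ((trilin (\<lambda>x. ystar x + wI x) \<phi> bb + l2_inner wcov (wgrad \<phi>)) - trilin es \<phi> bb - \<nu> * gradf bb \<phi> + \<nu> * g^2)"
    unfolding T gr using dt by (simp add: field_simps)
  moreover have "(l2_norm e1)^2 - (l2_norm e0)^2 = 2 * (l2_inner (\<lambda>x. y (a + dt) x - y a x) \<phi> - S)"
  proof -
    have L: "e0 \<in> L2t" "e1 \<in> L2t" "\<phi> \<in> L2t" "y a \<in> L2t" "y (a + dt) \<in> L2t" "Yn \<in> L2t" "Yn1 \<in> L2t"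
      using eH \<phi> yH YnH by (auto intro: Hk_L2t)
    have "l2_inner (\<lambda>x. y (a + dt) x - y a x) \<phi> - S = l2_inner (\<lambda>x. e1 x - e0 x) \<phi>"
      unfolding S_def e0_def e1_def using L by (simp add: l2_inner_diff_left)
    also have "\<dots> = (1/2) * l2_inner (\<lambda>x. e1 x - e0 x) (\<lambda>x. e1 x + e0 x)"
      unfolding \<phi>_def midpoint_field_def by (rule l2_inner_scaleR_right)
    also have "l2_inner (\<lambda>x. e1 x - e0 x) (\<lambda>x. e1 x + e0 x) = (l2_norm e1)^2 - (l2_norm e0)^2"
      using L by (simp add: l2_inner_diff_left l2_inner_add_right l2_norm_sq l2_inner_commute[of e0 e1])
    finally show ?thesis by simp
  qed
  ultimately have eq: "(l2_norm e1)^2 - (l2_norm e0)^2 + 2 * \<nu> * dt * g^2 =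
      2 * ((integral {a..a + dt} (\<lambda>s. trilin (u s) \<phi> (u s)) - dt * (trilin (\<lambda>x. ystar x + wI x) \<phi> bb + l2_inner wcov (wgrad \<phi>)))
      - \<nu> * (integral {a..a + dt} (\<lambda>s. gradf (u s) \<phi>) - dt * gradf bb \<phi>) + dt * trilin es \<phi> bb)"
    unfolding exact[OF \<phi>V] by (simp add: algebra_simps)
  define k where "k = 50 * (R + 1) + \<nu>"
  define E where "E = l2_norm es"
  have c1: "\<bar>integral {a..a + dt} (\<lambda>s. trilin (u s) \<phi> (u s)) - dt * (trilin (\<lambda>x. ystar x + wI x) \<phi> bb + l2_inner wcov (wgrad \<phi>))\<bar> \<le> 50 * (R + 1) * g * K"
    using consistency_convection[OF \<phi>] unfolding bb_def gG .
  have c2: "\<bar>\<nu> * (integral {a..a + dt} (\<lambda>s. gradf (u s) \<phi>) - dt * gradf bb \<phi>)\<bar> \<le> \<nu> * (g * K)"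
    using consistency_gradient[OF \<phi>] \<nu> unfolding bb_def gG abs_mult by simp
  have c3: "\<bar>dt * trilin es \<phi> bb\<bar> \<le> dt * (20 * R * E * g)"
  proof -
    have "\<bar>trilin es \<phi> bb\<bar> \<le> 10 * Hk_norm 2 bb * l2_norm es * g"
      unfolding g_def by (rule trilin_bound_H2_right[OF \<phi> Hk_L2t[OF es] bb2])
    also have "\<dots> \<le> 10 * (2 * R) * l2_norm es * g"
      using bbR by (intro mult_right_mono mult_left_mono) (auto simp: g_def)
    finally show ?thesis using dt by (simp add: abs_mult E_def)
  qed
  define Z where "Z = k * K + 20 * R * dt * E"
  have "(l2_norm e1)^2 - (l2_norm e0)^2 + 2 * \<nu> * dt * g^2 \<le> 2 * (50 * (R + 1) * g * K + \<nu> * (g * K) + dt * (20 * R * E * g))"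
  proof -
    have "2 * (a - b + c) \<le> 2 * (a' + b' + c')" if "\<bar>a\<bar> \<le> a'" "\<bar>b\<bar> \<le> b'" "\<bar>c\<bar> \<le> c'" for a b c a' b' c' :: real
    proof -
      have "a - b + c \<le> a' + b' + c'" using that by linarith
      then show ?thesis by simp
    qed
    then show ?thesis unfolding eq using c1 c2 c3 by blast
  qed
  also have "\<dots> = 2 * g * Z" by (simp add: Z_def k_def algebra_simps)
  also have "\<dots> \<le> \<nu> * dt * g^2 + Z^2 / (\<nu> * dt)"
  proof -
    define q where "q = \<nu> * dt"
    have q: "0 < q" using \<nu> dt by (simp add: q_def)
    define r where "r = Z^2 / q"
    have r: "r * q = Z^2" using q by (simp add: r_def)
    have "(q * g^2 + r - 2 * g * Z) * q = q * q * g^2 + r * q - 2 * g * Z * q"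
      by (simp add: algebra_simps)
    also have "\<dots> = (q * g - Z)^2"
      unfolding r by (simp add: power2_eq_square algebra_simps)
    finally have "(q * g^2 + Z^2 / q - 2 * g * Z) * q = (q * g - Z)^2"
      unfolding r_def .
    then have "0 \<le> (q * g^2 + Z^2 / q - 2 * g * Z) * q" by simp
    then show ?thesis using q by (simp add: zero_le_mult_iff q_def)
  qed
  also have "Z^2 / (\<nu> * dt) \<le> (2 * (k * K)^2 + 2 * (20 * R * dt * E)^2) / (\<nu> * dt)"
    using \<nu> dt sum_squares_bound[of "k * K" "20 * R * dt * E"] unfolding Z_def
    by (intro divide_right_mono) (auto simp: power2_sum)
  \<comment> \<open>Here 800 is 2 * 20^2, where 20 is the embedding constant 10 times the bound 2 R
    for \<open>bb\<close> divided by R.\<close>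
  also have "\<dots> = (800 * R^2 / \<nu>) * dt * E^2 + (2 * k^2 / \<nu>) * (K^2 / dt)"
    using \<nu> dt by (simp add: power_mult_distrib field_simps power2_eq_square)
  finally show ?thesis
    unfolding g_def \<phi>_def E_def k_def by (simp add: algebra_simps)
qed

text \<open>The extrapolation looks back two steps, so two earlier values stand on the right. Adding
  L A(n - 1) to the monitored quantity turns this into a recursion over one step with factor 1 + 2
  L. At n = 0 the truncated difference n - 1 is 0, in accordance with the convention for the value
  before the initial one.\<close>

lemma discrete_gronwall:
  fixes A g \<eta> :: "nat \<Rightarrow> real"
  assumes A: "\<And>n. 0 \<le> A n" and g: "\<And>n. 0 \<le> g n" and \<eta>: "\<And>n. 0 \<le> \<eta> n"
    and L: "0 \<le> L" and c: "0 \<le> c" and A0: "A 0 = 0"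
    and step: "\<And>n. n < N ==> A (Suc n) + c * g n \<le> A n + L * (A n + A (n - 1)) + \<eta> n"
    and n: "n \<le> N"
  shows "A n + c * (\<Sum>m<n. g m) \<le> exp (2 * L * real N) * (\<Sum>m<N. \<eta> m)"
proof -
  define b where "b n = A n + L * A (n - 1) + c * (\<Sum>m<n. g m)" for n
  have "b n \<le> (1 + 2 * L) ^ n * (\<Sum>m<n. \<eta> m)" if "n \<le> N" for n
    using that
  proof (induction n)
    case 0
    then show ?case by (simp add: b_def A0)
  next
    case (Suc n)
    have gs: "0 \<le> c * (\<Sum>m<n. g m)" using c g by (intro mult_nonneg_nonneg sum_nonneg)
    have Ab: "A n \<le> b n" using gs L A by (simp add: b_def)
    have "b (Suc n) = A (Suc n) + c * g n + L * A n + c * (\<Sum>m<n. g m)"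
      by (simp add: b_def algebra_simps)
    also have "\<dots> \<le> b n + 2 * L * A n + \<eta> n"
      using step[of n] Suc.prems by (simp add: b_def algebra_simps)
    also have "\<dots> \<le> (1 + 2 * L) * b n + \<eta> n"
      using mult_left_mono[OF Ab L] by (simp add: algebra_simps)
    also have "\<dots> \<le> (1 + 2 * L) * ((1 + 2 * L) ^ n * (\<Sum>m<n. \<eta> m)) + (1 + 2 * L) ^ Suc n * \<eta> n"
    proof (intro add_mono mult_left_mono)
      show "\<eta> n \<le> (1 + 2 * L) ^ Suc n * \<eta> n"
        using mult_right_mono[OF one_le_power[of "1 + 2 * L" "Suc n"] \<eta>[of n]] L by simp
    qed (use Suc L in auto)
    also have "\<dots> = (1 + 2 * L) ^ Suc n * (\<Sum>m<Suc n. \<eta> m)" by (simp add: algebra_simps)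
    finally show ?case .
  qed
  from this[OF n] have "b n \<le> (1 + 2 * L) ^ n * (\<Sum>m<n. \<eta> m)" .
  also have "\<dots> \<le> exp (2 * L * real N) * (\<Sum>m<N. \<eta> m)"
  proof (intro mult_mono sum_mono2)
    have "(1 + 2 * L) ^ n \<le> exp (2 * L) ^ n"
      using L exp_ge_add_one_self[of "2 * L"] by (intro power_mono) auto
    also have "\<dots> = exp (2 * L * real n)" by (simp add: exp_of_nat_mult[symmetric] mult.commute)
    also have "\<dots> \<le> exp (2 * L * real N)" using n L by (simp add: mult_left_mono)
    finally show "(1 + 2 * L) ^ n \<le> exp (2 * L * real N)" .
  qed (use n \<eta> in \<open>auto intro!: sum_nonneg\<close>)
  finally have "b n \<le> exp (2 * L * real N) * (\<Sum>m<N. \<eta> m)" .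
  moreover have "A n + c * (\<Sum>m<n. g m) \<le> b n" using L A by (simp add: b_def)
  ultimately show ?thesis by linarith
qed

lemma trilin_cong:
  assumes "ae_eq a a'" "ae_eq b b'" "ae_eq c c'"
  shows "trilin a b c = trilin a' b' c'"
proof -
  have "ae_eq (\<lambda>x. \<Sum>i\<in>UNIV. a x $ i *\<^sub>R wpd i b x) (\<lambda>x. \<Sum>i\<in>UNIV. a' x $ i *\<^sub>R wpd i b x)"
    by (rule ae_eq_map2[where h="\<lambda>v x. \<Sum>i\<in>UNIV. v $ i *\<^sub>R wpd i b x", OF assms(1) ae_eq_refl[of "\<lambda>x. x"]])
  then show ?thesis
    unfolding trilin_def wpd_cong[OF assms(2), symmetric] by (rule l2_inner_cong[OF _ assms(3)])
qed

lemma error_sq_cong: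
  assumes v: "\<And>k. ae_eq (v k) (v' k)"
  shows "error_sq dt z v n = error_sq dt z v' n"
proof -
  have 1: "l2_norm (\<lambda>x. z t x - v n x) = l2_norm (\<lambda>x. z t x - v' n x)" for t
    by (rule l2_norm_cong, rule ae_eq_map2[where h="(-)", OF ae_eq_refl v])
  have 2: "wgrad (midpoint_field (v (Suc m)) (v m)) = wgrad (midpoint_field (v' (Suc m)) (v' m))" for m
    unfolding midpoint_field_def
    by (rule wgrad_cong, rule ae_eq_map2[where h="\<lambda>a b. (1 / 2) *\<^sub>R (a + b)", OF v v])
  show ?thesis unfolding error_sq_def 1 2 ..
qed

text \<open>The scheme prescribes the initial value only up to a null set, and such a representative
  need not be periodic or measurable on the plane. Replacing it by \<open>u0\<close> puts every
  iterate into \<open>VV\<close> without affecting any equation.\<close>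

lemma is_scheme_start:
  assumes s: "is_scheme dt N M \<nu> u0 w v p"
  shows "is_scheme dt N M \<nu> u0 w (v(0 := u0)) p" and "ae_eq (v k) ((v(0 := u0)) k)"
proof -
  define v' where "v' = v(0 := u0)"
  have v: "ae_eq (v k) (v' k)" for k using s by (simp add: is_scheme_def v'_def)
  then show "ae_eq (v k) ((v(0 := u0)) k)" by (simp add: v'_def)
  have S: "v' (Suc n) = v (Suc n)" for n by (simp add: v'_def)
  have ex: "ae_eq (extrapolate v n) (extrapolate v' n)" for n
    unfolding extrapolate_def
    by (rule ae_eq_map2[where h="\<lambda>a b. (3/2) *\<^sub>R a - (1/2) *\<^sub>R b", OF v]) (use v in auto)
  have mid: "ae_eq (midpoint_field (v (Suc n)) (v n)) (midpoint_field (v (Suc n)) (v' n))" for n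
    unfolding midpoint_field_def by (rule ae_eq_map2[where h="\<lambda>a b. (1 / 2) *\<^sub>R (a + b)", OF ae_eq_refl v])
  have add: "ae_eq (\<lambda>x. f x + h x) (\<lambda>x. f' x + h x)" if "ae_eq f f'" for f f' h :: "(real^2) field"
    by (rule ae_eq_map2[OF that ae_eq_refl])
  have 1: "l2_inner (\<lambda>x. (1 / dt) *\<^sub>R (v (Suc n) x - v n x)) \<phi> = l2_inner (\<lambda>x. (1 / dt) *\<^sub>R (v (Suc n) x - v' n x)) \<phi>" for n \<phi>
    by (rule l2_inner_cong[OF _ ae_eq_refl], rule ae_eq_map2[where h="\<lambda>a b. (1 / dt) *\<^sub>R (a - b)", OF ae_eq_refl v])
  show "is_scheme dt N M \<nu> u0 w (v(0 := u0)) p"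
    using s unfolding is_scheme_def v'_def[symmetric] S
    by (simp add: 1 trilin_cong[OF add[OF ex] add[OF mid] ae_eq_refl] wgrad_cong[OF add[OF mid]] v'_def)
qed

section \<open>The pathwise error estimate\<close>

text \<open>The almost sure properties of one path, collected so that the error estimate is
  deterministic. That y is divergence free is demanded only at grid points and substep nodes: for a
  version it is known almost surely at each fixed time, which suffices for countably many
  times.\<close>

locale good_path =
  fixes T \<nu> R dt :: real and N M :: nat
    and y w :: "real \<Rightarrow> (real^2) field" and u0 :: "(real^2) field"
    and v :: "nat \<Rightarrow> (real^2) field" and p :: "nat \<Rightarrow> real field" and y' :: "nat \<Rightarrow> (real^2) field"
  assumes T: "0 < T" and \<nu>: "0 < \<nu>" and N: "0 < N" and dt_def: "dt = T / real N" and M: "real M * dt = 1"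
    and yc: "pcont 2 {0..T} y" and wc: "pcont 2 {0..T} w"
    and yR: "\<And>s. s \<in> {0..T} ==> Hk_norm 2 (y s) \<le> R"
    and wR: "\<And>s. s \<in> {0..T} ==> Hk_norm 2 (w s) \<le> R"
    and y'H: "\<And>n. n < N ==> y' n \<in> Hk 1"
    and yV: "\<And>n. n \<le> N ==> y (real n * dt) \<in> VV"
    and yV': "\<And>n l. n < N ==> l \<in> {1..M} ==> y (real n * dt + real l * dt^2) \<in> VV"
    and uHH: "\<And>s. s \<in> {0..T} ==> (\<lambda>x. y s x + w s x) \<in> HH"
    and u0: "u0 \<in> VV"
    and weak: "\<And>t \<phi>. t \<in> {0..T} ==> \<phi> \<in> VV ==>
      l2_inner (\<lambda>x. y t x + w t x) \<phi> - l2_inner u0 \<phi> =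
        - (\<integral>s\<in>{0..t}. trilin (\<lambda>x. y s x + w s x) (\<lambda>x. y s x + w s x) \<phi> \<partial>lebesgue)
        - \<nu> * (\<integral>s\<in>{0..t}. l2_inner (wgrad (\<lambda>x. y s x + w s x)) (wgrad \<phi>) \<partial>lebesgue)
        + l2_inner (w t) \<phi>"
    and scheme: "is_scheme dt N M \<nu> u0 w v p" and v0: "v 0 = u0"
begin

definition "ystar n = extrapolate (\<lambda>k. y (real k * dt)) n"
definition "Kn n = time_step.K (real n * dt) dt M y w (y' n) (ystar n)"
definition "e n = (\<lambda>x. y (real n * dt) x - v n x)"
definition "uu s = (\<lambda>x. y s x + w s x)"

lemma dt: "0 < dt" using T N by (simp add: dt_def)

lemma Ndt: "real N * dt = T" using N by (simp add: dt_def)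

lemma n_in: "n \<le> N ==> real n * dt \<in> {0..T}"
  using dt mult_right_mono[of "real n" "real N" dt] by (simp add: Ndt)

lemma step_sub: "n < N ==> {real n * dt..real n * dt + dt} \<subseteq> {0..T}"
proof -
  assume "n < N"
  then have "real (Suc n) * dt \<in> {0..T}" by (intro n_in) simp
  then show ?thesis using dt by (auto simp: algebra_simps intro: order_trans[OF mult_nonneg_nonneg])
qed

lemma Suc_dt: "real n * dt + dt = real (Suc n) * dt"
  by (simp add: algebra_simps)

lemma yH: "s \<in> {0..T} ==> y s \<in> Hk 2" and wH: "s \<in> {0..T} ==> w s \<in> Hk 2"
  using yc wc by (auto intro: pcont_Hk)

lemma Hk21: "f \<in> Hk 2 ==> f \<in> Hk 1"
  by (rule Hk_le[of 1 2]) auto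

lemma uV: "s \<in> {0..T} ==> uu s \<in> VV"
  using uHH[of s] yH[of s] wH[of s] unfolding uu_def by (intro HH_VV Hk_add Hk21)

lemma uc: "pcont 1 {0..T} uu"
  unfolding uu_def[abs_def] by (intro pcont_add pcont_mono[OF yc] pcont_mono[OF wc]) auto

lemma ystar_H2: "n < N ==> ystar n \<in> Hk 2" and ystar_R: "n < N ==> Hk_norm 2 (ystar n) \<le> 2 * R"
proof -
  assume n: "n < N"
  define z where "z = (if n = 0 then y (real 0 * dt) else y (real (n - 1) * dt))"
  have nn: "real n * dt \<in> {0..T}" "real (n - 1) * dt \<in> {0..T}" "real 0 * dt \<in> {0..T}"
    using n by (intro n_in; simp)+
  have z: "z \<in> Hk 2" "Hk_norm 2 z \<le> R" unfolding z_def using yH yR nn by auto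
  have eq: "ystar n = (\<lambda>x. (3/2) *\<^sub>R y (real n * dt) x - (1/2) *\<^sub>R z x)"
    by (auto simp: ystar_def extrapolate_def z_def)
  have yn: "y (real n * dt) \<in> Hk 2" using yH nn by blast
  show "ystar n \<in> Hk 2" unfolding eq by (intro Hk_diff Hk_scaleR z yn)
  have "Hk_norm 2 (ystar n) \<le> Hk_norm 2 (\<lambda>x. (3/2) *\<^sub>R y (real n * dt) x) + Hk_norm 2 (\<lambda>x. (1/2) *\<^sub>R z x)"
    unfolding eq by (intro Hk_triangle_diff Hk_scaleR z yn)
  also have "\<dots> = \<bar>3/2\<bar> * Hk_norm 2 (y (real n * dt)) + \<bar>1/2\<bar> * Hk_norm 2 z"
    using z yn by (simp add: Hk_norm_scaleR)
  finally show "Hk_norm 2 (ystar n) \<le> 2 * R" using z(2) yR[OF nn(1)] by simp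
qed

lemma time_step: "n < N ==> time_step (real n * dt) dt R M y w (y' n) (ystar n)"
proof
  assume n: "n < N"
  note sub = step_sub[OF n]
  show "pcont 2 {real n * dt..real n * dt + dt} y" "pcont 2 {real n * dt..real n * dt + dt} w"
    using pcont_subset[OF yc sub] pcont_subset[OF wc sub] by auto
  show "Hk_norm 2 (y s) \<le> R" "Hk_norm 2 (w s) \<le> R" if "s \<in> {real n * dt..real n * dt + dt}" for s
    using yR wR sub that by blast+
qed (use dt M y'H ystar_H2 ystar_R in auto)

lemma lebesgue_integral_continuous:
  fixes f :: "real \<Rightarrow> real"
  assumes "continuous_on {a..b} f"
  shows "(\<integral>s\<in>{a..b}. f s \<partial>lebesgue) = integral {a..b} f"
  by (rule set_lebesgue_integral_eq_integral(2)) (rule absolutely_integrable_continuous_real[OF assms])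

text \<open>The sum of y and the noise is divergence free at every time, so the derivative can be
  moved to the test function under the time integral. The noise on the two sides cancels, leaving an
  equation for increments of y.\<close>

lemma weak':
  assumes t: "t \<in> {0..T}" and \<phi>: "\<phi> \<in> VV"
  shows "l2_inner (y t) \<phi> - l2_inner u0 \<phi> =
    integral {0..t} (\<lambda>s. trilin (uu s) \<phi> (uu s)) - \<nu> * integral {0..t} (\<lambda>s. gradf (uu s) \<phi>)"
proof -
  have \<phi>H: "\<phi> \<in> Hk 1" using \<phi> by (rule VV_Hk)
  have sub: "{0..t} \<subseteq> {0..T}" using t by auto
  have c: "continuous_on {0..t} (\<lambda>s. - trilin (uu s) \<phi> (uu s))" "continuous_on {0..t} (\<lambda>s. gradf (uu s) \<phi>)"
    by (intro continuous_on_minus trilin_continuous gradf_continuous \<phi>H pcont_subset[OF uc sub])+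
  have sk: "trilin (uu s) (uu s) \<phi> = - trilin (uu s) \<phi> (uu s)" if "s \<in> {0..t}" for s
    using uV[of s] that sub by (intro trilin_skew \<phi>H VV_Hk) auto
  have c1: "continuous_on {0..t} (\<lambda>s. trilin (uu s) (uu s) \<phi>)"
    by (rule continuous_on_eq[OF c(1)]) (simp add: sk)
  have i1: "(\<integral>s\<in>{0..t}. trilin (uu s) (uu s) \<phi> \<partial>lebesgue) = - integral {0..t} (\<lambda>s. trilin (uu s) \<phi> (uu s))"
    unfolding lebesgue_integral_continuous[OF c1]
    by (subst integral_cong[of _ _ "\<lambda>s. - trilin (uu s) \<phi> (uu s)"]) (auto simp: sk)
  have i2: "(\<integral>s\<in>{0..t}. l2_inner (wgrad (uu s)) (wgrad \<phi>) \<partial>lebesgue) = integral {0..t} (\<lambda>s. gradf (uu s) \<phi>)"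
    using lebesgue_integral_continuous[OF c(2)] by (simp add: gradf_def)
  have "l2_inner (uu t) \<phi> = l2_inner (y t) \<phi> + l2_inner (w t) \<phi>"
    unfolding uu_def by (intro l2_inner_add_left Hk_L2t[OF yH] Hk_L2t[OF wH] Hk_L2t[OF \<phi>H] t)
  then show ?thesis
    using weak[OF t \<phi>] unfolding uu_def[symmetric] i1 i2 by simp
qed

text \<open>The divergence of an iterate has mean zero and may be taken as its own test function q,
  so its norm vanishes.\<close>

lemma vV: "n \<le> N ==> v n \<in> VV"
proof (cases n)
  case (Suc m)
  assume "n \<le> N"
  then have m: "m < N" using Suc by simp
  have H: "v (Suc m) \<in> Hk 1" and q: "\<And>q. q \<in> QQ ==> l2_inner (wdiv (v (Suc m))) q = 0"
    using scheme m by (auto simp: is_scheme_def)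
  have "l2_inner (wdiv (v (Suc m))) (wdiv (v (Suc m))) = 0" using q wdiv_mean[OF H] by blast
  then have "l2_norm (wdiv (v (Suc m))) = 0" by (simp add: l2_norm_def)
  then have "ae_eq (wdiv (v (Suc m))) (\<lambda>x. 0)"
    using wdiv_L2[OF H] by (subst (asm) l2_norm_eq_0) (auto simp: ae_eq_def L2_L2t)
  then show ?thesis using H Suc by (simp add: VV_def)
qed (use u0 v0 in simp)

lemma eV: "n \<le> N ==> e n \<in> VV"
  unfolding e_def by (intro VV_diff yV vV)

text \<open>At time 0 the weak equation says that \<open>e 0\<close> is orthogonal to every field in
  \<open>VV\<close>, and it is such a field itself.\<close>

lemma e0: "l2_norm (e 0) = 0"
proof -
  have V: "e 0 \<in> VV" by (rule eV) simp
  have "l2_inner (y 0) (e 0) - l2_inner u0 (e 0) = 0"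
    using weak'[OF _ V, of 0] T by simp
  moreover have "l2_inner (e 0) (e 0) = l2_inner (y 0) (e 0) - l2_inner u0 (e 0)"
    unfolding e_def[of 0] v0
    using Hk_L2t[OF VV_Hk[OF V]] Hk_L2t[OF VV_Hk[OF yV[of 0]]] Hk_L2t[OF VV_Hk[OF u0]]
    by (simp add: l2_inner_diff_left e_def v0)
  ultimately show ?thesis by (simp add: l2_norm_def)
qed

text \<open>The constant 4000 is 800 * 5, with 5 from the square of the extrapolated error (3/2)
  e(n) - (1/2) e(n - 1). For n = 0 both indices coincide, and this expression is
  \<open>e 0\<close>.\<close>

lemma error_step:
  assumes n: "n < N"
  shows "(l2_norm (e (Suc n)))^2 + \<nu> * dt * (l2_norm (wgrad (midpoint_field (e (Suc n)) (e n))))^2 \<le>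
    (l2_norm (e n))^2 + 4000 * R^2 / \<nu> * dt * ((l2_norm (e n))^2 + (l2_norm (e (n - 1)))^2) +
    (2 * (50 * (R + 1) + \<nu>)^2 / \<nu>) * ((Kn n)^2 / dt)"
proof -
  interpret S: time_step "real n * dt" dt R M y w "y' n" "ystar n" by (rule time_step[OF n])
  have nN: "n \<le> N" "Suc n \<le> N" "n - 1 \<le> N" using n by auto
  define es where "es = (\<lambda>x. ystar n x - extrapolate v n x)"
  have es: "es = (\<lambda>x. (3/2) *\<^sub>R e n x - (1/2) *\<^sub>R e (n - 1) x)"
    by (rule ext) (auto simp: es_def ystar_def extrapolate_def e_def algebra_simps)
  have ex: "extrapolate v n = (\<lambda>x. (3/2) *\<^sub>R v n x - (1/2) *\<^sub>R v (n - 1) x)"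
    by (rule ext) (auto simp: extrapolate_def)
  \<comment> \<open>At a node the noise is the difference of two divergence-free fields, the
    solution and y.\<close>
  have wV: "w (real n * dt + real l * dt^2) \<in> VV" if l: "l \<in> {1..M}" for l
  proof -
    have t: "real n * dt + real l * dt^2 \<in> {0..T}" using S.tl_in[OF l] step_sub[OF n] by blast
    have "(\<lambda>x. uu (real n * dt + real l * dt^2) x - y (real n * dt + real l * dt^2) x) \<in> VV"
      by (intro VV_diff uV[OF t] yV'[OF n l])
    then show ?thesis by (simp add: uu_def)
  qed
  have wI: "noise_mean dt M w n = S.wI" by (simp add: noise_mean_def S.wI_def)
  have cov: "noise_cov dt M w n = S.wcov" by (simp add: noise_cov_def S.wcov_def wI)
  have wIV: "S.wI \<in> VV" unfolding S.wI_def by (intro VV_scaleR VV_sum wV)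
  have esH: "es \<in> Hk 1" unfolding es by (intro VV_Hk VV_diff VV_scaleR eV nN)
  have "(l2_norm (e (Suc n)))^2 + \<nu> * dt * (l2_norm (wgrad (midpoint_field (e (Suc n)) (e n))))^2 \<le>
      (l2_norm (e n))^2 + (800 * R^2 / \<nu>) * dt * (l2_norm es)^2 + (2 * (50 * (R + 1) + \<nu>)^2 / \<nu>) * (S.K^2 / dt)"
    unfolding es_def e_def Suc_dt[symmetric]
  proof (rule S.energy_step[OF \<nu>])
    show "(\<lambda>x. y (real n * dt) x - v n x) \<in> VV" using eV[OF nN(1)] by (simp add: e_def)
    show "(\<lambda>x. y (real n * dt + dt) x - v (Suc n) x) \<in> VV" using eV[OF nN(2)] by (simp only: e_def Suc_dt)
    show "(\<lambda>x. ystar n x - extrapolate v n x) \<in> Hk 1" using esH by (simp add: es_def)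
    show "(\<lambda>x. extrapolate v n x + S.wI x) \<in> VV"
      unfolding ex by (intro VV_add VV_diff VV_scaleR vV nN wIV)
    fix \<phi> assume \<phi>: "\<phi> \<in> VV"
    have \<phi>H: "\<phi> \<in> Hk 1" using \<phi> by (rule VV_Hk)
    have t: "real n * dt \<in> {0..T}" "real n * dt + dt \<in> {0..T}" using n_in[OF nN(1)] n_in[OF nN(2)] by (simp_all only: Suc_dt)
    have u: "S.u = uu" by (simp add: S.u_def[abs_def] uu_def[abs_def])
    have comb: "integral {0..real n * dt + dt} f = integral {0..real n * dt} f + integral {real n * dt..real n * dt + dt} f"
      if "continuous_on {0..T} f" for f :: "real \<Rightarrow> real"
      using t dt by (intro Henstock_Kurzweil_Integration.integral_combine[symmetric] integrable_continuous_real continuous_on_subset[OF that]) auto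
    have c: "continuous_on {0..T} (\<lambda>s. trilin (uu s) \<phi> (uu s))" "continuous_on {0..T} (\<lambda>s. gradf (uu s) \<phi>)"
      by (intro trilin_continuous gradf_continuous \<phi>H uc)+
    have "l2_inner (\<lambda>x. y (real n * dt + dt) x - y (real n * dt) x) \<phi> = l2_inner (y (real n * dt + dt)) \<phi> - l2_inner (y (real n * dt)) \<phi>"
      by (intro l2_inner_diff_left Hk_L2t[OF yH] t Hk_L2t[OF \<phi>H])
    then show "l2_inner (\<lambda>x. y (real n * dt + dt) x - y (real n * dt) x) \<phi> =
        integral {real n * dt..real n * dt + dt} (\<lambda>s. trilin (S.u s) \<phi> (S.u s)) - \<nu> * integral {real n * dt..real n * dt + dt} (\<lambda>s. gradf (S.u s) \<phi>)"
      using weak'[OF t(1) \<phi>] weak'[OF t(2) \<phi>] unfolding u comb[OF c(1)] comb[OF c(2)] by (simp add: algebra_simps)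
    \<comment> \<open>The pressure disappears against divergence-free test functions, so it is never
      estimated.\<close>
    have "l2_inner (p (Suc n)) (wdiv \<phi>) = l2_inner (p (Suc n)) (\<lambda>x. 0)"
      using \<phi> by (intro l2_inner_cong ae_eq_refl) (simp add: VV_def)
    then have p0: "l2_inner (p (Suc n)) (wdiv \<phi>) = 0" by simp
    show "l2_inner (\<lambda>x. (1 / dt) *\<^sub>R (v (Suc n) x - v n x)) \<phi>
      + trilin (\<lambda>x. extrapolate v n x + S.wI x) (\<lambda>x. midpoint_field (v (Suc n)) (v n) x + S.wI x) \<phi> - l2_inner S.wcov (wgrad \<phi>)
      + \<nu> * gradf (\<lambda>x. midpoint_field (v (Suc n)) (v n) x + S.wI x) \<phi> = 0"
      using scheme n \<phi>H unfolding is_scheme_def wI[symmetric] cov[symmetric] gradf_def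
      by (simp add: p0)
  qed
  also have "S.K = Kn n" by (simp add: Kn_def)
  finally have main: "(l2_norm (e (Suc n)))^2 + \<nu> * dt * (l2_norm (wgrad (midpoint_field (e (Suc n)) (e n))))^2 \<le>
      (l2_norm (e n))^2 + (800 * R^2 / \<nu>) * dt * (l2_norm es)^2 + (2 * (50 * (R + 1) + \<nu>)^2 / \<nu>) * ((Kn n)^2 / dt)" .
  have "(l2_norm es)^2 \<le> 5 * ((l2_norm (e n))^2 + (l2_norm (e (n - 1)))^2)"
  proof -
    have L: "e n \<in> L2t" "e (n - 1) \<in> L2t" by (intro Hk_L2t[OF VV_Hk] eV nN)+
    have "l2_norm es \<le> l2_norm (\<lambda>x. (3/2) *\<^sub>R e n x) + l2_norm (\<lambda>x. (- 1/2) *\<^sub>R e (n - 1) x)"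
      unfolding es using l2_triangle[of "\<lambda>x. (3/2) *\<^sub>R e n x" "\<lambda>x. (- 1/2) *\<^sub>R e (n - 1) x"] L by simp
    also have "\<dots> = 3/2 * l2_norm (e n) + 1/2 * l2_norm (e (n - 1))" by (simp only: l2_norm_scaleR)
    finally have "(l2_norm es)^2 \<le> (3/2 * l2_norm (e n) + 1/2 * l2_norm (e (n - 1)))^2" by (intro power_mono) auto
    also have "\<dots> \<le> 5 * ((l2_norm (e n))^2 + (l2_norm (e (n - 1)))^2)"
    proof -
      have "(3/2 * A + 1/2 * B)^2 \<le> 5 * (A^2 + B^2)" for A B :: real
      proof -
        have "(3/2 * A + 1/2 * B)^2 = 9/4 * A^2 + 3/4 * (2 * A * B) + 1/4 * B^2"
          by (simp add: power2_eq_square algebra_simps)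
        also have "\<dots> \<le> 9/4 * A^2 + 3/4 * (A^2 + B^2) + 1/4 * B^2"
          by (intro add_mono mult_left_mono sum_squares_bound) auto
        also have "\<dots> \<le> 5 * (A^2 + B^2)" by (simp add: distrib_left)
        finally show ?thesis .
      qed
      then show ?thesis .
    qed
    finally show ?thesis .
  qed
  then have "(800 * R^2 / \<nu>) * dt * (l2_norm es)^2 \<le> (800 * R^2 / \<nu>) * dt * (5 * ((l2_norm (e n))^2 + (l2_norm (e (n - 1)))^2))"
    using \<nu> dt by (intro mult_left_mono) auto
  also have "\<dots> = 4000 * R^2 / \<nu> * dt * ((l2_norm (e n))^2 + (l2_norm (e (n - 1)))^2)" by simp
  finally show ?thesis using main by linarith
qed

text \<open>The factor 1 + 1/nu removes the weight nu from the gradient sum, and 8000 is twice 4000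
  because the Gronwall exponent is 2 L N. The error counts gradients from m = 1 on, while the energy
  argument controls also m = 0.\<close>

theorem error_bound:
  assumes n: "n \<le> N"
  shows "error_sq dt y v n \<le> (1 + 1 / \<nu>) * exp (8000 * R^2 / \<nu> * T) * (2 * (50 * (R + 1) + \<nu>)^2 / \<nu>) * (\<Sum>m<N. (Kn m)^2 / dt)"
proof -
  define C where "C = 2 * (50 * (R + 1) + \<nu>)^2 / \<nu>"
  define g where "g m = (l2_norm (wgrad (midpoint_field (e (Suc m)) (e m))))^2" for m
  define L where "L = 4000 * R^2 / \<nu> * dt"
  have C0: "0 \<le> C" using \<nu> by (simp add: C_def)
  have L0: "0 \<le> L" using \<nu> dt by (simp add: L_def)
  have G: "(l2_norm (e n))^2 + \<nu> * dt * (\<Sum>m<n. g m) \<le> exp (2 * L * real N) * (\<Sum>m<N. C * ((Kn m)^2 / dt))"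
  proof (rule discrete_gronwall[where A="\<lambda>n. (l2_norm (e n))^2"])
    show "(l2_norm (e (Suc m)))^2 + \<nu> * dt * g m \<le> (l2_norm (e m))^2 + L * ((l2_norm (e m))^2 + (l2_norm (e (m - 1)))^2) + C * ((Kn m)^2 / dt)"
      if "m < N" for m
      using error_step[OF that] by (simp add: g_def L_def C_def)
  qed (use e0 \<nu> dt C0 L0 n in \<open>auto simp: g_def\<close>)
  have mid: "ae_eq (\<lambda>x. wgrad (midpoint_field (y (real m * dt)) (y (real (Suc m) * dt))) x - wgrad (midpoint_field (v (Suc m)) (v m)) x)
      (wgrad (midpoint_field (e (Suc m)) (e m)))" if m: "m < N" for m
  proof -
    have mf: "midpoint_field f g \<in> Hk 1" if "f \<in> Hk 1" "g \<in> Hk 1" for f g :: "(real^2) field"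
      using that by (simp add: midpoint_field_def)
    have H: "y (real m * dt) \<in> Hk 1" "y (real (Suc m) * dt) \<in> Hk 1" "v m \<in> Hk 1" "v (Suc m) \<in> Hk 1"
      using m by (intro VV_Hk yV vV; simp)+
    have eq: "midpoint_field (e (Suc m)) (e m) =
        (\<lambda>x. midpoint_field (y (real m * dt)) (y (real (Suc m) * dt)) x - midpoint_field (v (Suc m)) (v m) x)"
      by (rule ext) (simp add: midpoint_field_def e_def algebra_simps)
    show ?thesis
      unfolding eq by (rule ae_eq_sym, rule wgrad_diff) (intro mf H)+
  qed
  have "(\<Sum>m=1..n-1. dt * (l2_norm (\<lambda>x. wgrad (midpoint_field (y (real m * dt)) (y (real (Suc m) * dt))) x - wgrad (midpoint_field (v (Suc m)) (v m)) x))^2)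
      = (\<Sum>m=1..n-1. dt * g m)"
  proof (intro sum.cong refl)
    fix m assume "m \<in> {1..n-1}"
    then have "m < N" using n by auto
    from l2_norm_cong[OF mid[OF this]]
    show "dt * (l2_norm (\<lambda>x. wgrad (midpoint_field (y (real m * dt)) (y (real (Suc m) * dt))) x - wgrad (midpoint_field (v (Suc m)) (v m)) x))^2 = dt * g m"
      by (simp only: g_def)
  qed
  also have "\<dots> \<le> (\<Sum>m<n. dt * g m)"
    using dt by (intro sum_mono2) (auto simp: g_def)
  finally have "error_sq dt y v n \<le> (l2_norm (e n))^2 + dt * (\<Sum>m<n. g m)"
    unfolding error_sq_def e_def by (simp add: sum_distrib_left)
  also have "\<dots> \<le> (1 + 1 / \<nu>) * ((l2_norm (e n))^2 + \<nu> * dt * (\<Sum>m<n. g m))"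
  proof -
    have "0 \<le> (1 / \<nu>) * (l2_norm (e n))^2 + \<nu> * dt * (\<Sum>m<n. g m)"
      using \<nu> dt by (auto simp: g_def intro!: add_nonneg_nonneg mult_nonneg_nonneg sum_nonneg)
    then show ?thesis using \<nu> by (simp add: algebra_simps)
  qed
  also have "\<dots> \<le> (1 + 1 / \<nu>) * (exp (2 * L * real N) * (\<Sum>m<N. C * ((Kn m)^2 / dt)))"
    using \<nu> G by (intro mult_left_mono) auto
  also have "2 * L * real N = 8000 * R^2 / \<nu> * T"
    using Ndt by (simp add: L_def mult_ac)
  also have "(1 + 1 / \<nu>) * (exp (8000 * R^2 / \<nu> * T) * (\<Sum>m<N. C * ((Kn m)^2 / dt))) =
      (1 + 1 / \<nu>) * exp (8000 * R^2 / \<nu> * T) * C * (\<Sum>m<N. (Kn m)^2 / dt)"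
    by (simp only: sum_distrib_left[symmetric] mult.assoc)
  finally show ?thesis unfolding C_def .
qed

end

section \<open>Moment bounds\<close>

text \<open>Stated with the nonnegative integral, so that the bound cannot hold by the default value
  0 of the Bochner integral. Measurability and sign are included to let bounds be combined by
  rules.\<close>

definition mb :: "'a measure \<Rightarrow> ('a \<Rightarrow> real) \<Rightarrow> real \<Rightarrow> bool" where
  "mb M f C \<longleftrightarrow> f \<in> borel_measurable M \<and> (\<forall>w\<in>space M. 0 \<le> f w) \<and> 0 \<le> C \<and> (\<integral>\<^sup>+w. ennreal (f w) \<partial>M) \<le> ennreal C"

lemma mb_measurable: "mb M f C ==> f \<in> borel_measurable M"
  by (simp add: mb_def)

lemma mb_mono:
  assumes f: "mb M f C" and g: "g \<in> borel_measurable M" "\<And>w. w \<in> space M ==> 0 \<le> g w"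
    "\<And>w. w \<in> space M ==> g w \<le> f w" and C: "C \<le> C'"
  shows "mb M g C'"
proof -
  have "(\<integral>\<^sup>+w. ennreal (g w) \<partial>M) \<le> (\<integral>\<^sup>+w. ennreal (f w) \<partial>M)"
    using g by (intro nn_integral_mono ennreal_leI) auto
  also have "\<dots> \<le> ennreal C" using f by (simp add: mb_def)
  also have "\<dots> \<le> ennreal C'" using C by (rule ennreal_leI)
  finally show ?thesis using f g C by (simp add: mb_def)
qed

lemma mb_weaken: "mb M f C ==> C \<le> C' ==> mb M f C'"
  by (rule mb_mono) (auto simp: mb_def)

lemma mb_add:
  assumes f: "mb M f C" and g: "mb M g D"
  shows "mb M (\<lambda>w. f w + g w) (C + D)"
proof -
  have "(\<integral>\<^sup>+w. ennreal (f w + g w) \<partial>M) = (\<integral>\<^sup>+w. ennreal (f w) + ennreal (g w) \<partial>M)"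
    using f g by (intro nn_integral_cong) (auto simp: mb_def)
  also have "\<dots> = (\<integral>\<^sup>+w. ennreal (f w) \<partial>M) + (\<integral>\<^sup>+w. ennreal (g w) \<partial>M)"
    using f g by (intro nn_integral_add) (auto simp: mb_def)
  also have "\<dots> \<le> ennreal C + ennreal D"
    using f g by (intro add_mono) (auto simp: mb_def)
  finally have "(\<integral>\<^sup>+w. ennreal (f w + g w) \<partial>M) \<le> ennreal (C + D)" using f g by (simp add: mb_def)
  moreover have "(\<lambda>w. f w + g w) \<in> borel_measurable M"
    using f g by (intro borel_measurable_add) (auto simp: mb_def)
  ultimately show ?thesis using f g by (auto simp: mb_def)
qed

lemma mb_scale:
  assumes f: "mb M f C" and c: "0 \<le> c"
  shows "mb M (\<lambda>w. c * f w) (c * C)"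
proof -
  have "(\<integral>\<^sup>+w. ennreal (c * f w) \<partial>M) = (\<integral>\<^sup>+w. ennreal c * ennreal (f w) \<partial>M)"
    using f c by (intro nn_integral_cong) (auto simp: mb_def ennreal_mult)
  also have "\<dots> = ennreal c * (\<integral>\<^sup>+w. ennreal (f w) \<partial>M)"
    using f by (intro nn_integral_cmult) (auto simp: mb_def)
  also have "\<dots> \<le> ennreal c * ennreal C"
    using f by (intro mult_left_mono) (auto simp: mb_def)
  finally have "(\<integral>\<^sup>+w. ennreal (c * f w) \<partial>M) \<le> ennreal (c * C)" using f c by (simp add: mb_def ennreal_mult)
  moreover have "(\<lambda>w. c * f w) \<in> borel_measurable M"
    using f by (intro borel_measurable_times borel_measurable_const) (auto simp: mb_def)
  ultimately show ?thesis using f c by (auto simp: mb_def)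
qed

lemma (in prob_space) mb_const: "0 \<le> c ==> mb M (\<lambda>_. c) c"
  by (simp add: mb_def emeasure_space_1)

lemma mb_zero: "mb M (\<lambda>_. 0) 0"
  by (simp add: mb_def)

lemma mb_sum: "finite I ==> (\<And>i. i \<in> I ==> mb M (f i) (C i)) ==> mb M (\<lambda>w. \<Sum>i\<in>I. f i w) (\<Sum>i\<in>I. C i)"
proof (induction I rule: finite_induct)
  case empty
  show ?case by (simp add: mb_zero)
next
  case (insert i I)
  then show ?case using mb_add[of M "f i" "C i" "\<lambda>w. \<Sum>i\<in>I. f i w" "\<Sum>i\<in>I. C i"] by simp
qed

lemma mb_integral:
  assumes "mb M f C"
  shows "integrable M f" "(\<integral>w. f w \<partial>M) \<le> C"
proof -
  have "(\<integral>\<^sup>+w. ennreal (f w) \<partial>M) < \<infinity>"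
    using assms by (auto simp: mb_def intro: order_le_less_trans)
  then show i: "integrable M f"
    using assms by (intro integrableI_nonneg) (auto simp: mb_def)
  have "ennreal (\<integral>w. f w \<partial>M) \<le> ennreal C"
    using assms nn_integral_eq_integral[OF i] by (auto simp: mb_def)
  then show "(\<integral>w. f w \<partial>M) \<le> C"
    using assms by (simp add: mb_def)
qed

lemma mbI_integral:
  assumes "integrable M f" "\<And>w. w \<in> space M ==> 0 \<le> f w" "(\<integral>w. f w \<partial>M) \<le> C"
  shows "mb M f C"
proof -
  have "0 \<le> (\<integral>w. f w \<partial>M)" using assms by (intro integral_nonneg_AE AE_I2) auto
  then have "0 \<le> C" using assms(3) by simp
  moreover have "(\<integral>\<^sup>+w. ennreal (f w) \<partial>M) = ennreal (\<integral>w. f w \<partial>M)"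
    by (rule nn_integral_eq_integral[OF assms(1)]) (rule AE_I2, rule assms(2))
  ultimately show ?thesis
    using assms by (simp add: mb_def ennreal_leI)
qed

text \<open>Minkowski's inequality in \<open>L\<^sup>2\<close>, from \<open>(f + g)\<^sup>2 \<le> (1 + B/A) f\<^sup>2 + (1 + A/B) g\<^sup>2\<close>.\<close>

lemma mb_minkowski:
  assumes f: "mb M (\<lambda>w. (f w)^2) (A^2)" and g: "mb M (\<lambda>w. (g w)^2) (B^2)" and AB: "0 < A" "0 < B"
    and h: "h \<in> borel_measurable M" "\<And>w. w \<in> space M ==> \<bar>h w\<bar> \<le> \<bar>f w\<bar> + \<bar>g w\<bar>"
  shows "mb M (\<lambda>w. (h w)^2) ((A + B)^2)"
proof (rule mb_mono[OF mb_add[OF mb_scale[OF f, of "1 + B / A"] mb_scale[OF g, of "1 + A / B"]]])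
  show "0 \<le> 1 + B / A" "0 \<le> 1 + A / B" using AB by auto
  show "(h w)^2 \<le> (1 + B / A) * (f w)^2 + (1 + A / B) * (g w)^2" if "w \<in> space M" for w
  proof -
    define a b where "a = \<bar>f w\<bar>" and "b = \<bar>g w\<bar>"
    have "(h w)^2 \<le> (a + b)^2"
      using power_mono[OF h(2)[OF that], of 2] by (simp add: a_def b_def)
    also have "\<dots> \<le> (1 + B / A) * a^2 + (1 + A / B) * b^2"
    proof -
      have "0 \<le> (B * a - A * b)^2 / (A * B)" using AB by simp
      also have "\<dots> = B / A * a^2 + A / B * b^2 - 2 * a * b"
        using AB by (simp add: power2_eq_square field_simps)
      finally show ?thesis by (simp add: power2_sum algebra_simps)
    qed
    finally show ?thesis by (simp add: a_def b_def)
  qed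
  show "(1 + B / A) * A^2 + (1 + A / B) * B^2 \<le> (A + B)^2"
    using AB by (simp add: power2_eq_square field_simps)
qed (use h(1) in auto)

text \<open>With q = f^2, the inequality 2 eps^2 q <= q^2 + eps^4 is integrated; it loses no
  constant, exactly as Jensen's inequality would.\<close>

lemma (in prob_space) mb_square_of_fourth:
  assumes f: "mb M (\<lambda>w. (f w) ^ 4) (\<epsilon> ^ 4)" and \<epsilon>: "0 < \<epsilon>" and m: "f \<in> borel_measurable M"
  shows "mb M (\<lambda>w. (f w)^2) (\<epsilon>^2)"
proof (rule mb_mono[OF mb_add[OF mb_scale[OF f, of "1 / (2 * \<epsilon>^2)"] mb_const[of "\<epsilon>^2 / 2"]]])
  show "(f w)^2 \<le> 1 / (2 * \<epsilon>^2) * f w ^ 4 + \<epsilon>^2 / 2" for w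
  proof -
    define q where "q = (f w)^2"
    have "0 \<le> (q - \<epsilon>^2)^2 / (2 * \<epsilon>^2)" by simp
    also have "\<dots> = 1 / (2 * \<epsilon>^2) * q^2 + \<epsilon>^2 / 2 - q"
      using \<epsilon> by (simp add: power2_eq_square field_simps)
    also have "q^2 = f w ^ 4" by (simp add: q_def power_mult[symmetric])
    finally show ?thesis unfolding q_def by linarith
  qed
  show "1 / (2 * \<epsilon>^2) * \<epsilon> ^ 4 + \<epsilon>^2 / 2 \<le> \<epsilon>^2"
    using \<epsilon> by (simp add: power4_eq_xxxx power2_eq_square field_simps)
qed (use m in auto)

section \<open>Measurability and moments of time integrals\<close>

lemma riemann_sum_tendsto:
  fixes g :: "real \<Rightarrow> real"
  assumes ab: "a \<le> b" and c: "continuous_on {a..b} g"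
  shows "(\<lambda>m. (b - a) / real (Suc m) * (\<Sum>l=1..Suc m. g (a + real l * ((b - a) / real (Suc m))))) \<longlonglongrightarrow> integral {a..b} g"
proof (rule tendstoI)
  fix \<epsilon> :: real assume \<epsilon>: "\<epsilon> > 0"
  \<comment> \<open>The summand 1 keeps the denominator positive when a = b.\<close>
  define \<eta> where "\<eta> = \<epsilon> / (2 * (b - a + 1))"
  have \<eta>: "\<eta> > 0" using \<epsilon> ab by (simp add: \<eta>_def)
  have "uniformly_continuous_on {a..b} g" using c by (rule compact_uniformly_continuous) simp
  then obtain \<delta> where \<delta>: "\<delta> > 0" "\<And>s t. s \<in> {a..b} ==> t \<in> {a..b} ==> dist s t < \<delta> ==> dist (g s) (g t) < \<eta>"
    using \<eta> unfolding uniformly_continuous_on_def by metis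
  obtain m0 where m0: "(b - a) / \<delta> < real m0" using reals_Archimedean2 by blast
  show "\<forall>\<^sub>F m in sequentially. dist ((b - a) / real (Suc m) * (\<Sum>l=1..Suc m. g (a + real l * ((b - a) / real (Suc m))))) (integral {a..b} g) < \<epsilon>"
  proof (rule eventually_sequentiallyI[of m0])
    fix m assume m: "m0 \<le> m"
    define h where "h = (b - a) / real (Suc m)"
    have h0: "0 \<le> h" using ab by (simp add: h_def)
    have mh: "real (Suc m) * h = b - a" by (simp add: h_def)
    have h\<delta>: "h < \<delta>"
    proof -
      have "(b - a) / \<delta> < real (Suc m)" using m0 m by (simp add: less_le_trans)
      then show ?thesis using \<delta>(1) by (simp add: h_def field_simps)
    qed
    have in1: "a + real l * h \<in> {a..b}" if "l \<in> {0..Suc m}" for l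
    proof -
      have "real l * h \<le> real (Suc m) * h" using that h0 by (intro mult_right_mono) auto
      then show ?thesis using h0 mh by auto
    qed
    have in2: "a + real (l - 1) * h + r \<in> {a..b}" "dist (a + real (l - 1) * h + r) (a + real l * h) < \<delta>"
      if l: "l \<in> {1..Suc m}" and r: "r \<in> {0..h}" for l r
    proof -
      have e: "real l * h = real (l - 1) * h + h" using l by (simp add: of_nat_diff algebra_simps)
      show "a + real (l - 1) * h + r \<in> {a..b}" using in1[of l] in1[of "l - 1"] l r e by auto
      show "dist (a + real (l - 1) * h + r) (a + real l * h) < \<delta>" using r e h\<delta> by (simp add: dist_real_def)
    qed
    have cs: "continuous_on {0..h} (\<lambda>r. \<Sum>l=1..Suc m. g (a + real (l - 1) * h + r))"
    proof (rule continuous_on_sum)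
      fix l assume "l \<in> {1..Suc m}"
      then have "(\<lambda>r. a + real (l - 1) * h + r) ` {0..h} \<subseteq> {a..b}" using in2 by blast
      then show "continuous_on {0..h} (\<lambda>r. g (a + real (l - 1) * h + r))"
        by (rule continuous_on_compose2[OF c, rotated]) (intro continuous_intros)
    qed
    have I: "integral {a..b} g = integral {0..h} (\<lambda>r. \<Sum>l=1..Suc m. g (a + real (l - 1) * h + r))"
      using integral_substeps[of h a "Suc m" g] h0 c mh by simp
    have J: "h * (\<Sum>l=1..Suc m. g (a + real l * h)) = integral {0..h} (\<lambda>r. \<Sum>l=1..Suc m. g (a + real l * h))"
      using h0 by simp
    have "\<bar>integral {0..h} (\<lambda>r. (\<Sum>l=1..Suc m. g (a + real (l - 1) * h + r)) - (\<Sum>l=1..Suc m. g (a + real l * h)))\<bar> \<le> integral {0..h} (\<lambda>r. real (Suc m) * \<eta>)"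
      unfolding real_norm_def[symmetric]
    proof (rule integral_norm_bound_integral)
      show "(\<lambda>r. (\<Sum>l=1..Suc m. g (a + real (l - 1) * h + r)) - (\<Sum>l=1..Suc m. g (a + real l * h))) integrable_on {0..h}"
        by (rule integrable_continuous_real[OF continuous_on_diff[OF cs continuous_on_const]])
      fix r assume r: "r \<in> {0..h}"
      have "norm (\<Sum>l=1..Suc m. g (a + real (l - 1) * h + r) - g (a + real l * h)) \<le> (\<Sum>l=1..Suc m. \<eta>)"
      proof (rule sum_norm_le)
        fix l assume l: "l \<in> {1..Suc m}"
        show "norm (g (a + real (l - 1) * h + r) - g (a + real l * h)) \<le> \<eta>"
          using \<delta>(2)[OF in2(1)[OF l r] in1[of l] in2(2)[OF l r]] l by (simp add: dist_real_def)
      qed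
      then show "norm ((\<Sum>l=1..Suc m. g (a + real (l - 1) * h + r)) - (\<Sum>l=1..Suc m. g (a + real l * h))) \<le> real (Suc m) * \<eta>"
        by (simp only: sum_subtractf) simp
    qed (intro integrable_const_ivl)
    also have "integral {0..h} (\<lambda>r. real (Suc m) * \<eta>) = (b - a) * \<eta>"
      using h0 mh by (simp add: mult.assoc[symmetric] mult.commute)
    also have "\<dots> < \<epsilon>"
    proof -
      have "\<epsilon> * (b - a) < \<epsilon> * (2 * (b - a + 1))" using ab by (intro mult_strict_left_mono \<epsilon>) auto
      then show ?thesis using ab by (simp add: \<eta>_def divide_less_eq mult.commute)
    qed
    finally have "\<bar>integral {a..b} g - h * (\<Sum>l=1..Suc m. g (a + real l * h))\<bar> < \<epsilon>"
      unfolding I J by (simp only: integral_diff[OF integrable_continuous_real[OF cs] integrable_const_ivl])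
    then show "dist ((b - a) / real (Suc m) * (\<Sum>l=1..Suc m. g (a + real l * ((b - a) / real (Suc m))))) (integral {a..b} g) < \<epsilon>"
      unfolding h_def[symmetric] dist_real_def by (simp add: abs_minus_commute)
  qed
qed

text \<open>Continuity in time makes the integral an almost sure limit of Riemann sums, so
  measurability at each fixed time is enough; completeness removes the exceptional set.\<close>

lemma (in complete_measure) time_integral_measurable:
  fixes f :: "real \<Rightarrow> 'a \<Rightarrow> real"
  assumes ab: "a \<le> b" and f: "\<And>s. s \<in> {a..b} ==> f s \<in> borel_measurable M"
    and c: "AE w in M. continuous_on {a..b} (\<lambda>s. f s w)"
  shows "(\<lambda>w. integral {a..b} (\<lambda>s. f s w)) \<in> borel_measurable M"
proof -
  define R where "R m w = (b - a) / real (Suc m) * (\<Sum>l=1..Suc m. f (a + real l * ((b - a) / real (Suc m))) w)" for m w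
  have tin: "a + real l * ((b - a) / real (Suc m)) \<in> {a..b}" if "l \<in> {1..Suc m}" for l m
  proof -
    have "real l * ((b - a) / real (Suc m)) \<le> real (Suc m) * ((b - a) / real (Suc m))"
      using that ab by (intro mult_right_mono) auto
    then show ?thesis using ab by auto
  qed
  have Rm [measurable]: "R m \<in> borel_measurable M" for m
    unfolding R_def[abs_def] by (intro borel_measurable_times borel_measurable_const borel_measurable_sum f tin)
  have "AE w in M. lim (\<lambda>m. R m w) = integral {a..b} (\<lambda>s. f s w)"
    using c unfolding R_def by eventually_elim (rule limI, rule riemann_sum_tendsto[OF ab])
  then show ?thesis
    by (rule borel_measurable_cong_AE[rotated]) measurable
qed

text \<open>Cauchy-Schwarz for the Riemann sums gives the bound uniformly in the mesh, and Fatou's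
  lemma carries it to the integral.\<close>

lemma (in complete_measure) mb_time_integral:
  fixes f :: "real \<Rightarrow> 'a \<Rightarrow> real"
  assumes ab: "a \<le> b"
    and f: "\<And>s. s \<in> {a..b} ==> f s \<in> borel_measurable M" "\<And>s. s \<in> {a..b} ==> mb M (\<lambda>w. (f s w)^2) C"
    and c: "AE w in M. continuous_on {a..b} (\<lambda>s. f s w)"
  shows "mb M (\<lambda>w. (integral {a..b} (\<lambda>s. f s w))^2) ((b - a)^2 * C)"
proof -
  define R where "R m w = (b - a) / real (Suc m) * (\<Sum>l=1..Suc m. f (a + real l * ((b - a) / real (Suc m))) w)" for m w
  have tin: "a + real l * ((b - a) / real (Suc m)) \<in> {a..b}" if "l \<in> {1..Suc m}" for l m
  proof -
    have "real l * ((b - a) / real (Suc m)) \<le> real (Suc m) * ((b - a) / real (Suc m))"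
      using that ab by (intro mult_right_mono) auto
    then show ?thesis using ab by auto
  qed
  have Rm [measurable]: "R m \<in> borel_measurable M" for m
    unfolding R_def[abs_def] by (intro borel_measurable_times borel_measurable_const borel_measurable_sum f tin)
  have lim: "AE w in M. (\<lambda>m. R m w) \<longlonglongrightarrow> integral {a..b} (\<lambda>s. f s w)"
    using c unfolding R_def by eventually_elim (rule riemann_sum_tendsto[OF ab])
  have C0: "0 \<le> C" using f(2)[of a] ab by (simp add: mb_def)
  have Im [measurable]: "(\<lambda>w. integral {a..b} (\<lambda>s. f s w)) \<in> borel_measurable M"
    by (rule time_integral_measurable[OF ab f(1) c])
  have Rb: "(\<integral>\<^sup>+w. ennreal ((R m w)^2) \<partial>M) \<le> ennreal ((b - a)^2 * C)" for m
  proof -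
    have "mb M (\<lambda>w. (b - a)^2 / real (Suc m) * (\<Sum>l=1..Suc m. (f (a + real l * ((b - a) / real (Suc m))) w)^2))
        ((b - a)^2 / real (Suc m) * (\<Sum>l=1..Suc m. C))"
      by (intro mb_scale mb_sum f tin) auto
    then have "mb M (\<lambda>w. (R m w)^2) ((b - a)^2 / real (Suc m) * (\<Sum>l=1..Suc m. C))"
    proof (rule mb_mono)
      fix w
      have "(\<Sum>l=1..Suc m. f (a + real l * ((b - a) / real (Suc m))) w)^2 \<le>
          real (Suc m) * (\<Sum>l=1..Suc m. (f (a + real l * ((b - a) / real (Suc m))) w)^2)"
        using Cauchy_Schwarz_ineq_sum[of "\<lambda>l. 1" "\<lambda>l. f (a + real l * ((b - a) / real (Suc m))) w" "{1..Suc m}"] by simp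
      then have "((b - a) / real (Suc m))^2 * (\<Sum>l=1..Suc m. f (a + real l * ((b - a) / real (Suc m))) w)^2 \<le>
          ((b - a) / real (Suc m))^2 * (real (Suc m) * (\<Sum>l=1..Suc m. (f (a + real l * ((b - a) / real (Suc m))) w)^2))"
        by (rule mult_left_mono) simp
      also have "\<dots> = (b - a)^2 / real (Suc m) * (\<Sum>l=1..Suc m. (f (a + real l * ((b - a) / real (Suc m))) w)^2)"
        by (simp add: power2_eq_square)
      finally show "(R m w)^2 \<le> (b - a)^2 / real (Suc m) * (\<Sum>l=1..Suc m. (f (a + real l * ((b - a) / real (Suc m))) w)^2)"
        unfolding R_def by (simp only: power_mult_distrib)
    qed auto
    moreover have "(b - a)^2 / real (Suc m) * (\<Sum>l=1..Suc m. C) = (b - a)^2 * C" by simp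
    ultimately show ?thesis by (simp only: mb_def)
  qed
  have "(\<integral>\<^sup>+w. ennreal ((integral {a..b} (\<lambda>s. f s w))^2) \<partial>M) = (\<integral>\<^sup>+w. liminf (\<lambda>m. ennreal ((R m w)^2)) \<partial>M)"
  proof (rule nn_integral_cong_AE)
    show "AE w in M. ennreal ((integral {a..b} (\<lambda>s. f s w))^2) = liminf (\<lambda>m. ennreal ((R m w)^2))"
      using lim
    proof eventually_elim
      case (elim w)
      then have "(\<lambda>m. ennreal ((R m w)^2)) \<longlonglongrightarrow> ennreal ((integral {a..b} (\<lambda>s. f s w))^2)"
        by (intro tendsto_intros)
      then show ?case by (rule lim_imp_Liminf[rotated, symmetric]) simp
    qed
  qed
  also have "\<dots> \<le> liminf (\<lambda>m. \<integral>\<^sup>+w. ennreal ((R m w)^2) \<partial>M)"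
    by (rule nn_integral_liminf) measurable
  also have "\<dots> \<le> ennreal ((b - a)^2 * C)"
    by (rule Liminf_le, simp, rule always_eventually, rule allI, rule Rb)
  finally show ?thesis using C0 by (simp add: mb_def)
qed

section \<open>Random fields\<close>

lemma fcm_add: "fcm M X ==> fcm M Y ==> (\<And>w. w \<in> space M ==> X w \<in> L2t) ==> (\<And>w. w \<in> space M ==> Y w \<in> L2t) ==> fcm M (\<lambda>w x. X w x + Y w x)"
  using fcm_lin[of M X Y 1 1] by simp

lemma fcm_diff: "fcm M X ==> fcm M Y ==> (\<And>w. w \<in> space M ==> X w \<in> L2t) ==> (\<And>w. w \<in> space M ==> Y w \<in> L2t) ==> fcm M (\<lambda>w x. X w x - Y w x)"
  using fcm_lin[of M X Y 1 "-1"] by simp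

lemma fcm_scaleR: "fcm M X ==> (\<And>w. w \<in> space M ==> X w \<in> L2t) ==> fcm M (\<lambda>w x. c *\<^sub>R X w x)"
  using fcm_lin[of M X X c 0] by simp

definition rf :: "nat \<Rightarrow> 'a measure \<Rightarrow> ('a \<Rightarrow> 'b::euclidean_space field) \<Rightarrow> bool" where
  "rf k M X \<longleftrightarrow> fcm M X \<and> (\<forall>w\<in>space M. X w \<in> Hk k)"

lemma rf_measurable: "rf k M X ==> (\<lambda>w. Hk_norm k (X w)) \<in> borel_measurable M"
  unfolding rf_def by (intro fcm_norm) auto

lemma rf_Hk: "rf k M X ==> w \<in> space M ==> X w \<in> Hk k"
  by (simp add: rf_def)

lemma Hk_measurable_rf: "Hk_measurable k M X ==> rf k M X"
  using Hk_measurable_fcm[of k M X] by (simp add: rf_def Hk_measurable_def)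

lemma rf_mono: "rf k M X ==> j \<le> k ==> rf j M X"
  unfolding rf_def using Hk_le by blast

lemma rf_add: "rf k M X ==> rf k M Y ==> rf k M (\<lambda>w x. X w x + Y w x)"
  unfolding rf_def by (auto intro!: fcm_add dest: Hk_L2t)

lemma rf_diff: "rf k M X ==> rf k M Y ==> rf k M (\<lambda>w x. X w x - Y w x)"
  unfolding rf_def by (auto intro!: fcm_diff dest: Hk_L2t)

lemma rf_scaleR: "rf k M X ==> rf k M (\<lambda>w x. c *\<^sub>R X w x)"
  unfolding rf_def by (auto intro!: fcm_scaleR dest: Hk_L2t)

lemma rf_zero: "rf k M (\<lambda>w x. 0)"
  by (simp add: rf_def fcm_def)

lemma rf_sum: "(\<And>i. i \<in> I ==> rf k M (X i)) ==> rf k M (\<lambda>w x. \<Sum>i\<in>I. X i w x)"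
  by (induction I rule: infinite_finite_induct) (auto intro!: rf_add rf_zero)

lemma rf_power: "rf k M X ==> (\<lambda>w. (Hk_norm k (X w)) ^ j) \<in> borel_measurable M"
  using rf_measurable[of k M X] by measurable

text \<open>From (p + q)^4 <= 8 p^4 + 8 q^4, obtained by applying (p + q)^2 <= 2 p^2 + 2 q^2
  twice.\<close>

lemma mb_fourth_lin:
  assumes X: "rf k M X" "mb M (\<lambda>w. Hk_norm k (X w) ^ 4) C" and Y: "rf k M Y" "mb M (\<lambda>w. Hk_norm k (Y w) ^ 4) D"
  shows "mb M (\<lambda>w. Hk_norm k (\<lambda>x. a *\<^sub>R X w x + b *\<^sub>R Y w x) ^ 4) (8 * a ^ 4 * C + 8 * b ^ 4 * D)"
proof (rule mb_mono[OF mb_add[OF mb_scale[OF X(2), of "8 * a ^ 4"] mb_scale[OF Y(2), of "8 * b ^ 4"]]])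
  show "(\<lambda>w. Hk_norm k (\<lambda>x. a *\<^sub>R X w x + b *\<^sub>R Y w x) ^ 4) \<in> borel_measurable M"
    by (intro rf_power rf_add rf_scaleR X Y)
  fix w assume w: "w \<in> space M"
  define p q where "p = \<bar>a\<bar> * Hk_norm k (X w)" and "q = \<bar>b\<bar> * Hk_norm k (Y w)"
  have pq: "0 \<le> p" "0 \<le> q" by (auto simp: p_def q_def)
  have "Hk_norm k (\<lambda>x. a *\<^sub>R X w x + b *\<^sub>R Y w x) \<le> p + q"
    using Hk_triangle[OF Hk_scaleR[OF rf_Hk[OF X(1) w], of a] Hk_scaleR[OF rf_Hk[OF Y(1) w], of b]]
    by (simp add: Hk_norm_scaleR rf_Hk[OF X(1) w] rf_Hk[OF Y(1) w] p_def q_def)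
  then have "Hk_norm k (\<lambda>x. a *\<^sub>R X w x + b *\<^sub>R Y w x) ^ 4 \<le> (p + q) ^ 4" by (intro power_mono) auto
  also have "\<dots> \<le> 8 * p ^ 4 + 8 * q ^ 4"
  proof -
    have "(p + q)^2 \<le> 2 * p^2 + 2 * q^2" using sum_squares_bound[of p q] by (simp add: power2_sum)
    then have "((p + q)^2)^2 \<le> (2 * p^2 + 2 * q^2)^2" by (intro power_mono) auto
    also have "\<dots> \<le> 8 * (p^2)^2 + 8 * (q^2)^2"
      using sum_squares_bound[of "p^2" "q^2"] by (simp add: power2_sum power_mult_distrib)
    finally show ?thesis by (simp add: power_mult[symmetric])
  qed
  finally show "Hk_norm k (\<lambda>x. a *\<^sub>R X w x + b *\<^sub>R Y w x) ^ 4 \<le> 8 * a ^ 4 * Hk_norm k (X w) ^ 4 + 8 * b ^ 4 * Hk_norm k (Y w) ^ 4"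
    by (simp add: p_def q_def power_mult_distrib)
qed auto

text \<open>\<open>Lp_norm\<close> is 0 when the integrand is not integrable, so a bound on it
  carries information only together with some finite moment, which \<open>fin\<close>
  supplies.\<close>

lemma Lp_norm_mb:
  assumes Z: "rf k M Z" and fin: "mb M (\<lambda>w. Hk_norm k (Z w) ^ j) C" and j: "0 < j"
    and le: "Lp_norm M (real j) k Z \<le> \<epsilon>"
  shows "mb M (\<lambda>w. Hk_norm k (Z w) ^ j) (\<epsilon> ^ j)"
proof (rule mbI_integral)
  show "integrable M (\<lambda>w. Hk_norm k (Z w) ^ j)" using fin by (rule mb_integral)
  define I where "I = (\<integral>w. Hk_norm k (Z w) ^ j \<partial>M)"
  have I0: "0 \<le> I" by (simp add: I_def)
  have pw: "Hk_norm k f powr real j = Hk_norm k f ^ j" for f :: "'b field"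
  proof (cases "Hk_norm k f = 0")
    case False
    then have "0 < Hk_norm k f" using Hk_norm_ge0[of k f] by linarith
    then show ?thesis by (rule powr_realpow)
  qed (use j in simp)
  have "I powr (1 / real j) \<le> \<epsilon>"
    using le unfolding Lp_norm_def pw I_def .
  then have "(I powr (1 / real j)) ^ j \<le> \<epsilon> ^ j" by (intro power_mono) auto
  moreover have "(I powr (1 / real j)) ^ j = I"
    using I0 j by (cases "I = 0") (auto simp: powr_realpow[symmetric] powr_powr)
  ultimately show "(\<integral>w. Hk_norm k (Z w) ^ j \<partial>M) \<le> \<epsilon> ^ j" by (simp add: I_def)
qed simp

section \<open>Fourth moments of Gaussian random fields\<close>

lemma (in prob_space) normal_fourth:
  assumes \<sigma>: "0 < \<sigma>" and X: "distributed M lborel X (normal_density 0 \<sigma>)"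
  shows "mb M (\<lambda>w. X w ^ 4) (3 * \<sigma> ^ 4)"
proof (rule mbI_integral)
  have m: "has_bochner_integral lborel (\<lambda>x. normal_density 0 \<sigma> x * x ^ 4) (3 * \<sigma> ^ 4)"
    using normal_moment_even[OF \<sigma>, of 0 2] by (simp add: fact_numeral power_divide)
  show "integrable M (\<lambda>w. X w ^ 4)"
    using m by (subst distributed_integrable[OF X, symmetric]) (auto simp: has_bochner_integral_iff)
  show "(\<integral>w. X w ^ 4 \<partial>M) \<le> 3 * \<sigma> ^ 4"
    using m by (subst distributed_integral[OF X, symmetric]) (auto simp: has_bochner_integral_iff)
qed simp

lemma (in prob_space) gaussian_sum_fourth:
  assumes J: "finite J" and ind: "indep_vars (\<lambda>_. borel) X J" and v: "0 < v"
    and X: "\<And>k. k \<in> J ==> distributed M lborel (X k) (normal_density 0 (sqrt v))"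
  shows "mb M (\<lambda>w. (\<Sum>k\<in>J. X k w * a k) ^ 4) (3 * v^2 * (\<Sum>k\<in>J. (a k)^2)^2)"
proof -
  \<comment> \<open>Terms with coefficient 0 are dropped because a normal density needs a positive
    variance.\<close>
  define J' where "J' = {k\<in>J. a k \<noteq> 0}"
  have J': "finite J'" "J' \<subseteq> J" using J by (auto simp: J'_def)
  have eq: "(\<Sum>k\<in>J. X k w * a k) = (\<Sum>k\<in>J'. X k w * a k)" for w
    using J by (intro sum.mono_neutral_right) (auto simp: J'_def)
  have eq2: "(\<Sum>k\<in>J. (a k)^2) = (\<Sum>k\<in>J'. (a k)^2)"
    using J by (intro sum.mono_neutral_right) (auto simp: J'_def)
  show ?thesis
  proof (cases "J' = {}")
    case True
    then show ?thesis unfolding eq eq2 by (simp add: mb_zero)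
  next
    case False
    define s where "s = (\<Sum>k\<in>J'. (a k)^2)"
    have s: "0 < s" unfolding s_def using J' False by (intro sum_pos) (auto simp: J'_def)
    have "indep_vars (\<lambda>_. borel) (\<lambda>k w. X k w * a k) J'"
      by (rule indep_vars_compose2[OF indep_vars_subset[OF ind J'(2)]]) measurable
    moreover have "distributed M lborel (\<lambda>w. X k w * a k) (normal_density 0 (\<bar>a k\<bar> * sqrt v))" if "k \<in> J'" for k
      using normal_density_affine[OF X[of k], of "a k" 0] that v J' by (auto simp: J'_def mult.commute)
    ultimately have "distributed M lborel (\<lambda>w. \<Sum>k\<in>J'. X k w * a k) (normal_density (\<Sum>k\<in>J'. 0) (sqrt (\<Sum>k\<in>J'. (\<bar>a k\<bar> * sqrt v)^2)))"
      using J' False v by (intro sum_indep_normal) (auto simp: J'_def)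
    moreover have "(\<Sum>k\<in>J'. (\<bar>a k\<bar> * sqrt v)^2) = s * v"
      using v by (simp add: s_def power_mult_distrib sum_distrib_right)
    ultimately have "distributed M lborel (\<lambda>w. \<Sum>k\<in>J'. X k w * a k) (normal_density 0 (sqrt (s * v)))"
      by simp
    from normal_fourth[OF _ this] have "mb M (\<lambda>w. (\<Sum>k\<in>J'. X k w * a k) ^ 4) (3 * sqrt (s * v) ^ 4)"
      using s v by simp
    moreover have "sqrt (s * v) ^ 4 = (s * v)^2"
      using s v power_mult[of "sqrt (s * v)" 2 2] by simp
    ultimately show ?thesis
      unfolding eq eq2 s_def[symmetric] by (simp add: power_mult_distrib mult_ac)
  qed
qed

text \<open>Passing to a limit in a bound on moments is Fatou's lemma.\<close>

lemma mb_liminf: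
  assumes f: "f \<in> borel_measurable M" "\<And>w. w \<in> space M ==> 0 \<le> f w" and g: "\<And>n::nat. mb M (g n) C"
    and lim: "AE w in M. (\<lambda>n. g n w) \<longlonglongrightarrow> f w"
  shows "mb M f C"
proof -
  have "(\<integral>\<^sup>+w. ennreal (f w) \<partial>M) = (\<integral>\<^sup>+w. liminf (\<lambda>n. ennreal (g n w)) \<partial>M)"
  proof (rule nn_integral_cong_AE)
    show "AE w in M. ennreal (f w) = liminf (\<lambda>n. ennreal (g n w))"
      using lim
    proof eventually_elim
      case (elim w)
      then have "(\<lambda>n. ennreal (g n w)) \<longlonglongrightarrow> ennreal (f w)" by (intro tendsto_intros)
      then show ?case by (rule lim_imp_Liminf[rotated, symmetric]) simp
    qed
  qed
  also have "\<dots> \<le> liminf (\<lambda>n. \<integral>\<^sup>+w. ennreal (g n w) \<partial>M)"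
    by (rule nn_integral_liminf) (use g in \<open>auto simp: mb_def\<close>)
  also have "\<dots> \<le> ennreal C"
    by (rule Liminf_le, simp, rule always_eventually) (use g in \<open>auto simp: mb_def\<close>)
  finally show ?thesis using f g[of 0] by (simp add: mb_def)
qed

lemma Hk_coord_bessel:
  assumes \<phi>: "\<phi> \<in> Hk k"
  shows "(\<Sum>\<kappa>\<in>freqs n. \<Sum>b\<in>Basis. wt k \<kappa> * (fc \<kappa> \<phi> \<bullet> b)^2) \<le> (Hk_norm k \<phi>)^2"
proof -
  have "(\<Sum>\<kappa>\<in>freqs n. \<Sum>b\<in>Basis. wt k \<kappa> * (fc \<kappa> \<phi> \<bullet> b)^2) = (\<Sum>\<kappa>\<in>freqs n. wt k \<kappa> * (norm (fc \<kappa> \<phi>))^2)"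
    by (simp add: norm_sq_Basis sum_distrib_left)
  also have "\<dots> \<le> (Hk_norm k \<phi>)^2"
  proof (rule finite_sum_le_has_sum[OF Hk_parseval'[OF \<phi>]])
    show "0 \<le> wt k \<kappa> * (norm (fc \<kappa> \<phi>))^2" for \<kappa> using wt_ge1[of k \<kappa>] by simp
  qed auto
  finally show ?thesis .
qed

text \<open>Each weighted Fourier coordinate is a scalar Gaussian with variance v s(i) and fourth
  moment 3 v^2 s(i)^2. The coordinates may be correlated: Cauchy-Schwarz with weights s(i) bounds
  the squared sum of squares by the total of the s(i) times the sum of L(i)^4 / s(i), whose
  expectation is 3 v^2 times that total. Bessel bounds the total by the squared norms of the fields,
  and Fatou handles infinitely many coordinates.\<close>

lemma (in prob_space) gaussian_field_fourth:
  fixes \<phi> :: "nat \<Rightarrow> 'b::euclidean_space field"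
  assumes J: "finite J" and ind: "indep_vars (\<lambda>_. borel) X J" and v: "0 < v"
    and X: "\<And>j. j \<in> J ==> distributed M lborel (X j) (normal_density 0 (sqrt v))"
    and \<phi>: "\<And>j. j \<in> J ==> \<phi> j \<in> Hk k"
  shows "rf k M (\<lambda>w x. \<Sum>j\<in>J. X j w *\<^sub>R \<phi> j x)"
    and "mb M (\<lambda>w. Hk_norm k (\<lambda>x. \<Sum>j\<in>J. X j w *\<^sub>R \<phi> j x) ^ 4) (3 * v^2 * (\<Sum>j\<in>J. (Hk_norm k (\<phi> j))^2)^2)"
proof -
  have Xm [measurable]: "X j \<in> borel_measurable M" if "j \<in> J" for j
    using distributed_measurable[OF X[OF that]] by simp
  define S where "S w = (\<lambda>x. \<Sum>j\<in>J. X j w *\<^sub>R \<phi> j x)" for w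
  have SH: "S w \<in> Hk k" for w unfolding S_def by (intro Hk_sum Hk_scaleR \<phi>)
  have fcS: "fc \<kappa> (S w) = (\<Sum>j\<in>J. X j w *\<^sub>R fc \<kappa> (\<phi> j))" for \<kappa> w
    unfolding S_def by (subst fc_sum) (auto intro: Hk_L2t[OF \<phi>] simp: fc_scaleR)
  show rf: "rf k M (\<lambda>w x. \<Sum>j\<in>J. X j w *\<^sub>R \<phi> j x)"
    unfolding rf_def fcm_def S_def[symmetric] fcS using SH by auto
  define A where "A = (\<Sum>j\<in>J. (Hk_norm k (\<phi> j))^2)"
  define L where "L i f = sqrt (wt k (fst i)) * (fc (fst i) f \<bullet> snd i)" for i and f :: "'b field"
  define I where "I n = freqs n \<times> (Basis :: 'b set)" for n
  define s where "s i = (\<Sum>j\<in>J. (L i (\<phi> j))^2)" for i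
  have w: "0 \<le> wt k \<kappa>" for \<kappa> using wt_ge1[of k \<kappa>] by simp
  have LS: "L i (S w) = (\<Sum>j\<in>J. X j w * L i (\<phi> j))" for i w
    by (simp add: L_def fcS inner_sum_left sum_distrib_left mult_ac)
  have sumI: "(\<Sum>i\<in>I n. (L i f)^2) = (\<Sum>\<kappa>\<in>freqs n. \<Sum>b\<in>Basis. wt k \<kappa> * (fc \<kappa> f \<bullet> b)^2)" for n f
    unfolding I_def by (subst sum.cartesian_product) (simp add: L_def power_mult_distrib w split_def)
  have fourth: "mb M (\<lambda>w. L i (S w) ^ 4) (3 * v^2 * (s i)^2)" for i
    unfolding LS s_def by (rule gaussian_sum_fourth[OF J ind v X])
  have sA: "(\<Sum>i\<in>I n. s i) \<le> A" for n
  proof -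
    have "(\<Sum>i\<in>I n. s i) = (\<Sum>j\<in>J. \<Sum>i\<in>I n. (L i (\<phi> j))^2)"
      unfolding s_def by (rule sum.swap)
    also have "\<dots> \<le> A"
      unfolding A_def sumI by (intro sum_mono Hk_coord_bessel \<phi>)
    finally show ?thesis .
  qed
  have s0: "0 \<le> s i" for i by (simp add: s_def sum_nonneg)
  have part: "mb M (\<lambda>w. (\<Sum>i\<in>I n. (L i (S w))^2)^2) (3 * v^2 * A^2)" for n
  proof -
    \<comment> \<open>Coordinates of variance 0 vanish identically; without them division by s(i) is
      possible.\<close>
    define I' where "I' = {i\<in>I n. s i \<noteq> 0}"
    define \<sigma> where "\<sigma> = (\<Sum>i\<in>I'. s i)"
    have fin: "finite (I n)" "finite I'" by (auto simp: I_def I'_def)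
    have L0: "L i (S w) = 0" if "s i = 0" for i w
    proof -
      have "\<forall>j\<in>J. (L i (\<phi> j))^2 = 0" using that J unfolding s_def by (subst (asm) sum_nonneg_eq_0_iff) auto
      then show ?thesis by (simp add: LS)
    qed
    have eq: "(\<Sum>i\<in>I n. (L i (S w))^2) = (\<Sum>i\<in>I'. (L i (S w))^2)" for w
      using fin L0 by (intro sum.mono_neutral_right) (auto simp: I'_def)
    have \<sigma>A: "0 \<le> \<sigma>" "\<sigma> \<le> A"
    proof -
      show "0 \<le> \<sigma>" unfolding \<sigma>_def by (intro sum_nonneg s0)
      have "\<sigma> \<le> (\<Sum>i\<in>I n. s i)" unfolding \<sigma>_def using fin s0 by (intro sum_mono2) (auto simp: I'_def)
      then show "\<sigma> \<le> A" using sA by (rule order_trans)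
    qed
    have "mb M (\<lambda>w. \<sigma> * (\<Sum>i\<in>I'. (1 / s i) * L i (S w) ^ 4)) (\<sigma> * (\<Sum>i\<in>I'. (1 / s i) * (3 * v^2 * (s i)^2)))"
      using fin s0 \<sigma>A by (intro mb_scale mb_sum fourth) auto
    then show ?thesis
    proof (rule mb_mono)
      show "(\<lambda>w. (\<Sum>i\<in>I n. (L i (S w))^2)^2) \<in> borel_measurable M"
        unfolding LS by measurable
      have "(\<Sum>i\<in>I'. (1 / s i) * (3 * v^2 * (s i)^2)) = 3 * v^2 * \<sigma>"
        unfolding \<sigma>_def sum_distrib_left by (intro sum.cong) (auto simp: I'_def power2_eq_square)
      moreover have "\<sigma> * (3 * v^2 * \<sigma>) \<le> 3 * v^2 * A^2"
      proof -
        have "\<sigma>^2 \<le> A^2" using \<sigma>A by (intro power_mono) auto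
        then have "3 * v^2 * \<sigma>^2 \<le> 3 * v^2 * A^2" by (intro mult_left_mono) auto
        then show ?thesis by (simp add: power2_eq_square mult_ac)
      qed
      ultimately show "\<sigma> * (\<Sum>i\<in>I'. (1 / s i) * (3 * v^2 * (s i)^2)) \<le> 3 * v^2 * A^2" by simp
      fix w
      have "(\<Sum>i\<in>I'. sqrt (s i) * ((L i (S w))^2 / sqrt (s i)))^2 \<le> (\<Sum>i\<in>I'. (sqrt (s i))^2) * (\<Sum>i\<in>I'. ((L i (S w))^2 / sqrt (s i))^2)"
        by (rule Cauchy_Schwarz_ineq_sum)
      moreover have "(\<Sum>i\<in>I'. sqrt (s i) * ((L i (S w))^2 / sqrt (s i))) = (\<Sum>i\<in>I'. (L i (S w))^2)"
        by (intro sum.cong) (auto simp: I'_def)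
      moreover have "(\<Sum>i\<in>I'. (sqrt (s i))^2) = \<sigma>" by (simp add: \<sigma>_def s0)
      moreover have "(\<Sum>i\<in>I'. ((L i (S w))^2 / sqrt (s i))^2) = (\<Sum>i\<in>I'. (1 / s i) * L i (S w) ^ 4)"
        by (intro sum.cong) (auto simp: power_divide s0 power_mult[symmetric])
      ultimately show "(\<Sum>i\<in>I n. (L i (S w))^2)^2 \<le> \<sigma> * (\<Sum>i\<in>I'. (1 / s i) * L i (S w) ^ 4)"
        unfolding eq by simp
    qed simp
  qed
  have "mb M (\<lambda>w. Hk_norm k (S w) ^ 4) (3 * v^2 * A^2)"
  proof (rule mb_liminf[OF _ _ part])
    show "(\<lambda>w. Hk_norm k (S w) ^ 4) \<in> borel_measurable M"
      using rf_power[OF rf] by (simp add: S_def)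
    show "AE w in M. (\<lambda>n. (\<Sum>i\<in>I n. (L i (S w))^2)^2) \<longlonglongrightarrow> Hk_norm k (S w) ^ 4"
    proof (rule AE_I2)
      fix w
      have "(\<lambda>n. (\<Sum>\<kappa>\<in>freqs n. wt k \<kappa> * (norm (fc \<kappa> (S w)))^2)^2) \<longlonglongrightarrow> ((Hk_norm k (S w))^2)^2"
        by (intro tendsto_power has_sum_freqs Hk_parseval' SH)
      then show "(\<lambda>n. (\<Sum>i\<in>I n. (L i (S w))^2)^2) \<longlonglongrightarrow> Hk_norm k (S w) ^ 4"
        unfolding sumI by (simp add: norm_sq_Basis sum_distrib_left power_mult[symmetric])
    qed
  qed simp
  then show "mb M (\<lambda>w. Hk_norm k (\<lambda>x. \<Sum>j\<in>J. X j w *\<^sub>R \<phi> j x) ^ 4) (3 * v^2 * (\<Sum>j\<in>J. (Hk_norm k (\<phi> j))^2)^2)"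
    by (simp add: S_def A_def)
qed

text \<open>Indices with squared distance at most 2^(-m) in mean make the squared distances summable
  almost surely, so the norms converge along them; Fatou's lemma then keeps the bound on fourth
  moments, although convergence holds only in mean square.\<close>

lemma mb_fourth_limit:
  fixes Z :: "'a \<Rightarrow> 'b::euclidean_space field"
  assumes Z: "rf k M Z" and S: "\<And>n. rf k M (S n)" and b: "\<And>n. mb M (\<lambda>w. Hk_norm k (S n w) ^ 4) C"
    and lim: "(\<lambda>n. \<integral>\<^sup>+w. ennreal ((Hk_norm k (\<lambda>x. Z w x - S n w x))^2) \<partial>M) \<longlonglongrightarrow> 0"
  shows "mb M (\<lambda>w. Hk_norm k (Z w) ^ 4) C"
proof -
  define D where "D n w = Hk_norm k (\<lambda>x. Z w x - S n w x)" for n w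
  have Dm [measurable]: "D n \<in> borel_measurable M" for n
    unfolding D_def[abs_def] by (rule rf_measurable[OF rf_diff[OF Z S]])
  have ex: "\<exists>n. (\<integral>\<^sup>+w. ennreal ((D n w)^2) \<partial>M) \<le> ennreal ((1/2) ^ m)" for m
  proof -
    have "\<forall>\<^sub>F n in sequentially. (\<integral>\<^sup>+w. ennreal ((D n w)^2) \<partial>M) < ennreal ((1/2) ^ m)"
      using lim unfolding D_def by (rule order_tendstoD) simp
    then obtain n where "(\<integral>\<^sup>+w. ennreal ((D n w)^2) \<partial>M) < ennreal ((1/2) ^ m)"
      by (rule eventually_sequentially[THEN iffD1, THEN exE]) blast
    then show ?thesis by (auto intro: less_imp_le)
  qed
  then obtain q where q: "\<And>m. (\<integral>\<^sup>+w. ennreal ((D (q m) w)^2) \<partial>M) \<le> ennreal ((1/2) ^ m)" by metis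
  have "(\<integral>\<^sup>+w. (\<Sum>m. ennreal ((D (q m) w)^2)) \<partial>M) = (\<Sum>m. \<integral>\<^sup>+w. ennreal ((D (q m) w)^2) \<partial>M)"
    by (rule nn_integral_suminf) measurable
  also have "\<dots> \<le> (\<Sum>m. ennreal ((1/2) ^ m))" by (intro suminf_le q) auto
  also have "\<dots> = ennreal (\<Sum>m. (1/2) ^ m)" by (rule suminf_ennreal2) (auto intro: summable_geometric)
  also have "\<dots> < \<infinity>" by simp
  finally have fin: "(\<integral>\<^sup>+w. (\<Sum>m. ennreal ((D (q m) w)^2)) \<partial>M) \<noteq> \<infinity>" by simp
  have "AE w in M. (\<Sum>m. ennreal ((D (q m) w)^2)) \<noteq> \<infinity>"
    by (rule nn_integral_PInf_AE[OF _ fin]) measurable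
  then have "AE w in M. (\<lambda>m. Hk_norm k (S (q m) w) ^ 4) \<longlonglongrightarrow> Hk_norm k (Z w) ^ 4"
    using AE_space
  proof eventually_elim
    case (elim w)
    have "summable (\<lambda>m. (D (q m) w)^2)"
      using elim(1) by (intro summable_suminf_not_top) auto
    then have "(\<lambda>m. (D (q m) w)^2) \<longlonglongrightarrow> 0" by (rule summable_LIMSEQ_zero)
    then have "(\<lambda>m. sqrt ((D (q m) w)^2)) \<longlonglongrightarrow> sqrt 0" by (intro tendsto_intros)
    then have D0: "(\<lambda>m. D (q m) w) \<longlonglongrightarrow> 0" by (simp add: D_def)
    have "(\<lambda>m. Hk_norm k (S (q m) w)) \<longlonglongrightarrow> Hk_norm k (Z w)"
    proof (rule tendsto_of_bound[OF D0], rule always_eventually, rule allI)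
      fix m
      show "\<bar>Hk_norm k (S (q m) w) - Hk_norm k (Z w)\<bar> \<le> D (q m) w"
        using Hk_triangle_abs[OF rf_Hk[OF Z elim(2)] rf_Hk[OF S elim(2)], of "q m"] by (simp add: D_def abs_minus_commute)
    qed
    then show ?case by (rule tendsto_power)
  qed
  then show ?thesis
    by (rule mb_liminf[OF rf_power[OF Z] _ b, rotated]) simp
qed

section \<open>Increments of the noise\<close>

locale noise =
  fixes P :: "'w measure" and F :: "real \<Rightarrow> 'w measure" and T :: real and K :: "nat set"
    and e :: "nat \<Rightarrow> 'u::real_inner" and W :: "nat \<Rightarrow> real \<Rightarrow> 'w \<Rightarrow> real"
    and \<Phi> :: "'u \<Rightarrow> (real^2) field" and PhiW :: "real \<Rightarrow> 'w \<Rightarrow> (real^2) field"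
  assumes basis: "stochastic_basis P F" and wiener: "cylindrical_wiener P F K W"
    and HS: "hilbert_schmidt K e 2 \<Phi>" and noise: "noise_process P F T K e \<Phi> W PhiW"

sublocale noise \<subseteq> prob_space P
  using basis by (simp add: stochastic_basis_def)

text \<open>Subsets of null sets already belong to the filtration at time 0, hence to P.\<close>

sublocale noise \<subseteq> complete_measure P
proof
  fix A B assume "B \<subseteq> A" "A \<in> null_sets P"
  moreover have "\<forall>N\<in>null_sets P. \<forall>A\<subseteq>N. A \<in> sets (F 0)" "\<forall>t\<ge>0. subalgebra P (F t)"
    using basis unfolding stochastic_basis_def by - (elim conjE, assumption)+
  ultimately have "B \<in> sets (F 0)" "subalgebra P (F 0)" by simp_all
  then show "B \<in> sets P" by (auto simp: subalgebra_def)
qed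

context noise
begin

text \<open>The squared Hilbert-Schmidt norm of the noise operator into H^2.\<close>

definition "hs_sq = (\<Sum>\<^sub>\<infinity>k\<in>K. (Hk_norm 2 (\<Phi> (e k)))^2)"

lemma filtration: "0 \<le> t ==> subalgebra P (F t)" "0 \<le> s ==> s \<le> t ==> subalgebra (F t) (F s)"
proof -
  have *: "\<forall>t\<ge>0. subalgebra P (F t)" "\<forall>s\<ge>0. \<forall>t\<ge>s. sets (F s) \<subseteq> sets (F t)"
    using basis unfolding stochastic_basis_def by - (elim conjE, assumption)+
  show "subalgebra P (F t)" if "0 \<le> t" using *(1) that by simp
  show "subalgebra (F t) (F s)" if "0 \<le> s" "s \<le> t"
    using *(1)[rule_format, of s] *(1)[rule_format, of t] *(2)[rule_format, of s t] that by (simp add: subalgebra_def)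
qed

text \<open>The final parts of m consecutive intervals of length h are used, each from offset r on.
  They are disjoint, and the partial sum is adapted to the start of the next one, so independence
  adds the variances to m (h - r).\<close>

lemma W_increments:
  assumes k: "k \<in> K" and a: "0 \<le> a" and r: "0 \<le> r" "r < h"
  defines "X \<equiv> \<lambda>m w. \<Sum>i<m. W k (a + real (Suc i) * h) w - W k (a + real i * h + r) w"
  shows "X m \<in> borel_measurable (F (a + real m * h))"
    and "0 < m ==> distributed P lborel (X m) (normal_density 0 (sqrt (real m * (h - r))))"
proof -
  have wp: "wiener_process P F (W k)" using wiener k by (simp add: cylindrical_wiener_def)
  have h: "0 < h" using r by simp
  have Wm: "W k t \<in> borel_measurable (F t)" if "0 \<le> t" for t using wp that by (simp add: wiener_process_def)
  have lift: "f \<in> borel_measurable (F t)" if "f \<in> borel_measurable (F s)" "0 \<le> s" "s \<le> t" for f :: "'w \<Rightarrow> real" and s t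
    using measurable_from_subalg[OF filtration(2)[OF that(2,3)] that(1)] .
  have t0: "0 \<le> a + real i * h" "0 \<le> a + real i * h + r" for i using a h r by auto
  have X: "X m \<in> borel_measurable (F (a + real m * h))" for m
  proof (induction m)
    case (Suc m)
    have "W k (a + real (Suc m) * h) \<in> borel_measurable (F (a + real (Suc m) * h))" by (rule Wm[OF t0(1)])
    moreover have "W k (a + real m * h + r) \<in> borel_measurable (F (a + real (Suc m) * h))"
      by (rule lift[OF Wm[OF t0(2)] t0(2)]) (use r in \<open>simp add: algebra_simps\<close>)
    moreover have "X m \<in> borel_measurable (F (a + real (Suc m) * h))"
      by (rule lift[OF Suc.IH t0(1)]) (use h in \<open>simp add: algebra_simps\<close>)
    ultimately show ?case unfolding X_def by (simp only: sum.lessThan_Suc) (intro borel_measurable_add borel_measurable_diff)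
  qed (simp add: X_def)
  show "X m \<in> borel_measurable (F (a + real m * h))" by (rule X)
  have D: "distributed P lborel (\<lambda>w. W k (a + real (Suc i) * h) w - W k (a + real i * h + r) w) (normal_density 0 (sqrt (h - r)))"
    and I: "indep_set (sets (F (a + real i * h + r)))
          {(\<lambda>w. W k (a + real (Suc i) * h) w - W k (a + real i * h + r) w) -` A \<inter> space P | A. A \<in> sets borel}" for i
  proof -
    have lt: "a + real i * h + r < a + real (Suc i) * h" using r by (simp add: algebra_simps)
    have eq: "a + real (Suc i) * h - (a + real i * h + r) = h - r" by (simp add: algebra_simps)
    note C = wp[unfolded wiener_process_def, THEN conjunct2, THEN conjunct2, THEN conjunct2, rule_format, OF t0(2) lt]
    show "distributed P lborel (\<lambda>w. W k (a + real (Suc i) * h) w - W k (a + real i * h + r) w) (normal_density 0 (sqrt (h - r)))"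
      "indep_set (sets (F (a + real i * h + r)))
          {(\<lambda>w. W k (a + real (Suc i) * h) w - W k (a + real i * h + r) w) -` A \<inter> space P | A. A \<in> sets borel}"
      using C unfolding eq by - (elim conjE, assumption)+
  qed
  show "distributed P lborel (X m) (normal_density 0 (sqrt (real m * (h - r))))" if "0 < m"
    using that
  proof (induction m rule: nat_induct_non_zero)
    case 1
    then show ?case using D[of 0] by (simp add: X_def One_nat_def)
  next
    case (Suc m)
    let ?Y = "\<lambda>w. W k (a + real (Suc m) * h) w - W k (a + real m * h + r) w"
    let ?G = "F (a + real m * h + r)"
    have Xm: "X m \<in> borel_measurable ?G" by (rule lift[OF X t0(1)]) (use r in simp)
    have sp: "space ?G = space P" using filtration(1)[OF t0(2)] by (simp add: subalgebra_def)
    have XP: "X m \<in> borel_measurable P" by (rule measurable_from_subalg[OF filtration(1)[OF t0(2)] Xm])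
    have YP: "?Y \<in> borel_measurable P" using distributed_measurable[OF D] by simp
    have sX: "sigma_sets (space P) {X m -` A \<inter> space P |A. A \<in> sets borel} \<subseteq> sets ?G"
    proof -
      have "{X m -` A \<inter> space P |A. A \<in> sets borel} \<subseteq> sets ?G" using measurable_sets[OF Xm] unfolding sp by blast
      from sets.sigma_sets_subset[OF this] show ?thesis unfolding sp .
    qed
    \<comment> \<open>The preimages of Borel sets already form a sigma-algebra, so independence as
      stated for a Wiener process is independence of random variables.\<close>
    have sY: "sigma_sets (space P) {?Y -` A \<inter> space P |A. A \<in> sets borel} = {?Y -` A \<inter> space P |A. A \<in> sets borel}"
      using sigma_sets_vimage_commute[of ?Y "space P" UNIV "sets borel", symmetric] sets.sigma_sets_eq[of "borel :: real measure"] by simp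
    have "indep_var borel (X m) borel ?Y"
      unfolding indep_var_eq sY
    proof (intro conjI XP YP)
      show "indep_set (sigma_sets (space P) {X m -` A \<inter> space P |A. A \<in> sets borel}) {?Y -` A \<inter> space P |A. A \<in> sets borel}"
        unfolding indep_set_def
      proof (rule indep_sets_mono_sets[OF I[of m, unfolded indep_set_def]])
        fix b :: bool
        show "case_bool (sigma_sets (space P) {X m -` A \<inter> space P |A. A \<in> sets borel}) {?Y -` A \<inter> space P |A. A \<in> sets borel} b
            \<subseteq> case_bool (sets ?G) {?Y -` A \<inter> space P |A. A \<in> sets borel} b"
          using sX by (cases b) simp_all
      qed
    qed
    from add_indep_normal[OF this _ _ Suc.IH D]
    have "distributed P lborel (\<lambda>w. X m w + ?Y w) (normal_density (0 + 0) (sqrt ((sqrt (real m * (h - r)))^2 + (sqrt (h - r))^2)))"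
      using Suc r by simp
    moreover have "(sqrt (real m * (h - r)))^2 + (sqrt (h - r))^2 = real (Suc m) * (h - r)"
    proof -
      have "0 \<le> real m * (h - r)" "0 \<le> h - r" using r by simp_all
      then show ?thesis by (simp only: real_sqrt_pow2) (simp add: algebra_simps)
    qed
    moreover have "X (Suc m) = (\<lambda>w. X m w + ?Y w)" by (rule ext) (simp add: X_def)
    ultimately show ?case by simp
  qed
qed

text \<open>The sum of increments is a measurable functional of the whole path, and the paths are
  independent across k.\<close>

lemma W_increments_indep:
  assumes a: "0 \<le> a" and r: "0 \<le> r" "r < h"
  shows "indep_vars (\<lambda>_. borel) (\<lambda>k w. \<Sum>i<m. W k (a + real (Suc i) * h) w - W k (a + real i * h + r) w) K"
proof -
  have h: "0 \<le> h" using r by simp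
  have t0: "0 \<le> a + real i * h" "0 \<le> a + real i * h + r" for i using a h r by auto
  have "indep_vars (\<lambda>_. Pi\<^sub>M {0..} (\<lambda>_. borel)) (\<lambda>k w. \<lambda>t\<in>{0..}. W k t w) K"
    using wiener by (simp add: cylindrical_wiener_def)
  then have "indep_vars (\<lambda>_. borel) (\<lambda>k w. (\<lambda>f :: real \<Rightarrow> real. \<Sum>i<m. f (a + real (Suc i) * h) - f (a + real i * h + r)) (\<lambda>t\<in>{0..}. W k t w)) K"
  proof (rule indep_vars_compose2)
    show "(\<lambda>f :: real \<Rightarrow> real. \<Sum>i<m. f (a + real (Suc i) * h) - f (a + real i * h + r)) \<in> borel_measurable (Pi\<^sub>M {0..} (\<lambda>_. borel))"
      by (intro borel_measurable_sum borel_measurable_diff measurable_component_singleton; simp only: atLeast_iff t0)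
  qed
  moreover have "(\<Sum>i<m. (\<lambda>t\<in>{0..}. W k t w) (a + real (Suc i) * h) - (\<lambda>t\<in>{0..}. W k t w) (a + real i * h + r)) =
      (\<Sum>i<m. W k (a + real (Suc i) * h) w - W k (a + real i * h + r) w)" for k w
    by (intro sum.cong refl, subst (1 2) restrict_apply') (simp_all only: atLeast_iff t0)
  ultimately show ?thesis by simp
qed

lemma PhiW_rf: "t \<in> {0..T} ==> rf 2 P (PhiW t)"
proof -
  assume t: "t \<in> {0..T}"
  have "rf 2 (F t) (PhiW t)" using noise t by (intro Hk_measurable_rf) (simp add: noise_process_def)
  moreover have sub: "subalgebra P (F t)" using t by (intro filtration) simp
  ultimately show ?thesis
    unfolding rf_def fcm_def by (auto intro: measurable_from_subalg[OF sub] simp: sub[unfolded subalgebra_def])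
qed

text \<open>For finitely many modes the sum of increments is a Gaussian field, whose fourth moment
  is bounded by the partial Hilbert-Schmidt norm; the modes are then added in mean square. One
  interval with r = 0 gives an ordinary increment, and M intervals of length dt^2 give the sum over
  substeps.\<close>

theorem noise_increments:
  assumes a: "0 \<le> a" and r: "0 \<le> r" "r \<le> h" and m: "0 < m" "a + real m * h \<le> T"
  shows "rf 2 P (\<lambda>w x. \<Sum>i<m. PhiW (a + real (Suc i) * h) w x - PhiW (a + real i * h + r) w x)"
    and "mb P (\<lambda>w. Hk_norm 2 (\<lambda>x. \<Sum>i<m. PhiW (a + real (Suc i) * h) w x - PhiW (a + real i * h + r) w x) ^ 4)
      (3 * hs_sq^2 * (real m * (h - r))^2)"
proof -
  have h: "0 \<le> h" using r by simp
  have t1: "a + real (Suc i) * h \<in> {0..T}" and t2: "a + real i * h + r \<in> {0..T}" if "i < m" for i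
  proof -
    have "real (Suc i) * h \<le> real m * h" using that h by (intro mult_right_mono) auto
    then show 1: "a + real (Suc i) * h \<in> {0..T}" using a h m(2) by auto
    have "a + real i * h + r \<le> a + real (Suc i) * h" using r by (simp add: algebra_simps)
    then show "a + real i * h + r \<in> {0..T}" using 1 a h r by auto
  qed
  show Zrf: "rf 2 P (\<lambda>w x. \<Sum>i<m. PhiW (a + real (Suc i) * h) w x - PhiW (a + real i * h + r) w x)"
    by (intro rf_sum rf_diff PhiW_rf t1 t2) auto
  show "mb P (\<lambda>w. Hk_norm 2 (\<lambda>x. \<Sum>i<m. PhiW (a + real (Suc i) * h) w x - PhiW (a + real i * h + r) w x) ^ 4)
      (3 * hs_sq^2 * (real m * (h - r))^2)"
  \<comment> \<open>The intervals are then empty, and the variance 0 has no normal density.\<close>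
  proof (cases "r = h")
    case True
    then have "PhiW (a + real (Suc i) * h) = PhiW (a + real i * h + r)" for i by (simp add: algebra_simps)
    then have "(\<Sum>i<m. PhiW (a + real (Suc i) * h) w x - PhiW (a + real i * h + r) w x) = 0" for w x
      by (simp only: diff_self sum.neutral_const)
    then show ?thesis using True by (simp only: Hk_norm_zero) (simp add: mb_zero)
  next
    case False
    then have rh: "r < h" using r by simp
    define X where "X k w = (\<Sum>i<m. W k (a + real (Suc i) * h) w - W k (a + real i * h + r) w)" for k w
    define J where "J n = K \<inter> {..<n}" for n
    have sm: "(\<lambda>k. (Hk_norm 2 (\<Phi> (e k)))^2) summable_on K" and \<Phi>: "\<Phi> v \<in> Hk 2" for v
      using HS by (auto simp: hilbert_schmidt_def)
    have g: "rf 2 P (\<lambda>w x. \<Sum>k\<in>J n. X k w *\<^sub>R \<Phi> (e k) x)"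
      "mb P (\<lambda>w. Hk_norm 2 (\<lambda>x. \<Sum>k\<in>J n. X k w *\<^sub>R \<Phi> (e k) x) ^ 4)
        (3 * (real m * (h - r))^2 * (\<Sum>k\<in>J n. (Hk_norm 2 (\<Phi> (e k)))^2)^2)" for n
    proof -
      have ind: "indep_vars (\<lambda>_. borel) X (J n)"
        unfolding X_def[abs_def] by (rule indep_vars_subset[OF W_increments_indep[OF a r(1) rh]]) (simp add: J_def)
      have D: "distributed P lborel (X k) (normal_density 0 (sqrt (real m * (h - r))))" if "k \<in> J n" for k
        unfolding X_def[abs_def] using that by (intro W_increments(2)[OF _ a r(1) rh m(1)]) (simp add: J_def)
      have v: "0 < real m * (h - r)" using m rh by simp
      have fin: "finite (J n)" by (simp add: J_def)
      show "rf 2 P (\<lambda>w x. \<Sum>k\<in>J n. X k w *\<^sub>R \<Phi> (e k) x)"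
        "mb P (\<lambda>w. Hk_norm 2 (\<lambda>x. \<Sum>k\<in>J n. X k w *\<^sub>R \<Phi> (e k) x) ^ 4)
        (3 * (real m * (h - r))^2 * (\<Sum>k\<in>J n. (Hk_norm 2 (\<Phi> (e k)))^2)^2)"
        by (rule gaussian_field_fourth[OF fin ind v D \<Phi>]; assumption)+
    qed
    have tr: "(\<Sum>k\<in>J n. (Hk_norm 2 (\<Phi> (e k)))^2) \<le> hs_sq" for n
      unfolding hs_sq_def by (rule finite_sum_le_infsum[OF sm]) (auto simp: J_def)
    define S where "S n t w = (\<lambda>x. \<Sum>k\<in>J n. W k t w *\<^sub>R \<Phi> (e k) x)" for n t w
    define d where "d n t w = (Hk_norm 2 (\<lambda>x. PhiW t w x - S n t w x))^2" for n t w
    have Wm: "W k t \<in> borel_measurable P" if "0 \<le> t" "k \<in> K" for k t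
      using wiener that by (intro measurable_from_subalg[OF filtration(1)]) (auto simp: cylindrical_wiener_def wiener_process_def)
    have Srf: "rf 2 P (S n t)" if "0 \<le> t" for n t
    proof -
      have "S n t w \<in> Hk 2" for w unfolding S_def by (intro Hk_sum Hk_scaleR \<Phi>)
      moreover have "fc \<kappa> (S n t w) = (\<Sum>k\<in>J n. W k t w *\<^sub>R fc \<kappa> (\<Phi> (e k)))" for \<kappa> w
        unfolding S_def by (subst fc_sum) (auto intro: Hk_L2t[OF \<Phi>] simp: fc_scaleR)
      moreover have "(\<lambda>w. \<Sum>k\<in>J n. W k t w *\<^sub>R fc \<kappa> (\<Phi> (e k))) \<in> borel_measurable P" for \<kappa>
        by (intro borel_measurable_sum borel_measurable_scaleR borel_measurable_const Wm that) (simp add: J_def)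
      ultimately show ?thesis by (simp add: rf_def fcm_def)
    qed
    have lim: "(\<lambda>n. \<integral>\<^sup>+w. ennreal (d n t w) \<partial>P) \<longlonglongrightarrow> 0" if "t \<in> {0..T}" for t
      using noise that unfolding d_def S_def J_def noise_process_def by blast
    have dm: "(\<lambda>w. ennreal (d n t w)) \<in> borel_measurable P" if "t \<in> {0..T}" for n t
    proof -
      have "0 \<le> t" using that by simp
      from rf_power[OF rf_diff[OF PhiW_rf[OF that] Srf[OF this]], of n 2] show ?thesis unfolding d_def by measurable
    qed
    let ?Z = "\<lambda>w x. \<Sum>i<m. PhiW (a + real (Suc i) * h) w x - PhiW (a + real i * h + r) w x"
    let ?b = "\<lambda>n w. \<Sum>i<m. ennreal (d n (a + real (Suc i) * h) w) + ennreal (d n (a + real i * h + r) w)"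
    have "mb P (\<lambda>w. Hk_norm 2 (?Z w) ^ 4) (3 * (real m * (h - r))^2 * hs_sq^2)"
    proof (rule mb_fourth_limit[OF Zrf g(1)])
      show "mb P (\<lambda>w. Hk_norm 2 (\<lambda>x. \<Sum>k\<in>J n. X k w *\<^sub>R \<Phi> (e k) x) ^ 4) (3 * (real m * (h - r))^2 * hs_sq^2)" for n
        by (rule mb_weaken[OF g(2)]) (intro mult_left_mono power_mono tr sum_nonneg; simp)
      have le: "ennreal ((Hk_norm 2 (\<lambda>x. ?Z w x - (\<Sum>k\<in>J n. X k w *\<^sub>R \<Phi> (e k) x)))^2) \<le> ennreal (2 * real m) * ?b n w"
        if w: "w \<in> space P" for n w
      proof -
        let ?D = "\<lambda>t x. PhiW t w x - S n t w x"
        have DH: "?D t \<in> Hk 2" if "t \<in> {0..T}" for t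
          using rf_Hk[OF PhiW_rf[OF that] w] rf_Hk[OF Srf w, of t n] that by (intro Hk_diff) auto
        have Xsum: "(\<Sum>k\<in>J n. X k w *\<^sub>R \<Phi> (e k) x) = (\<Sum>i<m. S n (a + real (Suc i) * h) w x - S n (a + real i * h + r) w x)" for x
          unfolding X_def S_def scaleR_sum_left sum_subtractf[symmetric] scaleR_left_diff_distrib by (rule sum.swap)
        have eq: "(\<lambda>x. ?Z w x - (\<Sum>k\<in>J n. X k w *\<^sub>R \<Phi> (e k) x)) =
            (\<lambda>x. \<Sum>i<m. ?D (a + real (Suc i) * h) x - ?D (a + real i * h + r) x)"
          unfolding Xsum sum_subtractf[symmetric] by (intro ext sum.cong refl) (simp add: algebra_simps)
        have "Hk_norm 2 (\<lambda>x. \<Sum>i<m. ?D (a + real (Suc i) * h) x - ?D (a + real i * h + r) x) \<le>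
            (\<Sum>i<m. Hk_norm 2 (\<lambda>x. ?D (a + real (Suc i) * h) x - ?D (a + real i * h + r) x))"
          by (intro Hk_triangle_sum Hk_diff[OF DH DH] t1 t2) auto
        also have "\<dots> \<le> (\<Sum>i<m. Hk_norm 2 (?D (a + real (Suc i) * h)) + Hk_norm 2 (?D (a + real i * h + r)))"
          by (intro sum_mono Hk_triangle_diff DH t1 t2) auto
        finally have "(Hk_norm 2 (\<lambda>x. \<Sum>i<m. ?D (a + real (Suc i) * h) x - ?D (a + real i * h + r) x))^2 \<le>
            (\<Sum>i<m. Hk_norm 2 (?D (a + real (Suc i) * h)) + Hk_norm 2 (?D (a + real i * h + r)))^2"
          by (intro power_mono) auto
        also have "\<dots> \<le> real m * (\<Sum>i<m. (Hk_norm 2 (?D (a + real (Suc i) * h)) + Hk_norm 2 (?D (a + real i * h + r)))^2)"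
          using Cauchy_Schwarz_ineq_sum[of "\<lambda>i. 1" "\<lambda>i. Hk_norm 2 (?D (a + real (Suc i) * h)) + Hk_norm 2 (?D (a + real i * h + r))" "{..<m}"] by simp
        also have "\<dots> \<le> real m * (\<Sum>i<m. 2 * (d n (a + real (Suc i) * h) w + d n (a + real i * h + r) w))"
        proof (intro mult_left_mono sum_mono)
          fix i
          show "(Hk_norm 2 (?D (a + real (Suc i) * h)) + Hk_norm 2 (?D (a + real i * h + r)))^2 \<le> 2 * (d n (a + real (Suc i) * h) w + d n (a + real i * h + r) w)"
            unfolding d_def using sum_squares_bound[of "Hk_norm 2 (?D (a + real (Suc i) * h))" "Hk_norm 2 (?D (a + real i * h + r))"] by (simp add: power2_sum)
        qed simp
        also have "\<dots> = 2 * real m * (\<Sum>i<m. d n (a + real (Suc i) * h) w + d n (a + real i * h + r) w)"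
          by (simp only: sum_distrib_left[symmetric] mult_ac)
        finally have "ennreal ((Hk_norm 2 (\<lambda>x. ?Z w x - (\<Sum>k\<in>J n. X k w *\<^sub>R \<Phi> (e k) x)))^2) \<le>
            ennreal (2 * real m * (\<Sum>i<m. d n (a + real (Suc i) * h) w + d n (a + real i * h + r) w))"
          unfolding eq by (rule ennreal_leI)
        also have "\<dots> = ennreal (2 * real m) * ?b n w"
          by (subst ennreal_mult) (auto simp: d_def sum_nonneg ennreal_plus[symmetric] simp del: ennreal_plus)
        finally show ?thesis .
      qed
      have "(\<lambda>n. ennreal (2 * real m) * (\<Sum>i<m. (\<integral>\<^sup>+w. ennreal (d n (a + real (Suc i) * h) w) \<partial>P) + (\<integral>\<^sup>+w. ennreal (d n (a + real i * h + r) w) \<partial>P)))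
          \<longlonglongrightarrow> ennreal (2 * real m) * (\<Sum>i<m. 0 + 0)"
        by (intro ennreal_tendsto_cmult tendsto_sum tendsto_add lim t1 t2) auto
      then have z: "(\<lambda>n. ennreal (2 * real m) * (\<Sum>i<m. (\<integral>\<^sup>+w. ennreal (d n (a + real (Suc i) * h) w) \<partial>P) + (\<integral>\<^sup>+w. ennreal (d n (a + real i * h + r) w) \<partial>P)))
          \<longlonglongrightarrow> 0" by simp
      have "(\<integral>\<^sup>+w. ennreal ((Hk_norm 2 (\<lambda>x. ?Z w x - (\<Sum>k\<in>J n. X k w *\<^sub>R \<Phi> (e k) x)))^2) \<partial>P)
          \<le> ennreal (2 * real m) * (\<Sum>i<m. (\<integral>\<^sup>+w. ennreal (d n (a + real (Suc i) * h) w) \<partial>P) + (\<integral>\<^sup>+w. ennreal (d n (a + real i * h + r) w) \<partial>P))" for n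
      proof -
        have "(\<integral>\<^sup>+w. ennreal ((Hk_norm 2 (\<lambda>x. ?Z w x - (\<Sum>k\<in>J n. X k w *\<^sub>R \<Phi> (e k) x)))^2) \<partial>P) \<le> (\<integral>\<^sup>+w. ennreal (2 * real m) * ?b n w \<partial>P)"
          by (intro nn_integral_mono le)
        also have "\<dots> = ennreal (2 * real m) * (\<Sum>i<m. \<integral>\<^sup>+w. ennreal (d n (a + real (Suc i) * h) w) + ennreal (d n (a + real i * h + r) w) \<partial>P)"
          by (subst nn_integral_cmult, intro borel_measurable_sum borel_measurable_add dm t1 t2, simp, simp)
             (subst nn_integral_sum, intro borel_measurable_add dm t1 t2, simp_all)
        also have "(\<Sum>i<m. \<integral>\<^sup>+w. ennreal (d n (a + real (Suc i) * h) w) + ennreal (d n (a + real i * h + r) w) \<partial>P) =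
            (\<Sum>i<m. (\<integral>\<^sup>+w. ennreal (d n (a + real (Suc i) * h) w) \<partial>P) + (\<integral>\<^sup>+w. ennreal (d n (a + real i * h + r) w) \<partial>P))"
          by (intro sum.cong refl nn_integral_add dm t1 t2) auto
        finally show ?thesis .
      qed
      then show "(\<lambda>n. \<integral>\<^sup>+w. ennreal ((Hk_norm 2 (\<lambda>x. ?Z w x - (\<Sum>k\<in>J n. X k w *\<^sub>R \<Phi> (e k) x)))^2) \<partial>P) \<longlonglongrightarrow> 0"
        by (intro tendsto_sandwich[OF _ _ tendsto_const z] always_eventually allI) auto
    qed
    then show ?thesis by (simp add: mult_ac)
  qed
qed

end

section \<open>Taylor expansion in mean square\<close>

lemma mb_cong_AE:
  assumes f: "mb M f C" and g: "g \<in> borel_measurable M" "\<And>w. w \<in> space M ==> 0 \<le> g w"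
    and ae: "AE w in M. g w \<le> f w"
  shows "mb M g C"
proof -
  have "(\<integral>\<^sup>+w. ennreal (g w) \<partial>M) \<le> (\<integral>\<^sup>+w. ennreal (f w) \<partial>M)"
    by (rule nn_integral_mono_AE) (use ae in eventually_elim, rule ennreal_leI)
  then show ?thesis using f g unfolding mb_def by (auto intro: order_trans)
qed

lemma (in complete_measure) Lp_norm_cong:
  assumes "AE w in M. ae_eq (Z w) (Z' w)"
  shows "Lp_norm M p k Z = Lp_norm M p k Z'"
proof -
  have "(\<integral>w. Hk_norm k (Z w) powr p \<partial>M) = (\<integral>w. Hk_norm k (Z' w) powr p \<partial>M)"
    by (rule integral_cong_AE_complete) (use assms in eventually_elim, simp add: Hk_norm_cong)
  then show ?thesis by (simp add: Lp_norm_def)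
qed

lemma Lp_4:
  assumes "X \<in> Lp M 4 k S"
  obtains X' C where "rf k M X'" "\<And>w. w \<in> space M ==> X' w \<in> S" "AE w in M. ae_eq (X w) (X' w)"
    "mb M (\<lambda>w. Hk_norm k (X' w) ^ 4) C"
proof -
  from assms obtain X' where X': "Hk_measurable k M X'" "\<forall>w\<in>space M. X' w \<in> S" "AE w in M. ae_eq (X w) (X' w)"
    and fin: "(\<integral>\<^sup>+w. ennreal (Hk_norm k (X' w) powr 4) \<partial>M) < \<infinity>"
    by (auto simp: Lp_def)
  have pw: "Hk_norm k f powr 4 = Hk_norm k f ^ 4" for f :: "'b field"
    using powr_realpow[of "Hk_norm k f" 4] Hk_norm_ge0[of k f] by (cases "Hk_norm k f = 0") auto
  have rf: "rf k M X'" using X'(1) by (rule Hk_measurable_rf)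
  have "mb M (\<lambda>w. Hk_norm k (X' w) ^ 4) (enn2real (\<integral>\<^sup>+w. ennreal (Hk_norm k (X' w) ^ 4) \<partial>M))"
    using fin rf_power[OF rf, of 4] unfolding pw mb_def by simp
  then show thesis using that rf X' by blast
qed

lemma (in prob_space) mb_square_of_fourth_ex:
  assumes X: "rf k M X" and C: "mb M (\<lambda>w. Hk_norm k (X w) ^ 4) C"
  shows "mb M (\<lambda>w. (Hk_norm k (X w))^2) (1 + C)"
proof (rule mb_mono[OF mb_add[OF mb_const[of 1] C]])
  fix w
  define q where "q = (Hk_norm k (X w))^2"
  have q: "Hk_norm k (X w) ^ 4 = q^2" by (simp add: q_def power_mult[symmetric])
  have "2 * q \<le> 1 + q^2" using sum_squares_bound[of 1 q] by simp
  then show "(Hk_norm k (X w))^2 \<le> 1 + Hk_norm k (X w) ^ 4"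
    unfolding q q_def[symmetric] using zero_le_power2[of q] by linarith
qed (use rf_power[OF X, of 2] in auto)

lemma mb_norm_scale:
  assumes X: "rf k M X" and C: "mb M (\<lambda>w. (Hk_norm k (X w))^2) (A^2)"
  shows "mb M (\<lambda>w. (Hk_norm k (\<lambda>x. c *\<^sub>R X w x))^2) ((\<bar>c\<bar> * A)^2)"
proof (rule mb_mono[OF mb_scale[OF C, of "c^2"]])
  show "(\<lambda>w. (Hk_norm k (\<lambda>x. c *\<^sub>R X w x))^2) \<in> borel_measurable M" by (intro rf_power rf_scaleR X)
  show "(Hk_norm k (\<lambda>x. c *\<^sub>R X w x))^2 \<le> c^2 * (Hk_norm k (X w))^2" if "w \<in> space M" for w
    by (simp add: Hk_norm_scaleR[OF rf_Hk[OF X that]] power_mult_distrib)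
qed (auto simp: power_mult_distrib)

lemma mb_norm_triangle:
  assumes X: "rf k M X" and Y: "rf k M Y" and A: "0 < A" "mb M (\<lambda>w. (Hk_norm k (X w))^2) (A^2)"
    and B: "0 < B" "mb M (\<lambda>w. (Hk_norm k (Y w))^2) (B^2)"
  shows "mb M (\<lambda>w. (Hk_norm k (\<lambda>x. X w x + Y w x))^2) ((A + B)^2)"
proof (rule mb_minkowski[OF A(2) B(2) A(1) B(1)])
  show "(\<lambda>w. Hk_norm k (\<lambda>x. X w x + Y w x)) \<in> borel_measurable M" by (intro rf_measurable rf_add X Y)
  show "\<bar>Hk_norm k (\<lambda>x. X w x + Y w x)\<bar> \<le> \<bar>Hk_norm k (X w)\<bar> + \<bar>Hk_norm k (Y w)\<bar>" if "w \<in> space M" for w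
    using Hk_triangle[OF rf_Hk[OF X that] rf_Hk[OF Y that]] by simp
qed

lemma mb_norm_commute:
  assumes X: "rf k M X" and Y: "rf k M Y" and C: "mb M (\<lambda>w. (Hk_norm k (\<lambda>x. X w x - Y w x))^2) C"
  shows "mb M (\<lambda>w. (Hk_norm k (\<lambda>x. Y w x - X w x))^2) C"
proof (rule mb_mono[OF C])
  show "(\<lambda>w. (Hk_norm k (\<lambda>x. Y w x - X w x))^2) \<in> borel_measurable M" by (intro rf_power rf_diff X Y)
  show "(Hk_norm k (\<lambda>x. Y w x - X w x))^2 \<le> (Hk_norm k (\<lambda>x. X w x - Y w x))^2" if "w \<in> space M" for w
    using Hk_norm_diff_commute[OF rf_Hk[OF X that] rf_Hk[OF Y that]] by simp
qed auto

text \<open>Here Y and D are versions with values in H^k at every sample point. The finite fourth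
  moments in \<open>Y4\<close> and \<open>D4\<close> give meaning to the bounds on
  \<open>Lp_norm\<close>, whose integral would otherwise be 0 by default.\<close>

locale smooth_field = prob_space P + complete_measure P for P :: "'w measure" +
  fixes T :: real and k :: nat and Y D :: "real \<Rightarrow> 'w \<Rightarrow> 'b::euclidean_space field"
  assumes T: "0 < T"
    and Y: "\<And>t. t \<in> {0..T} ==> rf k P (Y t)" and D: "\<And>t. t \<in> {0..T} ==> rf k P (D t)"
    and Y4: "\<And>t. t \<in> {0..T} ==> \<exists>C. mb P (\<lambda>w. Hk_norm k (Y t w) ^ 4) C"
    and D4: "\<And>t. t \<in> {0..T} ==> \<exists>C. mb P (\<lambda>w. Hk_norm k (D t w) ^ 4) C"
    and quot: "\<And>t. t \<in> {0..T} ==>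
      ((\<lambda>s. Lp_norm P 4 k (\<lambda>w x. (1 / (s - t)) *\<^sub>R (Y s w x - Y t w x) - D t w x)) \<longlongrightarrow> 0) (at t within {0..T})"
    and Dc: "\<And>t. t \<in> {0..T} ==> ((\<lambda>s. Lp_norm P 4 k (\<lambda>w x. D s w x - D t w x)) \<longlongrightarrow> 0) (at t within {0..T})"
    and Dh: "\<exists>C. \<forall>s\<in>{0..T}. \<forall>t\<in>{0..T}. Lp_norm P 2 k (\<lambda>w x. D t w x - D s w x) \<le> C * \<bar>t - s\<bar> powr (1/2)"
begin

lemma lin4:
  assumes "rf k P X" "mb P (\<lambda>w. Hk_norm k (X w) ^ 4) A" "rf k P Z" "mb P (\<lambda>w. Hk_norm k (Z w) ^ 4) B"
  shows "\<exists>C. mb P (\<lambda>w. Hk_norm k (\<lambda>x. X w x - Z w x) ^ 4) C"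
  using mb_fourth_lin[OF assms, of 1 "-1"] by (intro exI) simp

lemma Lp4_mb:
  assumes Z: "rf k P Z" and C: "mb P (\<lambda>w. Hk_norm k (Z w) ^ 4) C" and le: "Lp_norm P 4 k Z \<le> \<epsilon>"
  shows "mb P (\<lambda>w. Hk_norm k (Z w) ^ 4) (\<epsilon> ^ 4)"
  using Lp_norm_mb[OF Z C, of \<epsilon>] le by simp

lemma eventually_within:
  assumes "(f \<longlongrightarrow> (0::real)) (at t within {0..T})" and "0 < \<epsilon>"
  obtains d where "0 < d" "\<And>s. s \<in> {0..T} ==> s \<noteq> t ==> \<bar>s - t\<bar> < d ==> f s \<le> \<epsilon>"
proof -
  have "\<forall>\<^sub>F s in at t within {0..T}. f s < \<epsilon>" using assms by (rule order_tendstoD)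
  then obtain d where d: "0 < d" "\<forall>s\<in>{0..T}. s \<noteq> t \<and> dist s t < d \<longrightarrow> f s < \<epsilon>"
    unfolding eventually_at by blast
  show thesis
  proof (rule that[OF d(1)])
    fix s assume "s \<in> {0..T}" "s \<noteq> t" "\<bar>s - t\<bar> < d"
    then have "f s < \<epsilon>" using d(2) by (simp add: dist_real_def)
    then show "f s \<le> \<epsilon>" by simp
  qed
qed

text \<open>Continuity in L^4 bounds the moments near each time, and bisection extends local bounds
  to the compact interval.\<close>

lemma uniform_fourth: "\<exists>C. \<forall>t\<in>{0..T}. mb P (\<lambda>w. Hk_norm k (D t w) ^ 4) C"
proof -
  define Q where "Q a b \<longleftrightarrow> (\<exists>C. \<forall>t\<in>{a..b} \<inter> {0..T}. mb P (\<lambda>w. Hk_norm k (D t w) ^ 4) C)" for a b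
  have "Q 0 T"
  proof (rule Bolzano[of 0 T Q])
    show "0 \<le> T" using T by simp
    show "Q a c" if "Q a b" "Q b c" "a \<le> b" "b \<le> c" for a b c
    proof -
      from that obtain A B where A: "\<forall>t\<in>{a..b} \<inter> {0..T}. mb P (\<lambda>w. Hk_norm k (D t w) ^ 4) A"
        and B: "\<forall>t\<in>{b..c} \<inter> {0..T}. mb P (\<lambda>w. Hk_norm k (D t w) ^ 4) B" unfolding Q_def by blast
      have "mb P (\<lambda>w. Hk_norm k (D t w) ^ 4) (max A B)" if t: "t \<in> {a..c} \<inter> {0..T}" for t
      proof (cases "t \<le> b")
        case True
        then show ?thesis using A t by (intro mb_weaken[of P _ A "max A B"]) auto
      next
        case False
        then show ?thesis using B t by (intro mb_weaken[of P _ B "max A B"]) auto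
      qed
      then show ?thesis unfolding Q_def by blast
    qed
    fix x assume "0 \<le> x" "x \<le> T"
    then have x: "x \<in> {0..T}" by simp
    obtain d where d: "0 < d" "\<And>s. s \<in> {0..T} ==> s \<noteq> x ==> \<bar>s - x\<bar> < d ==> Lp_norm P 4 k (\<lambda>w z. D s w z - D x w z) \<le> 1"
      using eventually_within[OF Dc[OF x], of 1] by auto
    obtain C where C: "mb P (\<lambda>w. Hk_norm k (D x w) ^ 4) C" using D4[OF x] by blast
    have C0: "0 \<le> C" using C by (simp add: mb_def)
    have "mb P (\<lambda>w. Hk_norm k (D s w) ^ 4) (8 + 8 * C)" if s: "s \<in> {0..T}" "\<bar>s - x\<bar> < d" for s
    proof (cases "s = x")
      case True
      then show ?thesis using C0 by (simp add: mb_weaken[OF C])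
    next
      case False
      obtain B where B: "mb P (\<lambda>w. Hk_norm k (D s w) ^ 4) B" using D4[OF s(1)] by blast
      obtain B' where "mb P (\<lambda>w. Hk_norm k (\<lambda>z. D s w z - D x w z) ^ 4) B'"
        using lin4[OF D[OF s(1)] B D[OF x] C] by blast
      from Lp4_mb[OF rf_diff[OF D[OF s(1)] D[OF x]] this d(2)[OF s(1) False s(2)]]
      have "mb P (\<lambda>w. Hk_norm k (\<lambda>z. D s w z - D x w z) ^ 4) (1 ^ 4)" .
      from mb_fourth_lin[OF rf_diff[OF D[OF s(1)] D[OF x]] this D[OF x] C, of 1 1] show ?thesis by simp
    qed
    then show "\<exists>d>0. \<forall>a b. a \<le> x \<and> x \<le> b \<and> b - a < d \<longrightarrow> Q a b"
      using d(1) unfolding Q_def by (intro exI[of _ d] conjI allI impI exI[of _ "8 + 8 * C"] ballI) auto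
  qed
  then show ?thesis unfolding Q_def by auto
qed

text \<open>A mean value inequality in mean square, proved without integrating D in time: the local
  bound from the difference quotient is chained over the interval by bisection and Minkowski's
  inequality. The slope is of order |s - t|^(1/2) by Hoelder continuity, so the square is of order
  |s - t|^3.\<close>

lemma taylor: "\<exists>C. \<forall>t\<in>{0..T}. \<forall>s\<in>{0..T}. mb P (\<lambda>w. (Hk_norm k (\<lambda>x. Y s w x - Y t w x - (s - t) *\<^sub>R D t w x))^2) (C * \<bar>s - t\<bar> ^ 3)"
proof -
  obtain C0 where C0: "\<And>s t. s \<in> {0..T} ==> t \<in> {0..T} ==> Lp_norm P 2 k (\<lambda>w x. D t w x - D s w x) \<le> C0 * \<bar>t - s\<bar> powr (1/2)"
    using Dh by blast
  \<comment> \<open>At least 1, since Minkowski's inequality is available for positive constants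
    only.\<close>
  define C1 where "C1 = max C0 1"
  have C1: "0 < C1" "C0 \<le> C1" by (auto simp: C1_def)
  have D2: "mb P (\<lambda>w. (Hk_norm k (\<lambda>x. D s w x - D t w x))^2) ((C1 * \<bar>s - t\<bar> powr (1/2))^2)"
    if s: "s \<in> {0..T}" and t: "t \<in> {0..T}" for s t
  proof -
    obtain B where B: "mb P (\<lambda>w. Hk_norm k (D s w) ^ 4) B" using D4[OF s] by blast
    obtain B' where B': "mb P (\<lambda>w. Hk_norm k (D t w) ^ 4) B'" using D4[OF t] by blast
    obtain B'' where B'': "mb P (\<lambda>w. Hk_norm k (\<lambda>z. D s w z - D t w z) ^ 4) B''"
      using lin4[OF D[OF s] B D[OF t] B'] by blast
    have "C0 * \<bar>s - t\<bar> powr (1/2) \<le> C1 * \<bar>s - t\<bar> powr (1/2)" using C1 by (intro mult_right_mono) auto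
    then have "Lp_norm P (real 2) k (\<lambda>w x. D s w x - D t w x) \<le> C1 * \<bar>s - t\<bar> powr (1/2)"
      using C0[OF t s] by simp
    from Lp_norm_mb[OF rf_diff[OF D[OF s] D[OF t]] mb_square_of_fourth_ex[OF rf_diff[OF D[OF s] D[OF t]] B''] _ this]
    show ?thesis by simp
  qed
  have main: "mb P (\<lambda>w. (Hk_norm k (\<lambda>x. Y s w x - Y t w x - (s - t) *\<^sub>R D t w x))^2) ((2 * (C1 * \<bar>s - t\<bar> powr (1/2)) * \<bar>s - t\<bar>)^2)"
    if s: "s \<in> {0..T}" and t: "t \<in> {0..T}" and st: "s \<noteq> t" for s t
  proof -
    define c where "c = C1 * \<bar>s - t\<bar> powr (1/2)"
    have c: "0 < c" using C1 st by (simp add: c_def)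
    define lo hi where "lo = min s t" and "hi = max s t"
    have lohi: "0 \<le> lo" "hi \<le> T" "lo < hi" using s t st by (auto simp: lo_def hi_def)
    \<comment> \<open>Subtracting the linear function with the slope at t turns the Taylor remainder
      into a plain increment of g.\<close>
    define g where "g r w = (\<lambda>x. Y r w x - r *\<^sub>R D t w x)" for r w
    have g: "rf k P (g r)" if "r \<in> {0..T}" for r
      unfolding g_def[abs_def] by (intro rf_diff rf_scaleR Y D that t)
    have D2c: "mb P (\<lambda>w. (Hk_norm k (\<lambda>x. D r w x - D t w x))^2) (c^2)" if r: "r \<in> {lo..hi}" for r
    proof -
      have r': "r \<in> {0..T}" using r lohi by auto
      have "\<bar>r - t\<bar> \<le> \<bar>s - t\<bar>" using r by (auto simp: lo_def hi_def)
      then have "C1 * \<bar>r - t\<bar> powr (1/2) \<le> c" unfolding c_def using C1 by (intro mult_left_mono powr_mono2) auto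
      then have "(C1 * \<bar>r - t\<bar> powr (1/2))^2 \<le> c^2" using C1 by (intro power_mono) auto
      then show ?thesis by (rule mb_weaken[OF D2[OF r' t]])
    qed
    \<comment> \<open>The two premises confine the property to the interval, because bisection also
      asks about intervals that stick out of it. The case a = b is set apart since the constant
      would be 0 there.\<close>
    define Q where "Q a b \<longleftrightarrow> (lo \<le> a \<longrightarrow> b \<le> hi \<longrightarrow> a = b \<or> mb P (\<lambda>w. (Hk_norm k (\<lambda>x. g b w x - g a w x))^2) ((2 * c * (b - a))^2))" for a b
    have add: "mb P (\<lambda>w. (Hk_norm k (\<lambda>x. g r3 w x - g r1 w x))^2) ((2 * c * (r3 - r1))^2)"
      if "mb P (\<lambda>w. (Hk_norm k (\<lambda>x. g r2 w x - g r1 w x))^2) ((2 * c * (r2 - r1))^2)"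
        "mb P (\<lambda>w. (Hk_norm k (\<lambda>x. g r3 w x - g r2 w x))^2) ((2 * c * (r3 - r2))^2)"
        "r1 < r2" "r2 < r3" "lo \<le> r1" "r3 \<le> hi" for r1 r2 r3
    proof -
      have "r1 \<in> {0..T}" "r2 \<in> {0..T}" "r3 \<in> {0..T}" using that lohi by auto
      note rs = rf_diff[OF g[OF this(2)] g[OF this(1)]] rf_diff[OF g[OF this(3)] g[OF this(2)]]
      have "0 < 2 * c * (r2 - r1)" "0 < 2 * c * (r3 - r2)" using c that by auto
      from mb_norm_triangle[OF rs this(1) that(1) this(2) that(2)]
      have "mb P (\<lambda>w. (Hk_norm k (\<lambda>x. (g r2 w x - g r1 w x) + (g r3 w x - g r2 w x)))^2) ((2 * c * (r2 - r1) + 2 * c * (r3 - r2))^2)" .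
      moreover have "(g r2 w x - g r1 w x) + (g r3 w x - g r2 w x) = g r3 w x - g r1 w x" for w x by simp
      moreover have "2 * c * (r2 - r1) + 2 * c * (r3 - r2) = 2 * c * (r3 - r1)" by (simp add: algebra_simps)
      ultimately show ?thesis by simp
    qed
    have trans: "Q a3 c3" if "Q a3 b3" "Q b3 c3" "a3 \<le> b3" "b3 \<le> c3" for a3 b3 c3
    proof (cases "a3 = b3 \<or> b3 = c3")
      case True
      then show ?thesis using that by auto
    next
      case False
      then show ?thesis using that add[of b3 a3 c3] unfolding Q_def by auto
    qed
    have "Q lo hi"
    proof (rule Bolzano[of lo hi Q])
      show "lo \<le> hi" using lohi by simp
      fix x assume "lo \<le> x" "x \<le> hi"
      then have xl: "x \<in> {lo..hi}" and x: "x \<in> {0..T}" using lohi by auto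
      obtain d where d: "0 < d" "\<And>r. r \<in> {0..T} ==> r \<noteq> x ==> \<bar>r - x\<bar> < d ==>
          Lp_norm P 4 k (\<lambda>w z. (1 / (r - x)) *\<^sub>R (Y r w z - Y x w z) - D x w z) \<le> c"
        using eventually_within[OF quot[OF x] c] by auto
      have loc: "mb P (\<lambda>w. (Hk_norm k (\<lambda>z. g r w z - g x w z))^2) ((2 * c * \<bar>r - x\<bar>)^2)"
        if r: "r \<in> {0..T}" "r \<noteq> x" "\<bar>r - x\<bar> < d" for r
      proof -
        let ?q = "\<lambda>w z. (1 / (r - x)) *\<^sub>R (Y r w z - Y x w z) - D x w z"
        have q: "rf k P ?q" by (intro rf_diff rf_scaleR Y D r x)
        obtain B1 where B1: "mb P (\<lambda>w. Hk_norm k (Y r w) ^ 4) B1" using Y4[OF r(1)] by blast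
        obtain B2 where B2: "mb P (\<lambda>w. Hk_norm k (Y x w) ^ 4) B2" using Y4[OF x] by blast
        obtain B3 where B3: "mb P (\<lambda>w. Hk_norm k (D x w) ^ 4) B3" using D4[OF x] by blast
        obtain B4 where B4: "mb P (\<lambda>w. Hk_norm k (\<lambda>z. Y r w z - Y x w z) ^ 4) B4"
          using lin4[OF Y[OF r(1)] B1 Y[OF x] B2] by blast
        have "\<exists>B. mb P (\<lambda>w. Hk_norm k (?q w) ^ 4) B"
          using mb_fourth_lin[OF rf_diff[OF Y[OF r(1)] Y[OF x]] B4 D[OF x] B3, of "1 / (r - x)" "-1"] by (intro exI) simp
        then obtain B where "mb P (\<lambda>w. Hk_norm k (?q w) ^ 4) B" by blast
        from Lp4_mb[OF q this d(2)[OF r]] have "mb P (\<lambda>w. Hk_norm k (?q w) ^ 4) (c ^ 4)" .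
        from mb_square_of_fourth[OF this c rf_measurable[OF q]]
        have 1: "mb P (\<lambda>w. (Hk_norm k (?q w))^2) (c^2)" .
        have dr: "rf k P (\<lambda>w z. D x w z - D t w z)" by (intro rf_diff D x t)
        \<comment> \<open>One c comes from the difference quotient at x, the other from the distance
          of the slopes at x and t; together they are the 2 c in \<open>Q\<close>.\<close>
        have "mb P (\<lambda>w. (Hk_norm k (\<lambda>z. ?q w z + (D x w z - D t w z)))^2) ((c + c)^2)"
          by (rule mb_norm_triangle[OF q dr c 1 c D2c[OF xl]])
        from mb_norm_scale[OF rf_add[OF q dr] this, of "r - x"]
        have "mb P (\<lambda>w. (Hk_norm k (\<lambda>z. (r - x) *\<^sub>R (?q w z + (D x w z - D t w z))))^2) ((\<bar>r - x\<bar> * (c + c))^2)" .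
        moreover have "(r - x) *\<^sub>R (?q w z + (D x w z - D t w z)) = g r w z - g x w z" for w z
          using r(2) by (simp add: g_def scaleR_add_right scaleR_diff_right scaleR_diff_left)
        ultimately show ?thesis by (simp add: mult_ac)
      qed
      show "\<exists>d>0. \<forall>a b. a \<le> x \<and> x \<le> b \<and> b - a < d \<longrightarrow> Q a b"
      proof (intro exI[of _ d] conjI d(1) allI impI)
        fix a b assume ab: "a \<le> x \<and> x \<le> b \<and> b - a < d"
        have "Q a x"
        proof (cases "lo \<le> a \<and> a \<noteq> x")
          case True
          then have "a \<in> {0..T}" "a \<noteq> x" "\<bar>a - x\<bar> < d" using ab lohi x by auto
          note L = loc[OF this]
          have "mb P (\<lambda>w. (Hk_norm k (\<lambda>z. g x w z - g a w z))^2) ((2 * c * (x - a))^2)"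
            using ab mb_norm_commute[OF g[OF \<open>a \<in> {0..T}\<close>] g[OF x] L] by (simp add: abs_minus_commute[of a])
          then show ?thesis by (simp add: Q_def)
        qed (auto simp: Q_def)
        moreover have "Q x b"
        proof (cases "b \<le> hi \<and> b \<noteq> x")
          case True
          then have "b \<in> {0..T}" "b \<noteq> x" "\<bar>b - x\<bar> < d" using ab lohi x by auto
          from loc[OF this] have "mb P (\<lambda>w. (Hk_norm k (\<lambda>z. g b w z - g x w z))^2) ((2 * c * (b - x))^2)"
            using ab by simp
          then show ?thesis by (simp add: Q_def)
        qed (auto simp: Q_def)
        ultimately show "Q a b" using ab by (intro trans[of a x b]) auto
      qed
    qed (rule trans)
    then have G: "mb P (\<lambda>w. (Hk_norm k (\<lambda>x. g hi w x - g lo w x))^2) ((2 * c * (hi - lo))^2)"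
      using lohi by (simp add: Q_def)
    have e1: "hi - lo = \<bar>s - t\<bar>" by (auto simp: lo_def hi_def)
    have G2: "mb P (\<lambda>w. (Hk_norm k (\<lambda>x. g s w x - g t w x))^2) ((2 * c * \<bar>s - t\<bar>)^2)"
    proof (cases "s \<le> t")
      case True
      then have "hi = t" "lo = s" by (auto simp: lo_def hi_def)
      with G show ?thesis unfolding e1 by (intro mb_norm_commute[OF g[OF t] g[OF s]]) simp
    next
      case False
      then have "hi = s" "lo = t" by (auto simp: lo_def hi_def)
      with G show ?thesis unfolding e1 by simp
    qed
    have e3: "g s w x - g t w x = Y s w x - Y t w x - (s - t) *\<^sub>R D t w x" for w x
      by (simp add: g_def algebra_simps)
    show ?thesis using G2 unfolding e3 c_def[symmetric] by simp
  qed
  have "mb P (\<lambda>w. (Hk_norm k (\<lambda>x. Y s w x - Y t w x - (s - t) *\<^sub>R D t w x))^2) (4 * C1^2 * \<bar>s - t\<bar> ^ 3)"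
    if s: "s \<in> {0..T}" and t: "t \<in> {0..T}" for s t
  proof (cases "s = t")
    case True
    then show ?thesis by (simp add: mb_zero)
  next
    case False
    have q: "(\<bar>s - t\<bar> powr (1/2))^2 = \<bar>s - t\<bar>"
      using False by (simp add: powr_powr powr_realpow[symmetric])
    have "(2 * (C1 * \<bar>s - t\<bar> powr (1/2)) * \<bar>s - t\<bar>)^2 = 4 * C1^2 * (\<bar>s - t\<bar> powr (1/2))^2 * \<bar>s - t\<bar>^2"
      by (simp only: power_mult_distrib) simp
    also have "\<dots> = 4 * C1^2 * \<bar>s - t\<bar> ^ 3"
      unfolding q by (simp add: power3_eq_cube power2_eq_square)
    finally show ?thesis using main[OF s t False] by simp
  qed
  then show ?thesis by blast
qed

end

text \<open>Versions are chosen at every time separately. This is harmless because each hypothesis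
  compares at most two times, and \<open>Lp_norm\<close> does not change under modification on a
  null set.\<close>

theorem (in complete_measure) C1_Lp_taylor:
  assumes pr: "prob_space M" and T: "0 < T" and C1: "C1_Lp M 4 k S T X D0" and hol: "holder_Lp M 2 k S T (1/2) D0"
  obtains Y D C where
    "\<And>t. t \<in> {0..T} ==> rf k M (Y t)" "\<And>t. t \<in> {0..T} ==> rf k M (D t)"
    "\<And>t w. t \<in> {0..T} ==> w \<in> space M ==> Y t w \<in> S" "\<And>t. t \<in> {0..T} ==> AE w in M. ae_eq (X t w) (Y t w)"
    "\<And>t s. t \<in> {0..T} ==> s \<in> {0..T} ==>
      mb M (\<lambda>w. (Hk_norm k (\<lambda>x. Y s w x - Y t w x - (s - t) *\<^sub>R D t w x))^2) (C * \<bar>s - t\<bar> ^ 3)"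
    "\<And>t. t \<in> {0..T} ==> mb M (\<lambda>w. Hk_norm k (D t w) ^ 4) C"
proof -
  define ok where "ok Z Z' \<longleftrightarrow> rf k M Z' \<and> (\<forall>w\<in>space M. Z' w \<in> S) \<and> (AE w in M. ae_eq (Z w) (Z' w)) \<and>
    (\<exists>C. mb M (\<lambda>w. Hk_norm k (Z' w) ^ 4) C)" for Z Z'
  have ex: "\<exists>Z'. ok Z Z'" if "Z \<in> Lp M 4 k S" for Z
    using that by (rule Lp_4) (auto simp: ok_def)
  have "\<forall>t\<in>{0..T}. \<exists>Z'. ok (X t) Z'" "\<forall>t\<in>{0..T}. \<exists>Z'. ok (D0 t) Z'"
    using C1[unfolded C1_Lp_def, rule_format, THEN conjunct1, THEN ex]
      C1[unfolded C1_Lp_def, rule_format, THEN conjunct2, THEN conjunct1, THEN ex] by auto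
  then obtain Y D where Y: "\<And>t. t \<in> {0..T} ==> ok (X t) (Y t)" and D: "\<And>t. t \<in> {0..T} ==> ok (D0 t) (D t)"
    unfolding bchoice_iff by blast
  have aeY: "AE w in M. ae_eq (X t w) (Y t w)" and aeD: "AE w in M. ae_eq (D0 t w) (D t w)" if "t \<in> {0..T}" for t
    using Y[OF that] D[OF that] unfolding ok_def by - (elim conjE, assumption)+
  have D2: "Lp_norm M p k (\<lambda>w x. D0 s w x - D0 t w x) = Lp_norm M p k (\<lambda>w x. D s w x - D t w x)"
    if "s \<in> {0..T}" "t \<in> {0..T}" for s t p
    by (rule Lp_norm_cong) (use aeD[OF that(1)] aeD[OF that(2)] in eventually_elim, rule ae_eq_map2[where h="(-)"])
  have XD: "Lp_norm M 4 k (\<lambda>w x. (1 / (s - t)) *\<^sub>R (X s w x - X t w x) - D0 t w x) =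
      Lp_norm M 4 k (\<lambda>w x. (1 / (s - t)) *\<^sub>R (Y s w x - Y t w x) - D t w x)"
    if "s \<in> {0..T}" "t \<in> {0..T}" for s t
  proof (rule Lp_norm_cong, use aeY[OF that(1)] aeY[OF that(2)] aeD[OF that(2)] in eventually_elim)
    case (elim w)
    have "ae_eq (\<lambda>x. (1 / (s - t)) *\<^sub>R (X s w x - X t w x)) (\<lambda>x. (1 / (s - t)) *\<^sub>R (Y s w x - Y t w x))"
      by (rule ae_eq_map2[where h="\<lambda>a b. (1 / (s - t)) *\<^sub>R (a - b)", OF elim(1,2)])
    then show ?case by (rule ae_eq_map2[where h="(-)", OF _ elim(3)])
  qed
  have within: "\<forall>\<^sub>F s in at t within {0..T}. s \<in> {0..T}" for t
    by (simp add: eventually_at_filter)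
  interpret S: smooth_field M T k Y D
  proof (intro smooth_field.intro smooth_field_axioms.intro pr complete_measure_axioms T)
    fix t assume t: "t \<in> {0..T}"
    show "rf k M (Y t)" "rf k M (D t)" "\<exists>C. mb M (\<lambda>w. Hk_norm k (Y t w) ^ 4) C" "\<exists>C. mb M (\<lambda>w. Hk_norm k (D t w) ^ 4) C"
      using Y[OF t] D[OF t] unfolding ok_def by - (elim conjE, assumption)+
    have "((\<lambda>s. Lp_norm M 4 k (\<lambda>w x. (1 / (s - t)) *\<^sub>R (X s w x - X t w x) - D0 t w x)) \<longlongrightarrow> 0) (at t within {0..T})"
      "((\<lambda>s. Lp_norm M 4 k (\<lambda>w x. D0 s w x - D0 t w x)) \<longlongrightarrow> 0) (at t within {0..T})"
      using C1[unfolded C1_Lp_def, rule_format, OF t] by - (elim conjE, assumption)+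
    moreover have "\<forall>\<^sub>F s in at t within {0..T}. Lp_norm M 4 k (\<lambda>w x. (1 / (s - t)) *\<^sub>R (X s w x - X t w x) - D0 t w x) =
        Lp_norm M 4 k (\<lambda>w x. (1 / (s - t)) *\<^sub>R (Y s w x - Y t w x) - D t w x)"
      "\<forall>\<^sub>F s in at t within {0..T}. Lp_norm M 4 k (\<lambda>w x. D0 s w x - D0 t w x) = Lp_norm M 4 k (\<lambda>w x. D s w x - D t w x)"
      using within by (eventually_elim, simp only: XD t D2)+
    ultimately show "((\<lambda>s. Lp_norm M 4 k (\<lambda>w x. (1 / (s - t)) *\<^sub>R (Y s w x - Y t w x) - D t w x)) \<longlongrightarrow> 0) (at t within {0..T})"
      "((\<lambda>s. Lp_norm M 4 k (\<lambda>w x. D s w x - D t w x)) \<longlongrightarrow> 0) (at t within {0..T})"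
      by - (rule Lim_transform_eventually, assumption, assumption)+
  next
    show "\<exists>C. \<forall>s\<in>{0..T}. \<forall>t\<in>{0..T}. Lp_norm M 2 k (\<lambda>w x. D t w x - D s w x) \<le> C * \<bar>t - s\<bar> powr (1/2)"
    proof -
      obtain C where C: "\<And>s t. s \<in> {0..T} ==> t \<in> {0..T} ==> Lp_norm M 2 k (\<lambda>w x. D0 t w x - D0 s w x) \<le> C * \<bar>t - s\<bar> powr (1/2)"
        using hol unfolding holder_Lp_def by blast
      then show ?thesis by (intro exI[of _ C] ballI) (simp only: D2)
    qed
  qed
  obtain A where A: "\<And>t. t \<in> {0..T} ==> mb M (\<lambda>w. Hk_norm k (D t w) ^ 4) A" using S.uniform_fourth by blast
  obtain B where B: "\<And>s t. t \<in> {0..T} ==> s \<in> {0..T} ==>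
      mb M (\<lambda>w. (Hk_norm k (\<lambda>x. Y s w x - Y t w x - (s - t) *\<^sub>R D t w x))^2) (B * \<bar>s - t\<bar> ^ 3)"
    using S.taylor by blast
  show thesis
  proof (rule that[of Y D "max A B"])
    fix t assume t: "t \<in> {0..T}"
    show "rf k M (Y t)" "rf k M (D t)" by (rule S.Y[OF t], rule S.D[OF t])
    show "AE w in M. ae_eq (X t w) (Y t w)" by (rule aeY[OF t])
    show "Y t w \<in> S" if "w \<in> space M" for w using Y[OF t] that by (simp add: ok_def)
    show "mb M (\<lambda>w. Hk_norm k (D t w) ^ 4) (max A B)" by (rule mb_weaken[OF A[OF t]]) simp
    fix s assume s: "s \<in> {0..T}"
    show "mb M (\<lambda>w. (Hk_norm k (\<lambda>x. Y s w x - Y t w x - (s - t) *\<^sub>R D t w x))^2) (max A B * \<bar>s - t\<bar> ^ 3)"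
      by (rule mb_weaken[OF B[OF t s]]) (intro mult_right_mono; simp)
  qed
qed

section \<open>Moments of the consistency error\<close>

text \<open>A single constant A majorises all moment constants, those of the noise included, so that
  later bounds can be added without tracking them separately.\<close>

locale moments = noise P F T K e W \<Phi> PhiW
  for P :: "'w measure" and F :: "real \<Rightarrow> 'w measure" and T :: real and K :: "nat set"
    and e :: "nat \<Rightarrow> 'u::real_inner" and W :: "nat \<Rightarrow> real \<Rightarrow> 'w \<Rightarrow> real"
    and \<Phi> :: "'u \<Rightarrow> (real^2) field" and PhiW :: "real \<Rightarrow> 'w \<Rightarrow> (real^2) field" +
  fixes Y D :: "real \<Rightarrow> 'w \<Rightarrow> (real^2) field" and A R :: real
  assumes Yrf: "\<And>t. t \<in> {0..T} ==> rf 2 P (Y t)" and Ypath: "\<And>w. w \<in> space P ==> pcont 2 {0..T} (\<lambda>t. Y t w)"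
    and Drf: "\<And>t. t \<in> {0..T} ==> rf 1 P (D t)"
    and taylor: "\<And>t s. t \<in> {0..T} ==> s \<in> {0..T} ==>
      mb P (\<lambda>w. (Hk_norm 1 (\<lambda>x. Y s w x - Y t w x - (s - t) *\<^sub>R D t w x))^2) (A * \<bar>s - t\<bar> ^ 3)"
    and D4: "\<And>t. t \<in> {0..T} ==> mb P (\<lambda>w. Hk_norm 1 (D t w) ^ 4) A"
    and A1: "1 \<le> A" and A_noise: "3 * hs_sq^2 \<le> A" and R: "0 \<le> R"
begin

section \<open>Moments of increments of y and of the noise\<close>

lemma PhiW_pcont: "AE w in P. pcont 2 {0..T} (\<lambda>t. PhiW t w)"
  using noise unfolding noise_process_def Hk_path_pcont by - (elim conjE, assumption)

lemma mb_increment: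
  assumes "0 \<le> s" "s \<le> t" "t \<le> T"
  shows "mb P (\<lambda>w. Hk_norm 2 (\<lambda>x. PhiW t w x - PhiW s w x) ^ 4) (A * (t - s)^2)"
proof -
  have "mb P (\<lambda>w. Hk_norm 2 (\<lambda>x. PhiW t w x - PhiW s w x) ^ 4) (3 * hs_sq^2 * (t - s)^2)"
    using noise_increments(2)[of s 0 "t - s" 1] assms by simp
  then show ?thesis by (rule mb_weaken) (intro mult_right_mono A_noise; simp)
qed

lemma mb_D2: "t \<in> {0..T} ==> mb P (\<lambda>w. (Hk_norm 1 (D t w))^2) (2 * A)"
  by (rule mb_weaken[OF mb_square_of_fourth_ex[OF Drf D4]]) (use A1 in auto)

lemma mb_dy:
  assumes s: "s \<in> {0..T}" and t: "t \<in> {0..T}" and dt: "\<bar>s - t\<bar> \<le> dt" "dt \<le> 1"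
  shows "mb P (\<lambda>w. (Hk_norm 1 (\<lambda>x. Y s w x - Y t w x))^2) (6 * A * dt^2)"
proof (rule mb_mono[OF mb_add[OF mb_scale[OF taylor[OF t s], of 2] mb_scale[OF mb_D2[OF t], of "2 * dt^2"]]])
  have dt0: "0 \<le> dt" using dt by simp
  show "(\<lambda>w. (Hk_norm 1 (\<lambda>x. Y s w x - Y t w x))^2) \<in> borel_measurable P"
    by (intro rf_power rf_diff rf_mono[OF Yrf[OF s]] rf_mono[OF Yrf[OF t]]) auto
  fix w assume w: "w \<in> space P"
  let ?r = "\<lambda>x. Y s w x - Y t w x - (s - t) *\<^sub>R D t w x"
  have H: "Y s w \<in> Hk 1" "Y t w \<in> Hk 1" "D t w \<in> Hk 1"
    using rf_Hk[OF rf_mono[OF Yrf[OF s]] w] rf_Hk[OF rf_mono[OF Yrf[OF t]] w] rf_Hk[OF Drf[OF t] w] by auto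
  have "Hk_norm 1 (\<lambda>x. ?r x + (s - t) *\<^sub>R D t w x) \<le> Hk_norm 1 ?r + Hk_norm 1 (\<lambda>x. (s - t) *\<^sub>R D t w x)"
    by (intro Hk_triangle Hk_diff Hk_scaleR H)
  moreover have "Hk_norm 1 (\<lambda>x. (s - t) *\<^sub>R D t w x) \<le> dt * Hk_norm 1 (D t w)"
    using dt by (simp add: Hk_norm_scaleR[OF H(3)] mult_right_mono)
  ultimately have "Hk_norm 1 (\<lambda>x. Y s w x - Y t w x) \<le> Hk_norm 1 ?r + dt * Hk_norm 1 (D t w)" by simp
  then have "(Hk_norm 1 (\<lambda>x. Y s w x - Y t w x))^2 \<le> (Hk_norm 1 ?r + dt * Hk_norm 1 (D t w))^2"
    by (intro power_mono) auto
  also have "\<dots> \<le> 2 * (Hk_norm 1 ?r)^2 + 2 * dt^2 * (Hk_norm 1 (D t w))^2"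
    using sum_squares_bound[of "Hk_norm 1 ?r" "dt * Hk_norm 1 (D t w)"] by (simp add: power2_sum power_mult_distrib)
  finally show "(Hk_norm 1 (\<lambda>x. Y s w x - Y t w x))^2 \<le> 2 * (Hk_norm 1 ?r)^2 + 2 * dt^2 * (Hk_norm 1 (D t w))^2" .
next
  have dt0: "0 \<le> dt" using dt by simp
  have "\<bar>s - t\<bar> ^ 3 \<le> dt ^ 3" using dt by (intro power_mono) auto
  also have "\<dots> \<le> dt ^ 2" using dt dt0 by (intro power_decreasing) auto
  finally have "2 * (A * \<bar>s - t\<bar> ^ 3) \<le> 2 * (A * dt^2)" using A1 by (intro mult_left_mono) auto
  then show "2 * (A * \<bar>s - t\<bar> ^ 3) + 2 * dt^2 * (2 * A) \<le> 6 * A * dt^2" by simp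
qed auto

text \<open>For products of fourth-moment quantities: \<open>(p q)\<^sup>2 \<le> (c p\<^sup>4 + q\<^sup>4 / c) / 2\<close>.\<close>

lemma mb_product:
  assumes p: "mb P (\<lambda>w. p w ^ 4) B" "p \<in> borel_measurable P" and q: "mb P (\<lambda>w. q w ^ 4) C" "q \<in> borel_measurable P"
    and c: "0 < c"
  shows "mb P (\<lambda>w. (p w * q w)^2) ((c * B + C / c) / 2)"
proof (rule mb_mono[OF mb_add[OF mb_scale[OF p(1), of "c / 2"] mb_scale[OF q(1), of "1 / (2 * c)"]]])
  fix w
  have "(p w * q w)^2 \<le> c / 2 * (x^2)^2 + 1 / (2 * c) * (y^2)^2" if "x = p w" "y = q w" for x y
  proof -
    have "0 \<le> (c * x^2 - y^2)^2 / (2 * c)" using c by simp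
    also have "\<dots> = c / 2 * (x^2)^2 + 1 / (2 * c) * (y^2)^2 - x^2 * y^2"
      using c by (simp add: power2_eq_square field_simps)
    finally show ?thesis by (simp add: that power_mult_distrib)
  qed
  from this[OF refl refl] show "(p w * q w)^2 \<le> c / 2 * p w ^ 4 + 1 / (2 * c) * q w ^ 4"
    by (simp add: power_mult[symmetric])
qed (use c p q in \<open>auto simp: field_simps\<close>)

context
  fixes dt :: real and M n :: nat
  assumes dt: "0 < dt" "dt \<le> 1" and M: "real M * dt = 1" and n: "real n * dt + dt \<le> T"
begin

text \<open>This and the following definitions are the random counterparts of the quantities of a
  single step. They make sense on the whole probability space, also where the path bounds fail, so
  that expectations can be taken.\<close>

definition "a = real n * dt"
definition "rho s w = (\<lambda>x. Y s w x - midpoint_field (Y a w) (Y (a + dt) w) x - (s - (a + dt / 2)) *\<^sub>R D a w x)"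
definition "rhos s w = (\<lambda>x. Y s w x - extrapolate (\<lambda>k. Y (real k * dt) w) n x - (s - (a + dt / 2)) *\<^sub>R D a w x)"
definition "dY s w = (\<lambda>x. Y s w x - Y a w x)"
definition "dN s w = (\<lambda>x. PhiW s w x - PhiW a w x)"
definition "inc l r w = (\<lambda>x. PhiW (a + real (l - 1) * dt^2 + r) w x - PhiW (a + real l * dt^2) w x)"
text \<open>The truncation by \<open>2 R\<close> has no effect on the event where \<open>Y\<close> is bounded by \<open>R\<close>, and makes fourth moments of
  \<open>dY\<close> available from second moments.\<close>

definition "k1 s w = Hk_norm 1 (rhos s w) + Hk_norm 1 (rho s w) +
  dt * (Hk_norm 1 (D a w) * (min (Hk_norm 1 (dY s w)) (2 * R) + Hk_norm 2 (dN s w)))"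
definition "k2 r w = Hk_norm 2 (\<lambda>x. \<Sum>l=1..M. inc l r w x) +
  (\<Sum>l=1..M. Hk_norm 2 (inc l r w) * (Hk_norm 2 (dN (a + real l * dt^2) w) + Hk_norm 2 (dN (a + real (l - 1) * dt^2 + r) w)))"
definition "kk w = integral {a..a + dt} (\<lambda>s. k1 s w) + integral {0..dt^2} (\<lambda>r. k2 r w)"

lemma Mh: "real M * dt^2 = dt"
  using M by (simp add: power2_eq_square mult.assoc[symmetric])

lemma a_in: "a \<in> {0..T}" "a + dt \<in> {0..T}" and sub: "{a..a + dt} \<subseteq> {0..T}"
  using n dt by (auto simp: a_def intro: order_trans[of _ "real n * dt"])

lemma prev_in: "real (n - 1) * dt \<in> {0..T}"
proof -
  have "real (n - 1) * dt \<le> real n * dt" using dt by (intro mult_right_mono) auto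
  also have "\<dots> \<le> T" using a_in(1) by (simp add: a_def)
  finally show ?thesis using dt by simp
qed

lemma tl_in: "l \<in> {1..M} ==> a + real l * dt^2 \<in> {a..a + dt}"
  and t_in: "l \<in> {1..M} ==> r \<in> {0..dt^2} ==> a + real (l - 1) * dt^2 + r \<in> {a..a + dt}"
  and step_le: "l \<in> {1..M} ==> r \<in> {0..dt^2} ==> a + real (l - 1) * dt^2 + r \<le> a + real l * dt^2"
  and step_eq: "l \<in> {1..M} ==> a + real l * dt^2 = a + real (l - 1) * dt^2 + dt^2"
proof -
  assume l: "l \<in> {1..M}"
  have "real l * dt^2 \<le> real M * dt^2" using l by (intro mult_right_mono) auto
  then show *: "a + real l * dt^2 \<in> {a..a + dt}" using Mh by simp
  show eq: "a + real l * dt^2 = a + real (l - 1) * dt^2 + dt^2" using l by (simp add: of_nat_diff algebra_simps)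
  assume r: "r \<in> {0..dt^2}"
  show "a + real (l - 1) * dt^2 + r \<in> {a..a + dt}" "a + real (l - 1) * dt^2 + r \<le> a + real l * dt^2" using * r eq by auto
qed

lemma Y1: "t \<in> {0..T} ==> rf 1 P (Y t)"
  by (rule rf_mono[OF Yrf]) auto

lemma extrapolate_rf: "rf 1 P (\<lambda>w. extrapolate (\<lambda>k. Y (real k * dt) w) n)"
  using a_in(1) prev_in unfolding extrapolate_def a_def
  by (cases "n = 0") (simp_all add: rf_diff rf_scaleR Y1)

lemma rf_fields:
  assumes "s \<in> {a..a + dt}"
  shows "rf 1 P (rho s)" "rf 1 P (rhos s)" "rf 1 P (dY s)" "rf 2 P (dN s)"
proof -
  have s: "s \<in> {0..T}" using assms sub by blast
  show "rf 1 P (rho s)" "rf 1 P (rhos s)" "rf 1 P (dY s)" "rf 2 P (dN s)"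
    unfolding rho_def[abs_def] rhos_def[abs_def] dY_def[abs_def] dN_def[abs_def] midpoint_field_def
    by (intro rf_diff rf_add rf_scaleR Y1 Drf extrapolate_rf PhiW_rf s a_in)+
qed

lemma rf_inc: "l \<in> {1..M} ==> r \<in> {0..dt^2} ==> rf 2 P (inc l r)"
  unfolding inc_def[abs_def] using tl_in t_in sub by (intro rf_diff PhiW_rf) blast+

lemma taylor_le:
  assumes "s \<in> {0..T}" "t \<in> {0..T}" "\<bar>s - t\<bar> \<le> dt"
  shows "mb P (\<lambda>w. (Hk_norm 1 (\<lambda>x. Y s w x - Y t w x - (s - t) *\<^sub>R D t w x))^2) (A * dt ^ 3)"
  by (rule mb_weaken[OF taylor[OF assms(2,1)]]) (use A1 assms in \<open>intro mult_left_mono power_mono; simp\<close>)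

lemma mb_combine:
  assumes X: "rf 1 P X" "mb P (\<lambda>w. (Hk_norm 1 (X w))^2) B" and Z: "rf 1 P Z" "mb P (\<lambda>w. (Hk_norm 1 (Z w))^2) C"
    and V: "rf 1 P V" "\<And>w. w \<in> space P ==> V w = (\<lambda>x. X w x + c *\<^sub>R Z w x)" and le: "2 * B + 2 * c^2 * C \<le> E"
  shows "mb P (\<lambda>w. (Hk_norm 1 (V w))^2) E"
proof (rule mb_mono[OF mb_add[OF mb_scale[OF X(2), of 2] mb_scale[OF Z(2), of "2 * c^2"]] rf_power[OF V(1)]])
  fix w assume w: "w \<in> space P"
  have "Hk_norm 1 (V w) \<le> Hk_norm 1 (X w) + \<bar>c\<bar> * Hk_norm 1 (Z w)"
    using Hk_triangle[OF rf_Hk[OF X(1) w] Hk_scaleR[OF rf_Hk[OF Z(1) w], of c]]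
    by (simp add: V(2)[OF w] Hk_norm_scaleR[OF rf_Hk[OF Z(1) w]])
  then have "(Hk_norm 1 (V w))^2 \<le> (Hk_norm 1 (X w) + \<bar>c\<bar> * Hk_norm 1 (Z w))^2" by (intro power_mono) auto
  also have "\<dots> \<le> 2 * (Hk_norm 1 (X w))^2 + 2 * c^2 * (Hk_norm 1 (Z w))^2"
    using sum_squares_bound[of "Hk_norm 1 (X w)" "\<bar>c\<bar> * Hk_norm 1 (Z w)"] by (simp add: power2_sum power_mult_distrib)
  finally show "(Hk_norm 1 (V w))^2 \<le> 2 * (Hk_norm 1 (X w))^2 + 2 * c^2 * (Hk_norm 1 (Z w))^2" .
qed (use le in auto)

text \<open>The order in dt of the mean square of the extrapolation remainder: the first step
  extrapolates by a constant.\<close>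

definition "j = (if n = 0 then 2 else 3 :: nat)"

lemma dt3_le: "dt ^ 3 \<le> dt ^ j" and dtj_le: "dt ^ j \<le> dt^2"
  using dt by (auto simp: j_def intro!: power_decreasing)

text \<open>The remainder around the midpoint is the Taylor remainder from a to s minus half of the
  one from a to a + dt.\<close>

lemma mb_rho: "s \<in> {a..a + dt} ==> mb P (\<lambda>w. (Hk_norm 1 (rho s w))^2) (3 * A * dt ^ 3)"
proof -
  assume s: "s \<in> {a..a + dt}"
  then have s': "s \<in> {0..T}" "\<bar>s - a\<bar> \<le> dt" using sub by auto
  have "0 \<le> A * dt ^ 3" using A1 dt by simp
  then show ?thesis
  proof (intro mb_combine[where c="- 1/2", OF _ taylor_le[OF s'(1) a_in(1) s'(2)] _ taylor_le[OF a_in(2,1)] rf_fields(1)[OF s]]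
      rf_diff rf_scaleR Y1 Drf s' a_in)
    show "\<bar>a + dt - a\<bar> \<le> dt" using dt by simp
    show "rho s w = (\<lambda>x. Y s w x - Y a w x - (s - a) *\<^sub>R D a w x + (- 1/2) *\<^sub>R (Y (a + dt) w x - Y a w x - (a + dt - a) *\<^sub>R D a w x))"
      for w
    proof (rule ext)
      fix x
      have "(1/2) *\<^sub>R Y a w x + (1/2) *\<^sub>R Y a w x = Y a w x" by (simp add: scaleR_left_distrib[symmetric])
      then show "rho s w x = Y s w x - Y a w x - (s - a) *\<^sub>R D a w x + (- 1/2) *\<^sub>R (Y (a + dt) w x - Y a w x - (a + dt - a) *\<^sub>R D a w x)"
        by (simp add: rho_def midpoint_field_def algebra_simps)
    qed
  qed (simp add: power2_eq_square)
qed

text \<open>Away from the first step the extrapolation adds half of the Taylor remainder from a back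
  to a - dt. In the first step the term (dt/2) D(a) survives uncancelled and lowers the order to
  dt^2.\<close>

lemma mb_rhos: "s \<in> {a..a + dt} ==> mb P (\<lambda>w. (Hk_norm 1 (rhos s w))^2) (3 * A * dt ^ j)"
proof -
  assume s: "s \<in> {a..a + dt}"
  then have s': "s \<in> {0..T}" "\<bar>s - a\<bar> \<le> dt" using sub by auto
  have Adt: "0 \<le> A * dt ^ 3" using A1 dt by simp
  show ?thesis
  proof (cases "n = 0")
    case True
    then have a0: "a = 0" unfolding a_def by simp
    show ?thesis
    proof (intro mb_combine[where c="dt/2", OF _ taylor_le[OF s'(1) a_in(1) s'(2)] _ mb_D2[OF a_in(1)] rf_fields(2)[OF s]]
      rf_diff rf_scaleR Y1 Drf s' a_in)
      show "rhos s w = (\<lambda>x. Y s w x - Y a w x - (s - a) *\<^sub>R D a w x + (dt/2) *\<^sub>R D a w x)" for w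
      proof (rule ext)
        fix x
        have "(3/2) *\<^sub>R Y 0 w x - (1/2) *\<^sub>R Y 0 w x = Y 0 w x" by (simp add: scaleR_left_diff_distrib[symmetric])
        then show "rhos s w x = Y s w x - Y a w x - (s - a) *\<^sub>R D a w x + (dt/2) *\<^sub>R D a w x"
          unfolding rhos_def extrapolate_def using True a0 by (simp add: algebra_simps)
      qed
      have "A * dt ^ 3 \<le> A * dt^2" using A1 dt by (intro mult_left_mono power_decreasing) auto
      then show "2 * (A * dt ^ 3) + 2 * (dt / 2)^2 * (2 * A) \<le> 3 * A * dt ^ j"
        unfolding j_def using True by (simp add: power_divide)
    qed
  next
    case False
    have prev: "real (n - 1) * dt = a - dt" using False by (simp add: a_def of_nat_diff algebra_simps)
    have p: "a - dt \<in> {0..T}" using prev_in by (simp add: prev)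
    show ?thesis
    proof (intro mb_combine[where c="1/2", OF _ taylor_le[OF s'(1) a_in(1) s'(2)] _ taylor_le[OF p a_in(1)] rf_fields(2)[OF s]]
      rf_diff rf_scaleR Y1 Drf s' a_in p)
      show "\<bar>a - dt - a\<bar> \<le> dt" using dt by simp
      show "rhos s w = (\<lambda>x. Y s w x - Y a w x - (s - a) *\<^sub>R D a w x + (1/2) *\<^sub>R (Y (a - dt) w x - Y a w x - (a - dt - a) *\<^sub>R D a w x))" for w
      proof (rule ext)
        fix x
        have "(3/2) *\<^sub>R Y a w x = (1 + 1/2) *\<^sub>R Y a w x" by simp
        then have "(3/2) *\<^sub>R Y a w x = Y a w x + (1/2) *\<^sub>R Y a w x" by (simp only: scaleR_left_distrib scaleR_one)
        moreover have "extrapolate (\<lambda>k. Y (real k * dt) w) n x = (3/2) *\<^sub>R Y a w x - (1/2) *\<^sub>R Y (a - dt) w x"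
          using False by (simp add: extrapolate_def prev) (simp add: a_def)
        ultimately show "rhos s w x = Y s w x - Y a w x - (s - a) *\<^sub>R D a w x + (1/2) *\<^sub>R (Y (a - dt) w x - Y a w x - (a - dt - a) *\<^sub>R D a w x)"
          by (simp add: rhos_def algebra_simps)
      qed
      show "2 * (A * dt ^ 3) + 2 * (1/2)^2 * (A * dt ^ 3) \<le> 3 * A * dt ^ j"
        using False Adt by (simp add: j_def power2_eq_square)
    qed
  qed
qed

lemma k1_meas: "s \<in> {a..a + dt} ==> k1 s \<in> borel_measurable P"
  unfolding k1_def[abs_def]
  by (intro borel_measurable_add borel_measurable_times borel_measurable_min borel_measurable_const
      rf_measurable[OF rf_fields(1)] rf_measurable[OF rf_fields(2)] rf_measurable[OF rf_fields(3)] rf_measurable[OF rf_fields(4)]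
      rf_measurable[OF Drf] a_in)

text \<open>All four contributions have mean square of order dt^3 except the extrapolation
  remainder, which decides the exponent j.\<close>

lemma mb_k1:
  assumes s: "s \<in> {a..a + dt}"
  shows "mb P (\<lambda>w. (k1 s w)^2) (A * (30 + 48 * R^2) * dt ^ j)"
proof -
  have s': "s \<in> {0..T}" "\<bar>s - a\<bar> \<le> dt" using s sub by auto
  let ?m = "\<lambda>w. min (Hk_norm 1 (dY s w)) (2 * R)"
  have Dm: "(\<lambda>w. Hk_norm 1 (D a w)) \<in> borel_measurable P" by (rule rf_measurable[OF Drf[OF a_in(1)]])
  have mm: "?m \<in> borel_measurable P" by (intro borel_measurable_min borel_measurable_const rf_measurable[OF rf_fields(3)[OF s]])
  have m4: "mb P (\<lambda>w. ?m w ^ 4) ((2 * R)^2 * (6 * A * dt^2))"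
  proof (rule mb_mono[OF mb_scale[OF mb_dy[OF s'(1) a_in(1) s'(2) dt(2)], of "(2 * R)^2"]])
    fix w
    have "(?m w)^2 * (?m w)^2 \<le> (2 * R)^2 * (Hk_norm 1 (dY s w))^2"
      using R by (intro mult_mono power_mono) auto
    then show "?m w ^ 4 \<le> (2 * R)^2 * (Hk_norm 1 (\<lambda>x. Y s w x - Y a w x))^2"
      by (simp add: dY_def power_add[symmetric])
  qed (use mm R in auto)
  \<comment> \<open>The weight dt balances a fourth moment of order 1 against one of order dt^2, so
    that both parts are of order dt.\<close>
  have m1: "mb P (\<lambda>w. (Hk_norm 1 (D a w) * ?m w)^2) ((dt * A + (2 * R)^2 * (6 * A * dt^2) / dt) / 2)"
    by (rule mb_product[OF D4[OF a_in(1)] Dm m4 mm dt(1)])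
  have w4: "mb P (\<lambda>w. Hk_norm 2 (dN s w) ^ 4) (A * dt^2)"
    unfolding dN_def
  proof (rule mb_weaken[OF mb_increment])
    show "A * (s - a)^2 \<le> A * dt^2" using A1 s by (intro mult_left_mono power_mono) auto
  qed (use s a_in s' in auto)
  have m2: "mb P (\<lambda>w. (Hk_norm 1 (D a w) * Hk_norm 2 (dN s w))^2) ((dt * A + A * dt^2 / dt) / 2)"
    by (rule mb_product[OF D4[OF a_in(1)] Dm w4 rf_measurable[OF rf_fields(4)[OF s]] dt(1)])
  have "mb P (\<lambda>w. (4 * (Hk_norm 1 (rhos s w))^2 + 4 * (Hk_norm 1 (rho s w))^2) +
        (4 * dt^2 * (Hk_norm 1 (D a w) * ?m w)^2 + 4 * dt^2 * (Hk_norm 1 (D a w) * Hk_norm 2 (dN s w))^2))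
      ((4 * (3 * A * dt ^ j) + 4 * (3 * A * dt ^ 3)) +
        (4 * dt^2 * ((dt * A + (2 * R)^2 * (6 * A * dt^2) / dt) / 2) + 4 * dt^2 * ((dt * A + A * dt^2 / dt) / 2)))"
    by (intro mb_add mb_scale mb_rho mb_rhos m1 m2 s) auto
  then show ?thesis
  proof (rule mb_mono)
    show "(\<lambda>w. (k1 s w)^2) \<in> borel_measurable P" using k1_meas[OF s] by measurable
    have e1: "4 * dt^2 * ((dt * A + (2 * R)^2 * (6 * A * dt^2) / dt) / 2) = (2 + 48 * R^2) * (A * dt ^ 3)"
      using dt(1) by (simp add: power2_eq_square power3_eq_cube field_simps)
    have e2: "4 * dt^2 * ((dt * A + A * dt^2 / dt) / 2) = 4 * (A * dt ^ 3)"
      using dt(1) by (simp add: power2_eq_square power3_eq_cube field_simps)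
    have "(18 + 48 * R^2) * (A * dt ^ 3) \<le> (18 + 48 * R^2) * (A * dt ^ j)"
      using A1 by (intro mult_left_mono dt3_le) auto
    then show "(4 * (3 * A * dt ^ j) + 4 * (3 * A * dt ^ 3)) +
        (4 * dt^2 * ((dt * A + (2 * R)^2 * (6 * A * dt^2) / dt) / 2) + 4 * dt^2 * ((dt * A + A * dt^2 / dt) / 2)) \<le> A * (30 + 48 * R^2) * dt ^ j"
      unfolding e1 e2 by (simp add: algebra_simps)
    fix w
    have sq4: "(x1 + x2 + dt * (d * (x3 + x4)))^2 \<le> (4 * x1^2 + 4 * x2^2) + (4 * dt^2 * (d * x3)^2 + 4 * dt^2 * (d * x4)^2)"
      for x1 x2 x3 x4 d :: real
    proof -
      define y3 y4 where "y3 = dt * (d * x3)" and "y4 = dt * (d * x4)"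
      have "(x1 + x2 + y3 + y4)^2 \<le> 4 * x1^2 + 4 * x2^2 + 4 * y3^2 + 4 * y4^2"
        using sum_squares_bound[of x1 x2] sum_squares_bound[of x1 y3] sum_squares_bound[of x1 y4]
          sum_squares_bound[of x2 y3] sum_squares_bound[of x2 y4] sum_squares_bound[of y3 y4]
        by (simp add: power2_eq_square algebra_simps)
      then show ?thesis by (simp add: y3_def y4_def power_mult_distrib algebra_simps)
    qed
    show "(k1 s w)^2 \<le> (4 * (Hk_norm 1 (rhos s w))^2 + 4 * (Hk_norm 1 (rho s w))^2) +
        (4 * dt^2 * (Hk_norm 1 (D a w) * ?m w)^2 + 4 * dt^2 * (Hk_norm 1 (D a w) * Hk_norm 2 (dN s w))^2)"
      unfolding k1_def by (rule sq4)
  qed simp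
qed

lemma mb_inc:
  assumes l: "l \<in> {1..M}" and r: "r \<in> {0..dt^2}"
  shows "mb P (\<lambda>w. Hk_norm 2 (inc l r w) ^ 4) (A * dt ^ 4)"
proof -
  have t: "a + real (l - 1) * dt^2 + r \<in> {0..T}" "a + real l * dt^2 \<in> {0..T}" using t_in[OF l r] tl_in[OF l] sub by blast+
  have b: "mb P (\<lambda>w. Hk_norm 2 (\<lambda>x. PhiW (a + real l * dt^2) w x - PhiW (a + real (l - 1) * dt^2 + r) w x) ^ 4)
      (A * (a + real l * dt^2 - (a + real (l - 1) * dt^2 + r))^2)"
    by (rule mb_increment) (use t step_le[OF l r] in auto)
  show ?thesis
  proof (rule mb_mono[OF b rf_power[OF rf_inc[OF l r]]])
    have "(a + real l * dt^2 - (a + real (l - 1) * dt^2 + r))^2 \<le> (dt^2)^2"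
      using step_eq[OF l] r by (intro power_mono) auto
    then show "A * (a + real l * dt^2 - (a + real (l - 1) * dt^2 + r))^2 \<le> A * dt ^ 4"
      using A1 by (intro mult_left_mono) (auto simp: power_mult[symmetric])
    show "Hk_norm 2 (inc l r w) ^ 4 \<le> Hk_norm 2 (\<lambda>x. PhiW (a + real l * dt^2) w x - PhiW (a + real (l - 1) * dt^2 + r) w x) ^ 4"
      if "w \<in> space P" for w
      unfolding inc_def using Hk_norm_diff_commute[OF rf_Hk[OF PhiW_rf[OF t(1)] that] rf_Hk[OF PhiW_rf[OF t(2)] that]] by simp
  qed auto
qed

lemma M0: "0 < M"
  using M by (cases M) auto

text \<open>The increments lie over disjoint intervals of total length at most dt, so the fourth
  moment of the sum is of order dt^2; adding M norms would lose all smallness. The sign is reversed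
  because \<open>inc\<close> subtracts the value at the right end point.\<close>

lemma mb_inc_sum:
  assumes r: "r \<in> {0..dt^2}"
  shows "mb P (\<lambda>w. Hk_norm 2 (\<lambda>x. \<Sum>l=1..M. inc l r w x) ^ 4) (A * dt^2)"
proof -
  let ?S = "\<lambda>w x. \<Sum>i<M. PhiW (a + real (Suc i) * dt^2) w x - PhiW (a + real i * dt^2 + r) w x"
  have ar: "0 \<le> a" "0 \<le> r" "r \<le> dt^2" "a + real M * dt^2 \<le> T" using a_in r Mh by auto
  have eq: "(\<Sum>l=1..M. inc l r w x) = (-1) *\<^sub>R ?S w x" for w x
  proof -
    have "(\<Sum>l=1..M. inc l r w x) = (\<Sum>i<M. inc (Suc i) r w x)"
      by (rule sum.reindex_bij_witness[of _ Suc "\<lambda>l. l - 1"]) auto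
    then show ?thesis by (simp add: inc_def sum_negf[symmetric])
  qed
  show ?thesis
  proof (rule mb_mono[OF noise_increments(2)[OF ar(1-3) M0 ar(4)]])
    show "(\<lambda>w. Hk_norm 2 (\<lambda>x. \<Sum>l=1..M. inc l r w x) ^ 4) \<in> borel_measurable P"
      by (intro rf_power rf_sum rf_inc r)
    show "Hk_norm 2 (\<lambda>x. \<Sum>l=1..M. inc l r w x) ^ 4 \<le> Hk_norm 2 (?S w) ^ 4" if "w \<in> space P" for w
      unfolding eq using Hk_norm_scaleR[OF rf_Hk[OF noise_increments(1)[OF ar(1-3) M0 ar(4)] that], of "-1"] by simp
    have "real M * (dt^2 - r) \<le> dt" using mult_left_mono[of "dt^2 - r" "dt^2" "real M"] ar Mh by simp
    moreover have "0 \<le> real M * (dt^2 - r)" using ar by simp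
    ultimately have "(real M * (dt^2 - r))^2 \<le> dt^2" by (intro power_mono) auto
    then show "3 * hs_sq^2 * (real M * (dt^2 - r))^2 \<le> A * dt^2"
      using A_noise A1 by (intro mult_mono) auto
  qed auto
qed

lemma k2_meas: "r \<in> {0..dt^2} ==> k2 r \<in> borel_measurable P"
  unfolding k2_def[abs_def]
  by (intro borel_measurable_add borel_measurable_sum borel_measurable_times rf_measurable[OF rf_sum[OF rf_inc]]
      rf_measurable[OF rf_inc] rf_measurable[OF rf_fields(4)] tl_in t_in; assumption)

text \<open>A product of an increment over a substep with a deviation from the start of the step has
  mean square of order dt^3. Cauchy-Schwarz over the substeps costs M^2 = 1/dt^2, which leaves order
  dt, the same as for the sum of the increments.\<close>

lemma mb_k2:
  assumes r: "r \<in> {0..dt^2}"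
  shows "mb P (\<lambda>w. (k2 r w)^2) (10 * A * dt)"
proof -
  let ?S = "\<lambda>w. Hk_norm 2 (\<lambda>x. \<Sum>l=1..M. inc l r w x)"
  let ?p = "\<lambda>l w. Hk_norm 2 (dN (a + real l * dt^2) w)" and ?q = "\<lambda>l w. Hk_norm 2 (dN (a + real (l - 1) * dt^2 + r) w)"
  have dN4: "mb P (\<lambda>w. Hk_norm 2 (dN s w) ^ 4) (A * dt^2)" if s: "s \<in> {a..a + dt}" for s
    unfolding dN_def
  proof (rule mb_weaken[OF mb_increment])
    show "A * (s - a)^2 \<le> A * dt^2" using A1 s by (intro mult_left_mono power_mono) auto
  qed (use s a_in sub in auto)
  have Sm: "?S \<in> borel_measurable P" by (intro rf_measurable rf_sum rf_inc r)
  \<comment> \<open>The artificial factor 1 lets the product rule convert the fourth moment into a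
    second one of the right order.\<close>
  have S2: "mb P (\<lambda>w. (1 * ?S w)^2) ((dt * 1 + A * dt^2 / dt) / 2)"
    by (rule mb_product[OF _ _ mb_inc_sum[OF r] Sm dt(1)]) (use mb_const[of 1] in auto)
  have prod: "mb P (\<lambda>w. (?p l w * Hk_norm 2 (inc l r w))^2) ((dt * (A * dt^2) + (A * dt ^ 4) / dt) / 2)"
    "mb P (\<lambda>w. (?q l w * Hk_norm 2 (inc l r w))^2) ((dt * (A * dt^2) + (A * dt ^ 4) / dt) / 2)" if l: "l \<in> {1..M}" for l
    by (rule mb_product[OF dN4 _ mb_inc[OF l r] rf_measurable[OF rf_inc[OF l r]] dt(1)],
        (rule tl_in[OF l] t_in[OF l r]), rule rf_measurable[OF rf_fields(4)], (rule tl_in[OF l] t_in[OF l r]))+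
  have e4: "(dt * (A * dt^2) + (A * dt ^ 4) / dt) / 2 = A * dt ^ 3"
    using dt(1) by (simp add: power2_eq_square power3_eq_cube power4_eq_xxxx)
  have "mb P (\<lambda>w. 2 * (1 * ?S w)^2 + 2 * real M * (\<Sum>l=1..M. 2 * (?p l w * Hk_norm 2 (inc l r w))^2 + 2 * (?q l w * Hk_norm 2 (inc l r w))^2))
      (2 * ((dt * 1 + A * dt^2 / dt) / 2) + 2 * real M * (\<Sum>l=1..M. 2 * (A * dt ^ 3) + 2 * (A * dt ^ 3)))"
    by (intro mb_add mb_scale mb_sum prod[unfolded e4] S2) auto
  then show ?thesis
  proof (rule mb_mono)
    show "(\<lambda>w. (k2 r w)^2) \<in> borel_measurable P" using k2_meas[OF r] by measurable
    have "2 * real M * (\<Sum>l=1..M. 2 * (A * dt ^ 3) + 2 * (A * dt ^ 3)) = 8 * A * dt * (real M * dt)^2"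
      by (simp add: power2_eq_square power3_eq_cube)
    then have e5: "2 * real M * (\<Sum>l=1..M. 2 * (A * dt ^ 3) + 2 * (A * dt ^ 3)) = 8 * A * dt"
      unfolding M by simp
    have e6: "2 * ((dt * 1 + A * dt^2 / dt) / 2) = dt + A * dt"
      using dt(1) by (simp add: power2_eq_square)
    have "dt \<le> A * dt" using A1 dt(1) by simp
    then show "2 * ((dt * 1 + A * dt^2 / dt) / 2) + 2 * real M * (\<Sum>l=1..M. 2 * (A * dt ^ 3) + 2 * (A * dt ^ 3)) \<le> 10 * A * dt"
      unfolding e5 e6 by simp
    fix w
    have sq2: "(x + y)^2 \<le> 2 * x^2 + 2 * y^2" for x y :: real
      using sum_squares_bound[of x y] by (simp add: power2_sum)
    have "(k2 r w)^2 \<le> 2 * (1 * ?S w)^2 + 2 * (\<Sum>l=1..M. Hk_norm 2 (inc l r w) * (?p l w + ?q l w))^2"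
      using sq2[of "?S w"] unfolding k2_def by simp
    also have "(\<Sum>l=1..M. Hk_norm 2 (inc l r w) * (?p l w + ?q l w))^2 \<le> real M * (\<Sum>l=1..M. (Hk_norm 2 (inc l r w) * (?p l w + ?q l w))^2)"
      using Cauchy_Schwarz_ineq_sum[of "\<lambda>l. 1" "\<lambda>l. Hk_norm 2 (inc l r w) * (?p l w + ?q l w)" "{1..M}"] by simp
    also have "(\<Sum>l=1..M. (Hk_norm 2 (inc l r w) * (?p l w + ?q l w))^2) \<le>
        (\<Sum>l=1..M. 2 * (?p l w * Hk_norm 2 (inc l r w))^2 + 2 * (?q l w * Hk_norm 2 (inc l r w))^2)"
    proof (rule sum_mono)
      fix l
      show "(Hk_norm 2 (inc l r w) * (?p l w + ?q l w))^2 \<le> 2 * (?p l w * Hk_norm 2 (inc l r w))^2 + 2 * (?q l w * Hk_norm 2 (inc l r w))^2"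
        using sq2[of "?p l w * Hk_norm 2 (inc l r w)" "?q l w * Hk_norm 2 (inc l r w)"] by (simp add: algebra_simps)
    qed
    finally show "(k2 r w)^2 \<le> 2 * (1 * ?S w)^2 + 2 * real M * (\<Sum>l=1..M. 2 * (?p l w * Hk_norm 2 (inc l r w))^2 + 2 * (?q l w * Hk_norm 2 (inc l r w))^2)"
      by (simp add: mult_left_mono mult.assoc)
  qed simp
qed

lemma cont_k1: "w \<in> space P ==> pcont 2 {0..T} (\<lambda>t. PhiW t w) ==> continuous_on {a..a + dt} (\<lambda>s. k1 s w)"
proof -
  assume w: "w \<in> space P" and wc: "pcont 2 {0..T} (\<lambda>t. PhiW t w)"
  have y: "pcont 1 {a..a + dt} (\<lambda>t. Y t w)"
    by (rule pcont_mono[OF pcont_subset[OF Ypath[OF w] sub]]) simp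
  have wc': "pcont 2 {a..a + dt} (\<lambda>t. PhiW t w)" by (rule pcont_subset[OF wc sub])
  have H: "Y a w \<in> Hk 1" "Y (a + dt) w \<in> Hk 1" "D a w \<in> Hk 1" "PhiW a w \<in> Hk 2"
    using rf_Hk[OF Y1 w] rf_Hk[OF Drf w] rf_Hk[OF PhiW_rf w] a_in by blast+
  have mid: "midpoint_field (Y a w) (Y (a + dt) w) \<in> Hk 1" by (simp add: midpoint_field_def H)
  have "pcont 1 {a..a + dt} (\<lambda>s. rho s w)" "pcont 1 {a..a + dt} (\<lambda>s. rhos s w)" "pcont 1 {a..a + dt} (\<lambda>s. dY s w)"
    unfolding rho_def rhos_def dY_def
    by (intro pcont_diff y pcont_linear pcont_const H mid rf_Hk[OF extrapolate_rf w])+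
  moreover have "pcont 2 {a..a + dt} (\<lambda>s. dN s w)"
    unfolding dN_def by (intro pcont_diff wc' pcont_const H)
  ultimately show ?thesis
    unfolding k1_def by (intro continuous_intros pcont_norm)
qed

lemma cont_k2: "w \<in> space P ==> pcont 2 {0..T} (\<lambda>t. PhiW t w) ==> continuous_on {0..dt^2} (\<lambda>r. k2 r w)"
proof -
  assume w: "w \<in> space P" and wc: "pcont 2 {0..T} (\<lambda>t. PhiW t w)"
  have ws: "pcont 2 {0..dt^2} (\<lambda>r. PhiW (a + real (l - 1) * dt^2 + r) w)" if "l \<in> {1..M}" for l
    by (rule pcont_compose[OF wc], intro continuous_intros, use t_in[OF that] sub in blast)
  have H: "PhiW t w \<in> Hk 2" if "t \<in> {a..a + dt}" for t
    using rf_Hk[OF PhiW_rf w] that sub by blast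
  have inc: "pcont 2 {0..dt^2} (\<lambda>r. inc l r w)" if "l \<in> {1..M}" for l
    unfolding inc_def by (intro pcont_diff ws pcont_const H tl_in that)
  have aa: "a \<in> {a..a + dt}" using dt by simp
  have dN': "pcont 2 {0..dt^2} (\<lambda>r. dN (a + real (l - 1) * dt^2 + r) w)" if "l \<in> {1..M}" for l
    unfolding dN_def by (intro pcont_diff ws pcont_const H that aa)
  show ?thesis
    unfolding k2_def by (intro continuous_intros pcont_norm pcont_sum inc dN')
qed

text \<open>Integration multiplies mean squares by squared lengths: dt^2 for the first integral,
  dt^4 for the one over offsets, where the integrand contributes only a factor dt.\<close>

lemma mb_kk: "mb P (\<lambda>w. (kk w)^2) (A * (80 + 96 * R^2) * dt ^ (j + 2))"
proof -
  have c1: "AE w in P. continuous_on {a..a + dt} (\<lambda>s. k1 s w)" and c2: "AE w in P. continuous_on {0..dt^2} (\<lambda>r. k2 r w)"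
    using PhiW_pcont AE_space by (eventually_elim, simp add: cont_k1 cont_k2)+
  have 1: "mb P (\<lambda>w. (integral {a..a + dt} (\<lambda>s. k1 s w))^2) ((a + dt - a)^2 * (A * (30 + 48 * R^2) * dt ^ j))"
    using dt by (intro mb_time_integral c1 mb_k1 k1_meas) auto
  have 2: "mb P (\<lambda>w. (integral {0..dt^2} (\<lambda>s. k2 s w))^2) ((dt^2 - 0)^2 * (10 * A * dt))"
    by (intro mb_time_integral c2 mb_k2 k2_meas) auto
  have m: "(\<lambda>w. integral {a..a + dt} (\<lambda>s. k1 s w)) \<in> borel_measurable P" "(\<lambda>w. integral {0..dt^2} (\<lambda>r. k2 r w)) \<in> borel_measurable P"
    using dt by (intro time_integral_measurable c1 c2 k1_meas k2_meas; simp)+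
  show ?thesis
  proof (rule mb_mono[OF mb_add[OF mb_scale[OF 1, of 2] mb_scale[OF 2, of 2]]])
    show "(\<lambda>w. (kk w)^2) \<in> borel_measurable P" unfolding kk_def using m by measurable
    show "(kk w)^2 \<le> 2 * (integral {a..a + dt} (\<lambda>s. k1 s w))^2 + 2 * (integral {0..dt^2} (\<lambda>r. k2 r w))^2" for w
      using sum_squares_bound[of "integral {a..a + dt} (\<lambda>s. k1 s w)" "integral {0..dt^2} (\<lambda>r. k2 r w)"] unfolding kk_def by (simp add: power2_sum)
    have e1: "2 * ((a + dt - a)^2 * (A * (30 + 48 * R^2) * dt ^ j)) = (60 + 96 * R^2) * (A * dt ^ (j + 2))"
      by (simp add: power_add power2_eq_square algebra_simps)
    have "2 * ((dt^2 - 0)^2 * (10 * A * dt)) = 20 * (A * (dt^2 * dt ^ 3))"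
      by (simp add: power2_eq_square power3_eq_cube)
    also have "\<dots> \<le> 20 * (A * (dt^2 * dt ^ j))" using A1 by (intro mult_left_mono dt3_le) auto
    finally have le: "2 * ((dt^2 - 0)^2 * (10 * A * dt)) \<le> 20 * (A * (dt^2 * dt ^ j))" .
    have e3: "A * (80 + 96 * R^2) * dt ^ (j + 2) = (60 + 96 * R^2) * (A * dt ^ (j + 2)) + 20 * (A * (dt^2 * dt ^ j))"
      by (simp add: power_add power2_eq_square algebra_simps)
    show "2 * ((a + dt - a)^2 * (A * (30 + 48 * R^2) * dt ^ j)) + 2 * ((dt^2 - 0)^2 * (10 * A * dt)) \<le> A * (80 + 96 * R^2) * dt ^ (j + 2)"
      unfolding e1 e3 using le by (rule add_left_mono)
  qed auto
qed

end

end

section \<open>Convergence in probability\<close>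

lemma HH_cong: "v \<in> HH ==> ae_eq v w ==> w \<in> L2 ==> w \<in> HH"
  unfolding HH_def using l2_inner_cong[OF _ ae_eq_refl, of v w] by auto

lemma error_sq_cong_left:
  assumes z: "\<And>k. k \<le> n ==> ae_eq (z (real k * dt)) (z' (real k * dt))"
  shows "error_sq dt z v n = error_sq dt z' v n"
proof -
  have 1: "l2_norm (\<lambda>x. z (real n * dt) x - v n x) = l2_norm (\<lambda>x. z' (real n * dt) x - v n x)"
    by (rule l2_norm_cong, rule ae_eq_map2[where h="(-)", OF z ae_eq_refl]) simp
  have 2: "wgrad (midpoint_field (z (real m * dt)) (z (real (Suc m) * dt))) =
      wgrad (midpoint_field (z' (real m * dt)) (z' (real (Suc m) * dt)))" if "m \<in> {1..n-1}" for m
    unfolding midpoint_field_def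
    by (rule wgrad_cong, rule ae_eq_map2[where h="\<lambda>a b. (1 / 2) *\<^sub>R (a + b)", OF z z]) (use that in auto)
  have "(\<Sum>m=1..n-1. dt * (l2_norm (\<lambda>x. wgrad (midpoint_field (z (real m * dt)) (z (real (Suc m) * dt))) x
          - wgrad (midpoint_field (v (Suc m)) (v m)) x))^2) =
      (\<Sum>m=1..n-1. dt * (l2_norm (\<lambda>x. wgrad (midpoint_field (z' (real m * dt)) (z' (real (Suc m) * dt))) x
          - wgrad (midpoint_field (v (Suc m)) (v m)) x))^2)"
    by (rule sum.cong[OF refl]) (simp only: 2)
  then show ?thesis unfolding error_sq_def 1 by simp
qed

text \<open>The same noise values are added to exact and discrete fields and cancel. Since the
  gradient sum begins at m = 1, iterates are required in H^1 only from index 1 on; the initial one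
  is fixed merely up to a null set.\<close>

lemma error_sq_shift:
  assumes z: "\<And>k. k \<le> n ==> z (real k * dt) \<in> Hk 1" and w: "\<And>k. k \<le> n ==> w (real k * dt) \<in> Hk 1"
    and v: "\<And>k. 1 \<le> k ==> k \<le> n ==> v k \<in> Hk 1"
  shows "error_sq dt (\<lambda>t x. z t x + w t x) (\<lambda>k x. v k x + w (real k * dt) x) n = error_sq dt z v n"
proof -
  have mf: "midpoint_field f g \<in> Hk 1" if "f \<in> Hk 1" "g \<in> Hk 1" for f g :: "(real^2) field"
    using that by (simp add: midpoint_field_def)
  have "l2_norm (\<lambda>x. wgrad (midpoint_field (\<lambda>x. z (real m * dt) x + w (real m * dt) x) (\<lambda>x. z (real (Suc m) * dt) x + w (real (Suc m) * dt) x)) x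
          - wgrad (midpoint_field (\<lambda>x. v (Suc m) x + w (real (Suc m) * dt) x) (\<lambda>x. v m x + w (real m * dt) x)) x) =
      l2_norm (\<lambda>x. wgrad (midpoint_field (z (real m * dt)) (z (real (Suc m) * dt))) x - wgrad (midpoint_field (v (Suc m)) (v m)) x)"
    if m: "m \<in> {1..n-1}" for m
  proof (rule l2_norm_cong)
    have mm: "m \<le> n" "Suc m \<le> n" "1 \<le> m" "1 \<le> Suc m" using m by auto
    define wm where "wm = midpoint_field (w (real m * dt)) (w (real (Suc m) * dt))"
    have wmH: "wm \<in> Hk 1" unfolding wm_def by (intro mf w mm)
    have 1: "midpoint_field (\<lambda>x. z (real m * dt) x + w (real m * dt) x) (\<lambda>x. z (real (Suc m) * dt) x + w (real (Suc m) * dt) x) =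
        (\<lambda>x. midpoint_field (z (real m * dt)) (z (real (Suc m) * dt)) x + wm x)"
      by (rule ext) (simp add: midpoint_field_def wm_def algebra_simps)
    have 2: "midpoint_field (\<lambda>x. v (Suc m) x + w (real (Suc m) * dt) x) (\<lambda>x. v m x + w (real m * dt) x) =
        (\<lambda>x. midpoint_field (v (Suc m)) (v m) x + wm x)"
      by (rule ext) (simp add: midpoint_field_def wm_def algebra_simps)
    have zH: "midpoint_field (z (real m * dt)) (z (real (Suc m) * dt)) \<in> Hk 1" by (intro mf z mm)
    have vH: "midpoint_field (v (Suc m)) (v m) \<in> Hk 1" by (intro mf v mm)
    have "ae_eq (\<lambda>x. wgrad (\<lambda>x. midpoint_field (z (real m * dt)) (z (real (Suc m) * dt)) x + wm x) x -
          wgrad (\<lambda>x. midpoint_field (v (Suc m)) (v m) x + wm x) x)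
        (\<lambda>x. (wgrad (midpoint_field (z (real m * dt)) (z (real (Suc m) * dt))) x + wgrad wm x) -
          (wgrad (midpoint_field (v (Suc m)) (v m)) x + wgrad wm x))"
      by (rule ae_eq_map2[where h="(-)", OF wgrad_add[OF zH wmH] wgrad_add[OF vH wmH]])
    then show "ae_eq (\<lambda>x. wgrad (midpoint_field (\<lambda>x. z (real m * dt) x + w (real m * dt) x) (\<lambda>x. z (real (Suc m) * dt) x + w (real (Suc m) * dt) x)) x
          - wgrad (midpoint_field (\<lambda>x. v (Suc m) x + w (real (Suc m) * dt) x) (\<lambda>x. v m x + w (real m * dt) x)) x)
        (\<lambda>x. wgrad (midpoint_field (z (real m * dt)) (z (real (Suc m) * dt))) x - wgrad (midpoint_field (v (Suc m)) (v m)) x)"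
      unfolding 1 2 by simp
  qed
  then have "(\<Sum>m=1..n-1. dt * (l2_norm (\<lambda>x. wgrad (midpoint_field (\<lambda>x. z (real m * dt) x + w (real m * dt) x) (\<lambda>x. z (real (Suc m) * dt) x + w (real (Suc m) * dt) x)) x
          - wgrad (midpoint_field (\<lambda>x. v (Suc m) x + w (real (Suc m) * dt) x) (\<lambda>x. v m x + w (real m * dt) x)) x))^2) =
      (\<Sum>m=1..n-1. dt * (l2_norm (\<lambda>x. wgrad (midpoint_field (z (real m * dt)) (z (real (Suc m) * dt))) x - wgrad (midpoint_field (v (Suc m)) (v m)) x))^2)"
    by (intro sum.cong refl) (simp only:)
  then show ?thesis unfolding error_sq_def by simp
qed

text \<open>Continuous paths are bounded on the compact time interval, so the events with bound q
  increase to a set of full measure.\<close>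

lemma (in noise) bounded_noise:
  assumes T: "0 < T" and \<epsilon>: "0 < \<epsilon>"
  obtains B and q :: real where "B \<in> sets P" "measure P B \<ge> 1 - \<epsilon>" "0 \<le> q"
    "AE w in P. w \<in> B \<longrightarrow> (\<forall>t\<in>{0..T}. Hk_norm 2 (PhiW t w) \<le> q)"
proof -
  \<comment> \<open>Rational times make the event measurable as a countable intersection; for
    continuous paths the bound extends to all times.\<close>
  define I where "I = {0..T} \<inter> \<rat>"
  have cI: "countable I" unfolding I_def by (intro countable_Int2 countable_rat)
  define B where "B q = {w\<in>space P. \<forall>t\<in>I. Hk_norm 2 (PhiW t w) \<le> real q}" for q :: nat
  have Bm: "B q \<in> sets P" for q
  proof -
    have "{w\<in>space P. Hk_norm 2 (PhiW t w) \<le> real q} \<in> sets P" if "t \<in> I" for t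
      using rf_measurable[OF PhiW_rf[of t]] that by (simp add: I_def borel_measurable_iff_le)
    moreover have "0 \<in> I" using T by (simp add: I_def)
    ultimately have "(\<Inter>t\<in>I. {w\<in>space P. Hk_norm 2 (PhiW t w) \<le> real q}) \<in> sets P"
      by (intro sets.countable_INT' cI) auto
    also have "(\<Inter>t\<in>I. {w\<in>space P. Hk_norm 2 (PhiW t w) \<le> real q}) = B q"
      using \<open>0 \<in> I\<close> by (auto simp: B_def)
    finally show ?thesis .
  qed
  have path: "AE w in P. pcont 2 {0..T} (\<lambda>t. PhiW t w)"
    using noise unfolding noise_process_def Hk_path_pcont by - (elim conjE, assumption)
  have dense: "g t \<le> c" if g: "continuous_on {0..T} g" and c: "\<And>t. t \<in> I ==> g t \<le> c" and t: "t \<in> {0..T}" for g :: "real \<Rightarrow> real" and c t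
  proof (rule ccontr)
    assume "\<not> g t \<le> c"
    then have "0 < g t - c" by simp
    then obtain d where d: "0 < d" "\<And>s. s \<in> {0..T} ==> dist s t < d ==> dist (g s) (g t) < g t - c"
      using g t unfolding continuous_on_iff by metis
    have "max 0 (t - d) < min T (t + d)" using t d(1) T by auto
    then obtain s where s: "s \<in> \<rat>" "max 0 (t - d) < s" "s < min T (t + d)" using Rats_dense_in_real by blast
    then have "s \<in> {0..T}" "dist s t < d" by (auto simp: dist_real_def)
    from d(2)[OF this] have "c < g s" by (auto simp: dist_real_def)
    moreover have "g s \<le> c" using s \<open>s \<in> {0..T}\<close> by (intro c) (simp add: I_def)
    ultimately show False by simp
  qed
  have bound: "AE w in P. w \<in> B q \<longrightarrow> (\<forall>t\<in>{0..T}. Hk_norm 2 (PhiW t w) \<le> real q)" for q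
    using path
  proof eventually_elim
    case (elim w)
    show ?case using dense[OF pcont_norm[OF elim], of "real q"] by (auto simp: B_def)
  qed
  have "AE w in P. w \<in> (\<Union>q. B q)"
    using path AE_space
  proof eventually_elim
    case (elim w)
    have "compact ((\<lambda>t. Hk_norm 2 (PhiW t w)) ` {0..T})" by (intro compact_continuous_image pcont_norm elim) simp
    from compact_imp_bounded[OF this] obtain b where b: "\<forall>x\<in>(\<lambda>t. Hk_norm 2 (PhiW t w)) ` {0..T}. norm x \<le> b"
      unfolding bounded_iff by (elim exE)
    obtain q :: nat where "b \<le> real q" using real_arch_simple by blast
    have "Hk_norm 2 (PhiW t w) \<le> real q" if "t \<in> I" for t
      using b[rule_format, of "Hk_norm 2 (PhiW t w)"] that \<open>b \<le> real q\<close> by (simp add: I_def)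
    then have "w \<in> B q" using elim(2) by (simp add: B_def)
    then show ?case by (rule UN_I[OF UNIV_I])
  qed
  then have "measure P (\<Union>q. B q) = 1" using Bm by (subst prob_eq_1) auto
  moreover have "(\<lambda>q. measure P (B q)) \<longlonglongrightarrow> measure P (\<Union>q. B q)"
    using Bm by (intro finite_Lim_measure_incseq) (auto simp: incseq_def B_def intro: order_trans)
  ultimately have "\<forall>\<^sub>F q in sequentially. 1 - \<epsilon> < measure P (B q)"
    using \<epsilon> by (intro order_tendstoD(1)[where y=1]) auto
  then obtain q where "1 - \<epsilon> < measure P (B q)"
    using eventually_happens'[OF sequentially_bot] by blast
  then show thesis using that[OF Bm, of q "real q"] bound by auto
qed

locale setting = noise P F T K e W \<Phi> PhiW
  for P :: "'w measure" and F :: "real \<Rightarrow> 'w measure" and T :: real and K :: "nat set"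
    and e :: "nat \<Rightarrow> 'u::real_inner" and W :: "nat \<Rightarrow> real \<Rightarrow> 'w \<Rightarrow> real"
    and \<Phi> :: "'u \<Rightarrow> (real^2) field" and PhiW :: "real \<Rightarrow> 'w \<Rightarrow> (real^2) field" +
  fixes \<nu> :: real and u0 :: "'w \<Rightarrow> (real^2) field" and u y dty :: "real \<Rightarrow> 'w \<Rightarrow> (real^2) field"
    and Om :: "real \<Rightarrow> 'w set" and ys :: "nat \<Rightarrow> nat \<Rightarrow> 'w \<Rightarrow> (real^2) field" and ps :: "nat \<Rightarrow> nat \<Rightarrow> 'w \<Rightarrow> real field"
  assumes T: "T > 0" and nu: "\<nu> > 0"
    and u0_V: "\<And>w. w \<in> space P ==> u0 w \<in> VV"
    and u_sol: "weak_pathwise_solution P F T \<nu> u0 PhiW u"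
    and y_def: "y = (\<lambda>t w x. u t w x - PhiW t w x)"
    and Om_def: "Om = Omega_R P T (\<lambda>t w x. y t w x + PhiW t w x)"
    and scheme: "\<And>N M. 0 < N ==> real M * (T / real N) = 1 ==>
      AE w in P. is_scheme (T / real N) N M \<nu> (u0 w) (\<lambda>t. PhiW t w) (\<lambda>n. ys N n w) (\<lambda>n. ps N n w)"
    and reg_H2: "\<And>R. R > 0 ==> localize (Om R) y \<in> Lp_paths P 2 T 2"
    and reg_C1: "\<And>R. R > 0 ==> C1_Lp P 4 1 VV T (localize (Om R) y) (localize (Om R) dty)"
    and reg_holder: "\<And>R. R > 0 ==> holder_Lp P 2 1 VV T (1/2) (localize (Om R) dty)"
begin

lemma u_eq: "u t w = (\<lambda>x. y t w x + PhiW t w x)"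
  by (simp add: y_def)

lemma Om_iff: "w \<in> Om R \<longleftrightarrow> w \<in> space P \<and> (\<forall>t\<in>{0..T}. u t w \<in> Hk 2 \<and> Hk_norm 2 (u t w) \<le> R)"
  by (simp add: Om_def Omega_R_def u_eq[symmetric])

lemma localize_in: "w \<in> Om R ==> localize (Om R) X t w = X t w"
  by (simp add: localize_def)

text \<open>The two regularity assumptions yield two versions: Y with continuous H^2 paths and Z
  with the expansion in mean square and values in \<open>VV\<close>. At each fixed time they agree
  almost surely, which is enough to hand the moment bounds of Z over to Y.\<close>

lemma versions:
  assumes R: "0 < R" and R': "0 \<le> R'"
  obtains Y D A where "moments P F T K e W \<Phi> PhiW Y D A R'"
    "AE w in P. w \<in> Om R \<longrightarrow> (\<forall>t\<in>{0..T}. ae_eq (y t w) (Y t w))"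
    "\<And>t. t \<in> {0..T} ==> AE w in P. Y t w \<in> VV"
proof -
  obtain Y where Y: "\<forall>t\<in>{0..T}. Hk_measurable 2 P (Y t)" "\<forall>w\<in>space P. Hk_path 2 T (\<lambda>t. Y t w)"
    and XY: "AE w in P. \<forall>t\<in>{0..T}. ae_eq (localize (Om R) y t w) (Y t w)"
    using reg_H2[OF R] unfolding Lp_paths_def by blast
  have Yrf: "rf 2 P (Y t)" if "t \<in> {0..T}" for t using Y(1) that by (intro Hk_measurable_rf) blast
  have Y1: "rf 1 P (Y t)" if "t \<in> {0..T}" for t by (rule rf_mono[OF Yrf[OF that]]) simp
  obtain Z D C where Z: "\<And>t. t \<in> {0..T} ==> rf 1 P (Z t)" and D: "\<And>t. t \<in> {0..T} ==> rf 1 P (D t)"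
    and ZV: "\<And>t w. t \<in> {0..T} ==> w \<in> space P ==> Z t w \<in> VV"
    and XZ: "\<And>t. t \<in> {0..T} ==> AE w in P. ae_eq (localize (Om R) y t w) (Z t w)"
    and tay: "\<And>t s. t \<in> {0..T} ==> s \<in> {0..T} ==>
      mb P (\<lambda>w. (Hk_norm 1 (\<lambda>x. Z s w x - Z t w x - (s - t) *\<^sub>R D t w x))^2) (C * \<bar>s - t\<bar> ^ 3)"
    and D4: "\<And>t. t \<in> {0..T} ==> mb P (\<lambda>w. Hk_norm 1 (D t w) ^ 4) C"
    using C1_Lp_taylor[OF prob_space_axioms T reg_C1[OF R] reg_holder[OF R]] by blast
  have ZY: "AE w in P. ae_eq (Z t w) (Y t w)" if t: "t \<in> {0..T}" for t
    using XY XZ[OF t]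
  proof eventually_elim
    case (elim w)
    then show ?case using t by (blast intro: ae_eq_trans ae_eq_sym)
  qed
  define A where "A = max 1 (max C (3 * hs_sq^2))"
  show thesis
  proof (rule that[of Y D A])
    show "moments P F T K e W \<Phi> PhiW Y D A R'"
    proof
      fix t assume t: "t \<in> {0..T}"
      show "rf 2 P (Y t)" "rf 1 P (D t)" by (rule Yrf[OF t], rule D[OF t])
      show "mb P (\<lambda>w. Hk_norm 1 (D t w) ^ 4) A" by (rule mb_weaken[OF D4[OF t]]) (simp add: A_def)
      fix s assume s: "s \<in> {0..T}"
      have "mb P (\<lambda>w. (Hk_norm 1 (\<lambda>x. Y s w x - Y t w x - (s - t) *\<^sub>R D t w x))^2) (C * \<bar>s - t\<bar> ^ 3)"
      proof (rule mb_cong_AE[OF tay[OF t s]])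
        show "(\<lambda>w. (Hk_norm 1 (\<lambda>x. Y s w x - Y t w x - (s - t) *\<^sub>R D t w x))^2) \<in> borel_measurable P"
          by (intro rf_power rf_diff rf_scaleR Y1 D s t)
        show "AE w in P. (Hk_norm 1 (\<lambda>x. Y s w x - Y t w x - (s - t) *\<^sub>R D t w x))^2 \<le>
            (Hk_norm 1 (\<lambda>x. Z s w x - Z t w x - (s - t) *\<^sub>R D t w x))^2"
          using ZY[OF s] ZY[OF t]
        proof eventually_elim
          case (elim w)
          have "ae_eq (\<lambda>x. Z s w x - Z t w x - (s - t) *\<^sub>R D t w x) (\<lambda>x. Y s w x - Y t w x - (s - t) *\<^sub>R D t w x)"
            by (rule ae_eq_map2[where h="(-)", OF ae_eq_map2[where h="(-)", OF elim] ae_eq_refl])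
          then show ?case by (simp add: Hk_norm_cong)
        qed
      qed simp
      then show "mb P (\<lambda>w. (Hk_norm 1 (\<lambda>x. Y s w x - Y t w x - (s - t) *\<^sub>R D t w x))^2) (A * \<bar>s - t\<bar> ^ 3)"
        by (rule mb_weaken) (intro mult_right_mono; simp add: A_def)
    next
      fix w assume "w \<in> space P"
      then show "pcont 2 {0..T} (\<lambda>t. Y t w)" using Y(2) by (simp add: Hk_path_pcont)
    qed (use R' in \<open>auto simp: A_def\<close>)
    show "AE w in P. w \<in> Om R \<longrightarrow> (\<forall>t\<in>{0..T}. ae_eq (y t w) (Y t w))"
      using XY by eventually_elim (auto simp: localize_in)
    show "AE w in P. Y t w \<in> VV" if t: "t \<in> {0..T}" for t
      using ZY[OF t] AE_space
    proof eventually_elim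
      case (elim w)
      show ?case by (rule VV_cong[OF ZV[OF t elim(2)] elim(1) Hk_L2[OF rf_Hk[OF Y1[OF t] elim(2)]]])
    qed
  qed
qed

lemma solution_paths: "AE w in P. (\<forall>t\<in>{0..T}. u t w \<in> HH) \<and>
        (\<forall>t\<in>{0..T}. \<forall>\<phi>\<in>VV.
           l2_inner (u t w) \<phi> - l2_inner (u0 w) \<phi> =
             - (\<integral>s\<in>{0..t}. trilin (u s w) (u s w) \<phi> \<partial>lebesgue)
             - \<nu> * (\<integral>s\<in>{0..t}. l2_inner (wgrad (u s w)) (wgrad \<phi>) \<partial>lebesgue)
             + l2_inner (PhiW t w) \<phi>)"
  using u_sol[unfolded weak_pathwise_solution_def, THEN conjunct2] by eventually_elim (elim conjE, intro conjI)

definition "gronwall_const Q = (1 + 1 / \<nu>) * exp (8000 * Q^2 / \<nu> * T) * (2 * (50 * (Q + 1) + \<nu>)^2 / \<nu>)"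

text \<open>On the event the version Y satisfies the deterministic hypotheses with bound Q = R + q,
  and there the pathwise consistency error \<open>Kn\<close> coincides with the random variable
  \<open>kk\<close>. The second identity lets both assertions of the theorem share one
  bound.\<close>

lemma error_on_event:
  assumes mom: "moments P F T K e W \<Phi> PhiW Y D A Q" and Q: "Q = R + q" "0 < R" "0 \<le> q"
    and yY: "AE w in P. w \<in> Om R \<longrightarrow> (\<forall>t\<in>{0..T}. ae_eq (y t w) (Y t w))"
    and YV: "\<And>t. t \<in> {0..T} ==> AE w in P. Y t w \<in> VV"
    and N: "0 < N" and dt_def: "dt = T / real N" and dt1: "dt \<le> 1" and M: "real M * dt = 1"
  shows "AE w in P. w \<in> Om R \<longrightarrow> (\<forall>t\<in>{0..T}. Hk_norm 2 (PhiW t w) \<le> q) \<longrightarrow> (\<forall>n\<le>N.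
      error_sq dt (\<lambda>t. y t w) (\<lambda>k. ys N k w) n \<le> gronwall_const Q * (\<Sum>m<N. (moments.kk PhiW Y D Q dt M m w)^2 / dt) \<and>
      error_sq dt (\<lambda>t. u t w) (\<lambda>k x. ys N k w x + PhiW (real k * dt) w x) n = error_sq dt (\<lambda>t. y t w) (\<lambda>k. ys N k w) n)"
proof -
  interpret m: moments P F T K e W \<Phi> PhiW Y D A Q by (rule mom)
  have dt: "0 < dt" using T N by (simp add: dt_def)
  have Ndt: "real N * dt = T" using N by (simp add: dt_def)
  have n_in: "real n * dt \<in> {0..T}" if "n \<le> N" for n
    using that dt mult_right_mono[of "real n" "real N" dt] by (simp add: Ndt)
  have n_le: "real n * dt + dt \<le> T" if "n < N" for n
    using n_in[of "Suc n"] that by (simp add: algebra_simps)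
  \<comment> \<open>The exceptional set depends on the time, so the statement is made for the
    countably many nodes that the scheme uses.\<close>
  have VVs: "AE w in P. \<forall>n l. real n * dt + real l * dt^2 \<in> {0..T} \<longrightarrow> Y (real n * dt + real l * dt^2) w \<in> VV"
    unfolding AE_all_countable
  proof (intro allI)
    fix n l
    show "AE w in P. real n * dt + real l * dt^2 \<in> {0..T} \<longrightarrow> Y (real n * dt + real l * dt^2) w \<in> VV"
      using YV[of "real n * dt + real l * dt^2"] by (cases "real n * dt + real l * dt^2 \<in> {0..T}") auto
  qed
  show ?thesis
    using AE_space yY VVs solution_paths m.PhiW_pcont scheme[OF N M[unfolded dt_def], folded dt_def]
  proof eventually_elim
    case (elim w)
    note w = elim(1) and wc = elim(5)
    show ?case
    proof (intro impI allI)
      fix n assume Om: "w \<in> Om R" and wq: "\<forall>t\<in>{0..T}. Hk_norm 2 (PhiW t w) \<le> q" and n: "n \<le> N"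
      have yY: "ae_eq (y t w) (Y t w)" if "t \<in> {0..T}" for t using elim(2) Om that by blast
      have uY: "ae_eq (u t w) (\<lambda>x. Y t w x + PhiW t w x)" if "t \<in> {0..T}" for t
        unfolding u_eq by (rule ae_eq_map2[where h="(+)", OF yY[OF that] ae_eq_refl])
      have YH: "Y t w \<in> Hk 2" and wH: "PhiW t w \<in> Hk 2" if "t \<in> {0..T}" for t
        using rf_Hk[OF m.Yrf[OF that] w] rf_Hk[OF PhiW_rf[OF that] w] by auto
      have uH: "u t w \<in> Hk 2" "Hk_norm 2 (u t w) \<le> R" if "t \<in> {0..T}" for t using Om that by (auto simp: Om_iff)
      have yH: "y t w \<in> Hk 2" if "t \<in> {0..T}" for t unfolding y_def by (intro Hk_diff uH wH that)
      have YR: "Hk_norm 2 (Y t w) \<le> Q" if t: "t \<in> {0..T}" for t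
      proof -
        have "Hk_norm 2 (Y t w) = Hk_norm 2 (\<lambda>x. u t w x - PhiW t w x)"
          using Hk_norm_cong[OF yY[OF t], of 2] by (simp add: y_def)
        also have "\<dots> \<le> Hk_norm 2 (u t w) + Hk_norm 2 (PhiW t w)" by (intro Hk_triangle_diff uH wH t)
        finally show ?thesis using uH(2)[OF t] wq t Q(1) by force
      qed
      define v where "v = (\<lambda>k. ys N k w)(0 := u0 w)"
      have sch: "is_scheme dt N M \<nu> (u0 w) (\<lambda>t. PhiW t w) v (\<lambda>n. ps N n w)"
        unfolding v_def by (rule is_scheme_start(1)[OF elim(6)])
      have HHs: "\<forall>t\<in>{0..T}. u t w \<in> HH" using elim(4) by blast
      interpret g: good_path T \<nu> Q dt N M "\<lambda>t. Y t w" "\<lambda>t. PhiW t w" "u0 w" v "\<lambda>n. ps N n w" "\<lambda>n. D (real n * dt) w"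
      proof (rule good_path.intro)
        show "0 < T" "0 < \<nu>" "0 < N" "dt = T / real N" "real M * dt = 1" by (fact T nu N dt_def M)+
        show "pcont 2 {0..T} (\<lambda>t. Y t w)" "pcont 2 {0..T} (\<lambda>t. PhiW t w)" by (rule m.Ypath[OF w], rule wc)
        show "u0 w \<in> VV" by (rule u0_V[OF w])
        show "is_scheme dt N M \<nu> (u0 w) (\<lambda>t. PhiW t w) v (\<lambda>n. ps N n w)" by (rule sch)
        show "v 0 = u0 w" by (simp add: v_def)
        show "D (real n * dt) w \<in> Hk 1" if "n < N" for n
          using that by (intro rf_Hk[OF m.Drf w] n_in) simp
        show "Y (real n * dt) w \<in> VV" if "n \<le> N" for n
          using elim(3)[rule_format, of n 0] n_in[OF that] by simp
        show "Y (real n * dt + real l * dt^2) w \<in> VV" if nl: "n < N" "l \<in> {1..M}" for n l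
          using elim(3)[rule_format, of n l] m.tl_in[OF dt dt1 M n_le[OF nl(1)] nl(2)] m.sub[OF dt dt1 M n_le[OF nl(1)]]
          unfolding m.a_def[OF dt dt1 M n_le[OF nl(1)]] by blast
      next
        fix s assume s: "s \<in> {0..T}"
        show "Hk_norm 2 (Y s w) \<le> Q" by (rule YR[OF s])
        show "Hk_norm 2 (PhiW s w) \<le> Q" using wq[rule_format, OF s] Q by simp
        show "(\<lambda>x. Y s w x + PhiW s w x) \<in> HH"
          by (rule HH_cong[OF HHs[rule_format, OF s] uY[OF s]]) (rule Hk_L2[OF Hk_add[OF YH[OF s] wH[OF s]]])
        fix \<phi> :: "(real^2) field" assume \<phi>: "\<phi> \<in> VV"
        have ss: "s' \<in> {0..T}" if "s' \<in> {0..s}" for s' using that s by auto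
        have i1: "(\<integral>s'\<in>{0..s}. trilin (u s' w) (u s' w) \<phi> \<partial>lebesgue) =
            (\<integral>s'\<in>{0..s}. trilin (\<lambda>x. Y s' w x + PhiW s' w x) (\<lambda>x. Y s' w x + PhiW s' w x) \<phi> \<partial>lebesgue)"
          by (rule set_lebesgue_integral_cong, simp) (intro allI impI trilin_cong uY ss ae_eq_refl)
        have i2: "(\<integral>s'\<in>{0..s}. l2_inner (wgrad (u s' w)) (wgrad \<phi>) \<partial>lebesgue) =
            (\<integral>s'\<in>{0..s}. l2_inner (wgrad (\<lambda>x. Y s' w x + PhiW s' w x)) (wgrad \<phi>) \<partial>lebesgue)"
          by (rule set_lebesgue_integral_cong, simp) (intro allI impI, subst wgrad_cong[OF uY[OF ss]], simp_all)
        have i3: "l2_inner (u s w) \<phi> = l2_inner (\<lambda>x. Y s w x + PhiW s w x) \<phi>"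
          by (rule l2_inner_cong[OF uY[OF s] ae_eq_refl])
        show "l2_inner (\<lambda>x. Y s w x + PhiW s w x) \<phi> - l2_inner (u0 w) \<phi> =
            - (\<integral>s'\<in>{0..s}. trilin (\<lambda>x. Y s' w x + PhiW s' w x) (\<lambda>x. Y s' w x + PhiW s' w x) \<phi> \<partial>lebesgue)
            - \<nu> * (\<integral>s'\<in>{0..s}. l2_inner (wgrad (\<lambda>x. Y s' w x + PhiW s' w x)) (wgrad \<phi>) \<partial>lebesgue)
            + l2_inner (PhiW s w) \<phi>"
          using elim(4)[THEN conjunct2, rule_format, OF s \<phi>] unfolding i1 i2 i3 .
      qed
      have Kn: "g.Kn m = m.kk dt M m w" if m: "m < N" for m
      proof -
        note h = dt dt1 M n_le[OF m]
        interpret S: time_step "real m * dt" dt Q M "\<lambda>t. Y t w" "\<lambda>t. PhiW t w" "D (real m * dt) w" "g.ystar m"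
          by (rule g.time_step[OF m])
        have a: "m.a dt m = real m * dt" by (rule m.a_def[OF h])
        have k1: "S.\<kappa>1 s = m.k1 dt m s w" if s: "s \<in> {real m * dt..real m * dt + dt}" for s
        proof -
          have s2: "s \<in> {0..T}" "real m * dt \<in> {0..T}" using m.sub[OF h] m.a_in(1)[OF h] s unfolding a by blast+
          have "Hk_norm 1 (S.dy s) \<le> Hk_norm 2 (S.dy s)" by (rule S.N21[OF S.dy_H2[OF s]])
          also have "\<dots> \<le> Hk_norm 2 (Y s w) + Hk_norm 2 (Y (real m * dt) w)"
            unfolding S.dy_def by (intro Hk_triangle_diff YH s2)
          also have "\<dots> \<le> 2 * Q" using YR[OF s2(1)] YR[OF s2(2)] by simp
          finally have "min (Hk_norm 1 (S.dy s)) (2 * Q) = Hk_norm 1 (S.dy s)" by simp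
          moreover have "m.dY dt m s w = S.dy s" by (simp add: m.dY_def[OF h] S.dy_def a)
          moreover have "m.dN dt m s w = S.dw s" by (simp add: m.dN_def[OF h] S.dw_def a)
          moreover have "m.rho dt m s w = S.\<rho> s" by (simp add: m.rho_def[OF h] S.\<rho>_def S.ymid_def a)
          moreover have "m.rhos dt m s w = S.\<rho>s s" unfolding S.\<rho>s_def unfolding m.rhos_def[OF h] a g.ystar_def ..
          ultimately show ?thesis unfolding m.k1_def[OF h] S.\<kappa>1_def a by simp
        qed
        have k2: "S.\<kappa>2 r = m.k2 dt M m r w" for r
        proof -
          have "m.dN dt m s w = S.dw s" for s by (simp add: m.dN_def[OF h] S.dw_def a)
          moreover have inc: "m.inc dt m l r w = S.\<Delta> l r" for l by (simp add: m.inc_def[OF h] S.\<Delta>_def a)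
          moreover have "S.\<Delta>sum r = (\<lambda>x. \<Sum>l=1..M. m.inc dt m l r w x)" by (simp add: S.\<Delta>sum_def inc)
          ultimately show ?thesis unfolding m.k2_def[OF h] S.\<kappa>2_def a by simp
        qed
        have "integral {real m * dt..real m * dt + dt} S.\<kappa>1 = integral {real m * dt..real m * dt + dt} (\<lambda>s. m.k1 dt m s w)"
          by (rule integral_cong) (rule k1)
        moreover have "integral {0..dt^2} S.\<kappa>2 = integral {0..dt^2} (\<lambda>r. m.k2 dt M m r w)"
          by (rule integral_cong) (rule k2)
        ultimately show ?thesis unfolding g.Kn_def S.K_def m.kk_def[OF h] a by simp
      qed
      have "error_sq dt (\<lambda>t. y t w) (\<lambda>k. ys N k w) n = error_sq dt (\<lambda>t. Y t w) (\<lambda>k. ys N k w) n"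
        by (rule error_sq_cong_left) (rule yY, rule n_in, use n in simp)
      also have "\<dots> = error_sq dt (\<lambda>t. Y t w) v n"
        unfolding v_def by (rule error_sq_cong) (rule is_scheme_start(2)[OF elim(6)])
      also have "\<dots> \<le> gronwall_const Q * (\<Sum>m<N. (g.Kn m)^2 / dt)"
        unfolding gronwall_const_def by (rule g.error_bound[OF n])
      also have "(\<Sum>m<N. (g.Kn m)^2 / dt) = (\<Sum>m<N. (m.kk dt M m w)^2 / dt)"
        by (intro sum.cong refl) (simp add: Kn)
      finally have E: "error_sq dt (\<lambda>t. y t w) (\<lambda>k. ys N k w) n \<le> gronwall_const Q * (\<Sum>m<N. (m.kk dt M m w)^2 / dt)" .
      have "error_sq dt (\<lambda>t x. y t w x + PhiW t w x) (\<lambda>k x. ys N k w x + PhiW (real k * dt) w x) n = error_sq dt (\<lambda>t. y t w) (\<lambda>k. ys N k w) n"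
      proof (rule error_sq_shift)
        fix k assume k: "k \<le> n"
        then have "real k * dt \<in> {0..T}" using n by (intro n_in) simp
        then show "y (real k * dt) w \<in> Hk 1" "PhiW (real k * dt) w \<in> Hk 1"
          using yH wH by (auto intro: g.Hk21)
        show "ys N k w \<in> Hk 1" if "1 \<le> k"
        proof -
          have "v k \<in> VV" using k n by (intro g.vV) simp
          then show ?thesis using that by (auto simp: v_def intro: VV_Hk)
        qed
      qed
      then show "error_sq dt (\<lambda>t. y t w) (\<lambda>k. ys N k w) n \<le> gronwall_const Q * (\<Sum>m<N. (m.kk dt M m w)^2 / dt) \<and>
          error_sq dt (\<lambda>t. u t w) (\<lambda>k x. ys N k w x + PhiW (real k * dt) w x) n = error_sq dt (\<lambda>t. y t w) (\<lambda>k. ys N k w) n"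
        using E by (simp add: u_eq)
    qed
  qed
qed

end

section \<open>Markov's inequality and the passage to the limit\<close>

lemma (in prob_space) mb_markov:
  assumes f: "mb M f C" and c: "0 < c"
  shows "prob {w\<in>space M. c \<le> f w} \<le> C / c"
proof -
  have "prob {w\<in>space M. c \<le> f w} \<le> (\<integral>w. f w \<partial>M) / c"
    using f by (intro integral_Markov_inequality_measure[OF mb_integral(1)[OF f], of "space M"] c) (auto simp: mb_def)
  also have "\<dots> \<le> C / c" using mb_integral(2)[OF f] c by (intro divide_right_mono) auto
  finally show ?thesis .
qed

text \<open>The N = T/dt steps contribute dt^4 each, altogether T dt^3. The first step contributes
  an additional dt^3, but only once, so its lower order does no harm.\<close>

lemma (in moments) mb_total:
  assumes T: "0 < T" and N: "0 < N" and dt_def: "dt = T / real N" and dt1: "dt \<le> 1" and M: "real M * dt = 1"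
  shows "mb P (\<lambda>w. \<Sum>m<N. (kk dt M m w)^2 / dt) (A * (80 + 96 * R^2) * (1 + T) * dt ^ 3)"
proof -
  define C where "C = A * (80 + 96 * R^2)"
  have dt: "0 < dt" using T N by (simp add: dt_def)
  have Ndt: "real N * dt = T" using N by (simp add: dt_def)
  have C: "0 \<le> C" using A1 by (simp add: C_def)
  have "mb P (\<lambda>w. \<Sum>m<N. (1 / dt) * (kk dt M m w)^2) (\<Sum>m<N. C * dt ^ 4 + (if m = 0 then C * dt ^ 3 else 0))"
  proof (rule mb_sum)
    fix m assume "m \<in> {..<N}"
    then have "real (Suc m) * dt \<le> real N * dt" using dt by (intro mult_right_mono) auto
    then have "real (Suc m) * dt \<le> T" unfolding Ndt .
    then have le: "real m * dt + dt \<le> T" by (simp add: algebra_simps)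
    have b: "mb P (\<lambda>w. (1 / dt) * (kk dt M m w)^2) ((1 / dt) * (C * dt ^ (j m + 2)))"
      unfolding C_def using dt by (intro mb_scale mb_kk[OF dt dt1 M le]) simp
    have e: "(1 / dt) * (C * dt ^ (j m + 2)) = C * dt ^ (j m + 1)"
      using dt by (simp add: power_add power2_eq_square)
    have "C * dt ^ (j m + 1) \<le> C * dt ^ 4 + (if m = 0 then C * dt ^ 3 else 0)"
      using dt C unfolding j_def[OF dt dt1 M le] by (cases "m = 0") simp_all
    then show "mb P (\<lambda>w. (1 / dt) * (kk dt M m w)^2) (C * dt ^ 4 + (if m = 0 then C * dt ^ 3 else 0))"
      unfolding e[symmetric] by (rule mb_weaken[OF b])
  qed simp
  moreover have "(\<Sum>m<N. C * dt ^ 4 + (if m = 0 then C * dt ^ 3 else 0)) = C * (1 + T) * dt ^ 3"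
  proof -
    have "(\<Sum>m<N. C * dt ^ 4 + (if m = 0 then C * dt ^ 3 else 0)) = C * dt ^ 3 * (real N * dt) + C * dt ^ 3"
    proof -
      have "dt ^ 4 = dt ^ 3 * dt" by (simp add: power4_eq_xxxx power3_eq_cube)
      moreover have "(\<Sum>m<N. if m = 0 then C * dt ^ 3 else 0) = C * dt ^ 3" using N by (subst sum.delta) auto
      ultimately show ?thesis unfolding sum.distrib by simp
    qed
    then show ?thesis unfolding Ndt by (simp add: algebra_simps)
  qed
  moreover have "(\<lambda>w. \<Sum>m<N. (1 / dt) * (kk dt M m w)^2) = (\<lambda>w. \<Sum>m<N. (kk dt M m w)^2 / dt)" by simp
  ultimately show ?thesis unfolding C_def by (simp only:)
qed

context setting
begin

text \<open>The exceptional set H of probability at most 2 delta does not depend on N. Off it only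
  the Markov term remains, of order dt^(3 - 2 alpha) with a constant fixed beforehand, and this
  falls below delta.\<close>

lemma error_prob_eventually:
  assumes Om_lim: "((\<lambda>R. measure P (Om R)) \<longlongrightarrow> 1) at_top" and \<xi>: "\<xi> > 0" and \<alpha>: "\<alpha> < 3/2" and \<epsilon>: "0 < \<epsilon>"
  shows "\<forall>\<^sub>F N in step_filter T. 0 < N \<and> (\<forall>n\<in>{1..N}.
      measure P {w\<in>space P. error_sq (T / real N) (\<lambda>t. y t w) (\<lambda>k. ys N k w) n > \<xi> * (T / real N) powr (2 * \<alpha>)} \<le> \<epsilon> \<and>
      measure P {w\<in>space P. error_sq (T / real N) (\<lambda>t. u t w) (\<lambda>k x. ys N k w x + PhiW (real k * (T / real N)) w x) n
        > \<xi> * (T / real N) powr (2 * \<alpha>)} \<le> \<epsilon>)"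
proof -
  \<comment> \<open>One third each for \<open>Om R\<close>, for the noise and for Markov's
    inequality. The cap at 1/2 makes \<open>Om R\<close> have positive measure.\<close>
  define \<delta> where "\<delta> = min (\<epsilon> / 3) (1/2)"
  have \<delta>: "0 < \<delta>" "\<delta> < 1" "3 * \<delta> \<le> \<epsilon>" using \<epsilon> by (auto simp: \<delta>_def)
  have "\<forall>\<^sub>F R in at_top. 1 - \<delta> < measure P (Om R) \<and> 0 < (R::real)"
    using \<delta> by (intro eventually_conj order_tendstoD(1)[OF Om_lim] eventually_gt_at_top) auto
  then obtain R where R: "1 - \<delta> < measure P (Om R)" "0 < R"
    using eventually_happens'[OF trivial_limit_at_top_linorder] by blast
  \<comment> \<open>A set that is not measurable is assigned measure 0, so positivity of the measure
    already shows measurability.\<close>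
  have Om: "Om R \<in> sets P"
  proof (rule ccontr)
    assume "Om R \<notin> sets P"
    then have "measure P (Om R) = 0" by (rule measure_notin_sets)
    then show False using R(1) \<delta> by simp
  qed
  obtain B q where B: "B \<in> sets P" "1 - \<delta> \<le> measure P B" and q: "0 \<le> q"
    and Bq: "AE w in P. w \<in> B \<longrightarrow> (\<forall>t\<in>{0..T}. Hk_norm 2 (PhiW t w) \<le> q)"
    by (rule bounded_noise[OF T \<delta>(1)])
  define Q where "Q = R + q"
  have Q0: "0 \<le> Q" using R q by (simp add: Q_def)
  obtain Y D A where mom: "moments P F T K e W \<Phi> PhiW Y D A Q"
    and yY: "AE w in P. w \<in> Om R \<longrightarrow> (\<forall>t\<in>{0..T}. ae_eq (y t w) (Y t w))"
    and YV: "\<And>t. t \<in> {0..T} ==> AE w in P. Y t w \<in> VV"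
    using versions[OF R(2) Q0] by blast
  interpret m: moments P F T K e W \<Phi> PhiW Y D A Q by (rule mom)
  define G where "G = gronwall_const Q"
  define C where "C = G * (A * (80 + 96 * Q^2) * (1 + T)) / \<xi>"
  have G: "0 \<le> G" using nu by (simp add: G_def gronwall_const_def)
  define H where "H = space P - (Om R \<inter> B)"
  have Hm: "H \<in> sets P" using Om B by (simp add: H_def)
  have H: "measure P H \<le> 2 * \<delta>"
  proof -
    have "H = (space P - Om R) \<union> (space P - B)" by (auto simp: H_def)
    then have "measure P H \<le> measure P (space P - Om R) + measure P (space P - B)"
      using Om B by (simp add: measure_Un_le)
    also have "\<dots> \<le> \<delta> + \<delta>" using prob_compl[OF Om] prob_compl[OF B(1)] R(1) B(2) by simp
    finally show ?thesis by simp
  qed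
  have main: "measure P {w\<in>space P. error_sq (T / real N) (\<lambda>t. y t w) (\<lambda>k. ys N k w) n > \<xi> * (T / real N) powr (2 * \<alpha>)} \<le> \<epsilon> \<and>
      measure P {w\<in>space P. error_sq (T / real N) (\<lambda>t. u t w) (\<lambda>k x. ys N k w x + PhiW (real k * (T / real N)) w x) n
        > \<xi> * (T / real N) powr (2 * \<alpha>)} \<le> \<epsilon>"
    if N: "0 < N" and T1: "T / real N \<le> 1" and M: "real M * (T / real N) = 1" and small: "C * (T / real N) powr (3 - 2 * \<alpha>) < \<delta>"
      and n: "n \<in> {1..N}" for N M n
  proof -
    define dt where "dt = T / real N"
    have dt: "0 < dt" "dt \<le> 1" "real M * dt = 1" using T N T1 M by (auto simp: dt_def)
    define S where "S w = (\<Sum>m<N. (m.kk dt M m w)^2 / dt)" for w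
    define \<theta> where "\<theta> = \<xi> * dt powr (2 * \<alpha>)"
    have \<theta>: "0 < \<theta>" using \<xi> dt by (simp add: \<theta>_def)
    have S: "mb P (\<lambda>w. G * S w) (G * (A * (80 + 96 * Q^2) * (1 + T) * dt ^ 3))"
      unfolding S_def by (intro mb_scale G m.mb_total[OF T N dt_def dt(2,3)])
    define E where "E = {w\<in>space P. \<theta> \<le> G * S w}"
    have Em: "E \<in> sets P" unfolding E_def using mb_measurable[OF S] by measurable
    have "measure P E \<le> G * (A * (80 + 96 * Q^2) * (1 + T) * dt ^ 3) / \<theta>"
      unfolding E_def by (rule mb_markov[OF S \<theta>])
    also have "\<dots> = C * dt powr (3 - 2 * \<alpha>)"
    proof -
      have "dt powr (3 - 2 * \<alpha>) = dt ^ 3 / dt powr (2 * \<alpha>)"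
        using dt powr_realpow[of dt 3] by (simp add: powr_diff)
      then show ?thesis by (simp add: C_def \<theta>_def)
    qed
    finally have E: "measure P E \<le> \<delta>" using small by (simp add: dt_def)
    have HE: "measure P (H \<union> E) \<le> \<epsilon>"
      using measure_Un_le[OF Hm Em] H E \<delta>(3) by linarith
    have ev: "AE w in P. w \<in> Om R \<longrightarrow> (\<forall>t\<in>{0..T}. Hk_norm 2 (PhiW t w) \<le> q) \<longrightarrow> (\<forall>n\<le>N.
        error_sq dt (\<lambda>t. y t w) (\<lambda>k. ys N k w) n \<le> G * S w \<and>
        error_sq dt (\<lambda>t. u t w) (\<lambda>k x. ys N k w x + PhiW (real k * dt) w x) n = error_sq dt (\<lambda>t. y t w) (\<lambda>k. ys N k w) n)"
      unfolding S_def G_def by (rule error_on_event[OF mom Q_def R(2) q yY YV N dt_def dt(2,3)])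
    have "AE w in P. w \<notin> H \<union> E \<longrightarrow> error_sq dt (\<lambda>t. y t w) (\<lambda>k. ys N k w) n \<le> \<theta> \<and>
        error_sq dt (\<lambda>t. u t w) (\<lambda>k x. ys N k w x + PhiW (real k * dt) w x) n = error_sq dt (\<lambda>t. y t w) (\<lambda>k. ys N k w) n"
      using ev Bq AE_space
    proof eventually_elim
      case (elim w)
      show ?case
      proof
        assume "w \<notin> H \<union> E"
        then have *: "w \<in> Om R" "w \<in> B" "G * S w \<le> \<theta>" using elim(3) by (auto simp: H_def E_def)
        from n have "n \<le> N" by simp
        from elim(1)[rule_format, OF *(1) elim(2)[rule_format, OF *(2)] this] *(3)
        show "error_sq dt (\<lambda>t. y t w) (\<lambda>k. ys N k w) n \<le> \<theta> \<and>
          error_sq dt (\<lambda>t. u t w) (\<lambda>k x. ys N k w x + PhiW (real k * dt) w x) n = error_sq dt (\<lambda>t. y t w) (\<lambda>k. ys N k w) n"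
          by linarith
      qed
    qed
    \<comment> \<open>Monotonicity of the measure asks for measurability of the larger set only,
      here H together with E.\<close>
    then have "AE w in P. w \<in> {w\<in>space P. error_sq dt (\<lambda>t. y t w) (\<lambda>k. ys N k w) n > \<theta>} \<longrightarrow> w \<in> H \<union> E"
      "AE w in P. w \<in> {w\<in>space P. error_sq dt (\<lambda>t. u t w) (\<lambda>k x. ys N k w x + PhiW (real k * dt) w x) n > \<theta>} \<longrightarrow> w \<in> H \<union> E"
      by (eventually_elim, auto)+
    note le = this[THEN finite_measure_mono_AE, OF sets.Un[OF Hm Em]]
    show ?thesis
      using order_trans[OF le(1) HE] order_trans[OF le(2) HE] unfolding \<theta>_def dt_def by blast
  qed
  have lim: "(\<lambda>N. T / real N) \<longlonglongrightarrow> 0"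
    by (rule tendsto_divide_0[OF tendsto_const]) (rule filterlim_at_top_imp_at_infinity[OF filterlim_real_sequentially])
  have "(\<lambda>N. (T / real N) powr (3 - 2 * \<alpha>)) \<longlonglongrightarrow> 0"
    using \<alpha> T by (intro tendsto_zero_powrI[OF lim tendsto_const]) auto
  then have "(\<lambda>N. C * (T / real N) powr (3 - 2 * \<alpha>)) \<longlonglongrightarrow> C * 0" by (intro tendsto_intros)
  then have "\<forall>\<^sub>F N in sequentially. C * (T / real N) powr (3 - 2 * \<alpha>) < \<delta>"
    using \<delta>(1) by (intro order_tendstoD(2)) auto
  moreover have "\<forall>\<^sub>F N in sequentially. T / real N < 1" using lim by (rule order_tendstoD(2)) simp
  ultimately have "\<forall>\<^sub>F N in sequentially. N \<in> {N. \<exists>M. real M * (T / real N) = 1} \<longrightarrow> 0 < N \<and> (\<forall>n\<in>{1..N}.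
      measure P {w\<in>space P. error_sq (T / real N) (\<lambda>t. y t w) (\<lambda>k. ys N k w) n > \<xi> * (T / real N) powr (2 * \<alpha>)} \<le> \<epsilon> \<and>
      measure P {w\<in>space P. error_sq (T / real N) (\<lambda>t. u t w) (\<lambda>k x. ys N k w x + PhiW (real k * (T / real N)) w x) n
        > \<xi> * (T / real N) powr (2 * \<alpha>)} \<le> \<epsilon>)"
    using eventually_gt_at_top[of 0]
  proof eventually_elim
    case (elim N)
    show ?case
    proof (intro impI conjI[OF elim(3)] ballI)
      fix n assume "N \<in> {N. \<exists>M. real M * (T / real N) = 1}" and n: "n \<in> {1..N}"
      then obtain M where M: "real M * (T / real N) = 1" by blast
      from elim(2) have "T / real N \<le> 1" by simp
      from main[OF elim(3) this M elim(1) n]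
      show "measure P {w\<in>space P. error_sq (T / real N) (\<lambda>t. y t w) (\<lambda>k. ys N k w) n > \<xi> * (T / real N) powr (2 * \<alpha>)} \<le> \<epsilon> \<and>
        measure P {w\<in>space P. error_sq (T / real N) (\<lambda>t. u t w) (\<lambda>k x. ys N k w x + PhiW (real k * (T / real N)) w x) n
          > \<xi> * (T / real N) powr (2 * \<alpha>)} \<le> \<epsilon>" .
    qed
  qed
  then show ?thesis unfolding step_filter_def eventually_inf_principal .
qed

end

text \<open>Positivity of N makes the index set nonempty, so \<open>Max\<close> is attained and
  inherits both the sign and the uniform bound.\<close>

lemma tendsto_Max_zero:
  fixes f :: "nat \<Rightarrow> nat \<Rightarrow> real"
  assumes f: "\<And>N n. 0 \<le> f N n" and ev: "\<And>\<epsilon>. 0 < \<epsilon> ==> \<forall>\<^sub>F N in F. 0 < N \<and> (\<forall>n\<in>{1..N}. f N n \<le> \<epsilon>)"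
  shows "((\<lambda>N. Max (f N ` {1..N})) \<longlongrightarrow> 0) F"
proof (rule tendstoI)
  fix \<epsilon> :: real assume \<epsilon>: "0 < \<epsilon>"
  then have "0 < \<epsilon> / 2" by simp
  from ev[OF this] show "\<forall>\<^sub>F N in F. dist (Max (f N ` {1..N})) 0 < \<epsilon>"
  proof eventually_elim
    case (elim N)
    then have ne: "f N ` {1..N} \<noteq> {}" "finite (f N ` {1..N})" by auto
    have "Max (f N ` {1..N}) \<le> \<epsilon> / 2" using elim by (subst Max_le_iff[OF ne(2,1)]) auto
    moreover have "Max (f N ` {1..N}) \<in> f N ` {1..N}" using ne by (intro Max_in) auto
    then have "0 \<le> Max (f N ` {1..N})" using f by auto
    ultimately show ?case using \<epsilon> by (simp add: dist_real_def)
  qed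
qed

theorem corollary3p1:
  fixes P :: "'w measure" and F :: "real \<Rightarrow> 'w measure"
    and T \<nu> r :: real
    and K :: "nat set"
    and e :: "nat \<Rightarrow> 'u::{real_inner, complete_space, second_countable_topology}"
    and W :: "nat \<Rightarrow> real \<Rightarrow> 'w \<Rightarrow> real"
    and \<Phi> :: "'u \<Rightarrow> (real^2) field"
    and PhiW :: "real \<Rightarrow> 'w \<Rightarrow> (real^2) field"
    and u0 :: "'w \<Rightarrow> (real^2) field"
    and u y dty :: "real \<Rightarrow> 'w \<Rightarrow> (real^2) field"
    and Om :: "real \<Rightarrow> 'w set"
    and ys us :: "nat \<Rightarrow> nat \<Rightarrow> 'w \<Rightarrow> (real^2) field"
    and ps :: "nat \<Rightarrow> nat \<Rightarrow> 'w \<Rightarrow> real field"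
    and \<xi> \<alpha> :: real
  assumes T: "T > 0" and nu: "\<nu> > 0"
    and basis: "stochastic_basis P F"
    and onb: "orthonormal_basis K e"
    and wiener: "cylindrical_wiener P F K W"
    and HS: "hilbert_schmidt K e 2 \<Phi>"
    and Phi_div: "\<And>k. k \<in> K \<Longrightarrow> \<Phi> (e k) \<in> VV"
    and PhiW: "noise_process P F T K e \<Phi> W PhiW"
    and u0_meas: "Hk_measurable 1 (F 0) u0"
    and u0_V: "\<And>\<omega>. \<omega> \<in> space P \<Longrightarrow> u0 \<omega> \<in> VV"
    and r: "r > 2" and u0_Lr: "u0 \<in> Lp P r 0 HH"
    and u_sol: "weak_pathwise_solution P F T \<nu> u0 PhiW u"
    and y_def: "y = (\<lambda>t \<omega> x. u t \<omega> x - PhiW t \<omega> x)"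
    and Om_def: "Om = Omega_R P T (\<lambda>t \<omega> x. y t \<omega> x + PhiW t \<omega> x)"
    and scheme: "\<And>N M. 0 < N \<Longrightarrow> real M * (T / real N) = 1 \<Longrightarrow>
      AE \<omega> in P. is_scheme (T / real N) N M \<nu> (u0 \<omega>) (\<lambda>t. PhiW t \<omega>)
                   (\<lambda>n. ys N n \<omega>) (\<lambda>n. ps N n \<omega>)"
    and us_def: "us = (\<lambda>N n \<omega> x. ys N n \<omega> x + PhiW (real n * (T / real N)) \<omega> x)"
    and reg_H2: "\<And>R. R > 0 \<Longrightarrow> localize (Om R) y \<in> Lp_paths P 2 T 2"
    and reg_C1: "\<And>R. R > 0 \<Longrightarrow> C1_Lp P 4 1 VV T (localize (Om R) y) (localize (Om R) dty)"
    and reg_holder: "\<And>R. R > 0 \<Longrightarrow> holder_Lp P 2 1 VV T (1/2) (localize (Om R) dty)"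
    and Om_lim: "((\<lambda>R. measure P (Om R)) \<longlongrightarrow> 1) at_top"
    and xi: "\<xi> > 0" and alpha: "\<alpha> < 3/2"
  shows "((\<lambda>N. Max ((\<lambda>n. measure P {\<omega>\<in>space P.
              error_sq (T / real N) (\<lambda>t. y t \<omega>) (\<lambda>k. ys N k \<omega>) n > \<xi> * (T / real N) powr (2 * \<alpha>)})
            ` {1..N})) \<longlongrightarrow> 0) (step_filter T)
       \<and> ((\<lambda>N. Max ((\<lambda>n. measure P {\<omega>\<in>space P.
              error_sq (T / real N) (\<lambda>t. u t \<omega>) (\<lambda>k. us N k \<omega>) n > \<xi> * (T / real N) powr (2 * \<alpha>)})
            ` {1..N})) \<longlongrightarrow> 0) (step_filter T)"
proof -
  interpret setting P F T K e W \<Phi> PhiW \<nu> u0 u y dty Om ys ps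
    by (intro setting.intro noise.intro setting_axioms.intro) (fact assms)+
  show ?thesis
    unfolding us_def
  proof (intro conjI tendsto_Max_zero measure_nonneg)
    fix \<epsilon> :: real assume "0 < \<epsilon>"
    note ev = error_prob_eventually[OF Om_lim xi alpha this]
    show "\<forall>\<^sub>F N in step_filter T. 0 < N \<and> (\<forall>n\<in>{1..N}. measure P {w\<in>space P.
        error_sq (T / real N) (\<lambda>t. y t w) (\<lambda>k. ys N k w) n > \<xi> * (T / real N) powr (2 * \<alpha>)} \<le> \<epsilon>)"
      using ev by eventually_elim blast
    show "\<forall>\<^sub>F N in step_filter T. 0 < N \<and> (\<forall>n\<in>{1..N}. measure P {w\<in>space P.
        error_sq (T / real N) (\<lambda>t. u t w) (\<lambda>k x. ys N k w x + PhiW (real k * (T / real N)) w x) n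
          > \<xi> * (T / real N) powr (2 * \<alpha>)} \<le> \<epsilon>)"
      using ev by eventually_elim blast
  qed
qed

end
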